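(* Let $(\Sigma,d_\Sigma)$ be a Polish space. Let $((W_i^n)_{1\le i\le n})_{n\ge1}$ be a triangular array of $\mathbb{R}_+$-valued random variables and $((X_i^n)_{1\le i\le n})_{n\ge1}$ a triangular array of $\Sigma$-valued random variables, all defined on a probability space $(\Omega,\mathcal{A},\mathbb{P})$, such that: for every $n$, $\sum_{i=1}^nW_i^n=n$; for every $n$, $(W_1^n,\dots,W_n^n)$ is exchangeable; $\left(\frac1n\sum_{i=1}^n\delta_{W_i^n}\right)_{n\ge1}$ satisfies an LDP on $M_1^1(\mathbb{R}_+)$ endowed with the distance $W_{1,|\cdot|}$ with good rate function $I^W$; $\left(\frac1n\sum_{i=1}^n\delta_{X_i^n}\right)_{n\ge1}$ satisfies an LDP on $M_1(\Sigma)$ endowed with the weak convergence topology with good rate function $I^X$; and for every $n$ the vectors $(X_1^n,\dots,X_n^n)$ and $(W_1^n,\dots,W_n^n)$ are independent. Then the sequence $$L^n=\frac1n\sum_{i=1}^nW_i^n\delta_{X_i^n},\qquad n\ge1,$$ satisfies an LDP on $M_1(\Sigma)$ endowed with the weak convergence topology with good rate function $$K(\nu)=\inf_{\rho:\,F(\rho)=\nu}J(\rho)=\inf_{\rho_2\in M_1(\Sigma)}\left\{\inf_{\rho_x:\,F(\rho_x\otimes\rho_2)=\nu}\left\{\int_\Sigma H(\rho_x|\rho_1)\,\rho_2(dx)+I^W(\rho_1)\right\}+I^X(\rho_2)\right\}=\inf_{\rho_2\in M_1(\Sigma)}\left\{\mathcal{K}(\nu;\rho_2)+I^X(\rho_2)\right\}.$$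 It follows that $K(\nu)\le I^X(\nu)$ for every $\nu\in M_1(\Sigma)$.
   Context: LDP: a sequence of Borel probability measures $(P^n)$ on a topological space $\mathcal{Y}$ satisfies an LDP with rate function $I$ if $I:\mathcal{Y}\to[0,\infty]$ is lower semicontinuous and, for every measurable $A\subset\mathcal{Y}$ with interior $A^o$ and closure $\bar A$, $-\inf_{A^o}I\le\liminf_n\frac1n\log P^n(A)\le\limsup_n\frac1n\log P^n(A)\le-\inf_{\bar A}I$. $I$ is good if its level sets $\{I\le\alpha\}$, $\alpha<\infty$, are compact. A sequence of random variables satisfies an LDP if their laws do. $M_1(E)$ denotes the set of Borel probability measures on $E$. $M_1^1(\mathbb{R}_+)=\{\rho\in M_1(\mathbb{R}_+):\int x\,\rho(dx)=1\}$. $W_{1,|\cdot|}$ is the Wasserstein-1 distance for $|x-y|$. For $\rho\in M_1(\mathbb{R}_+\times\Sigma)$, $\rho_1,\rho_2$ are its marginals on $\mathbb{R}_+$ and $\Sigma$. $\mathcal{M}_1^1(\mathbb{R}_+\times\Sigma)=\{\rho\in M_1(\mathbb{R}_+\times\Sigma):\int x\,\rho_1(dx)=1\}$. The map $F:\mathcal{M}_1^1(\mathbb{R}_+\times\Sigma)\to M_1(\Sigma)$ is $F(\rho)(A)=\int_{\mathbb{R}_+\times A}w\,\rho(dw,dx)$. $H(\nu|\rho)=\int\log\frac{d\nu}{d\rho}d\nu$ if $\nu\ll\rho$, $+\infty$ otherwise. For $\rho\in\mathcal{M}_1^1(\mathbb{R}_+\times\Sigma)$, $J(\rho)=H(\rho|\rho_1\otimes\rho_2)+I^W(\rho_1)+I^X(\rho_2)$.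 For $\nu,\mu\in M_1(\Sigma)$, $\mathcal{K}(\nu;\mu)=\inf\{H(\rho|\rho_1\otimes\mu)+I^W(\rho_1):\rho\in\mathcal{M}_1^1(\mathbb{R}_+\times\Sigma),\ \rho_2=\mu,\ F(\rho)=\nu\}$. In the infimum over $\rho_x$, $x\mapsto\rho_x(dw)\in M_1(\mathbb{R}_+)$ ranges over stochastic kernels, $\rho=\rho_x\otimes\rho_2$ is the measure $\rho_x(dw)\rho_2(dx)$, and $\rho_1$ is its first marginal. Exchangeable means that the law is invariant under every permutation of coordinates. *)

theory Defs
  imports "HOL-Probability.Probability"
begin

definition borel_of :: "'y topology \<Rightarrow> 'y measure" where
  "borel_of T = sigma (topspace T) {U. openin T U}"

definition lower_semicontinuous :: "'y topology \<Rightarrow> ('y \<Rightarrow> ennreal) \<Rightarrow> bool" where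
  "lower_semicontinuous T I \<longleftrightarrow> (\<forall>a. openin T {y \<in> topspace T. a < I y})"

definition good_rate :: "'y topology \<Rightarrow> ('y \<Rightarrow> ennreal) \<Rightarrow> bool" where
  "good_rate T I \<longleftrightarrow> (\<forall>a<\<infinity>. compactin T {y \<in> topspace T. I y \<le> a})"

text \<open>The library's \<^const>\<open>ln\<close> does not take the value \<open>-\<infinity>\<close> at \<open>0\<close>.\<close>

definition elog :: "real \<Rightarrow> ereal" where
  "elog p = (if p = 0 then -\<infinity> else ereal (ln p))"

text \<open>
  Sequences are indexed by \<open>n \<ge> 1\<close>; the value at \<open>n = 0\<close> is unconstrained and does not affect
  the limits. The infimum of \<open>I\<close> over the empty set is \<open>\<infinity>\<close>.
\<close>

definition LDP :: "'y topology \<Rightarrow> (nat \<Rightarrow> 'y measure) \<Rightarrow> ('y \<Rightarrow> ennreal) \<Rightarrow> bool" where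
  "LDP T P I \<longleftrightarrow>
     (\<forall>n\<ge>1. P n \<in> space (prob_algebra (borel_of T))) \<and>
     lower_semicontinuous T I \<and>
     (\<forall>A\<in>sets (borel_of T).
        - enn2ereal (INF y\<in>T interior_of A. I y)
          \<le> liminf (\<lambda>n. ereal (1 / real n) * elog (measure (P n) A)) \<and>
        limsup (\<lambda>n. ereal (1 / real n) * elog (measure (P n) A))
          \<le> - enn2ereal (INF y\<in>T closure_of A. I y))"

definition LDP_rv ::
  "'w measure \<Rightarrow> 'y topology \<Rightarrow> (nat \<Rightarrow> 'w \<Rightarrow> 'y) \<Rightarrow> ('y \<Rightarrow> ennreal) \<Rightarrow> bool" where
  "LDP_rv M T Y I \<longleftrightarrow>
     (\<forall>n\<ge>1. Y n \<in> measurable M (borel_of T)) \<and>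
     LDP T (\<lambda>n. distr M (borel_of T) (Y n)) I"

text \<open>
  For a measurable space \<open>K\<close>, the set of probability measures on \<open>K\<close> is
  \<^term>\<open>space (prob_algebra K)\<close>. On \<^term>\<open>Rplus \<Otimes>\<^sub>M borel\<close>, the product \<open>\<sigma>\<close>-algebra is the Borel
  one, because both factors are second countable.
\<close>

definition Rplus :: "real measure" where
  "Rplus = restrict_space borel {0..}"

abbreviation M1 :: "'a::topological_space measure set" where
  "M1 \<equiv> space (prob_algebra borel)"

definition weak_topology :: "'a::topological_space measure topology" where
  "weak_topology = topology_generated_by
     {{\<mu> \<in> M1. (\<integral>x. f x \<partial>\<mu>) \<in> U} | (f :: 'a \<Rightarrow> real) U.
        continuous_on UNIV f \<and> bounded (range f) \<and> open U}"

definition M11_Rplus :: "real measure set" where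
  "M11_Rplus = {\<rho> \<in> space (prob_algebra Rplus). (\<integral>\<^sup>+x. ennreal x \<partial>\<rho>) = 1}"

definition couplings :: "real measure \<Rightarrow> real measure \<Rightarrow> (real \<times> real) measure set" where
  "couplings \<mu> \<nu> = {\<pi> \<in> space (prob_algebra (Rplus \<Otimes>\<^sub>M Rplus)).
     distr \<pi> Rplus fst = \<mu> \<and> distr \<pi> Rplus snd = \<nu>}"

text \<open>The infimum is finite on \<^const>\<open>M11_Rplus\<close>, whose elements have finite first moment.\<close>

definition W1 :: "real measure \<Rightarrow> real measure \<Rightarrow> real" where
  "W1 \<mu> \<nu> = enn2real (INF \<pi>\<in>couplings \<mu> \<nu>. \<integral>\<^sup>+(x, y). ennreal \<bar>x - y\<bar> \<partial>\<pi>)"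

definition W1_topology :: "real measure topology" where
  "W1_topology = Metric_space.mtopology M11_Rplus W1"

definition marg1 :: "(real \<times> 's::topological_space) measure \<Rightarrow> real measure" where
  "marg1 \<rho> = distr \<rho> Rplus fst"

definition marg2 :: "(real \<times> 's::topological_space) measure \<Rightarrow> 's measure" where
  "marg2 \<rho> = distr \<rho> borel snd"

definition M11 :: "(real \<times> 's::topological_space) measure set" where
  "M11 = {\<rho> \<in> space (prob_algebra (Rplus \<Otimes>\<^sub>M borel)). (\<integral>\<^sup>+x. ennreal x \<partial>marg1 \<rho>) = 1}"

definition Fmap :: "(real \<times> 's::topological_space) measure \<Rightarrow> 's measure" where
  "Fmap \<rho> = distr (density \<rho> (\<lambda>(w, x). ennreal w)) borel snd"

lemma emeasure_Fmap:
  assumes \<rho>: "\<rho> \<in> M11" and A: "A \<in> sets borel"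
  shows "emeasure (Fmap \<rho>) A = (\<integral>\<^sup>+(w, x). ennreal w * indicator ({0..} \<times> A) (w, x) \<partial>\<rho>)"
proof -
  have s: "sets \<rho> = sets (Rplus \<Otimes>\<^sub>M borel)"
    using \<rho> by (auto simp: M11_def space_prob_algebra)
  have sp: "space \<rho> = {0..} \<times> UNIV"
    using sets_eq_imp_space_eq[OF s] by (simp add: space_pair_measure Rplus_def space_restrict_space)
  have [measurable]: "(\<lambda>w. ennreal w) \<in> borel_measurable Rplus"
    unfolding Rplus_def by (rule measurable_restrict_space1) simp
  have f: "(\<lambda>(w, x). ennreal w) \<in> borel_measurable \<rho>"
    unfolding measurable_cong_sets[OF s refl] by measurable
  have m: "snd \<in> measurable \<rho> borel"
    unfolding measurable_cong_sets[OF s refl] by measurable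
  have B: "snd -` A \<inter> space \<rho> \<in> sets \<rho>"
    using m A by (rule measurable_sets)
  have "emeasure (Fmap \<rho>) A = (\<integral>\<^sup>+p. (case p of (w, x) \<Rightarrow> ennreal w) * indicator (snd -` A \<inter> space \<rho>) p \<partial>\<rho>)"
    unfolding Fmap_def using A m B f by (simp add: emeasure_distr emeasure_density)
  also have "\<dots> = (\<integral>\<^sup>+(w, x). ennreal w * indicator ({0..} \<times> A) (w, x) \<partial>\<rho>)"
    by (rule nn_integral_cong) (auto simp: sp indicator_def)
  finally show ?thesis .
qed

text \<open>The measure \<open>\<kappa>\<^sub>x(dw) \<mu>(dx)\<close>, for a stochastic kernel \<open>\<kappa>\<close> from the second factor to \<^const>\<open>Rplus\<close>.\<close>

definition kernel_prod ::
  "('s \<Rightarrow> real measure) \<Rightarrow> 's::topological_space measure \<Rightarrow> (real \<times> 's) measure" where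
  "kernel_prod \<kappa> \<mu> = \<mu> \<bind> (\<lambda>x. distr (\<kappa> x) (Rplus \<Otimes>\<^sub>M borel) (\<lambda>w. (w, x)))"

lemma emeasure_kernel_prod:
  assumes \<kappa>[measurable]: "\<kappa> \<in> measurable borel (prob_algebra Rplus)" and \<mu>: "\<mu> \<in> M1"
    and A[measurable]: "A \<in> sets (Rplus \<Otimes>\<^sub>M borel)"
  shows "emeasure (kernel_prod \<kappa> \<mu>) A = (\<integral>\<^sup>+x. emeasure (\<kappa> x) {w \<in> {0..}. (w, x) \<in> A} \<partial>\<mu>)"
proof -
  have s: "sets \<mu> = sets borel"
    using \<mu> by (simp add: space_prob_algebra)
  have k: "\<kappa> \<in> measurable borel (subprob_algebra Rplus)"
    using \<kappa> by (rule measurable_prob_algebraD)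
  have "(\<lambda>x. distr (\<kappa> x) (Rplus \<Otimes>\<^sub>M borel) (\<lambda>w. (w, x)))
      \<in> measurable borel (subprob_algebra (Rplus \<Otimes>\<^sub>M borel))"
    by (rule measurable_distr2[OF _ k]) measurable
  then have K: "(\<lambda>x. distr (\<kappa> x) (Rplus \<Otimes>\<^sub>M borel) (\<lambda>w. (w, x)))
      \<in> measurable \<mu> (subprob_algebra (Rplus \<Otimes>\<^sub>M borel))"
    unfolding measurable_cong_sets[OF s refl] .
  have "space \<mu> \<noteq> {}"
    using \<mu> by (simp add: space_prob_algebra prob_space.not_empty)
  then have "emeasure (kernel_prod \<kappa> \<mu>) A =
      (\<integral>\<^sup>+x. emeasure (distr (\<kappa> x) (Rplus \<Otimes>\<^sub>M borel) (\<lambda>w. (w, x))) A \<partial>\<mu>)"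
    unfolding kernel_prod_def by (rule emeasure_bind[OF _ K A])
  also have "\<dots> = (\<integral>\<^sup>+x. emeasure (\<kappa> x) {w \<in> {0..}. (w, x) \<in> A} \<partial>\<mu>)"
  proof (rule nn_integral_cong)
    fix x assume "x \<in> space \<mu>"
    have s: "sets (\<kappa> x) = sets Rplus"
      using measurable_space[OF \<kappa>, of x] by (simp add: space_prob_algebra)
    have m: "(\<lambda>w. (w, x)) \<in> measurable (\<kappa> x) (Rplus \<Otimes>\<^sub>M borel)"
      unfolding measurable_cong_sets[OF s refl] by measurable
    have "space (\<kappa> x) = {0..}"
      using sets_eq_imp_space_eq[OF s] by (simp add: Rplus_def space_restrict_space)
    then have "(\<lambda>w. (w, x)) -` A \<inter> space (\<kappa> x) = {w \<in> {0..}. (w, x) \<in> A}"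
      by auto
    then show "emeasure (distr (\<kappa> x) (Rplus \<Otimes>\<^sub>M borel) (\<lambda>w. (w, x))) A =
        emeasure (\<kappa> x) {w \<in> {0..}. (w, x) \<in> A}"
      using emeasure_distr[OF m A] by simp
  qed
  finally show ?thesis .
qed

text \<open>
  For probability measures \<open>\<nu> \<lless> \<rho>\<close> the negative part of \<open>log (d\<nu>/d\<rho>)\<close> is always \<open>\<nu>\<close>-integrable,
  so if the whole is not integrable then \<open>\<integral>log (d\<nu>/d\<rho>) d\<nu> = \<infinity>\<close>. The library's
  \<^const>\<open>KL_divergence\<close> takes the reference measure \<open>\<rho>\<close> first and would be \<open>0\<close> there.
  By Jensen's inequality a finite value is nonnegative, so that \<^const>\<open>ennreal\<close> cuts nothing off.
\<close>

definition rel_entropy :: "'a measure \<Rightarrow> 'a measure \<Rightarrow> ennreal" where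
  "rel_entropy \<nu> \<rho> =
     (if absolutely_continuous \<rho> \<nu> \<and> integrable \<nu> (entropy_density (exp 1) \<rho> \<nu>)
      then ennreal (KL_divergence (exp 1) \<rho> \<nu>) else \<infinity>)"

definition Jrate ::
  "(real measure \<Rightarrow> ennreal) \<Rightarrow> ('s::topological_space measure \<Rightarrow> ennreal)
    \<Rightarrow> (real \<times> 's) measure \<Rightarrow> ennreal" where
  "Jrate IW IX \<rho> =
     rel_entropy \<rho> (marg1 \<rho> \<Otimes>\<^sub>M marg2 \<rho>) + IW (marg1 \<rho>) + IX (marg2 \<rho>)"

definition calK ::
  "(real measure \<Rightarrow> ennreal) \<Rightarrow> 's::topological_space measure \<Rightarrow> 's measure \<Rightarrow> ennreal" where
  "calK IW \<nu> \<mu> =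
     (INF \<rho>\<in>{\<rho> \<in> M11. marg2 \<rho> = \<mu> \<and> Fmap \<rho> = \<nu>}.
        rel_entropy \<rho> (marg1 \<rho> \<Otimes>\<^sub>M \<mu>) + IW (marg1 \<rho>))"

definition Krate ::
  "(real measure \<Rightarrow> ennreal) \<Rightarrow> ('s::topological_space measure \<Rightarrow> ennreal)
    \<Rightarrow> 's measure \<Rightarrow> ennreal" where
  "Krate IW IX \<nu> = (INF \<rho>\<in>{\<rho> \<in> M11. Fmap \<rho> = \<nu>}. Jrate IW IX \<rho>)"

text \<open>\<open>1/n \<Sum>\<^sub>i w\<^sub>i \<delta>\<^bsub>x\<^sub>i\<^esub>\<close> as a measure on \<open>K\<close>, with \<open>i\<close> ranging over \<open>1..n\<close>.\<close>

definition weighted_empirical ::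
  "'a measure \<Rightarrow> nat \<Rightarrow> (nat \<Rightarrow> real) \<Rightarrow> (nat \<Rightarrow> 'a) \<Rightarrow> 'a measure" where
  "weighted_empirical K n w x =
     distr (point_measure {1..n} (\<lambda>i. ennreal (w i / real n))) K x"

lemma emeasure_weighted_empirical:
  assumes "\<And>i. i \<in> {1..n} \<Longrightarrow> x i \<in> space K" and A: "A \<in> sets K"
  shows "emeasure (weighted_empirical K n w x) A =
    (\<Sum>i=1..n. ennreal (w i / real n) * emeasure (return K (x i)) A)"
proof -
  have "emeasure (weighted_empirical K n w x) A =
      emeasure (point_measure {1..n} (\<lambda>i. ennreal (w i / real n))) (x -` A \<inter> {1..n})"
    unfolding weighted_empirical_def using assms
    by (subst emeasure_distr) (auto simp: space_point_measure)
  also have "\<dots> = (\<Sum>i\<in>x -` A \<inter> {1..n}. ennreal (w i / real n))"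
    by (rule emeasure_point_measure_finite) auto
  also have "\<dots> = (\<Sum>i=1..n. ennreal (w i / real n) * emeasure (return K (x i)) A)"
    using A by (intro sum.mono_neutral_cong_left) (auto simp: indicator_def)
  finally show ?thesis .
qed

definition exchangeable :: "'w measure \<Rightarrow> 'a measure \<Rightarrow> nat \<Rightarrow> (nat \<Rightarrow> 'w \<Rightarrow> 'a) \<Rightarrow> bool" where
  "exchangeable M K n Y \<longleftrightarrow>
     (\<forall>\<sigma>. \<sigma> permutes {1..n} \<longrightarrow>
        distr M (Pi\<^sub>M {1..n} (\<lambda>_. K)) (\<lambda>\<omega>. \<lambda>i\<in>{1..n}. Y (\<sigma> i) \<omega>) =
        distr M (Pi\<^sub>M {1..n} (\<lambda>_. K)) (\<lambda>\<omega>. \<lambda>i\<in>{1..n}. Y i \<omega>))"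

text \<open>
  The library's \<^const>\<open>prob_space.indep_var\<close> requires both variables to have the same type; this is
  its unfolding without that restriction.
\<close>

definition independent_rv ::
  "'w measure \<Rightarrow> 'a measure \<Rightarrow> ('w \<Rightarrow> 'a) \<Rightarrow> 'b measure \<Rightarrow> ('w \<Rightarrow> 'b) \<Rightarrow> bool" where
  "independent_rv M A Y B Z \<longleftrightarrow>
     Y \<in> measurable M A \<and> Z \<in> measurable M B \<and>
     prob_space.indep_set M
       {Y -` S \<inter> space M | S. S \<in> sets A} {Z -` S \<inter> space M | S. S \<in> sets B}"

end

theory Submission
 imports Defs
begin

text \<open>
 \<open>L\<^sup>n\<close> is the image under \<open>F\<close> of the joint empirical measure of weights and points, whose marginals
 are the two given empirical measures. Replace weights and points by labels in finite partitions whose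
 cells have null boundary. Exchangeability of the weights and independence make the table of the label
 pairs hypergeometric given its margins, so counting label functions gives a table of mutual information
 \<open>h\<close> the probability \<open>exp (- n h)\<close> up to a polynomial factor. The table of \<open>\<rho>\<close> determines \<open>F(\<rho>)\<close> up to a
 small error, uniformly over first marginals in a Wasserstein neighbourhood, since there the tails of the
 weights are controlled. Its mutual information is at most \<open>H(\<rho>|\<rho>\<^sub>1 \<otimes> \<rho>\<^sub>2)\<close>, with equality for
 suitable densities that are constant on cells, and couplings of fixed marginals with bounded entropy are setwise
 relatively compact. Both LDP bounds are therefore local statements near a pair of marginals; compactness
 of the level sets of \<open>I\<^sup>W\<close> and \<open>I\<^sup>X\<close> globalises the upper bound and also yields goodness of \<open>K\<close>.

 The kernel form of \<open>K\<close> follows from the variational formula for relative entropy and from disintegration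
 along densities. Product couplings and \<open>inf I\<^sup>W = 0\<close> give \<open>K \<le> I\<^sup>X\<close>.
\<close>

text \<open>The map \<open>Fmap\<close> is not weakly continuous, because the weight is unbounded,
  and the relative entropy of an atomic joint empirical measure says nothing about probabilities.
  Hence no LDP for the joint empirical measure is formulated: every estimate lives near one pair
  (\<alpha>, \<beta>) of marginals and sees the joint measure only through a finite table. If IW
  \<alpha> = x and IX \<beta> = y, being near (\<alpha>, \<beta>) costs x + y by independence. At
  level a this leaves the entropy budget a - x - y for the coupling. Couplings within the budget
  have their image in the open set under consideration; by compactness the same holds for a slightly
  larger budget c, and tables that exceed c cost exp (- n c). The gap between the two budgets pays
  for the size of the neighbourhoods, and a further loss in the exponent pays for the polynomial
  factors. If x + y > a, the marginals alone are expensive enough. Weak neighbourhoods are given by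
  finite sets of test functions and limits are taken along filters. The limits of couplings exist
  setwise because all entropies refer to the single measure \<alpha> \<otimes> \<beta>.\<close>

abbreviation RS :: "(real\<times>'s::topological_space) measure" where
 "RS \<equiv> Rplus\<Otimes>\<^sub>Mborel"

abbreviation bdd_cont :: "('s::topological_space => real) => bool" where
 "bdd_cont h \<equiv> continuous_on UNIV h \<and> bounded (range h)"

abbreviation mean :: "'a measure => ('a => real) => real" where
 "mean \<mu> h \<equiv> \<integral>x. h x\<partial>\<mu>"

abbreviation near :: "('a => real) set => real => 'a measure => 'a measure => bool" where
 "near hs e \<mu> \<nu> \<equiv> \<forall>h\<in>hs. \<bar>mean \<mu> h - mean \<nu> h\<bar> < e"

section \<open>Exponential bounds from large deviation principles\<close>

lemma elog_less_iff:
 assumes "0\<le>p" "n \<ge> 1"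
 shows "ereal (1/real n)*elog p < ereal (- s) \<longleftrightarrow> p < exp (- real n * s)"
proof (cases "p = 0")
 case False
 then have "p > 0" using assms by simp
 have "ereal (1/real n)*elog p < ereal (- s) \<longleftrightarrow> ln p < - real n * s"
  using False assms by (simp add: elog_def field_simps)
 also have "\<dots> \<longleftrightarrow> p < exp (- real n * s)"
  using \<open>p > 0\<close> by (metis exp_gt_zero exp_less_cancel_iff exp_ln)
 finally show ?thesis .
qed (use assms in \<open>simp add: elog_def\<close>)

lemma elog_greater_iff:
 assumes "0\<le>p" "n \<ge> 1"
 shows "ereal (- s) < ereal (1/real n)*elog p \<longleftrightarrow> exp (- real n * s) < p"
proof (cases "p = 0")
 case False
 then have "p > 0" using assms by simp
 have "ereal (- s) < ereal (1/real n)*elog p \<longleftrightarrow> - real n * s < ln p"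
  using False assms by (simp add: elog_def field_simps)
 also have "\<dots> \<longleftrightarrow> exp (- real n * s) < p"
  using \<open>p > 0\<close> by (metis exp_gt_zero exp_less_cancel_iff exp_ln)
 finally show ?thesis .
qed (use assms in \<open>simp add: elog_def\<close>)

text \<open>The strict gap between s and S turns an asymptotic bound into one valid for all large n,
  in a form where probabilities can be added and multiplied.\<close>

lemma limsup_elog_imp:
 assumes "limsup (%n. ereal (1/real n)*elog (p n))\<le>- S" "ereal s < S" "\<And>n. 0\<le>p n"
 shows "\<forall>\<^sub>F n in sequentially. p n\<le>exp (- real n * s)"
proof -
 have "- S < ereal (- s)" using assms(2) by (metis ereal_minus_less_minus uminus_ereal.simps(1))
 then have "limsup (%n. ereal (1/real n)*elog (p n)) < ereal (- s)"
  using assms(1) by (rule le_less_trans[rotated])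
 then have "\<forall>\<^sub>F n in sequentially. ereal (1/real n)*elog (p n) < ereal (- s)"
  by (rule Limsup_lessD)
 then show ?thesis using eventually_ge_at_top[of 1]
  by eventually_elim (use elog_less_iff[OF assms(3)] in \<open>auto intro: less_imp_le\<close>)
qed

lemma liminf_elog_imp:
 assumes "- S\<le>liminf (%n. ereal (1/real n)*elog (p n))" "S < ereal s" "\<And>n. 0\<le>p n"
 shows "\<forall>\<^sub>F n in sequentially. exp (- real n * s)\<le>p n"
proof -
 have "ereal (- s) < - S" using assms(2) by (metis ereal_minus_less_minus uminus_ereal.simps(1))
 then have "ereal (- s) < liminf (%n. ereal (1/real n)*elog (p n))"
  using assms(1) by (rule less_le_trans)
 then have "\<forall>\<^sub>F n in sequentially. ereal (- s) < ereal (1/real n)*elog (p n)"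
  by (rule less_LiminfD)
 then show ?thesis using eventually_ge_at_top[of 1]
  by eventually_elim (use elog_greater_iff[OF assms(3)] in \<open>auto intro: less_imp_le\<close>)
qed

text \<open>A real number strictly between - S and the limsup would contradict the exponential bound
  at that number. All later estimates therefore aim at exponential bounds for each s
  separately.\<close>

lemma limsup_elog_le:
 assumes ev: "\<And>s. ereal s < S ==> \<forall>\<^sub>F n in sequentially. p n\<le>exp (- real n * s)"
  and p: "\<And>n. 0\<le>p n"
 shows "limsup (%n. ereal (1/real n)*elog (p n))\<le>- S"
proof (rule ccontr)
 assume "\<not> ?thesis"
 then have "- S < limsup (%n. ereal (1/real n)*elog (p n))" by simp
 then obtain r where r: "- S < ereal r" "ereal r < limsup (%n. ereal (1/real n)*elog (p n))"
  using ereal_dense2 by blast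
 have "ereal (- r) < S" using r(1) by (metis ereal_minus_less_minus uminus_ereal.simps(1) ereal_uminus_uminus)
 from ev[OF this] eventually_ge_at_top[of 1]
 have "\<forall>\<^sub>F n in sequentially. ereal (1/real n)*elog (p n)\<le>ereal r"
 proof eventually_elim
  case (elim n)
  then show ?case using elog_greater_iff[OF p[of n] elim(2), of "- r"] by (auto simp: not_less[symmetric])
 qed
 then have "limsup (%n. ereal (1/real n)*elog (p n))\<le>ereal r"
  by (rule Limsup_bounded)
 then show False using r(2) by simp
qed

lemma liminf_elog_ge:
 assumes ev: "\<And>s. S < ereal s ==> \<forall>\<^sub>F n in sequentially. exp (- real n * s)\<le>p n"
  and p: "\<And>n. 0\<le>p n"
 shows "- S\<le>liminf (%n. ereal (1/real n)*elog (p n))"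
proof (rule ccontr)
 assume "\<not> ?thesis"
 then have "liminf (%n. ereal (1/real n)*elog (p n)) < - S" by simp
 then obtain r where r: "ereal r < - S" "liminf (%n. ereal (1/real n)*elog (p n)) < ereal r"
  using ereal_dense2 by blast
 have "S < ereal (- r)" using r(1) by (metis ereal_minus_less_minus uminus_ereal.simps(1) ereal_uminus_uminus)
 from ev[OF this] eventually_ge_at_top[of 1]
 have "\<forall>\<^sub>F n in sequentially. ereal r\<le>ereal (1/real n)*elog (p n)"
 proof eventually_elim
  case (elim n)
  then show ?case using elog_less_iff[OF p[of n] elim(2), of "- r"] by (auto simp: not_less[symmetric])
 qed
 then have "ereal r\<le>liminf (%n. ereal (1/real n)*elog (p n))"
  by (rule Liminf_bounded)
 then show False using r(2) by simp
qed

text \<open>Rate functions take values in \<open>ennreal\<close>, rescaled logarithms in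
  \<open>ereal\<close>; this and the next two facts move comparisons with real thresholds between
  the two.\<close>

lemma ereal_less_enn2ereal: "0\<le>s ==> ereal s < enn2ereal x \<longleftrightarrow> ennreal s < x"
 by (metis enn2ereal_ennreal less_ennreal.rep_eq)

lemma ereal_le_enn2ereal: "0\<le>s ==> ereal s\<le>enn2ereal x \<longleftrightarrow> ennreal s\<le>x"
 by (metis enn2ereal_ennreal less_eq_ennreal.rep_eq)

lemma enn2ereal_less_ereal: "0\<le>s ==> enn2ereal x < ereal s \<longleftrightarrow> x < ennreal s"
 by (metis enn2ereal_ennreal less_ennreal.rep_eq)

section \<open>Exponential bounds for closed sets, open sets and small neighbourhoods\<close>

lemma sets_borel_of: "sets (borel_of T) = sigma_sets (topspace T) {U. openin T U}"
 unfolding borel_of_def by (rule sets_measure_of) (auto dest: openin_subset)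

lemma space_borel_of [simp]: "space (borel_of T) = topspace T"
 unfolding borel_of_def by (rule space_measure_of) (auto dest: openin_subset)

lemma openin_sets_borel_of: "openin T U ==> U\<in>sets (borel_of T)"
 unfolding sets_borel_of by (rule sigma_sets.Basic) simp

lemma closedin_sets_borel_of: "closedin T C ==> C\<in>sets (borel_of T)"
proof -
 assume C: "closedin T C"
 then have "C = space (borel_of T) - (topspace T - C)" by (auto dest: closedin_subset)
 then show ?thesis using C by (metis openin_sets_borel_of sets.compl_sets closedin_def)
qed

lemma LDP_closed_upper:
 assumes L: "LDP T P I" and C: "closedin T C" and s: "\<And>y. y\<in>C ==> ennreal a\<le>I y" and "0\<le>a" "s < a"
 shows "\<forall>\<^sub>F n in sequentially. measure (P n) C\<le>exp (- real n * s)"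
proof (rule limsup_elog_imp[where S = "enn2ereal (INF y\<in>C. I y)"])
 show "limsup (%n. ereal (1/real n)*elog (measure (P n) C))\<le>- enn2ereal (INF y\<in>C. I y)"
  using L closedin_sets_borel_of[OF C] C unfolding LDP_def by (auto simp: closure_of_closedin)
 have "ennreal a\<le>(INF y\<in>C. I y)" by (rule INF_greatest) (rule s)
 then have "ereal a\<le>enn2ereal (INF y\<in>C. I y)" using \<open>0 \<le> a\<close> by (simp only: ereal_le_enn2ereal)
 then show "ereal s < enn2ereal (INF y\<in>C. I y)" using \<open>s < a\<close> using order_less_le_trans[of "ereal s" "ereal a"] by simp
qed simp

lemma LDP_open_lower:
 assumes L: "LDP T P I" and U: "openin T U" "y\<in>U" and s: "I y < ennreal s" "0\<le>s"
 shows "\<forall>\<^sub>F n in sequentially. exp (- real n * s)\<le>measure (P n) U"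
proof (rule liminf_elog_imp[where S = "enn2ereal (INF y\<in>U. I y)"])
 show "- enn2ereal (INF y\<in>U. I y)\<le>liminf (%n. ereal (1/real n)*elog (measure (P n) U))"
  using L openin_sets_borel_of[OF U(1)] U unfolding LDP_def by (auto simp: interior_of_openin)
 have "(INF y\<in>U. I y) < ennreal s" using U s by (auto simp: INF_less_iff)
 then show "enn2ereal (INF y\<in>U. I y) < ereal s" using s by (simp only: enn2ereal_less_ereal)
qed simp

text \<open>The upper bound of an LDP is effective on closed sets only, so a neighbourhood of y
  inside a closed set with large rate is required. Goodness supplies it: the compact level set at
  some a between s and I y can be separated from y, and the complement of its open hull is
  closed.\<close>

lemma LDP_local_upper:
 assumes L: "LDP T P I" and H: "Hausdorff_space T" and g: "good_rate T I"
  and y: "y\<in>topspace T" and s: "ennreal s < I y" "0\<le>s"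
 obtains U where "openin T U" "y\<in>U" "\<forall>\<^sub>F n in sequentially. measure (P n) U\<le>exp (- real n * s)"
proof -
 obtain a where a: "s < a" "ennreal a < I y"
 proof -
  obtain q where q: "ennreal s < q" "q < I y" using s dense by blast
  then have "q < top" using order_less_le_trans[OF q(2) top_greatest] by simp
  then obtain a where "q = ennreal a" "0\<le>a" by (cases q) auto
  then show ?thesis using q s that[of a] by (simp add: ennreal_less_iff)
 qed
 have a0: "0\<le>a" using a s by simp
 have c1: "compactin T {z\<in>topspace T. I z\<le>ennreal a}"
  using g unfolding good_rate_def by (simp add: ennreal_less_top)
 have c2: "compactin T {y}" using y by simp
 have dj: "disjnt {y} {z\<in>topspace T. I z\<le>ennreal a}" using a by (auto simp: disjnt_def)
 obtain U V where UV: "openin T U" "openin T V" "{y}\<subseteq>U" "{z\<in>topspace T. I z\<le>ennreal a}\<subseteq>V" "disjnt U V"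
  by (rule Hausdorff_space_compact_separation[OF H c2 c1 dj])
 let ?C = "topspace T - V"
 have C: "closedin T ?C" using UV by blast
 have UC: "U\<subseteq>?C" using UV by (auto simp: disjnt_def dest: openin_subset)
 have "\<forall>\<^sub>F n in sequentially. measure (P n) ?C\<le>exp (- real n * s)"
  by (rule LDP_closed_upper[OF L C _ a0 a(1)]) (use UV in force)
 then have "\<forall>\<^sub>F n in sequentially. measure (P n) U\<le>exp (- real n * s)" using eventually_ge_at_top[of 1]
 proof eventually_elim
  case (elim n)
  have "P n\<in>space (prob_algebra (borel_of T))" using L elim unfolding LDP_def by blast
  then have p: "prob_space (P n)" "sets (P n) = sets (borel_of T)" by (auto simp: space_prob_algebra)
  interpret prob_space "P n" by fact
  have "measure (P n) U\<le>measure (P n) ?C"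
   by (rule finite_measure_mono[OF UC]) (simp add: p closedin_sets_borel_of[OF C])
  then show ?case using elim by simp
 qed
 then show thesis using that UV by blast
qed

text \<open>The whole space is closed and has probability 1, which does not decay
  exponentially.\<close>

lemma LDP_inf_zero:
 assumes L: "LDP T P I"
 shows "(INF y\<in>topspace T. I y) = 0"
proof (rule ccontr)
 assume "\<not> ?thesis"
 then have "0 < (INF y\<in>topspace T. I y)" by (simp add: zero_less_iff_neq_zero)
 then obtain q where q: "0 < q" "q < (INF y\<in>topspace T. I y)" using dense by blast
 then have "q < top" using order_less_le_trans[OF q(2) top_greatest] by simp
 then obtain a where a: "q = ennreal a" "0 < a" using q(1) by (cases q) auto
 have "\<forall>\<^sub>F n in sequentially. measure (P n) (topspace T)\<le>exp (- real n*(a/2))"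
  by (rule LDP_closed_upper[OF L, of _ a]) (use q a in \<open>auto simp: less_INF_D less_imp_le\<close>)
 then have "\<forall>\<^sub>F n::nat in sequentially. False" using eventually_ge_at_top[of 1]
 proof eventually_elim
  case (elim n)
  have "P n\<in>space (prob_algebra (borel_of T))" using L elim unfolding LDP_def by blast
  then have p: "prob_space (P n)" "sets (P n) = sets (borel_of T)" by (auto simp: space_prob_algebra)
  have "measure (P n) (topspace T) = 1"
   using prob_space.prob_space[OF p(1)] sets_eq_imp_space_eq[OF p(2)] by simp
  moreover have "exp (- real n*(a/2)) < 1" using elim a by simp
  ultimately show ?case using elim by simp
 qed
 then show False by simp
qed

section \<open>The weak topology\<close>

lemma topspace_weak [simp]: "topspace weak_topology = (M1 :: 'a::topological_space measure set)"
proof -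
 have "(M1 :: 'a measure set)\<in>{{\<mu>\<in>M1. (mean \<mu> f)\<in>U} | (f :: 'a => real) U.
    continuous_on UNIV f \<and> bounded (range f) \<and> open U}"
  unfolding mem_Collect_eq by (intro exI[of _ "%_. 0"] exI[of _ UNIV]) simp
 then show ?thesis unfolding weak_topology_def topology_generated_by_topspace by blast
qed

lemma openin_weak_integral:
 fixes f :: "'a::topological_space => real"
 assumes "continuous_on UNIV f" "bounded (range f)" "open U"
 shows "openin weak_topology {\<mu>\<in>M1. (mean \<mu> f)\<in>U}"
 unfolding weak_topology_def using assms by (intro topology_generated_by_Basis) blast

lemma tendsto_weak_nhdsin:
 fixes f :: "'a::topological_space => real"
 assumes "continuous_on UNIV f" "bounded (range f)"
 shows "((%\<mu>. \<integral>x. f x\<partial>\<mu>) \<longlongrightarrow> (mean \<nu> f)) (nhdsin weak_topology \<nu>)"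
proof (rule topological_tendstoI)
 fix S :: "real set" assume S: "open S" "(mean \<nu> f)\<in>S"
 show "\<forall>\<^sub>F \<mu> in nhdsin weak_topology \<nu>. (mean \<mu> f)\<in>S"
 proof (cases "\<nu>\<in>M1")
  case True
  show ?thesis unfolding eventually_nhdsin
  proof (intro disjI2 exI conjI)
   show "openin weak_topology {\<mu>\<in>M1. (mean \<mu> f)\<in>S}" by (rule openin_weak_integral[OF assms S(1)])
   show "\<nu>\<in>{\<mu>\<in>M1. (mean \<mu> f)\<in>S}" using True S(2) by blast
  qed blast
 qed (simp add: eventually_nhdsin)
qed

text \<open>Induction over the generation of the open set from the subbasis: intersections unite the
  finite sets of test functions and take the smaller radius, unions use the member that contains
  \<nu>.\<close>

lemma weak_nhds_basic:
 fixes G :: "'a::topological_space measure set"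
 assumes "openin weak_topology G" "\<nu>\<in>G"
 obtains hs and e :: real where "finite hs" "0 < e"
  "\<forall>h\<in>hs. bdd_cont (h :: 'a => real)"
  "\<forall>\<nu>'\<in>M1. (near hs e \<nu>' \<nu>) --> \<nu>'\<in>G"
proof -
 let ?B = "{{\<mu>\<in>M1. (mean \<mu> f)\<in>U} | (f :: 'a => real) U.
    continuous_on UNIV f \<and> bounded (range f) \<and> open U}"
 have "generate_topology_on ?B G"
  using assms(1) unfolding weak_topology_def openin_topology_generated_by_iff .
 then have "\<exists>hs e. finite hs \<and> (0::real) < e \<and>
   (\<forall>h\<in>hs. bdd_cont (h :: 'a => real)) \<and>
   (\<forall>\<nu>'\<in>M1. (near hs e \<nu>' \<nu>) --> \<nu>'\<in>G)"
  using assms(2)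
 proof (induction)
  case Empty
  then show ?case by simp
 next
  case (Int a b)
  have n: "\<nu>\<in>a" "\<nu>\<in>b" using Int.prems by blast+
  from Int.IH(1)[OF n(1)] obtain ha ea where
   a: "finite ha" "(0::real) < ea" "\<forall>h\<in>ha. bdd_cont (h :: 'a => real)"
    "\<forall>\<nu>'\<in>M1. (\<forall>h\<in>ha. \<bar>(mean \<nu>' h) - (mean \<nu> h)\<bar> < ea) --> \<nu>'\<in>a"
   by (elim exE conjE) (rule that)
  from Int.IH(2)[OF n(2)] obtain hb eb where
   b: "finite hb" "(0::real) < eb" "\<forall>h\<in>hb. bdd_cont (h :: 'a => real)"
    "\<forall>\<nu>'\<in>M1. (\<forall>h\<in>hb. \<bar>(mean \<nu>' h) - (mean \<nu> h)\<bar> < eb) --> \<nu>'\<in>b"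
   by (elim exE conjE) (rule that)
  show ?case
  proof (intro exI[of _ "ha\<union>hb"] exI[of _ "min ea eb"] conjI ballI impI)
   fix \<nu>' :: "'a measure" assume "\<nu>'\<in>M1" "\<forall>h\<in>ha\<union>hb. \<bar>(mean \<nu>' h) - (mean \<nu> h)\<bar> < min ea eb"
   then show "\<nu>'\<in>a\<inter>b" using a(4) b(4) by (metis IntI UnCI min_less_iff_conj)
  qed (use a b in blast | use a b in simp)+
 next
  case (UN K)
  then obtain k where k: "k\<in>K" "\<nu>\<in>k" by blast
  from UN.IH[OF k] obtain hs e where
   "finite hs" "(0::real) < e" "\<forall>h\<in>hs. bdd_cont (h :: 'a => real)"
    "\<forall>\<nu>'\<in>M1. (near hs e \<nu>' \<nu>) --> \<nu>'\<in>k"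
   by (elim exE conjE) (rule that)
  then show ?case using k(1) by (intro exI[of _ hs] exI[of _ e]) blast
 next
  case (Basis s)
  then obtain f :: "'a => real" and U where fU: "s = {\<mu>\<in>M1. (mean \<mu> f)\<in>U}"
   "continuous_on UNIV f" "bounded (range f)" "open U" by blast
  then obtain e where "e > 0" "ball (mean \<nu> f) e\<subseteq>U"
   using Basis.prems by (auto simp: open_contains_ball)
  moreover have "(mean \<nu>' f)\<in>ball (mean \<nu> f) e" if "\<bar>(mean \<nu>' f) - (mean \<nu> f)\<bar> < e" for \<nu>'
   using that by (simp add: dist_real_def)
  ultimately show ?case using fU(2,3) unfolding fU(1)
   by (intro exI[of _ "{f}"] exI[of _ e]) blast
 qed
 then show thesis by (elim exE conjE) (rule that)
qed

section \<open>Lipschitz test functions and the measure of open sets\<close>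

lemma prob_algebraD:
 assumes "M\<in>space (prob_algebra K)"
 shows "prob_space M" "sets M = sets K" "space M = space K"
proof -
 show p: "prob_space M" and s: "sets M = sets K" using assms by (simp_all add: space_prob_algebra)
 show "space M = space K" by (rule sets_eq_imp_space_eq[OF s])
qed

text \<open>The open-set half of the portmanteau theorem. The indicator of U is the increasing limit
  of the Lipschitz functions min 1 (k dist(x, - U)), and one k is good enough for r. Asking for
  convergence on bounded Lipschitz functions only makes it apply to the weak and to the Wasserstein
  topology alike; the set X allows for measures on the half line.\<close>

lemma open_measure_liminf:
 fixes \<mu> :: "'i => 'a::metric_space measure"
 assumes K: "K = restrict_space borel X"
  and \<mu>: "\<forall>\<^sub>F i in F. \<mu> i\<in>space (prob_algebra K)" and \<nu>: "\<nu>\<in>space (prob_algebra K)"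
  and lim: "\<And>(f :: 'a => real) L. L-lipschitz_on UNIV f ==> bounded (range f) ==> ((%i. \<integral>x. f x\<partial>\<mu> i) \<longlongrightarrow> (mean \<nu> f)) F"
  and U: "open U" and r: "r < measure \<nu> (U\<inter>X)"
 shows "\<forall>\<^sub>F i in F. r < measure (\<mu> i) (U\<inter>X)"
\<comment> \<open>\<open>infdist\<close> to the empty set is 0 by convention, so the approximating
  functions would vanish identically in this case.\<close>
proof (cases "U = UNIV")
 case True
 have sX: "space K = X" by (simp add: K space_restrict_space)
 have one: "measure M (U\<inter>X) = 1" if "M\<in>space (prob_algebra K)" for M
  using prob_space.prob_space[OF prob_algebraD(1)[OF that]] prob_algebraD(3)[OF that] True sX by simp
 show ?thesis using \<mu> by eventually_elim (use one r \<nu> in auto)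
next
 case False
 have sX: "space K = X" by (simp add: K space_restrict_space)
 define C where "C = - U"
 have C: "closed C" "C\<noteq>{}" using U False by (auto simp: C_def)
 define f where "f k x = min 1 (real k*infdist x C)" for k and x :: 'a
 have f_Lip: "(real k)-lipschitz_on UNIV (f k)" for k
 proof (rule lipschitz_onI)
  fix x y :: 'a
  have "real k*\<bar>infdist x C - infdist y C\<bar>\<le>real k*dist x y"
   by (intro mult_left_mono infdist_triangle_abs) simp
  moreover have "\<bar>real k*infdist x C - real k*infdist y C\<bar> = real k*\<bar>infdist x C - infdist y C\<bar>"
   by (simp add: abs_mult flip: right_diff_distrib)
  ultimately show "dist (f k x) (f k y)\<le>real k*dist x y"
   unfolding f_def dist_real_def by linarith
 qed simp
 have f01: "0\<le>f k x" "f k x\<le>1" for k x by (auto simp: f_def infdist_nonneg)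
 have fb: "bounded (range (f k))" for k
  using f01(1)[of k] f01(2)[of k] by (intro boundedI[of _ 1]) auto
 have f_le: "f k x\<le>indicator U x" for k x
  using f01(2)[of k x] by (cases "x\<in>U") (auto simp: f_def C_def)
 have f_lim: "(%k. f k x) \<longlonglongrightarrow> indicator U x" for x
 proof (cases "x\<in>U")
  case True
  then have "infdist x C > 0" using infdist_pos_not_in_closed[OF C] by (simp add: C_def)
  then obtain k0 :: nat where "1 < real k0*infdist x C" using reals_Archimedean3 by blast
  then have "f k x = 1" if "k \<ge> k0" for k
  proof -
   have "real k0*infdist x C\<le>real k*infdist x C" using that by (intro mult_right_mono) (auto simp: infdist_nonneg)
   then show ?thesis using \<open>1 < real k0 * infdist x C\<close> by (simp add: f_def)
  qed
  then have "\<forall>\<^sub>F k in sequentially. f k x = indicator U x"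
   using True by (auto simp: eventually_sequentially)
  then show ?thesis by (rule tendsto_eventually)
 qed (auto simp: f_def C_def)
 have fm: "f k\<in>borel_measurable K" for k
  unfolding K using f_Lip[of k]
  by (intro measurable_restrict_space1 borel_measurable_continuous_onI lipschitz_on_continuous_on)
 have Um: "U\<inter>X\<in>sets K" unfolding K using U by (auto simp: sets_restrict_space)
 have ind: "(\<integral>x. indicator U x\<partial>M) = measure M (U\<inter>X)" if M: "M\<in>space (prob_algebra K)" for M
 proof -
  show ?thesis using prob_algebraD(3)[OF M] sX by simp
 qed
 have le: "(\<integral>x. f k x\<partial>M)\<le>measure M (U\<inter>X)" if M: "M\<in>space (prob_algebra K)" for M k
 proof -
  interpret prob_space M using M by (simp add: space_prob_algebra)
  have s: "sets M = sets K" using M by (simp add: space_prob_algebra)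
  have sp: "space M = X" using prob_algebraD(3)[OF M] sX by simp
  have [measurable]: "f k\<in>borel_measurable M" using fm unfolding measurable_cong_sets[OF s refl] .
  have "(\<integral>x. f k x\<partial>M)\<le>(\<integral>x. indicator (U\<inter>X) x\<partial>M)"
  proof (rule integral_mono)
   show "integrable M (f k)" by (rule integrable_const_bound[where B=1]) (use f01 in auto)
   show "integrable M (indicator (U\<inter>X) :: _ => real)" using Um s by (intro integrable_real_indicator) (auto simp: emeasure_eq_measure)
  qed (use f_le sp in \<open>auto simp: indicator_def split: if_splits\<close>)
  also have "\<dots> = measure M (U\<inter>X)" using Um s by simp
  finally show ?thesis .
 qed
 have "(%k. \<integral>x. f k x\<partial>\<nu>) \<longlonglongrightarrow> (\<integral>x. indicator U x\<partial>\<nu>)"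
 proof (rule integral_dominated_convergence[where w = "%_. 1"])
  interpret prob_space \<nu> using \<nu> by (simp add: space_prob_algebra)
  have s: "sets \<nu> = sets K" using \<nu> by (simp add: space_prob_algebra)
  show "f k\<in>borel_measurable \<nu>" for k using fm unfolding measurable_cong_sets[OF s refl] .
  show "indicat_real U\<in>borel_measurable \<nu>"
   unfolding measurable_cong_sets[OF s refl] K by (intro measurable_restrict_space1 borel_measurable_indicator) (use U in auto)
  show "integrable \<nu> (%_. 1::real)" by simp
 qed (use f_lim f01 in auto)
 then have "\<forall>\<^sub>F k in sequentially. r < (\<integral>x. f k x\<partial>\<nu>)"
  using r ind[OF \<nu>] by (intro order_tendstoD(1)) auto
 then obtain k where k: "r < (\<integral>x. f k x\<partial>\<nu>)" by (auto simp: eventually_sequentially)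
 from order_tendstoD(1)[OF lim[OF f_Lip fb] k] \<mu>
 show ?thesis
 proof eventually_elim
  case (elim i)
  then show ?case using le[of "\<mu> i" k] by simp
 qed
qed

text \<open>Each measure, viewed as a constant net indexed by \<open>unit\<close>, converges to the
  other one, so the open-set inequality holds in both directions. Traces of open sets form an
  intersection-stable generator.\<close>

lemma prob_measure_eq_by_lipschitz:
 fixes \<mu> \<nu> :: "'a::metric_space measure"
 assumes K: "K = restrict_space borel X"
  and \<mu>: "\<mu>\<in>space (prob_algebra K)" and \<nu>: "\<nu>\<in>space (prob_algebra K)"
  and eq: "\<And>(f :: 'a => real) L. L-lipschitz_on UNIV f ==> bounded (range f) ==> (mean \<mu> f) = (mean \<nu> f)"
 shows "\<mu> = \<nu>"
proof -
 have le: "measure \<beta> (U\<inter>X)\<le>measure \<alpha> (U\<inter>X)"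
  if U: "open U" and \<alpha>\<beta>: "\<alpha>\<in>space (prob_algebra K)" "\<beta>\<in>space (prob_algebra K)"
   "\<And>(f :: 'a => real) L. L-lipschitz_on UNIV f ==> bounded (range f) ==> (mean \<alpha> f) = (mean \<beta> f)" for U \<alpha> \<beta>
 proof (rule ccontr)
  assume "\<not> ?thesis"
  then have "measure \<alpha> (U\<inter>X) < measure \<beta> (U\<inter>X)" by simp
  have "\<forall>\<^sub>F i::unit in top. measure \<alpha> (U\<inter>X) < measure \<alpha> (U\<inter>X)"
  proof (rule open_measure_liminf[OF K _ \<alpha>\<beta>(2) _ U])
   show "((%i. \<integral>x. f x\<partial>\<alpha>) \<longlongrightarrow> (mean \<beta> f)) top" if "L-lipschitz_on UNIV f" "bounded (range f)" for f :: "'a => real" and L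
    unfolding \<alpha>\<beta>(3)[OF that] by (rule tendsto_const)
  qed (use \<alpha>\<beta>(1) \<open>measure \<alpha> (U \<inter> X) < measure \<beta> (U \<inter> X)\<close> in simp_all)
  then show False by simp
 qed
 interpret m: prob_space \<mu> using \<mu> by (simp add: space_prob_algebra)
 interpret n: prob_space \<nu> using \<nu> by (simp add: space_prob_algebra)
 have s: "sets \<mu> = sets K" "sets \<nu> = sets K" using \<mu> \<nu> by (auto simp: space_prob_algebra)
 have gen: "sets K = sigma_sets X ((%U. U\<inter>X) ` {U. open U})"
 proof -
  have "sets K = (%U. U\<inter>X) ` sigma_sets UNIV {U. open U}"
   by (simp add: K sets_restrict_space borel_def Int_commute)
  also have "\<dots> = {(%x. x) -` A\<inter>X |A. A\<in>sigma_sets UNIV {U. open U}}" by auto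
  also have "\<dots> = sigma_sets X {(%x. x) -` A\<inter>X |A. A\<in>{U. open U}}"
   by (rule sigma_sets_vimage_commute) simp
  also have "{(%x. x) -` A\<inter>X |A. A\<in>{U. open U}} = (%U. U\<inter>X) ` {U. open U}" by auto
  finally show ?thesis .
 qed
 show ?thesis
 proof (rule measure_eqI_generator_eq)
  show "Int_stable ((%U. U\<inter>X) ` {U::'a set. open U})"
  proof (rule Int_stableI)
   fix a b assume "a\<in>(%U. U\<inter>X) ` {U::'a set. open U}" "b\<in>(%U. U\<inter>X) ` {U::'a set. open U}"
   then obtain A B where "a = A\<inter>X" "b = B\<inter>X" "open A" "open B" by blast
   then have "a\<inter>b = (A\<inter>B)\<inter>X" "open (A\<inter>B)" by auto
   then show "a\<inter>b\<in>(%U. U\<inter>X) ` {U::'a set. open U}" by blast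
  qed
  show "range (%_::nat. X)\<subseteq>(%U. U\<inter>X) ` {U::'a set. open U}" by (auto intro!: image_eqI[where x = UNIV])
  show "emeasure \<mu> S = emeasure \<nu> S" if "S\<in>(%U. U\<inter>X) ` {U::'a set. open U}" for S
   using that le[of _ \<mu> \<nu>] le[of _ \<nu> \<mu>] \<mu> \<nu> eq by (auto simp: m.emeasure_eq_measure n.emeasure_eq_measure intro!: antisym)
 qed (use s gen in auto)
qed

lemma borel_restrict_UNIV: "(borel :: 'a::topological_space measure) = restrict_space borel UNIV"
 by (rule measure_eqI) (auto simp: sets_restrict_space emeasure_restrict_space)

lemma Hausdorff_weak: "Hausdorff_space (weak_topology :: 'a::metric_space measure topology)"
 unfolding Hausdorff_space_def
proof (intro allI impI, elim conjE)
 fix \<mu> \<nu> :: "'a measure"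
 assume "\<mu>\<in>topspace weak_topology" "\<nu>\<in>topspace weak_topology" "\<mu>\<noteq>\<nu>"
 then have m: "\<mu>\<in>M1" "\<nu>\<in>M1" by auto
 have "\<exists>f L. L-lipschitz_on UNIV f \<and> bounded (range f) \<and> (mean \<mu> f)\<noteq>(\<integral>x. (f x :: real)\<partial>\<nu>)"
 proof (rule ccontr)
  assume "\<not> ?thesis"
  then have "\<mu> = \<nu>" by (intro prob_measure_eq_by_lipschitz[OF borel_restrict_UNIV m]) auto
  then show False using \<open>\<mu> \<noteq> \<nu>\<close> by simp
 qed
 then obtain f :: "'a => real" and L where f: "L-lipschitz_on UNIV f" "bounded (range f)" "(mean \<mu> f)\<noteq>(mean \<nu> f)"
  by (elim exE conjE) (rule that)
 obtain U V where UV: "open U" "open V" "(mean \<mu> f)\<in>U" "(mean \<nu> f)\<in>V" "U\<inter>V = {}"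
  using hausdorff[OF f(3)] by (elim exE conjE) (rule that)
 have c: "continuous_on UNIV f" using f(1) by (rule lipschitz_on_continuous_on)
 show "\<exists>U V. openin weak_topology U \<and> openin weak_topology V \<and> \<mu>\<in>U \<and> \<nu>\<in>V \<and> disjnt U V"
 proof (intro exI conjI)
  show "openin weak_topology {\<mu>\<in>M1. (mean \<mu> f)\<in>U}" by (rule openin_weak_integral[OF c f(2) UV(1)])
  show "openin weak_topology {\<mu>\<in>M1. (mean \<mu> f)\<in>V}" by (rule openin_weak_integral[OF c f(2) UV(2)])
  show "disjnt {\<mu>\<in>M1. (mean \<mu> f)\<in>U} {\<mu>\<in>M1. (mean \<mu> f)\<in>V}"
   using UV(5) unfolding disjnt_def by blast
 qed (use m UV(3,4) in blast)+
qed

section \<open>The variational formula for relative entropy\<close>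

lemma mult_ln_ge: "x*ln x \<ge> -1" if "x \<ge> 0" for x :: real
proof (cases "x = 0")
 case False
 then have "x > 0" using that by simp
 then have "ln (1/x)\<le>1/x - 1" by (intro ln_le_minus_one) simp
 then have "x*ln (1/x)\<le>x*(1/x - 1)" using \<open>x > 0\<close> by (intro mult_left_mono) auto
 also have "x*(1/x - 1) = 1 - x" using \<open>x > 0\<close> by (simp add: field_simps)
 finally show ?thesis using \<open>x > 0\<close> by (simp add: ln_div)
qed simp

text \<open>Replaces \<open>RN_deriv\<close> and \<open>entropy_density\<close> by the integral of g
  ln g; the value of \<open>ln\<close> at 0 is irrelevant since it is multiplied by 0.\<close>

lemma rel_entropy_density:
 fixes g :: "'a => real"
 assumes "prob_space m" and [measurable]: "g\<in>borel_measurable m" and g0: "\<And>x. x\<in>space m ==> 0\<le>g x"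
 shows "rel_entropy (density m g) m =
  (if integrable m (%x. g x*ln (g x)) then ennreal (\<integral>x. g x*ln (g x)\<partial>m) else \<infinity>)"
proof -
 interpret prob_space m by fact
 have ac: "absolutely_continuous m (density m g)"
  by (rule absolutely_continuousI_density) simp
 have KL: "KL_divergence (exp 1) m (density m g) = (\<integral>x. g x*ln (g x)\<partial>m)"
  by (subst KL_density) (use g0 in \<open>auto simp: log_def intro!: AE_I2\<close>)
 have "density m (%x. RN_deriv m (density m g) x) = density m g"
  by (rule density_RN_deriv[OF ac]) simp
 then have eq: "AE x in m. ennreal (g x) = RN_deriv m (density m g) x"
  by (intro RN_deriv_unique) auto
 have "integrable (density m g) (entropy_density (exp 1) m (density m g)) \<longleftrightarrow>
   integrable m (%x. g x*entropy_density (exp 1) m (density m g) x)"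
  by (subst integrable_density) (use g0 in \<open>auto intro!: AE_I2\<close>)
 also have "\<dots> \<longleftrightarrow> integrable m (%x. g x*ln (g x))"
 proof (rule integrable_cong_AE)
  show "AE x in m. g x*entropy_density (exp 1) m (density m g) x = g x*ln (g x)"
   using eq AE_space
  proof eventually_elim
   case (elim x)
   then show ?case
    by (metis comp_apply div_by_1 enn2real_ennreal entropy_density_def g0 ln_exp log_def)
  qed
 qed (auto simp: entropy_density_def comp_def)
 finally show ?thesis using ac KL by (simp add: rel_entropy_def)
qed

lemma absolutely_continuous_density_real:
 assumes "prob_space m" "prob_space \<rho>" and s: "sets \<rho> = sets m" and ac: "absolutely_continuous m \<rho>"
 obtains g :: "'a => real" where "g\<in>borel_measurable m" "\<And>x. 0\<le>g x" "\<rho> = density m (%x. ennreal (g x))"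
proof -
 interpret m: prob_space m by fact
 interpret r: prob_space \<rho> by fact
 have fin: "AE x in m. RN_deriv m \<rho> x\<noteq>\<infinity>"
  by (rule m.RN_deriv_finite[OF _ ac s]) unfold_locales
 have "\<rho> = density m (RN_deriv m \<rho>)"
  using m.density_RN_deriv[OF ac s] by simp
 also have "\<dots> = density m (%x. ennreal (enn2real (RN_deriv m \<rho> x)))"
  by (rule density_cong) (use fin in \<open>auto simp: less_top\<close>)
 finally show thesis
  by (intro that[of "%x. enn2real (RN_deriv m \<rho> x)"]) auto
qed

lemma integrable_density_real:
 fixes g :: "'a => real"
 assumes "prob_space (density m (%x. ennreal (g x)))" "g\<in>borel_measurable m" "\<And>x. 0\<le>g x"
 shows "integrable m g" "(mean m g) = 1"
proof -
 have e: "(\<integral>\<^sup>+x. ennreal (g x)\<partial>m) = 1"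
  using prob_space.emeasure_space_1[OF assms(1)] assms(2)
  by (simp add: emeasure_density cong: nn_integral_cong)
 then show "integrable m g"
  using assms by (intro integrableI_nonneg) auto
 then show "(mean m g) = 1"
  using e assms by (subst integral_eq_nn_integral) auto
qed

text \<open>The easy half of the Donsker-Varadhan formula. With Z the integral of exp f, the
  inequality ln u \<le> u - 1 at u = exp (f x) / (Z g x) gives a pointwise bound whose right-hand
  side exp (f x) / Z - g x integrates to 0.\<close>

lemma rel_entropy_le_imp_variational:
 fixes f :: "'a => real"
 assumes pm: "prob_space m" and pr: "prob_space \<rho>" and s: "sets \<rho> = sets m"
  and H: "rel_entropy \<rho> m\<le>ennreal c" and c: "0\<le>c"
  and f[measurable]: "f\<in>borel_measurable m" and B: "\<And>x. x\<in>space m ==> \<bar>f x\<bar>\<le>B"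
 shows "(mean \<rho> f)\<le>c + ln (\<integral>x. exp (f x)\<partial>m)"
proof -
 interpret m: prob_space m by fact
 have "rel_entropy \<rho> m\<noteq>\<infinity>" using H by (auto simp: top_unique)
 then have ac: "absolutely_continuous m \<rho>"
  unfolding rel_entropy_def by (auto split: if_splits)
 obtain g where g[measurable]: "g\<in>borel_measurable m" and g0: "\<And>x. 0\<le>g x" and \<rho>: "\<rho> = density m (%x. ennreal (g x))"
  using absolutely_continuous_density_real[OF pm pr s ac] by blast
 note gi = integrable_density_real[OF pr[unfolded \<rho>] g g0]
 have H': "rel_entropy \<rho> m = (if integrable m (%x. g x*ln (g x)) then ennreal (\<integral>x. g x*ln (g x)\<partial>m) else \<infinity>)"
  unfolding \<rho> by (rule rel_entropy_density) (auto simp: pm g0)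
 then have i: "integrable m (%x. g x*ln (g x))"
  and Hc: "(\<integral>x. g x*ln (g x)\<partial>m)\<le>c"
  using H c \<open>rel_entropy \<rho> m \<noteq> \<infinity>\<close> by (auto split: if_splits)
 define Z where "Z = (\<integral>x. exp (f x)\<partial>m)"
 have ie: "integrable m (%x. exp (f x))"
  by (rule m.integrable_const_bound[where B = "exp B"]) (use B in \<open>fastforce intro!: AE_I2\<close>)+
 have "exp (-B)\<le>Z"
 proof -
  have "(\<integral>x. exp (-B)\<partial>m)\<le>Z" unfolding Z_def
   by (rule integral_mono) (use B ie in \<open>fastforce simp: abs_le_iff\<close>)+
  then show ?thesis by (simp add: m.prob_space)
 qed
 then have Z: "Z > 0" by (smt (verit) exp_gt_zero)
 have ifg: "integrable m (%x. f x*g x)"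
  by (rule Bochner_Integration.integrable_bound[OF integrable_mult_right[OF gi(1), of B]])
    (use B g0 in \<open>force simp: abs_mult intro!: AE_I2 mult_right_mono\<close>)+
 have pt: "g x*(f x - ln Z) - g x*ln (g x)\<le>exp (f x)/Z - g x" for x
 proof (cases "g x = 0")
  case False
  then have gp: "g x > 0" using g0[of x] by simp
  define u where "u = exp (f x)/Z/g x"
  have u: "u > 0" using gp Z by (simp add: u_def)
  have "ln u = f x - ln Z - ln (g x)"
   using gp Z by (simp add: u_def ln_div ln_mult)
  moreover have "ln u\<le>u - 1" using u by (rule ln_le_minus_one)
  ultimately have "g x*(f x - ln Z - ln (g x))\<le>g x*(u - 1)"
   using gp by (intro mult_left_mono) auto
  also have "\<dots> = exp (f x)/Z - g x" using gp by (simp add: u_def field_simps)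
  finally show ?thesis by (simp add: algebra_simps)
 qed (use Z in auto)
 have "(\<integral>x. g x*(f x - ln Z) - g x*ln (g x)\<partial>m)\<le>(\<integral>x. exp (f x)/Z - g x\<partial>m)"
  by (rule integral_mono) (use pt ie gi ifg i in \<open>auto simp: algebra_simps\<close>)
 also have "(\<integral>x. exp (f x)/Z - g x\<partial>m) = 0"
  using ie gi Z by (simp add: Z_def)
 also have "(\<integral>x. g x*(f x - ln Z) - g x*ln (g x)\<partial>m) = (\<integral>x. f x*g x\<partial>m) - ln Z - (\<integral>x. g x*ln (g x)\<partial>m)"
  using gi ifg i by (simp add: algebra_simps)
 finally have "(\<integral>x. f x*g x\<partial>m)\<le>c + ln Z" using Hc by simp
 moreover have "(mean \<rho> f) = (\<integral>x. f x*g x\<partial>m)"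
  unfolding \<rho> by (subst integral_density) (use g0 in \<open>auto simp: mult.commute\<close>)
 ultimately show ?thesis by (simp add: Z_def)
qed

text \<open>The converse half of the Donsker-Varadhan formula. Large multiples of the indicator of
  an m-null set force absolute continuity: their exponential has integral 1 under m, so t times the
  \<rho>-measure stays below c for every t. Truncations of the logarithm of the density then recover
  the entropy through Fatou's lemma.\<close>

lemma variational_imp_rel_entropy_le:
 assumes pm: "prob_space m" and pr: "prob_space \<rho>" and s: "sets \<rho> = sets m" and c: "0\<le>c"
  and V: "\<And>f B. f\<in>borel_measurable m ==> (\<And>x. \<bar>f x\<bar>\<le>B) ==> (mean \<rho> f)\<le>c + ln (\<integral>x. exp (f x)\<partial>m)"
 shows "rel_entropy \<rho> m\<le>ennreal c"
proof -
 interpret m: prob_space m by fact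
 interpret r: prob_space \<rho> by fact
 have "A\<in>null_sets \<rho>" if A: "A\<in>null_sets m" for A
 proof -
  have A': "A\<in>sets m" "A\<in>sets \<rho>" using A s by auto
  have t: "t*measure \<rho> A\<le>c" if "t > 0" for t
  proof -
   have "(\<integral>x. t*indicator A x\<partial>\<rho>)\<le>c + ln (\<integral>x. exp (t*indicator A x)\<partial>m)"
    using A' that by (intro V[where B = t]) (auto simp: indicator_def)
   also have "(\<integral>x. exp (t*indicator A x)\<partial>m) = (\<integral>x. 1\<partial>m)"
    using AE_not_in[OF A] A'
    by (intro integral_cong_AE) (auto simp: indicator_def elim!: eventually_mono)
   finally show ?thesis using A' by (simp add: m.prob_space)
  qed
  have "measure \<rho> A\<le>0"
  proof (rule ccontr)
   assume "\<not> ?thesis"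
   then have p: "measure \<rho> A > 0" by simp
   have "(c + 1)/measure \<rho> A*measure \<rho> A\<le>c" using p c by (intro t) simp
   then show False using p by simp
  qed
  then show ?thesis using A' by (auto simp: null_sets_def r.emeasure_eq_measure measure_nonneg antisym)
 qed
 then have ac: "absolutely_continuous m \<rho>" by (auto simp: absolutely_continuous_def)
 obtain g where g[measurable]: "g\<in>borel_measurable m" and g0: "\<And>x. 0\<le>g x" and \<rho>: "\<rho> = density m (%x. ennreal (g x))"
  using absolutely_continuous_density_real[OF pm pr s ac] by blast
 note gi = integrable_density_real[OF pr[unfolded \<rho>] g g0]
 \<comment> \<open>ln g, with g cut to the interval from 1/(k+1) to k+1. The lower cut raises the
   integral of exp f by at most 1/(k+1), so the logarithmic term of the variational bound tends to
   0.\<close>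
 define f where "f k x = ln (max (min (g x) (real (Suc k))) (1/real (Suc k)))" for k x
 have [measurable]: "f k\<in>borel_measurable m" for k unfolding f_def by measurable
 have fB: "\<bar>f k x\<bar>\<le>ln (Suc k)" for k x
 proof -
  let ?y = "max (min (g x) (real (Suc k))) (1/real (Suc k))"
  have "1/real (Suc k)\<le>?y" "?y\<le>Suc k" by (auto simp: max_def min_def field_simps)
  then have "ln (1/real (Suc k))\<le>ln ?y" "ln ?y\<le>ln (Suc k)"
   by (intro ln_mono; simp; fail | intro iffD2[OF ln_le_cancel_iff]; fastforce simp: less_max_iff_disj)+
  then show ?thesis unfolding f_def by (simp add: ln_div abs_le_iff)
 qed
 have ub: "(\<integral>x. f k x*g x\<partial>m)\<le>c + 1/Suc k" for k
 proof -
  have *: "exp (f k x) = max (min (g x) (real (Suc k))) (1/real (Suc k))" for x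
   unfolding f_def by (subst exp_ln) (auto simp: less_max_iff_disj)
  have i: "integrable m (%x. exp (f k x))"
   unfolding * by (rule m.integrable_const_bound[where B = "Suc k"]) (auto simp: field_simps max_def min_def g0 intro: order_trans)
  have "(\<integral>x. 1/real (Suc k)\<partial>m)\<le>(\<integral>x. exp (f k x)\<partial>m)"
   by (rule integral_mono) (use i in \<open>auto simp: *\<close>)
  then have pos: "0 < (\<integral>x. exp (f k x)\<partial>m)"
   by (simp add: m.prob_space) (smt (verit) divide_pos_pos of_nat_0_le_iff)
  have "(\<integral>x. exp (f k x)\<partial>m)\<le>(\<integral>x. g x + 1/Suc k\<partial>m)"
  proof (rule integral_mono)
   show "exp (f k x)\<le>g x + 1/real (Suc k)" for x
   proof -
    have "1/real (Suc k) \<ge> 0" by simp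
    then show ?thesis unfolding * using g0[of x] by linarith
   qed
  qed (use gi i in auto)
  also have "\<dots> = 1 + 1/Suc k" using gi by (simp add: m.prob_space)
  finally have "ln (\<integral>x. exp (f k x)\<partial>m)\<le>ln (1 + 1/Suc k)"
   using pos by (intro ln_mono) auto
  also have "\<dots>\<le>1/Suc k" by (rule ln_add_one_self_le_self) simp
  finally have "ln (\<integral>x. exp (f k x)\<partial>m)\<le>1/Suc k" .
  moreover have "(\<integral>x. f k x*g x\<partial>m) = (\<integral>x. f k x\<partial>\<rho>)"
   unfolding \<rho> by (subst integral_density) (use g0 in \<open>auto simp: mult.commute\<close>)
  moreover have "\<dots>\<le>c + ln (\<integral>x. exp (f k x)\<partial>m)"
   using fB by (intro V[where B = "ln (Suc k)"]) auto
  ultimately show ?thesis by linarith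
 qed
 have lim: "(%k. f k x*g x + 1) \<longlonglongrightarrow> g x*ln (g x) + 1" for x
 proof (cases "g x = 0")
  case False
  then have gp: "g x > 0" using g0[of x] by simp
  obtain K :: nat where K: "g x\<le>real K" "1/g x\<le>real K"
   using real_arch_simple[of "max (g x) (1/g x)"] by auto
  have "f k x = ln (g x)" if "k \<ge> K" for k
  proof -
   have "g x\<le>Suc k" using K that by linarith
   moreover have "1/g x\<le>Suc k" using K that by linarith
   then have "1/Suc k\<le>g x" using gp by (simp add: field_simps)
   ultimately show ?thesis by (simp add: f_def min_absorb1 max_absorb1)
  qed
  then have "\<forall>\<^sub>F k in sequentially. f k x*g x + 1 = g x*ln (g x) + 1"
   by (auto simp: eventually_sequentially mult.commute intro!: exI[of _ K])
  then show ?thesis by (rule tendsto_eventually)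
 qed simp
 \<comment> \<open>Since t ln t \<ge> -1, adding 1 makes all integrands nonnegative; this is what
   Fatou's lemma requires.\<close>
 have nn: "0\<le>f k x*g x + 1" for k x
 proof (cases "g x \<ge> 1")
  case True
  then have "f k x \<ge> 0" unfolding f_def by (intro ln_ge_zero) (auto simp: le_max_iff_disj)
  then show ?thesis using True by simp
 next
  case False
  show ?thesis
  proof (cases "g x = 0")
   case False
   then have gp: "g x > 0" using g0[of x] by simp
   have "ln (g x)\<le>f k x" unfolding f_def
    using \<open>\<not> 1 \<le> g x\<close> gp by (subst ln_le_cancel_iff) (auto simp: less_max_iff_disj le_max_iff_disj)
   then have "g x*ln (g x)\<le>g x*f k x" using gp by (intro mult_left_mono) auto
   then show ?thesis using mult_ln_ge[of "g x"] g0[of x] unfolding mult.commute[of "f k x"] by linarith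
  qed simp
 qed
 have if_: "integrable m (%x. f k x*g x)" for k
  by (rule Bochner_Integration.integrable_bound[OF integrable_mult_right[OF gi(1), of "ln (Suc k)"]])
    (use fB[of k] g0 in \<open>force simp: abs_mult intro!: AE_I2 mult_right_mono\<close>)+
 have "(\<integral>\<^sup>+x. ennreal (g x*ln (g x) + 1)\<partial>m) = (\<integral>\<^sup>+x. liminf (%k. ennreal (f k x*g x + 1))\<partial>m)"
  using lim by (intro nn_integral_cong lim_imp_Liminf[symmetric] tendsto_ennrealI) auto
 also have "\<dots>\<le>liminf (%k. \<integral>\<^sup>+x. ennreal (f k x*g x + 1)\<partial>m)"
  by (rule nn_integral_liminf) auto
 also have "\<dots> = liminf (%k. ennreal ((\<integral>x. f k x*g x\<partial>m) + 1))"
  using nn if_ by (subst nn_integral_eq_integral) (auto simp: m.prob_space)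
 also have "\<dots>\<le>liminf (%k. ennreal (c + 1/Suc k + 1))"
  using ub by (intro Liminf_mono always_eventually allI ennreal_leI) auto
 also have "\<dots> = ennreal (c + 0 + 1)"
  using LIMSEQ_inverse_real_of_nat
  by (intro lim_imp_Liminf tendsto_ennrealI tendsto_intros) (auto simp: inverse_eq_divide)
 finally have le: "(\<integral>\<^sup>+x. ennreal (g x*ln (g x) + 1)\<partial>m)\<le>ennreal (c + 1)" by simp
 have pos: "0\<le>g x*ln (g x) + 1" for x using mult_ln_ge[OF g0, of x] by simp
 have int1: "integrable m (%x. g x*ln (g x) + 1)"
  using le pos by (intro integrableI_nonneg) (auto simp: less_top[symmetric] top_unique)
 then have int: "integrable m (%x. g x*ln (g x))"
  using Bochner_Integration.integrable_diff[OF int1, of "%_. 1"] by simp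
 have "ennreal (\<integral>x. g x*ln (g x) + 1\<partial>m)\<le>ennreal (c + 1)"
  using le nn_integral_eq_integral[OF int1] pos by simp
 then have "(\<integral>x. g x*ln (g x) + 1\<partial>m)\<le>c + 1"
  using c by (subst (asm) ennreal_le_iff) auto
 then have "(\<integral>x. g x*ln (g x)\<partial>m)\<le>c"
  using int by (simp add: m.prob_space)
 then show ?thesis
  unfolding \<rho> using int by (subst rel_entropy_density) (auto simp: pm g0 intro: ennreal_leI)
qed

section \<open>The Wasserstein topology\<close>

lemma space_Rplus [simp]: "space Rplus = {0..}"
 by (simp add: Rplus_def space_restrict_space)

lemma measurable_Rplus_real [measurable]: "(%x. x)\<in>borel_measurable Rplus"
 unfolding Rplus_def by (rule measurable_restrict_space1) simp

lemma borel_measurable_Rplus: "f\<in>borel_measurable borel ==> f\<in>borel_measurable Rplus"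
 unfolding Rplus_def by (rule measurable_restrict_space1)

definition cost :: "(real\<times>real) measure => ennreal" where
 "cost \<pi> = (\<integral>\<^sup>+p. ennreal \<bar>fst p - snd p\<bar>\<partial>\<pi>)"

lemma W1_cost: "W1 \<mu> \<nu> = enn2real (INF \<pi>\<in>couplings \<mu> \<nu>. cost \<pi>)"
 unfolding W1_def cost_def by (simp add: split_beta')

lemma couplingsD:
 assumes "\<pi>\<in>couplings \<mu> \<nu>"
 shows "prob_space \<pi>" "sets \<pi> = sets (Rplus\<Otimes>\<^sub>MRplus)" "space \<pi> = {0..}\<times>{0..}"
  "distr \<pi> Rplus fst = \<mu>" "distr \<pi> Rplus snd = \<nu>"
proof -
 have p: "\<pi>\<in>space (prob_algebra (Rplus\<Otimes>\<^sub>MRplus))" and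
  m: "distr \<pi> Rplus fst = \<mu>" "distr \<pi> Rplus snd = \<nu>"
  using assms unfolding couplings_def by blast+
 show "prob_space \<pi>" "sets \<pi> = sets (Rplus\<Otimes>\<^sub>MRplus)" "distr \<pi> Rplus fst = \<mu>" "distr \<pi> Rplus snd = \<nu>"
  using prob_algebraD[OF p] m by simp_all
 show "space \<pi> = {0..}\<times>{0..}"
  using prob_algebraD(3)[OF p] by (simp add: space_pair_measure)
qed

lemma M11_RplusD:
 assumes "\<mu>\<in>M11_Rplus"
 shows "prob_space \<mu>" "sets \<mu> = sets Rplus" "space \<mu> = {0..}" "(\<integral>\<^sup>+x. ennreal x\<partial>\<mu>) = 1"
  "\<mu>\<in>space (prob_algebra Rplus)" "integrable \<mu> (%x. x)" "(\<integral>x. x\<partial>\<mu>) = 1"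
proof -
 have p: "\<mu>\<in>space (prob_algebra Rplus)" and i: "(\<integral>\<^sup>+x. ennreal x\<partial>\<mu>) = 1"
  using assms unfolding M11_Rplus_def by blast+
 show "prob_space \<mu>" and s: "sets \<mu> = sets Rplus" and sp: "space \<mu> = {0..}"
  using prob_algebraD[OF p] by simp_all
 show "(\<integral>\<^sup>+x. ennreal x\<partial>\<mu>) = 1" "\<mu>\<in>space (prob_algebra Rplus)" by fact+
 have m: "(%x. x)\<in>borel_measurable \<mu>" unfolding measurable_cong_sets[OF s refl] by (rule measurable_Rplus_real)
 have nn: "AE x in \<mu>. 0\<le>x" by (rule AE_I2) (simp add: sp)
 show "integrable \<mu> (%x. x)" by (rule integrableI_nonneg[OF m nn]) (simp add: i)
 then show "(\<integral>x. x\<partial>\<mu>) = 1" by (subst integral_eq_nn_integral[OF m nn]) (simp add: i)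
qed

lemma Lipschitz_Rplus:
 fixes f :: "real => real"
 assumes "\<mu>\<in>M11_Rplus" and f: "L-lipschitz_on UNIV f"
 shows "f\<in>borel_measurable \<mu>" "integrable \<mu> f"
proof -
 note m = M11_RplusD[OF assms(1)]
 interpret prob_space \<mu> by fact
 have "f\<in>borel_measurable borel"
  using f by (intro borel_measurable_continuous_onI lipschitz_on_continuous_on)
 then show fm: "f\<in>borel_measurable \<mu>"
  unfolding measurable_cong_sets[OF m(2) refl] by (rule borel_measurable_Rplus)
 have "\<bar>f x\<bar>\<le>\<bar>f 0\<bar> + L*\<bar>x\<bar>" for x
  using lipschitz_onD[OF f, of x 0] by (simp add: dist_real_def)
 then have 1: "AE x in \<mu>. norm (f x)\<le>norm (\<bar>f 0\<bar> + L*\<bar>x\<bar>)"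
  using lipschitz_on_nonneg[OF f] by (intro AE_I2) simp
 have 2: "integrable \<mu> (%x. \<bar>f 0\<bar> + L*\<bar>x\<bar>)" using m(6) by simp
 show "integrable \<mu> f"
  by (rule Bochner_Integration.integrable_bound[OF 2 fm 1])
qed

lemma product_coupling:
 assumes "\<mu>\<in>M11_Rplus" "\<nu>\<in>M11_Rplus"
 shows "\<mu>\<Otimes>\<^sub>M\<nu>\<in>couplings \<mu> \<nu>"
proof -
 note m = M11_RplusD[OF assms(1)] and n = M11_RplusD[OF assms(2)]
 interpret m: prob_space \<mu> by fact
 interpret n: prob_space \<nu> by fact
 interpret P: pair_prob_space \<mu> \<nu> ..
 have s: "sets (\<mu>\<Otimes>\<^sub>M\<nu>) = sets (Rplus\<Otimes>\<^sub>MRplus)" by (rule sets_pair_measure_cong[OF m(2) n(2)])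
 have "distr (\<mu>\<Otimes>\<^sub>M\<nu>) Rplus fst = distr (\<mu>\<Otimes>\<^sub>M\<nu>) \<mu> fst" by (rule distr_cong) (simp_all add: m(2))
 also have "\<dots> = \<mu>" by (rule n.distr_pair_fst)
 finally have 1: "distr (\<mu>\<Otimes>\<^sub>M\<nu>) Rplus fst = \<mu>" .
 have "distr (\<mu>\<Otimes>\<^sub>M\<nu>) Rplus snd = distr (distr (\<nu>\<Otimes>\<^sub>M\<mu>) (\<mu>\<Otimes>\<^sub>M\<nu>) (%(x,y). (y,x))) Rplus snd"
  by (subst P.distr_pair_swap) simp
 also have "\<dots> = distr (\<nu>\<Otimes>\<^sub>M\<mu>) Rplus (snd \<circ> (%(x,y). (y,x)))"
 proof (rule distr_distr)
  show "snd\<in>measurable (\<mu>\<Otimes>\<^sub>M\<nu>) Rplus"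
   unfolding measurable_cong_sets[OF refl n(2)[symmetric]] by (rule measurable_snd)
 qed measurable
 also have "\<dots> = distr (\<nu>\<Otimes>\<^sub>M\<mu>) \<nu> fst" by (rule distr_cong) (auto simp: n(2))
 also have "\<dots> = \<nu>" by (rule m.distr_pair_fst)
 finally have 2: "distr (\<mu>\<Otimes>\<^sub>M\<nu>) Rplus snd = \<nu>" .
 show ?thesis unfolding couplings_def
  using 1 2 s P.prob_space_axioms by (simp add: space_prob_algebra)
qed

lemma coupling_integral:
 assumes c: "\<pi>\<in>couplings \<mu> \<nu>" and \<mu>: "\<mu>\<in>M11_Rplus" and \<nu>: "\<nu>\<in>M11_Rplus"
  and f: "L-lipschitz_on UNIV (f :: real => real)"
 shows "integrable \<pi> (%p. f (fst p))" "(\<integral>p. f (fst p)\<partial>\<pi>) = (mean \<mu> f)"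
  "integrable \<pi> (%p. f (snd p))" "(\<integral>p. f (snd p)\<partial>\<pi>) = (mean \<nu> f)"
proof -
 note C = couplingsD[OF c]
 have f1: "fst\<in>measurable \<pi> Rplus" and f2: "snd\<in>measurable \<pi> Rplus"
  unfolding measurable_cong_sets[OF C(2) refl] by measurable
 have "f\<in>borel_measurable borel"
  using f by (intro borel_measurable_continuous_onI lipschitz_on_continuous_on)
 then have fm: "f\<in>borel_measurable Rplus" by (rule borel_measurable_Rplus)
 show "integrable \<pi> (%p. f (fst p))" using integrable_distr_eq[OF f1 fm] Lipschitz_Rplus(2)[OF \<mu> f] C(4) by simp
 show "integrable \<pi> (%p. f (snd p))" using integrable_distr_eq[OF f2 fm] Lipschitz_Rplus(2)[OF \<nu> f] C(5) by simp
 show "(\<integral>p. f (fst p)\<partial>\<pi>) = (mean \<mu> f)" using integral_distr[OF f1 fm] C(4) by simp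
 show "(\<integral>p. f (snd p)\<partial>\<pi>) = (mean \<nu> f)" using integral_distr[OF f2 fm] C(5) by simp
qed

text \<open>On the half line \<bar>x - y\<bar> \<le> x + y, and both first moments equal 1; hence
  the constant 2.\<close>

lemma coupling_cost:
 assumes c: "\<pi>\<in>couplings \<mu> \<nu>" and \<mu>: "\<mu>\<in>M11_Rplus" and \<nu>: "\<nu>\<in>M11_Rplus"
 shows "integrable \<pi> (%p. \<bar>fst p - snd p\<bar>)" "cost \<pi> = ennreal (\<integral>p. \<bar>fst p - snd p\<bar>\<partial>\<pi>)" "cost \<pi>\<le>2"
proof -
 note I = coupling_integral[OF c \<mu> \<nu> lipschitz_on_id]
 show i: "integrable \<pi> (%p. \<bar>fst p - snd p\<bar>)" using I by auto
 show e: "cost \<pi> = ennreal (\<integral>p. \<bar>fst p - snd p\<bar>\<partial>\<pi>)"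
  unfolding cost_def by (rule nn_integral_eq_integral[OF i]) auto
 have "(\<integral>p. \<bar>fst p - snd p\<bar>\<partial>\<pi>)\<le>(\<integral>p. fst p + snd p\<partial>\<pi>)"
  by (rule integral_mono) (use i I couplingsD(3)[OF c] in auto)
 also have "\<dots> = 2" using I M11_RplusD(7)[OF \<mu>] M11_RplusD(7)[OF \<nu>] by simp
 finally show "cost \<pi>\<le>2" unfolding e by (simp add: ennreal_le_iff2 flip: ennreal_numeral)
qed

lemma W1_le:
 assumes c: "\<pi>\<in>couplings \<mu> \<nu>" and "cost \<pi>\<le>ennreal r" "0\<le>r"
 shows "W1 \<mu> \<nu>\<le>r"
 unfolding W1_cost
 by (rule enn2real_leI[OF assms(3)]) (rule INF_lower2[where f = cost, OF c assms(2)])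

text \<open>The product coupling bounds the infimum by 2, so \<open>enn2real\<close> in the
  definition of \<open>W1\<close> does not collapse an infinite value to 0.\<close>

lemma W1_approx:
 assumes \<mu>: "\<mu>\<in>M11_Rplus" and \<nu>: "\<nu>\<in>M11_Rplus" and "W1 \<mu> \<nu> < r"
 obtains \<pi> where "\<pi>\<in>couplings \<mu> \<nu>" "cost \<pi> < ennreal r"
proof -
 let ?I = "INF \<pi>\<in>couplings \<mu> \<nu>. cost \<pi>"
 have "?I\<le>2" 
  by (rule INF_lower2[OF product_coupling[OF \<mu> \<nu>]]) (rule coupling_cost(3)[OF product_coupling[OF \<mu> \<nu>] \<mu> \<nu>])
 then have "?I < top" by (rule order_le_less_trans) simp
 then have "?I = ennreal (W1 \<mu> \<nu>)" unfolding W1_cost by (rule ennreal_enn2real[symmetric])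
 also have "\<dots> < ennreal r" using assms(3) by (simp add: ennreal_less_iff W1_cost)
 finally have "\<exists>\<pi>\<in>couplings \<mu> \<nu>. cost \<pi> < ennreal r" by (simp only: INF_less_iff)
 then show thesis by (elim bexE) (rule that)
qed

text \<open>The easy half of Kantorovich duality: integrate f (x) - f (y) against a nearly optimal
  coupling. The slack is divided by L + 1 because L may be 0.\<close>

lemma W1_lipschitz:
 fixes f :: "real => real"
 assumes \<mu>: "\<mu>\<in>M11_Rplus" and \<nu>: "\<nu>\<in>M11_Rplus" and f: "L-lipschitz_on UNIV f"
 shows "\<bar>(mean \<mu> f) - (mean \<nu> f)\<bar>\<le>L*W1 \<mu> \<nu>"
proof (rule field_le_epsilon)
 fix e :: real assume "0 < e"
 have L: "0\<le>L" by (rule lipschitz_on_nonneg[OF f])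
 obtain \<pi> where \<pi>: "\<pi>\<in>couplings \<mu> \<nu>" "cost \<pi> < ennreal (W1 \<mu> \<nu> + e/(L + 1))"
  using W1_approx[OF \<mu> \<nu>, of "W1 \<mu> \<nu> + e/(L + 1)"] \<open>0 < e\<close> L by auto
 note I = coupling_integral[OF \<pi>(1) \<mu> \<nu> f] and C = coupling_cost[OF \<pi>(1) \<mu> \<nu>]
 have "(\<integral>p. \<bar>fst p - snd p\<bar>\<partial>\<pi>)\<le>W1 \<mu> \<nu> + e/(L + 1)"
  using \<pi>(2) unfolding C(2) by (subst (asm) ennreal_less_iff) auto
 then have "L*(\<integral>p. \<bar>fst p - snd p\<bar>\<partial>\<pi>)\<le>L*(W1 \<mu> \<nu> + e/(L + 1))"
  using L by (rule mult_left_mono)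
 also have "\<dots>\<le>L*W1 \<mu> \<nu> + e" using L \<open>0 < e\<close> by (simp add: field_simps)
 finally have 1: "L*(\<integral>p. \<bar>fst p - snd p\<bar>\<partial>\<pi>)\<le>L*W1 \<mu> \<nu> + e" .
 have "\<bar>(mean \<mu> f) - (mean \<nu> f)\<bar> = \<bar>\<integral>p. f (fst p) - f (snd p)\<partial>\<pi>\<bar>"
  using I by simp
 also have "\<dots>\<le>(\<integral>p. \<bar>f (fst p) - f (snd p)\<bar>\<partial>\<pi>)" by (rule integral_abs_bound)
 also have "\<dots>\<le>(\<integral>p. L*\<bar>fst p - snd p\<bar>\<partial>\<pi>)"
  by (rule integral_mono) (use I C(1) lipschitz_onD[OF f] in \<open>auto simp: dist_real_def\<close>)
 also have "\<dots> = L*(\<integral>p. \<bar>fst p - snd p\<bar>\<partial>\<pi>)" by simp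
 finally show "\<bar>(mean \<mu> f) - (mean \<nu> f)\<bar>\<le>L*W1 \<mu> \<nu> + e" using 1 by simp
qed

text \<open>The kernel joins p and q whenever their middle coordinates share a cell and divides by
  the mass of that cell. Integrating q out gives 1 except on cells of mass 0, and as there are only
  countably many cells, the exceptional p form a null set.\<close>

lemma glue_marginal:
 fixes M1 :: "'x measure" and M2 :: "'z measure" and c :: "real => int"
 assumes p1: "prob_space M1" and p2: "prob_space M2"
  and [measurable]: "u\<in>measurable M1 Rplus" "v\<in>measurable M2 Rplus" "c\<in>measurable Rplus (count_space UNIV)"
  and n1: "distr M1 Rplus u = \<nu>" and n2: "distr M2 Rplus v = \<nu>"
  and A: "A\<in>sets M1"
 shows "(\<integral>\<^sup>+p. \<integral>\<^sup>+q. indicator A p*(if c (u p) = c (v q) then 1/emeasure \<nu> (c -` {c (u p)}\<inter>space Rplus) else 0)\<partial>M2\<partial>M1) = emeasure M1 A"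
proof -
 interpret p1: prob_space M1 by fact
 interpret p2: prob_space M2 by fact
 define w where "w k = emeasure \<nu> (c -` {k}\<inter>space Rplus)" for k
 have cell: "c -` {k}\<inter>space Rplus\<in>sets Rplus" for k by measurable
 have w2: "w k = emeasure M2 ((%q. c (v q)) -` {k}\<inter>space M2)" for k
  unfolding w_def n2[symmetric] using measurable_space[OF assms(4)]
  by (subst emeasure_distr[OF _ cell]) (auto intro!: arg_cong[where f = "emeasure M2"])
 have w1: "w k = emeasure M1 ((%q. c (u q)) -` {k}\<inter>space M1)" for k
  unfolding w_def n1[symmetric] using measurable_space[OF assms(3)]
  by (subst emeasure_distr[OF _ cell]) (auto intro!: arg_cong[where f = "emeasure M1"])
 have fin: "w k < top" for k unfolding w2 by (simp add: less_top[symmetric])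
 have in2: "(\<integral>\<^sup>+q. indicator A p*(if c (u p) = c (v q) then 1/w (c (u p)) else 0)\<partial>M2) =
   indicator A p*(if w (c (u p)) = 0 then 0 else 1)" for p
 proof -
  let ?S = "(%q. c (v q)) -` {c (u p)}\<inter>space M2"
  have S: "?S\<in>sets M2" by measurable
  have "(\<integral>\<^sup>+q. indicator A p*(if c (u p) = c (v q) then 1/w (c (u p)) else 0)\<partial>M2) =
    (\<integral>\<^sup>+q. (indicator A p*(1/w (c (u p))))*indicator ?S q\<partial>M2)"
   by (rule nn_integral_cong) (auto simp: indicator_def)
  also have "\<dots> = indicator A p*(1/w (c (u p)))*emeasure M2 ?S"
   by (rule nn_integral_cmult_indicator[OF S])
  also have "\<dots> = indicator A p*(1/w (c (u p))*w (c (u p)))"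
   by (simp only: w2 mult.assoc)
  also have "1/w (c (u p))*w (c (u p)) = (if w (c (u p)) = 0 then 0 else 1)"
   using fin by (simp add: ennreal_divide_times ennreal_divide_self)
  finally show ?thesis .
 qed
 have "AE p in M1. \<forall>k\<in>{k. w k = 0}. c (u p)\<noteq>k"
 proof (subst AE_ball_countable)
  show "\<forall>k\<in>{k. w k = 0}. AE p in M1. c (u p)\<noteq>k"
  proof
   fix k assume "k\<in>{k. w k = 0}"
   then have "emeasure M1 ((%q. c (u q)) -` {k}\<inter>space M1) = 0" using w1 by simp
   then show "AE p in M1. c (u p)\<noteq>k"
    by (intro AE_I[where N = "(%q. c (u q)) -` {k}\<inter>space M1"]) auto
  qed
 qed simp
 then have "AE p in M1. indicator A p*(if w (c (u p)) = 0 then 0 else 1) = (indicator A p :: ennreal)"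
  by eventually_elim auto
 then have "(\<integral>\<^sup>+p. indicator A p*(if w (c (u p)) = 0 then 0 else 1)\<partial>M1) = (\<integral>\<^sup>+p. indicator A p\<partial>M1)"
  by (rule nn_integral_cong_AE)
 then show ?thesis unfolding w_def[symmetric] in2 using A by simp
qed

text \<open>Without disintegration, two couplings are glued along a discretisation of the middle variable,
 at the price of the mesh \<open>\<eta>\<close>.\<close>

lemma glue_couplings:
 assumes \<pi>1: "\<pi>1\<in>couplings \<mu> \<nu>" and \<pi>2: "\<pi>2\<in>couplings \<nu> \<kappa>" and \<eta>: "0 < \<eta>"
 obtains \<pi> where "\<pi>\<in>couplings \<mu> \<kappa>" "cost \<pi>\<le>cost \<pi>1 + ennreal \<eta> + cost \<pi>2"
proof -
 note C1 = couplingsD[OF \<pi>1] and C2 = couplingsD[OF \<pi>2]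
 interpret p1: prob_space \<pi>1 by fact
 interpret p2: prob_space \<pi>2 by fact
 interpret P: pair_prob_space \<pi>1 \<pi>2 ..
 interpret P': pair_prob_space \<pi>2 \<pi>1 ..
 \<comment> \<open>Cells of width \<eta>: two middle coordinates with the same label differ by at
   most \<eta>, which is the only loss of the construction.\<close>
 define c where "c y = \<lfloor>y/\<eta>\<rfloor>" for y :: real
 have c_close: "\<bar>y - y'\<bar>\<le>\<eta>" if "c y = c y'" for y y'
 proof -
  have "\<bar>y/\<eta> - y'/\<eta>\<bar>\<le>1" using that unfolding c_def by linarith
  then have "\<bar>(y - y')/\<eta>\<bar>\<le>1" by (simp add: diff_divide_distrib)
  then show ?thesis using \<eta> by (simp add: abs_divide)
 qed
 have cm[measurable]: "c\<in>measurable Rplus (count_space UNIV)"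
  unfolding c_def Rplus_def by (rule measurable_restrict_space1) measurable
 have m1[measurable]: "fst\<in>measurable \<pi>1 Rplus" "snd\<in>measurable \<pi>1 Rplus"
  unfolding measurable_cong_sets[OF C1(2) refl] by measurable
 have m2[measurable]: "fst\<in>measurable \<pi>2 Rplus" "snd\<in>measurable \<pi>2 Rplus"
  unfolding measurable_cong_sets[OF C2(2) refl] by measurable
 let ?w = "%k. emeasure \<nu> (c -` {k}\<inter>space Rplus)"
 \<comment> \<open>Under the density g the two couplings are conditionally independent given the
   common cell of their middle coordinates.\<close>
 define g where "g r = (if c (snd (fst r)) = c (fst (snd r)) then 1/?w (c (snd (fst r))) else 0)" for r :: "(real\<times>real)\<times>(real\<times>real)"
 have gm[measurable]: "g\<in>borel_measurable (\<pi>1\<Otimes>\<^sub>M\<pi>2)" unfolding g_def by measurable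
 define Q where "Q = density (\<pi>1\<Otimes>\<^sub>M\<pi>2) g"
 have sQ: "sets Q = sets (\<pi>1\<Otimes>\<^sub>M\<pi>2)" "space Q = space \<pi>1\<times>space \<pi>2" by (auto simp: Q_def space_pair_measure)
 have Q1: "distr Q \<pi>1 fst = \<pi>1"
 proof (rule measure_eqI)
  fix A assume "A\<in>sets (distr Q \<pi>1 fst)"
  then have A[measurable]: "A\<in>sets \<pi>1" by simp
  have "emeasure (distr Q \<pi>1 fst) A = emeasure Q (fst -` A\<inter>space Q)"
   by (rule emeasure_distr) (auto simp: Q_def)
  also have "\<dots> = (\<integral>\<^sup>+r. indicator A (fst r)*g r\<partial>(\<pi>1\<Otimes>\<^sub>M\<pi>2))"
   unfolding Q_def by (subst emeasure_density) (auto intro!: nn_integral_cong simp: indicator_def space_pair_measure)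
  also have "\<dots> = (\<integral>\<^sup>+p. \<integral>\<^sup>+q. indicator A p*g (p,q)\<partial>\<pi>2\<partial>\<pi>1)"
   by (subst p2.nn_integral_fst[symmetric]) auto
  also have "\<dots> = emeasure \<pi>1 A"
   unfolding g_def fst_conv snd_conv
   by (rule glue_marginal[OF p1.prob_space_axioms p2.prob_space_axioms m1(2) m2(1) cm C1(5) C2(4) A])
  finally show "emeasure (distr Q \<pi>1 fst) A = emeasure \<pi>1 A" .
 qed simp
 have Q2: "distr Q \<pi>2 snd = \<pi>2"
 proof (rule measure_eqI)
  fix A assume "A\<in>sets (distr Q \<pi>2 snd)"
  then have A[measurable]: "A\<in>sets \<pi>2" by simp
  have "emeasure (distr Q \<pi>2 snd) A = emeasure Q (snd -` A\<inter>space Q)"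
   by (rule emeasure_distr) (auto simp: Q_def)
  also have "\<dots> = (\<integral>\<^sup>+r. indicator A (snd r)*g r\<partial>(\<pi>1\<Otimes>\<^sub>M\<pi>2))"
   unfolding Q_def by (subst emeasure_density) (auto intro!: nn_integral_cong simp: indicator_def space_pair_measure)
  also have "\<dots> = (\<integral>\<^sup>+q. \<integral>\<^sup>+p. indicator A q*g (p,q)\<partial>\<pi>1\<partial>\<pi>2)"
   by (subst P.nn_integral_snd[symmetric]) auto
  also have "\<dots> = (\<integral>\<^sup>+q. \<integral>\<^sup>+p. indicator A q*(if c (fst q) = c (snd p) then 1/?w (c (fst q)) else 0)\<partial>\<pi>1\<partial>\<pi>2)"
   by (intro nn_integral_cong) (simp add: g_def)
  also have "\<dots> = emeasure \<pi>2 A"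
   by (rule glue_marginal[OF p2.prob_space_axioms p1.prob_space_axioms m2(1) m1(2) cm C2(4) C1(5) A])
  finally show "emeasure (distr Q \<pi>2 snd) A = emeasure \<pi>2 A" .
 qed simp
 have "prob_space (distr Q \<pi>1 fst)" by (simp only: Q1 p1.prob_space_axioms)
 moreover have "fst\<in>measurable Q \<pi>1" by (simp add: Q_def)
 ultimately interpret Q: prob_space Q by (rule prob_space_distrD[rotated])
 let ?f = "%r :: (real\<times>real)\<times>(real\<times>real). (fst (fst r),snd (snd r))"
 have fm[measurable]: "?f\<in>measurable Q (Rplus\<Otimes>\<^sub>MRplus)" unfolding Q_def by measurable
 define \<pi> where "\<pi> = distr Q (Rplus\<Otimes>\<^sub>MRplus) ?f"
 have a: "distr \<pi> Rplus fst = distr (distr Q \<pi>1 fst) Rplus fst"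
  unfolding \<pi>_def by (subst (1 2) distr_distr) (auto simp: comp_def Q_def)
 have b: "distr \<pi> Rplus snd = distr (distr Q \<pi>2 snd) Rplus snd"
  unfolding \<pi>_def by (subst (1 2) distr_distr) (auto simp: comp_def Q_def)
 have "\<pi>\<in>couplings \<mu> \<kappa>" unfolding couplings_def
  using a b C1(4) C2(5) unfolding Q1 Q2 by (simp add: space_prob_algebra \<pi>_def Q.prob_space_distr)
 moreover have "cost \<pi>\<le>cost \<pi>1 + ennreal \<eta> + cost \<pi>2"
 proof -
  have [measurable]: "(%r. fst (fst r))\<in>borel_measurable Q" "(%r. snd (fst r))\<in>borel_measurable Q"
   "(%r. fst (snd r))\<in>borel_measurable Q" "(%r. snd (snd r))\<in>borel_measurable Q"
   unfolding Q_def using measurable_Rplus_real by measurable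
  have "cost \<pi> = (\<integral>\<^sup>+r. ennreal \<bar>fst (fst r) - snd (snd r)\<bar>\<partial>Q)"
   unfolding cost_def \<pi>_def by (subst nn_integral_distr) auto
  also have "\<dots>\<le>(\<integral>\<^sup>+r. ennreal \<bar>fst (fst r) - snd (fst r)\<bar> + ennreal \<bar>snd (fst r) - fst (snd r)\<bar> + ennreal \<bar>fst (snd r) - snd (snd r)\<bar>\<partial>Q)"
  proof (rule nn_integral_mono)
   fix r show "ennreal \<bar>fst (fst r) - snd (snd r)\<bar>\<le>ennreal \<bar>fst (fst r) - snd (fst r)\<bar> + ennreal \<bar>snd (fst r) - fst (snd r)\<bar> + ennreal \<bar>fst (snd r) - snd (snd r)\<bar>"
   proof -
    have "ennreal \<bar>fst (fst r) - snd (snd r)\<bar>\<le>ennreal (\<bar>fst (fst r) - snd (fst r)\<bar> + \<bar>snd (fst r) - fst (snd r)\<bar> + \<bar>fst (snd r) - snd (snd r)\<bar>)"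
     by (intro ennreal_leI) linarith
    then show ?thesis by (simp only: ennreal_plus abs_ge_zero add_nonneg_nonneg)
   qed
  qed
  also have "\<dots> = (\<integral>\<^sup>+r. ennreal \<bar>fst (fst r) - snd (fst r)\<bar>\<partial>Q) + (\<integral>\<^sup>+r. ennreal \<bar>snd (fst r) - fst (snd r)\<bar>\<partial>Q) + (\<integral>\<^sup>+r. ennreal \<bar>fst (snd r) - snd (snd r)\<bar>\<partial>Q)"
   by (simp add: nn_integral_add)
  also have "(\<integral>\<^sup>+r. ennreal \<bar>fst (fst r) - snd (fst r)\<bar>\<partial>Q) = cost (distr Q \<pi>1 fst)"
   unfolding cost_def by (subst nn_integral_distr) (auto simp: Q_def)
  also have "cost (distr Q \<pi>1 fst) = cost \<pi>1" by (simp only: Q1)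
  also have "(\<integral>\<^sup>+r. ennreal \<bar>fst (snd r) - snd (snd r)\<bar>\<partial>Q) = cost (distr Q \<pi>2 snd)"
   unfolding cost_def by (subst nn_integral_distr) (auto simp: Q_def)
  also have "cost (distr Q \<pi>2 snd) = cost \<pi>2" by (simp only: Q2)
  also have "(\<integral>\<^sup>+r. ennreal \<bar>snd (fst r) - fst (snd r)\<bar>\<partial>Q)\<le>(\<integral>\<^sup>+r. ennreal \<eta>\<partial>Q)"
  proof -
   have "(\<integral>\<^sup>+r. ennreal \<bar>snd (fst r) - fst (snd r)\<bar>\<partial>Q) = (\<integral>\<^sup>+r. g r*ennreal \<bar>snd (fst r) - fst (snd r)\<bar>\<partial>(\<pi>1\<Otimes>\<^sub>M\<pi>2))"
    unfolding Q_def by (subst nn_integral_density) auto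
   also have "\<dots>\<le>(\<integral>\<^sup>+r. g r*ennreal \<eta>\<partial>(\<pi>1\<Otimes>\<^sub>M\<pi>2))"
   proof (rule nn_integral_mono)
    fix r show "g r*ennreal \<bar>snd (fst r) - fst (snd r)\<bar>\<le>g r*ennreal \<eta>"
    proof (cases "c (snd (fst r)) = c (fst (snd r))")
     case True
     then show ?thesis by (intro mult_left_mono ennreal_leI c_close) auto
    qed (simp add: g_def)
   qed
   also have "\<dots> = (\<integral>\<^sup>+r. ennreal \<eta>\<partial>Q)" unfolding Q_def by (subst nn_integral_density) auto
   finally show ?thesis .
  qed
  also have "(\<integral>\<^sup>+r. ennreal \<eta>\<partial>Q) = ennreal \<eta>" by (simp add: Q.emeasure_space_1)
  finally show ?thesis by (simp add: add_mono)
 qed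
 ultimately show thesis by (rule that)
qed

section \<open>The metric axioms for the Wasserstein distance\<close>

lemma couplings_swap:
 assumes "\<pi>\<in>couplings \<mu> \<nu>"
 shows "distr \<pi> (Rplus\<Otimes>\<^sub>MRplus) (%p. (snd p,fst p))\<in>couplings \<nu> \<mu>"
  "cost (distr \<pi> (Rplus\<Otimes>\<^sub>MRplus) (%p. (snd p,fst p))) = cost \<pi>"
proof -
 note C = couplingsD[OF assms]
 interpret prob_space \<pi> by fact
 have m: "(%p. (snd p,fst p))\<in>measurable \<pi> (Rplus\<Otimes>\<^sub>MRplus)"
  unfolding measurable_cong_sets[OF C(2) refl] by measurable
 show "distr \<pi> (Rplus\<Otimes>\<^sub>MRplus) (%p. (snd p,fst p))\<in>couplings \<nu> \<mu>"
  unfolding couplings_def using C(4,5) m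
  by (simp add: space_prob_algebra prob_space_distr distr_distr comp_def)
 have [measurable]: "(%x. fst x)\<in>borel_measurable (Rplus\<Otimes>\<^sub>MRplus)" "(%x. snd x)\<in>borel_measurable (Rplus\<Otimes>\<^sub>MRplus)"
  using measurable_compose[OF measurable_fst measurable_Rplus_real]
   measurable_compose[OF measurable_snd measurable_Rplus_real] by blast+
 show "cost (distr \<pi> (Rplus\<Otimes>\<^sub>MRplus) (%p. (snd p,fst p))) = cost \<pi>"
  unfolding cost_def by (subst nn_integral_distr[OF m]) (auto simp: abs_minus_commute)
qed

lemma W1_commute: "W1 \<mu> \<nu> = W1 \<nu> \<mu>"
proof -
 have "(INF \<pi>\<in>couplings \<nu> \<mu>. cost \<pi>)\<le>(INF \<pi>\<in>couplings \<mu> \<nu>. cost \<pi>)" for \<mu> \<nu>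
  by (rule INF_mono) (metis couplings_swap order_refl)
 then show ?thesis unfolding W1_cost by (metis antisym)
qed

lemma W1_self: assumes "\<mu>\<in>M11_Rplus" shows "W1 \<mu> \<mu> = 0"
proof -
 note m = M11_RplusD[OF assms]
 interpret prob_space \<mu> by fact
 have d: "(%x. (x,x))\<in>measurable \<mu> (Rplus\<Otimes>\<^sub>MRplus)"
  unfolding measurable_cong_sets[OF m(2) refl] by measurable
 have i: "distr \<mu> Rplus (%x. x) = \<mu>"
  by (rule distr_id2) (simp add: m(2))
 have "distr \<mu> (Rplus\<Otimes>\<^sub>MRplus) (%x. (x,x))\<in>couplings \<mu> \<mu>"
  unfolding couplings_def using d i
  by (simp add: space_prob_algebra prob_space_distr distr_distr comp_def)
 moreover have "cost (distr \<mu> (Rplus\<Otimes>\<^sub>MRplus) (%x. (x,x)))\<le>ennreal 0"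
 proof -
  have [measurable]: "(%x. fst x)\<in>borel_measurable (Rplus\<Otimes>\<^sub>MRplus)" "(%x. snd x)\<in>borel_measurable (Rplus\<Otimes>\<^sub>MRplus)"
   using measurable_compose[OF measurable_fst measurable_Rplus_real]
    measurable_compose[OF measurable_snd measurable_Rplus_real] by blast+
  show ?thesis unfolding cost_def by (subst nn_integral_distr[OF d]) auto
 qed
 ultimately have "W1 \<mu> \<mu>\<le>0" by (rule W1_le) simp
 then show ?thesis unfolding W1_cost by (simp add: antisym)
qed

lemma W1_triangle:
 assumes "\<mu>\<in>M11_Rplus" "\<nu>\<in>M11_Rplus" "\<kappa>\<in>M11_Rplus"
 shows "W1 \<mu> \<kappa>\<le>W1 \<mu> \<nu> + W1 \<nu> \<kappa>"
proof (rule field_le_epsilon)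
 fix e :: real assume "0 < e"
 have nn: "0\<le>W1 \<mu> \<nu>" "0\<le>W1 \<nu> \<kappa>" unfolding W1_cost by simp_all
 have pl: "ennreal a + ennreal b + ennreal c = ennreal (a + b + c)" if "0\<le>a" "0\<le>b" "0\<le>c" for a b c :: real
  using that by simp
 obtain \<pi>1 where 1: "\<pi>1\<in>couplings \<mu> \<nu>" "cost \<pi>1 < ennreal (W1 \<mu> \<nu> + e/3)"
  by (rule W1_approx[OF assms(1,2), of "W1 \<mu> \<nu> + e/3"]) (use \<open>0 < e\<close> in auto)
 obtain \<pi>2 where 2: "\<pi>2\<in>couplings \<nu> \<kappa>" "cost \<pi>2 < ennreal (W1 \<nu> \<kappa> + e/3)"
  by (rule W1_approx[OF assms(2,3), of "W1 \<nu> \<kappa> + e/3"]) (use \<open>0 < e\<close> in auto)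
 obtain \<pi> where 3: "\<pi>\<in>couplings \<mu> \<kappa>" "cost \<pi>\<le>cost \<pi>1 + ennreal (e/3) + cost \<pi>2"
  by (rule glue_couplings[OF 1(1) 2(1), of "e/3"]) (use \<open>0 < e\<close> in auto)
 have "cost \<pi>\<le>ennreal (W1 \<mu> \<nu> + e/3) + ennreal (e/3) + ennreal (W1 \<nu> \<kappa> + e/3)"
  by (rule order_trans[OF 3(2)]) (intro add_mono less_imp_le[OF 1(2)] less_imp_le[OF 2(2)] order_refl)
 also have "\<dots> = ennreal (W1 \<mu> \<nu> + e/3 + e/3 + (W1 \<nu> \<kappa> + e/3))"
  by (rule pl) (use nn \<open>0 < e\<close> in auto)
 finally have "W1 \<mu> \<kappa>\<le>W1 \<mu> \<nu> + e/3 + e/3 + (W1 \<nu> \<kappa> + e/3)"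
  by (rule W1_le[OF 3(1)]) (use nn \<open>0 < e\<close> in auto)
 then show "W1 \<mu> \<kappa>\<le>W1 \<mu> \<nu> + W1 \<nu> \<kappa> + e" by simp
qed

lemma W1_zero_imp_eq:
 assumes "\<mu>\<in>M11_Rplus" "\<nu>\<in>M11_Rplus" "W1 \<mu> \<nu> = 0"
 shows "\<mu> = \<nu>"
proof (rule prob_measure_eq_by_lipschitz[OF Rplus_def M11_RplusD(5)[OF assms(1)] M11_RplusD(5)[OF assms(2)]])
 fix f :: "real => real" and L assume "L-lipschitz_on UNIV f"
 from W1_lipschitz[OF assms(1,2) this] assms(3) show "(mean \<mu> f) = (mean \<nu> f)" by simp
qed

text \<open>\<open>W1_topology\<close> is built with \<open>Metric_space.mtopology\<close>, so these
  axioms are what make balls of \<open>W1\<close> open and the topology Hausdorff.\<close>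

interpretation W1_space: Metric_space M11_Rplus W1
proof
 show "0\<le>W1 \<mu> \<nu>" for \<mu> \<nu> unfolding W1_cost by simp
 show "W1 \<mu> \<nu> = W1 \<nu> \<mu>" for \<mu> \<nu> by (rule W1_commute)
 show "(W1 \<mu> \<nu> = 0) = (\<mu> = \<nu>)" if "\<mu>\<in>M11_Rplus" "\<nu>\<in>M11_Rplus" for \<mu> \<nu>
  using W1_self[OF that(1)] W1_zero_imp_eq[OF that] by (cases "\<mu> = \<nu>") auto
 show "W1 \<mu> \<kappa>\<le>W1 \<mu> \<nu> + W1 \<nu> \<kappa>" if "\<mu>\<in>M11_Rplus" "\<nu>\<in>M11_Rplus" "\<kappa>\<in>M11_Rplus" for \<mu> \<nu> \<kappa>
  by (rule W1_triangle[OF that])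
qed

lemma topspace_W1 [simp]: "topspace W1_topology = M11_Rplus"
 unfolding W1_topology_def by (rule W1_space.topspace_mtopology)

lemma Hausdorff_W1: "Hausdorff_space W1_topology"
 unfolding W1_topology_def by (rule W1_space.Hausdorff_space_mtopology)

text \<open>The function f may be unbounded. This is the point of the Wasserstein topology here: it
  controls the excess of the weights above a level R near \<nu>.\<close>

lemma tendsto_W1_nhdsin:
 fixes f :: "real => real"
 assumes f: "L-lipschitz_on UNIV f"
 shows "((%\<mu>. \<integral>x. f x\<partial>\<mu>) \<longlongrightarrow> (mean \<nu> f)) (nhdsin W1_topology \<nu>)"
proof (cases "\<nu>\<in>M11_Rplus")
 case True
 have L: "0\<le>L" by (rule lipschitz_on_nonneg[OF f])
 show ?thesis
 proof (rule tendstoI)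
  fix e :: real assume e: "0 < e"
  let ?U = "W1_space.mball \<nu> (e/(L + 1))"
  have "openin W1_topology ?U" unfolding W1_topology_def by (rule W1_space.openin_mball)
  moreover have "\<nu>\<in>?U" using True e L by simp
  moreover have "dist (mean \<mu> f) (mean \<nu> f) < e" if "\<mu>\<in>?U" for \<mu>
  proof -
   have m: "\<mu>\<in>M11_Rplus" "W1 \<nu> \<mu> < e/(L + 1)" using that by auto
   have "dist (mean \<mu> f) (mean \<nu> f)\<le>L*W1 \<nu> \<mu>"
    using W1_lipschitz[OF True m(1) f] by (simp add: dist_real_def abs_minus_commute)
   also have "\<dots>\<le>L*(e/(L + 1))" using m(2) L by (intro mult_left_mono) auto
   also have "\<dots> < e" using L e by (simp add: field_simps)
   finally show ?thesis .
  qed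
  ultimately show "\<forall>\<^sub>F \<mu> in nhdsin W1_topology \<nu>. dist (mean \<mu> f) (mean \<nu> f) < e"
   unfolding eventually_nhdsin by blast
 qed
qed (simp add: nhdsin_degenerate)

section \<open>Counting contingency tables\<close>

definition eta :: "real => real" where "eta x = x*ln x"

lemma eta_0 [simp]: "eta 0 = 0" by (simp add: eta_def)

text \<open>For tables of total mass 1 this is the mutual information, written so that it is visibly continuous.\<close>

definition mutual_info :: "'j set => 'k set => ('j\<times>'k => real) => real" where
 "mutual_info J K t = (\<Sum>p\<in>J\<times>K. eta (t p)) - (\<Sum>j\<in>J. eta (\<Sum>k\<in>K. t (j,k))) - (\<Sum>k\<in>K. eta (\<Sum>j\<in>J. t (j,k)))"

definition tables :: "'i set => 'j set => 'k set => ('i => 'k) => ('j\<times>'k => nat) => ('i => 'j) set" where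
 "tables S J K b N = {a\<in>S \<rightarrow>\<^sub>E J. \<forall>j\<in>J. \<forall>k\<in>K. card {i\<in>S. a i = j \<and> b i = k} = N (j,k)}"

lemma card_insert_filter:
 assumes "finite S" "s\<notin>S"
 shows "card {i\<in>insert s S. P i} = card {i\<in>S. P i} + (if P s then 1 else 0)"
proof -
 have "{i\<in>insert s S. P i} = (if P s then insert s {i\<in>S. P i} else {i\<in>S. P i})" by auto
 then show ?thesis using assms by simp
qed

text \<open>In column k the row labels can be arranged in c! / (product of the entries' factorials)
  ways, where c is the column size; different columns are independent. The multiplied-out form stays
  in \<open>nat\<close> and suits an induction that strips one index s and sums over its row
  label.\<close>

lemma card_tables:
 assumes "finite S" "finite J" "finite K" "b ` S\<subseteq>K"
  and "\<And>k. k\<in>K ==> (\<Sum>j\<in>J. N (j,k)) = card {i\<in>S. b i = k}"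
 shows "card (tables S J K b N)*(\<Prod>p\<in>J\<times>K. fact (N p)) = (\<Prod>k\<in>K. fact (card {i\<in>S. b i = k}) :: nat)"
 using assms(1,4,5)
proof (induction S arbitrary: N)
 case empty
 then have N0: "N (j,k) = 0" if "j\<in>J" "k\<in>K" for j k
  using that \<open>finite J\<close> by auto
 then have "tables {} J K b N = {%_. undefined}" by (auto simp: tables_def)
 moreover have "(\<Prod>p\<in>J\<times>K. fact (N p)) = (1::nat)" using N0 by (intro prod.neutral) auto
 ultimately show ?case by simp
next
 case (insert s S)
 note fin = \<open>finite S\<close> \<open>finite J\<close> \<open>finite K\<close>
 let ?k = "b s"
 have kK: "?k\<in>K" and bS: "b ` S\<subseteq>K" using insert.prems by auto
 \<comment> \<open>The table that remains after s has used the entry (j, b s). The truncated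
   subtraction is exact because only labels j with a positive entry are considered.\<close>
 define N' where "N' j = N((j,?k) := N (j,?k) - 1)" for j
 let ?c = "%k. card {i\<in>S. b i = k}"
 have marg: "(\<Sum>j\<in>J. N (j,k)) = ?c k + (if ?k = k then 1 else 0)" if "k\<in>K" for k
  using insert.prems(2)[OF that] card_insert_filter[OF insert.hyps(1,2), of "%i. b i = k"] by simp
 let ?J = "{j\<in>J. 0 < N (j,?k)}"
 have marg': "(\<Sum>j\<in>J. N' j0 (j,k)) = ?c k" if "j0\<in>?J" "k\<in>K" for j0 k
 proof (cases "k = ?k")
  case True
  have "(\<Sum>j\<in>J. N' j0 (j,k)) = N (j0,?k) - 1 + (\<Sum>j\<in>J - {j0}. N (j,k))"
   using that fin True by (subst sum.remove[of _ j0]) (auto simp: N'_def intro!: sum.cong)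
  moreover have "(\<Sum>j\<in>J. N (j,k)) = N (j0,?k) + (\<Sum>j\<in>J - {j0}. N (j,k))"
   using that fin True by (subst sum.remove[of _ j0]) auto
  ultimately show ?thesis using marg[OF that(2)] that True by auto
 next
  case False
  then show ?thesis using marg[OF that(2)] by (auto simp: N'_def)
 qed
 have step: "a(s := j)\<in>tables (insert s S) J K b N \<longleftrightarrow> a\<in>tables S J K b (N' j)"
  if "j\<in>?J" "a\<in>S \<rightarrow>\<^sub>E J" for a j
 proof -
  have "card {i\<in>insert s S. (a(s := j)) i = j' \<and> b i = k} = card {i\<in>S. a i = j' \<and> b i = k} + (if j = j' \<and> ?k = k then 1 else 0)" for j' k
  proof -
   have "{i\<in>S. (a(s := j)) i = j' \<and> b i = k} = {i\<in>S. a i = j' \<and> b i = k}" using insert.hyps by auto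
   then show ?thesis using card_insert_filter[OF insert.hyps(1,2), of "%i. (a(s := j)) i = j' \<and> b i = k"] by simp
  qed
  moreover have "a(s := j)\<in>insert s S \<rightarrow>\<^sub>E J" using that by (auto simp: PiE_iff extensional_def)
  moreover have "(\<forall>j'\<in>J. \<forall>k\<in>K. card {i\<in>S. a i = j' \<and> b i = k} + (if j = j' \<and> ?k = k then 1 else 0) = N (j',k)) \<longleftrightarrow>
    (\<forall>j'\<in>J. \<forall>k\<in>K. card {i\<in>S. a i = j' \<and> b i = k} = N' j (j',k))"
   using that(1) by (intro ball_cong refl) (auto simp: N'_def)
  ultimately show ?thesis using that(2) by (simp add: tables_def)
 qed
 have T: "tables (insert s S) J K b N = (\<Union>j\<in>?J. (%a. a(s := j)) ` tables S J K b (N' j))"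
 proof (intro equalityI subsetI)
  fix a assume a: "a\<in>tables (insert s S) J K b N"
  then have aP: "a\<in>insert s S \<rightarrow>\<^sub>E J" by (simp add: tables_def)
  define a' where "a' = a(s := undefined)"
  have a': "a'\<in>S \<rightarrow>\<^sub>E J" "a = a'(s := a s)" using aP insert.hyps by (auto simp: a'_def PiE_iff extensional_def)
  have "card {i\<in>insert s S. a i = a s \<and> b i = ?k} = N (a s,?k)" using a aP kK by (auto simp: tables_def PiE_iff)
  moreover have "0 < card {i\<in>insert s S. a i = a s \<and> b i = ?k}" using insert.hyps by (subst card_gt_0_iff) auto
  ultimately have j: "a s\<in>?J" using aP by (auto simp: PiE_iff)
  have "a'\<in>tables S J K b (N' (a s))" using step[OF j a'(1)] a a'(2) by simp
  then show "a\<in>(\<Union>j\<in>?J. (%a. a(s := j)) ` tables S J K b (N' j))" using j a'(2) by blast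
 next
  fix a assume "a\<in>(\<Union>j\<in>?J. (%a. a(s := j)) ` tables S J K b (N' j))"
  then obtain j a' where "j\<in>?J" "a'\<in>tables S J K b (N' j)" "a = a'(s := j)" by blast
  then show "a\<in>tables (insert s S) J K b N" using step[of j a'] by (simp add: tables_def)
 qed
 have finT: "finite (tables S J K b N0)" for N0
  unfolding tables_def using fin by (auto intro: finite_subset[OF _ finite_PiE[of S "%_. J"]])
 have inj: "inj_on (%a. a(s := j)) (tables S J K b N0)" for j N0
 proof (rule inj_onI)
  fix x y assume "x\<in>tables S J K b N0" "y\<in>tables S J K b N0" "x(s := j) = y(s := j)"
  then show "x = y" using insert.hyps(2)
   by (auto simp: tables_def PiE_iff extensional_def fun_eq_iff split: if_splits) metis
 qed
 have "card (tables (insert s S) J K b N) = (\<Sum>j\<in>?J. card ((%a. a(s := j)) ` tables S J K b (N' j)))"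
  unfolding T using fin finT by (intro card_UN_disjoint) (auto simp: fun_eq_iff, metis)
 also have "\<dots> = (\<Sum>j\<in>?J. card (tables S J K b (N' j)))" by (simp add: card_image inj)
 finally have cT: "card (tables (insert s S) J K b N) = (\<Sum>j\<in>?J. card (tables S J K b (N' j)))" .
 have pr: "(\<Prod>p\<in>J\<times>K. fact (N p)) = N (j,?k)*(\<Prod>p\<in>J\<times>K. fact (N' j p) :: nat)" if "j\<in>?J" for j
 proof -
  have in_: "(j,?k)\<in>J\<times>K" using that kK by simp
  have "(\<Prod>p\<in>J\<times>K. fact (N p)) = fact (N (j,?k))*(\<Prod>p\<in>J\<times>K - {(j,?k)}. fact (N p) :: nat)"
   using fin in_ by (subst prod.remove[of _ "(j,?k)"]) auto
  moreover have "(\<Prod>p\<in>J\<times>K. fact (N' j p)) = fact (N (j,?k) - 1)*(\<Prod>p\<in>J\<times>K - {(j,?k)}. fact (N p) :: nat)"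
   using fin in_ by (subst prod.remove[of _ "(j,?k)"]) (auto simp: N'_def intro!: prod.cong)
  moreover have "fact (N (j,?k)) = N (j,?k)*(fact (N (j,?k) - 1) :: nat)" using that by (simp add: fact_reduce)
  ultimately show ?thesis by simp
 qed
 have "card (tables (insert s S) J K b N)*(\<Prod>p\<in>J\<times>K. fact (N p)) =
   (\<Sum>j\<in>?J. card (tables S J K b (N' j))*(\<Prod>p\<in>J\<times>K. fact (N p)))"
  unfolding cT by (rule sum_distrib_right)
 \<comment> \<open>By \<open>pr\<close>, restoring the removed unit multiplies the product of
   factorials by the entry N (j, b s). The remaining factor does not depend on j, so the sum over j
   produces the enlarged column size, the factor missing from its factorial.\<close>
 also have "\<dots> = (\<Sum>j\<in>?J. N (j,?k)*(\<Prod>k\<in>K. fact (?c k)))"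
 proof (rule sum.cong[OF refl])
  fix j assume j: "j\<in>?J"
  have "card (tables S J K b (N' j))*(\<Prod>p\<in>J\<times>K. fact (N' j p)) = (\<Prod>k\<in>K. fact (?c k) :: nat)"
   by (rule insert.IH[OF bS marg'[OF j]])
  then show "card (tables S J K b (N' j))*(\<Prod>p\<in>J\<times>K. fact (N p)) = N (j,?k)*(\<Prod>k\<in>K. fact (?c k) :: nat)"
   unfolding pr[OF j] by simp
 qed
 also have "\<dots> = (\<Sum>j\<in>J. N (j,?k))*(\<Prod>k\<in>K. fact (?c k))"
  unfolding sum_distrib_right using fin by (intro sum.mono_neutral_left) auto
 also have "\<dots> = (\<Prod>k\<in>K. fact (card {i\<in>insert s S. b i = k}))"
 proof -
  have "(\<Prod>k\<in>K. fact (card {i\<in>insert s S. b i = k})) = fact (?c ?k + 1)*(\<Prod>k\<in>K - {?k}. fact (?c k) :: nat)"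
  proof -
   have "(\<Prod>k\<in>K - {?k}. fact (card {i\<in>insert s S. b i = k})) = (\<Prod>k\<in>K - {?k}. fact (?c k) :: nat)"
   proof (rule prod.cong[OF refl])
    fix k assume "k\<in>K - {?k}"
    then have "?k\<noteq>k" by auto
    then show "fact (card {i\<in>insert s S. b i = k}) = (fact (?c k) :: nat)"
     using card_insert_filter[OF insert.hyps(1,2), of "%i. b i = k"] by simp
   qed
   then show ?thesis
    using fin kK card_insert_filter[OF insert.hyps(1,2), of "%i. b i = ?k"]
    by (subst prod.remove[of _ ?k]) simp_all
  qed
  moreover have "(\<Prod>k\<in>K. fact (?c k)) = fact (?c ?k)*(\<Prod>k\<in>K - {?k}. fact (?c k) :: nat)"
   using fin kK by (subst prod.remove[of _ ?k]) auto
  ultimately show ?thesis using marg[OF kK] by (simp add: algebra_simps)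
 qed
 finally show ?case .
qed

text \<open>The bound (k/e)^k \<le> k!; the induction step is (1 + 1/k)^k \<le> e.\<close>

lemma ln_fact_lower: "eta (real k) - real k\<le>ln (fact k)"
proof (induction k)
 case (Suc k)
 have "real k*ln (1 + 1/real k)\<le>1" if "k > 0"
  using ln_add_one_self_le_self[of "1/real k"] that by (simp add: field_simps)
 moreover have "ln (1 + 1/real k) = ln (real (Suc k)) - ln (real k)" if "k > 0"
 proof -
  have "1 + 1/real k = real (Suc k)/real k" using that by (simp add: field_simps)
  then show ?thesis using that by (simp only: ln_div) simp
 qed
 ultimately have "real k*(ln (real (Suc k)) - ln (real k))\<le>1" by (cases "k = 0") auto
 then have "eta (real (Suc k)) - real (Suc k)\<le>ln (real (Suc k)) + (eta (real k) - real k)"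
  by (simp add: eta_def algebra_simps)
 also have "\<dots>\<le>ln (real (Suc k)) + ln (fact k)" using Suc by simp
 also have "\<dots> = ln (fact (Suc k))" by (simp add: ln_mult)
 finally show ?case .
qed simp

text \<open>A crude Stirling bound, k! \<le> (k/e)^k (k+1)^2. The exponent 2 comes from the
  induction step, which needs 1 \<le> k/(k+1) + 2/(k+2). Polynomial precision suffices on the
  exponential scale.\<close>

lemma ln_fact_upper: "ln (fact k)\<le>eta (real k) - real k + 2*ln (real k + 1)"
proof (induction k)
 case (Suc k)
 have inv: "1 - 1/x\<le>ln x" if "x > 0" for x :: real
  using ln_le_minus_one[of "1/x"] that by (simp add: ln_div)
 have a: "real k/(real k + 1)\<le>real k*(ln (real k + 1) - ln (real k))"
 proof (cases "k = 0")
  case False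
  have "1 - 1/((real k + 1)/real k)\<le>ln ((real k + 1)/real k)" using False by (intro inv) auto
  then have "1/(real k + 1)\<le>ln (real k + 1) - ln (real k)" using False by (simp add: ln_div field_simps)
  then have "real k*(1/(real k + 1))\<le>real k*(ln (real k + 1) - ln (real k))" by (intro mult_left_mono) auto
  then show ?thesis by simp
 qed simp
 have "1 - 1/((real k + 2)/(real k + 1))\<le>ln ((real k + 2)/(real k + 1))" by (intro inv) auto
 then have b: "1/(real k + 2)\<le>ln (real k + 2) - ln (real k + 1)" by (simp add: ln_div field_simps)
 have "real k/(real k + 1) = 1 - 1/(real k + 1)" "1/(real k + 1)\<le>2*(1/(real k + 2))"
  by (simp_all add: field_simps)
 then have "1\<le>real k/(real k + 1) + 2*(1/(real k + 2))" by linarith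
 note c = this
 have "1\<le>real k*(ln (real k + 1) - ln (real k)) + 2*(ln (real k + 2) - ln (real k + 1))"
  by (rule order_trans[OF c]) (intro add_mono a mult_left_mono b; simp)
 then have "ln (real k + 1) + (eta (real k) - real k + 2*ln (real k + 1))\<le>eta (real (Suc k)) - real (Suc k) + 2*ln (real (Suc k) + 1)"
  by (simp add: eta_def algebra_simps)
 moreover have "ln (fact (Suc k)) = ln (real k + 1) + ln (fact k)" by (simp add: ln_mult add.commute)
 ultimately show ?case using Suc by linarith
qed simp

text \<open>Scaling by n turns eta (x/n) into eta x - x ln n. The three sums have the same total n
  and enter with signs -, +, +, so one term n ln n = eta n survives.\<close>

lemma mutual_info_scaled:
 fixes N :: "'j\<times>'k => nat"
 assumes "finite J" "finite K" "n > 0" and n: "(\<Sum>p\<in>J\<times>K. N p) = n"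
 shows "real n*mutual_info J K (%p. N p/n) =
  (\<Sum>p\<in>J\<times>K. eta (N p)) - (\<Sum>j\<in>J. eta (\<Sum>k\<in>K. N (j,k))) - (\<Sum>k\<in>K. eta (\<Sum>j\<in>J. N (j,k))) + eta n"
proof -
 have e: "real n*eta (x/n) = eta x - x*ln n" if "0\<le>x" for x
  using that \<open>n > 0\<close> by (cases "x = 0") (auto simp: eta_def ln_div algebra_simps)
 have "real n*mutual_info J K (%p. N p/n) =
   (\<Sum>p\<in>J\<times>K. real n*eta (N p/n)) - (\<Sum>j\<in>J. real n*eta ((\<Sum>k\<in>K. N (j,k))/n)) - (\<Sum>k\<in>K. real n*eta ((\<Sum>j\<in>J. N (j,k))/n))"
  unfolding mutual_info_def by (simp add: sum_distrib_left right_diff_distrib sum_divide_distrib)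
 also have "\<dots> = (\<Sum>p\<in>J\<times>K. eta (N p) - N p*ln n) - (\<Sum>j\<in>J. eta (\<Sum>k\<in>K. N (j,k)) - (\<Sum>k\<in>K. N (j,k))*ln n)
   - (\<Sum>k\<in>K. eta (\<Sum>j\<in>J. N (j,k)) - (\<Sum>j\<in>J. N (j,k))*ln n)"
  by (simp add: e sum_nonneg)
 also have "\<dots> = (\<Sum>p\<in>J\<times>K. eta (N p)) - (\<Sum>j\<in>J. eta (\<Sum>k\<in>K. N (j,k))) - (\<Sum>k\<in>K. eta (\<Sum>j\<in>J. N (j,k)))
   - (\<Sum>p\<in>J\<times>K. real (N p))*ln n + (\<Sum>j\<in>J. \<Sum>k\<in>K. real (N (j,k)))*ln n + (\<Sum>k\<in>K. \<Sum>j\<in>J. real (N (j,k)))*ln n"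
  by (simp add: sum_subtractf sum_distrib_right)
 also have "(\<Sum>k\<in>K. \<Sum>j\<in>J. real (N (j,k))) = (\<Sum>j\<in>J. \<Sum>k\<in>K. real (N (j,k)))" by (rule sum.swap)
 also have "(\<Sum>j\<in>J. \<Sum>k\<in>K. real (N (j,k))) = (\<Sum>p\<in>J\<times>K. real (N p))" by (simp add: sum.cartesian_product)
 also have "(\<Sum>p\<in>J\<times>K. real (N p)) = n" using n by (simp flip: of_nat_sum)
 finally show ?thesis by (simp add: eta_def)
qed

text \<open>The generalised hypergeometric distribution: the probability of the table N, given both
  margins, when one of two label vectors is permuted uniformly at random.\<close>

definition table_ratio :: "'j set => 'k set => ('j\<times>'k => nat) => real" where
 "table_ratio J K N = (\<Prod>j\<in>J. fact (\<Sum>k\<in>K. N (j,k)))*(\<Prod>k\<in>K. fact (\<Sum>j\<in>J. N (j,k))) /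
   (fact (\<Sum>p\<in>J\<times>K. N p)*(\<Prod>p\<in>J\<times>K. fact (N p)))"

text \<open>Factorial bounds are inserted into each factor. The linear terms cancel, since rows,
  columns, entries and the grand total each sum to n and occur twice with each sign. Every factorial
  estimated from above contributes a factor (n+1)^2: those of the margins in the first bound, those
  of the entries and of n in the second.\<close>

lemma table_ratio_bounds:
 fixes N :: "'j\<times>'k => nat"
 assumes fin: "finite J" "finite K" and n0: "n > 0" and n: "(\<Sum>p\<in>J\<times>K. N p) = n"
 defines "D \<equiv> real n*mutual_info J K (%p. N p/n)"
 shows "table_ratio J K N\<le>exp (- D)*(real n + 1)^(2*(card J + card K))"
  and "exp (- D)\<le>table_ratio J K N*(real n + 1)^(2*(1 + card (J\<times>K)))"
proof -
 let ?r = "%j. \<Sum>k\<in>K. N (j,k)" and ?c = "%k. \<Sum>j\<in>J. N (j,k)"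
 have sr: "(\<Sum>j\<in>J. ?r j) = n" using n by (simp add: sum.cartesian_product)
 have sc: "(\<Sum>k\<in>K. ?c k) = n" using sr by (subst sum.swap) simp
 have rn: "?r j\<le>n" if "j\<in>J" for j using sr that fin member_le_sum[of j J ?r] by simp
 have cn: "?c k\<le>n" if "k\<in>K" for k using sc that fin member_le_sum[of k K ?c] by simp
 have Nn: "N p\<le>n" if "p\<in>J\<times>K" for p using n that fin member_le_sum[of p "J\<times>K" N] by simp
 have D: "D = (\<Sum>p\<in>J\<times>K. eta (N p)) - (\<Sum>j\<in>J. eta (?r j)) - (\<Sum>k\<in>K. eta (?c k)) + eta n"
  unfolding D_def by (subst mutual_info_scaled[OF fin n0 n]) (simp add: of_nat_sum)
 have pos: "table_ratio J K N > 0" unfolding table_ratio_def by (auto intro!: divide_pos_pos mult_pos_pos prod_pos)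
 have L: "ln (table_ratio J K N) = (\<Sum>j\<in>J. ln (fact (?r j))) + (\<Sum>k\<in>K. ln (fact (?c k))) - ln (fact n) - (\<Sum>p\<in>J\<times>K. ln (fact (N p)))"
 proof -
  have "ln (\<Prod>j\<in>J. fact (?r j) :: real) = (\<Sum>j\<in>J. ln (fact (?r j)))" by (rule ln_prod) (use fin in auto)
  moreover have "ln (\<Prod>k\<in>K. fact (?c k) :: real) = (\<Sum>k\<in>K. ln (fact (?c k)))" by (rule ln_prod) (use fin in auto)
  moreover have "ln (\<Prod>p\<in>J\<times>K. fact (N p) :: real) = (\<Sum>p\<in>J\<times>K. ln (fact (N p)))" by (rule ln_prod) (use fin in auto)
  moreover have "(\<Prod>j\<in>J. fact (?r j) :: real) > 0" "(\<Prod>k\<in>K. fact (?c k) :: real) > 0" "(\<Prod>p\<in>J\<times>K. fact (N p) :: real) > 0"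
   by (auto intro!: prod_pos)
  ultimately show ?thesis unfolding table_ratio_def n by (simp add: ln_div ln_mult)
 qed
 have sums: "(\<Sum>j\<in>J. real (?r j)) = n" "(\<Sum>k\<in>K. real (?c k)) = n" "(\<Sum>p\<in>J\<times>K. real (N p)) = n"
  using sr sc n by (simp_all only: flip: of_nat_sum)
 let ?l = "2*ln (real n + 1)"
 have "(\<Sum>j\<in>J. ln (fact (?r j)))\<le>(\<Sum>j\<in>J. eta (?r j) - real (?r j) + ?l)"
 proof (rule sum_mono)
  fix j assume "j\<in>J"
  then have "ln (real (?r j) + 1)\<le>ln (real n + 1)" using rn by (subst ln_le_cancel_iff) (auto simp del: of_nat_sum)
  then show "ln (fact (?r j))\<le>eta (?r j) - real (?r j) + ?l" using ln_fact_upper[of "?r j"] by linarith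
 qed
 moreover have "(\<Sum>j\<in>J. eta (?r j) - real (?r j) + ?l) = (\<Sum>j\<in>J. eta (?r j)) - n + card J*?l"
  by (simp only: sum.distrib sum_subtractf sums sum_constant)
 moreover have "(\<Sum>k\<in>K. ln (fact (?c k)))\<le>(\<Sum>k\<in>K. eta (?c k) - real (?c k) + ?l)"
 proof (rule sum_mono)
  fix k assume "k\<in>K"
  then have "ln (real (?c k) + 1)\<le>ln (real n + 1)" using cn by (subst ln_le_cancel_iff) (auto simp del: of_nat_sum)
  then show "ln (fact (?c k))\<le>eta (?c k) - real (?c k) + ?l" using ln_fact_upper[of "?c k"] by linarith
 qed
 moreover have "(\<Sum>k\<in>K. eta (?c k) - real (?c k) + ?l) = (\<Sum>k\<in>K. eta (?c k)) - n + card K*?l"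
  by (simp only: sum.distrib sum_subtractf sums sum_constant)
 moreover have "(\<Sum>p\<in>J\<times>K. eta (N p) - real (N p))\<le>(\<Sum>p\<in>J\<times>K. ln (fact (N p)))"
  by (rule sum_mono) (rule ln_fact_lower)
 moreover have "(\<Sum>p\<in>J\<times>K. eta (N p) - real (N p)) = (\<Sum>p\<in>J\<times>K. eta (N p)) - n"
  by (simp only: sum_subtractf sums)
 moreover have "eta n - n\<le>ln (fact n)" by (rule ln_fact_lower)
 ultimately have "ln (table_ratio J K N)\<le>- D + card J*?l + card K*?l" unfolding L D by linarith
 also have "\<dots> = ln (exp (- D)*(real n + 1)^(2*(card J + card K)))"
  by (simp add: ln_mult ln_realpow algebra_simps)
 finally show "table_ratio J K N\<le>exp (- D)*(real n + 1)^(2*(card J + card K))"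
  using pos by (subst (asm) ln_le_cancel_iff) auto
 have "(\<Sum>j\<in>J. eta (?r j) - real (?r j))\<le>(\<Sum>j\<in>J. ln (fact (?r j)))"
  by (rule sum_mono) (rule ln_fact_lower)
 moreover have "(\<Sum>j\<in>J. eta (?r j) - real (?r j)) = (\<Sum>j\<in>J. eta (?r j)) - n"
  by (simp only: sum_subtractf sums)
 moreover have "(\<Sum>k\<in>K. eta (?c k) - real (?c k))\<le>(\<Sum>k\<in>K. ln (fact (?c k)))"
  by (rule sum_mono) (rule ln_fact_lower)
 moreover have "(\<Sum>k\<in>K. eta (?c k) - real (?c k)) = (\<Sum>k\<in>K. eta (?c k)) - n"
  by (simp only: sum_subtractf sums)
 moreover have "(\<Sum>p\<in>J\<times>K. ln (fact (N p)))\<le>(\<Sum>p\<in>J\<times>K. eta (N p) - real (N p) + ?l)"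
 proof (rule sum_mono)
  fix p assume "p\<in>J\<times>K"
  then have "ln (real (N p) + 1)\<le>ln (real n + 1)" using Nn[of p] by (subst ln_le_cancel_iff) auto
  then show "ln (fact (N p))\<le>eta (N p) - real (N p) + ?l" using ln_fact_upper[of "N p"] by linarith
 qed
 moreover have "(\<Sum>p\<in>J\<times>K. eta (N p) - real (N p) + ?l) = (\<Sum>p\<in>J\<times>K. eta (N p)) - n + card (J\<times>K)*?l"
  by (simp only: sum.distrib sum_subtractf sums sum_constant)
 moreover have "ln (fact n)\<le>eta n - n + ?l" by (rule ln_fact_upper)
 ultimately have "- D\<le>ln (table_ratio J K N) + ?l + card (J\<times>K)*?l" unfolding L D by linarith
 also have "\<dots> = ln (table_ratio J K N) + real (2*(1 + card (J\<times>K)))*ln (real n + 1)"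
  by (simp add: algebra_simps del: card_cartesian_product)
 also have "\<dots> = ln (table_ratio J K N*(real n + 1)^(2*(1 + card (J\<times>K))))"
 proof -
  have *: "ln x + real m*ln y = ln (x*y^m)" if "x > 0" "y > 0" for x y :: real and m
   using that by (simp add: ln_mult ln_realpow)
  show ?thesis by (rule *[OF pos]) simp
 qed
 finally show "exp (- D)\<le>table_ratio J K N*(real n + 1)^(2*(1 + card (J\<times>K)))"
  using pos by (subst (asm) ln_ge_iff) auto
qed

section \<open>Tables of random labels\<close>

text \<open>Fibres of a and a' over the same label have equal size, so bijections between them exist
  and glue to a permutation of S.\<close>

lemma same_counts_permutation:
 assumes "finite S" and a: "a ` S\<subseteq>J" and a': "a' ` S\<subseteq>J"
  and cnt: "\<And>j. j\<in>J ==> card {i\<in>S. a i = j} = card {i\<in>S. a' i = j}"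
 obtains \<sigma> where "\<sigma> permutes S" "\<And>i. i\<in>S ==> a' i = a (\<sigma> i)"
proof -
 have "\<exists>f. bij_betw f {i\<in>S. a' i = j} {i\<in>S. a i = j}" if "j\<in>J" for j
  using cnt[OF that] \<open>finite S\<close> by (intro finite_same_card_bij) auto
 then obtain f where f: "\<And>j. j\<in>J ==> bij_betw (f j) {i\<in>S. a' i = j} {i\<in>S. a i = j}" by metis
 define \<sigma> where "\<sigma> i = (if i\<in>S then f (a' i) i else i)" for i
 have \<sigma>: "\<sigma> i\<in>S \<and> a (\<sigma> i) = a' i" if "i\<in>S" for i
  using bij_betwE[OF f[of "a' i"]] that a' by (auto simp: \<sigma>_def)
 have "inj_on \<sigma> S"
 proof (rule inj_onI)
  fix i k assume ik: "i\<in>S" "k\<in>S" "\<sigma> i = \<sigma> k"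
  then have "a' i = a' k" using \<sigma>[of i] \<sigma>[of k] by simp
  then show "i = k" using bij_betw_imp_inj_on[OF f[of "a' i"]] ik a' by (auto simp: \<sigma>_def inj_on_def)
 qed
 then have "bij_betw \<sigma> S S" using endo_inj_surj[OF \<open>finite S\<close>, of \<sigma>] \<sigma> by (auto simp: bij_betw_def)
 then have "\<sigma> permutes S" by (rule bij_imp_permutes) (simp add: \<sigma>_def)
 then show thesis by (rule that) (use \<sigma> in auto)
qed

text \<open>Restricted to J, as \<open>table\<close> is to the product set, so that equality of
  margins and of tables is equality of functions.\<close>

definition counts :: "'i set => 'j set => ('i => 'j) => 'j => nat" where
 "counts S J a = (\<lambda>j\<in>J. card {i\<in>S. a i = j})"

definition table :: "'i set => 'j set => 'k set => ('i => 'j) => ('i => 'k) => 'j\<times>'k => nat" where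
 "table S J K a b = (\<lambda>(j,k)\<in>J\<times>K. card {i\<in>S. a i = j \<and> b i = k})"

lemma table_margins:
 assumes "finite S" "finite J" "finite K" "a ` S\<subseteq>J" "b ` S\<subseteq>K"
 shows "k\<in>K ==> (\<Sum>j\<in>J. table S J K a b (j,k)) = card {i\<in>S. b i = k}"
  and "j\<in>J ==> (\<Sum>k\<in>K. table S J K a b (j,k)) = card {i\<in>S. a i = j}"
  and "(\<Sum>p\<in>J\<times>K. table S J K a b p) = card S"
proof -
 have 1: "(\<Sum>j\<in>J. table S J K a b (j,k)) = card {i\<in>S. b i = k}" if "k\<in>K" for k
 proof -
  have "(\<Sum>j\<in>J. table S J K a b (j,k)) = (\<Sum>j\<in>J. card {i\<in>S. a i = j \<and> b i = k})"
   using that by (intro sum.cong) (auto simp: table_def)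
  also have "\<dots> = card (\<Union>j\<in>J. {i\<in>S. a i = j \<and> b i = k})"
   using assms by (intro card_UN_disjoint[symmetric]) auto
  also have "(\<Union>j\<in>J. {i\<in>S. a i = j \<and> b i = k}) = {i\<in>S. b i = k}" using assms by auto
  finally show ?thesis .
 qed
 then show "k\<in>K ==> (\<Sum>j\<in>J. table S J K a b (j,k)) = card {i\<in>S. b i = k}" .
 show 2: "(\<Sum>k\<in>K. table S J K a b (j,k)) = card {i\<in>S. a i = j}" if "j\<in>J" for j
 proof -
  have "(\<Sum>k\<in>K. table S J K a b (j,k)) = (\<Sum>k\<in>K. card {i\<in>S. a i = j \<and> b i = k})"
   using that by (intro sum.cong) (auto simp: table_def)
  also have "\<dots> = card (\<Union>k\<in>K. {i\<in>S. a i = j \<and> b i = k})"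
   using assms by (intro card_UN_disjoint[symmetric]) auto
  also have "(\<Union>k\<in>K. {i\<in>S. a i = j \<and> b i = k}) = {i\<in>S. a i = j}" using assms by auto
  finally show ?thesis .
 qed
 have "(\<Sum>p\<in>J\<times>K. table S J K a b p) = (\<Sum>j\<in>J. \<Sum>k\<in>K. table S J K a b (j,k))"
  by (simp add: sum.cartesian_product)
 also have "\<dots> = (\<Sum>j\<in>J. card {i\<in>S. a i = j})" by (rule sum.cong[OF refl 2])
 also have "\<dots> = card (\<Union>j\<in>J. {i\<in>S. a i = j})"
  using assms by (intro card_UN_disjoint[symmetric]) auto
 also have "(\<Union>j\<in>J. {i\<in>S. a i = j}) = S" using assms by auto
 finally show "(\<Sum>p\<in>J\<times>K. table S J K a b p) = card S" .
qed

lemma table_bound: "finite S ==> table S J K a b\<in>J\<times>K \<rightarrow>\<^sub>E {..card S}"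
 by (auto simp: table_def intro!: card_mono)

text \<open>The probabilistic input, reduced to finitely many label vectors. E will be an event
  about the empirical measure of the weights, hence invariant under permutations, so that
  exchangeability survives intersection with it; G plays the same part for the points.
  Exchangeability and independence are required only on the atoms where a label vector is
  fixed.\<close>

locale random_labels = prob_space M for M :: "'w measure" +
 fixes S :: "'i set" and J :: "'j set" and K :: "'k set"
  and A :: "'w => 'i => 'j" and B :: "'w => 'i => 'k" and E G :: "'w set"
 assumes fin: "finite S" "finite J" "finite K" and S_ne: "S\<noteq>{}"
  and A: "\<And>\<omega>. \<omega>\<in>space M ==> A \<omega>\<in>S \<rightarrow>\<^sub>E J" and B: "\<And>\<omega>. \<omega>\<in>space M ==> B \<omega>\<in>S \<rightarrow>\<^sub>E K"
  and E: "E\<in>events" and G: "G\<in>events"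
  and EA: "\<And>a. {\<omega>\<in>space M. A \<omega> = a}\<in>events" and GB: "\<And>b. {\<omega>\<in>space M. B \<omega> = b}\<in>events"
  and exch: "\<And>\<sigma> a. \<sigma> permutes S ==> a\<in>S \<rightarrow>\<^sub>E J ==> prob {\<omega>\<in>E. A \<omega> = (\<lambda>i\<in>S. a (\<sigma> i))} = prob {\<omega>\<in>E. A \<omega> = a}"
  and indep: "\<And>a b. prob {\<omega>\<in>E\<inter>G. A \<omega> = a \<and> B \<omega> = b} = prob {\<omega>\<in>E. A \<omega> = a} * prob {\<omega>\<in>G. B \<omega> = b}"
begin

abbreviation "T \<omega> \<equiv> table S J K (A \<omega>) (B \<omega>)"

lemma E_space: "\<omega>\<in>E ==> \<omega>\<in>space M" and G_space: "\<omega>\<in>G ==> \<omega>\<in>space M"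
 using E G sets.sets_into_space by auto

lemma finite_labels: "finite (S \<rightarrow>\<^sub>E J)" "finite (S \<rightarrow>\<^sub>E K)"
 using fin by (auto intro: finite_PiE)

lemma EA': "{\<omega>\<in>E. A \<omega> = a}\<in>events"
proof -
 have "{\<omega>\<in>E. A \<omega> = a} = E\<inter>{\<omega>\<in>space M. A \<omega> = a}" using E_space by auto
 then show ?thesis using E EA by auto
qed

lemma GB': "{\<omega>\<in>G. B \<omega> = b}\<in>events"
proof -
 have "{\<omega>\<in>G. B \<omega> = b} = G\<inter>{\<omega>\<in>space M. B \<omega> = b}" using G_space by auto
 then show ?thesis using G GB by auto
qed

lemma EGAB: "{\<omega>\<in>E\<inter>G. A \<omega> = a \<and> B \<omega> = b}\<in>events"
proof -
 have "{\<omega>\<in>E\<inter>G. A \<omega> = a \<and> B \<omega> = b} = {\<omega>\<in>E. A \<omega> = a}\<inter>{\<omega>\<in>G. B \<omega> = b}" by auto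
 then show ?thesis using EA' GB' by auto
qed

lemma prob_A: "prob {\<omega>\<in>E. P (A \<omega>)} = (\<Sum>a\<in>{a\<in>S \<rightarrow>\<^sub>E J. P a}. prob {\<omega>\<in>E. A \<omega> = a})"
proof -
 have "{\<omega>\<in>E. P (A \<omega>)} = (\<Union>a\<in>{a\<in>S \<rightarrow>\<^sub>E J. P a}. {\<omega>\<in>E. A \<omega> = a})" using A E_space by auto
 moreover have "prob (\<Union>a\<in>{a\<in>S \<rightarrow>\<^sub>E J. P a}. {\<omega>\<in>E. A \<omega> = a}) = (\<Sum>a\<in>{a\<in>S \<rightarrow>\<^sub>E J. P a}. prob {\<omega>\<in>E. A \<omega> = a})"
  using finite_labels EA' by (intro finite_measure_finite_Union) (auto simp: disjoint_family_on_def)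
 ultimately show ?thesis by simp
qed

lemma prob_B: "prob {\<omega>\<in>G. P (B \<omega>)} = (\<Sum>b\<in>{b\<in>S \<rightarrow>\<^sub>E K. P b}. prob {\<omega>\<in>G. B \<omega> = b})"
proof -
 have "{\<omega>\<in>G. P (B \<omega>)} = (\<Union>b\<in>{b\<in>S \<rightarrow>\<^sub>E K. P b}. {\<omega>\<in>G. B \<omega> = b})" using B G_space by auto
 moreover have "prob (\<Union>b\<in>{b\<in>S \<rightarrow>\<^sub>E K. P b}. {\<omega>\<in>G. B \<omega> = b}) = (\<Sum>b\<in>{b\<in>S \<rightarrow>\<^sub>E K. P b}. prob {\<omega>\<in>G. B \<omega> = b})"
  using finite_labels GB' by (intro finite_measure_finite_Union) (auto simp: disjoint_family_on_def)
 ultimately show ?thesis by simp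
qed

lemma AB_Union: "{\<omega>\<in>E\<inter>G. P (A \<omega>) (B \<omega>)} =
  (\<Union>(b,a)\<in>(SIGMA b:S \<rightarrow>\<^sub>E K. {a\<in>S \<rightarrow>\<^sub>E J. P a b}). {\<omega>\<in>E\<inter>G. A \<omega> = a \<and> B \<omega> = b})"
 using A B E_space by auto

lemma AB_event: "{\<omega>\<in>E\<inter>G. P (A \<omega>) (B \<omega>)}\<in>events"
 unfolding AB_Union using finite_labels EGAB by (intro sets.finite_UN finite_SigmaI) auto

lemma prob_AB: "prob {\<omega>\<in>E\<inter>G. P (A \<omega>) (B \<omega>)} =
 (\<Sum>b\<in>S \<rightarrow>\<^sub>E K. prob {\<omega>\<in>G. B \<omega> = b} * (\<Sum>a\<in>{a\<in>S \<rightarrow>\<^sub>E J. P a b}. prob {\<omega>\<in>E. A \<omega> = a}))"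
proof -
 have "prob {\<omega>\<in>E\<inter>G. P (A \<omega>) (B \<omega>)} =
  (\<Sum>q\<in>(SIGMA b:S \<rightarrow>\<^sub>E K. {a\<in>S \<rightarrow>\<^sub>E J. P a b}). prob (case q of (b,a) => {\<omega>\<in>E\<inter>G. A \<omega> = a \<and> B \<omega> = b}))"
  unfolding AB_Union using finite_labels EGAB
  by (intro finite_measure_finite_Union finite_SigmaI) (auto simp: disjoint_family_on_def)
 also have "\<dots> = (\<Sum>b\<in>S \<rightarrow>\<^sub>E K. \<Sum>a\<in>{a\<in>S \<rightarrow>\<^sub>E J. P a b}. prob {\<omega>\<in>E\<inter>G. A \<omega> = a \<and> B \<omega> = b})"
  using finite_labels by (subst sum.Sigma) (auto intro!: sum.cong)
 finally show ?thesis by (simp only: indep sum_distrib_left mult.commute)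
qed

text \<open>By exchangeability all row label vectors with the same counts r are equally likely
  within E. The sum is therefore the probability of having counts r, times the fraction of those
  vectors that produce N together with b; this fraction is \<open>table_ratio\<close>.\<close>

lemma prob_tables:
 assumes b: "b\<in>S \<rightarrow>\<^sub>E K" and N: "\<And>k. k\<in>K ==> (\<Sum>j\<in>J. N (j,k)) = card {i\<in>S. b i = k}"
 defines "r \<equiv> \<lambda>j\<in>J. \<Sum>k\<in>K. N (j,k)"
 shows "(\<Sum>a\<in>tables S J K b N. prob {\<omega>\<in>E. A \<omega> = a}) = table_ratio J K N*prob {\<omega>\<in>E. counts S J (A \<omega>) = r}"
proof -
 have bK: "b ` S\<subseteq>K" using b by auto
 define C where "C = {a\<in>S \<rightarrow>\<^sub>E J. counts S J a = r}"
 have sub: "tables S J K b N\<subseteq>C"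
 proof
  fix a assume a: "a\<in>tables S J K b N"
  then have aJ: "a ` S\<subseteq>J" by (auto simp: tables_def)
  have "r j = card {i\<in>S. a i = j}" if "j\<in>J" for j
  proof -
   have "r j = (\<Sum>k\<in>K. table S J K a b (j,k))" unfolding r_def
    using a that by (auto simp: tables_def table_def intro!: sum.cong)
   then show ?thesis using table_margins(2)[OF fin aJ bK that] by simp
  qed
  then show "a\<in>C" using a by (auto simp: C_def counts_def tables_def r_def)
 qed
 have cT: "card (tables S J K b N)*(\<Prod>p\<in>J\<times>K. fact (N p)) = (\<Prod>k\<in>K. fact (\<Sum>j\<in>J. N (j,k)) :: nat)"
  using card_tables[OF fin bK N] N by simp
 have "0 < (\<Prod>k\<in>K. fact (\<Sum>j\<in>J. N (j,k)) :: nat)" by (intro prod_pos) simp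
 then have "card (tables S J K b N)\<noteq>0" unfolding cT[symmetric] by simp
 then obtain a0 where a0: "a0\<in>tables S J K b N" by fastforce
 then have a0C: "a0\<in>C" using sub by auto
 have const: "prob {\<omega>\<in>E. A \<omega> = a} = prob {\<omega>\<in>E. A \<omega> = a0}" if a: "a\<in>C" for a
 proof -
  have J: "a0 ` S\<subseteq>J" "a ` S\<subseteq>J" using a a0C by (auto simp: C_def)
  have "card {i\<in>S. a0 i = j} = card {i\<in>S. a i = j}" if "j\<in>J" for j
   using a a0C that by (auto simp: C_def counts_def fun_eq_iff dest!: spec[of _ j])
  then obtain \<sigma> where \<sigma>: "\<sigma> permutes S" "\<And>i. i\<in>S ==> a i = a0 (\<sigma> i)"
   using same_counts_permutation[OF fin(1) J] by blast
  have "a = (\<lambda>i\<in>S. a0 (\<sigma> i))" using a \<sigma>(2) by (auto simp: C_def PiE_iff extensional_def fun_eq_iff)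
  then show ?thesis using exch[OF \<sigma>(1), of a0] a0C by (simp add: C_def)
 qed
 have sumN: "(\<Sum>p\<in>J\<times>K. N p) = card S"
 proof -
  have "(\<Sum>p\<in>J\<times>K. N p) = (\<Sum>k\<in>K. \<Sum>j\<in>J. N (j,k))" by (subst sum.swap) (simp add: sum.cartesian_product)
  also have "\<dots> = (\<Sum>k\<in>K. card {i\<in>S. b i = k})" using N by simp
  also have "\<dots> = card (\<Union>k\<in>K. {i\<in>S. b i = k})" using fin by (intro card_UN_disjoint[symmetric]) auto
  also have "(\<Union>k\<in>K. {i\<in>S. b i = k}) = S" using bK by auto
  finally show ?thesis .
 qed
 \<comment> \<open>Vectors with given counts are tables with a single column, so the same counting
   lemma yields the multinomial coefficient.\<close>
 have CT: "C = tables S J {()} (%_. ()) (%(j,_). \<Sum>k\<in>K. N (j,k))"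
  by (auto simp: C_def tables_def counts_def r_def fun_eq_iff)
 have cC: "card C*(\<Prod>j\<in>J. fact (\<Sum>k\<in>K. N (j,k))) = (fact (card S) :: nat)"
 proof -
  have "card C*(\<Prod>p\<in>J\<times>{()}. fact (case p of (j,_) => \<Sum>k\<in>K. N (j,k))) = (\<Prod>k\<in>{()}. fact (card {i\<in>S. () = k}) :: nat)"
   unfolding CT using sumN by (intro card_tables[OF fin(1,2)]) (auto simp: sum.cartesian_product)
  moreover have "(\<Prod>p\<in>J\<times>{()}. fact (case p of (j,_) => \<Sum>k\<in>K. N (j,k))) = (\<Prod>j\<in>J. fact (\<Sum>k\<in>K. N (j,k)) :: nat)"
   by (rule prod.reindex_bij_witness[of _ "%j. (j,())" fst]) auto
  ultimately show ?thesis by simp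
 qed
 have ratio: "real (card (tables S J K b N)) = table_ratio J K N*real (card C)"
 proof -
  have p1: "(\<Prod>p\<in>J\<times>K. fact (N p) :: real) > 0" "(\<Prod>j\<in>J. fact (\<Sum>k\<in>K. N (j,k)) :: real) > 0"
   by (auto intro!: prod_pos)
  have t: "real (card (tables S J K b N)) = (\<Prod>k\<in>K. fact (\<Sum>j\<in>J. N (j,k)))/(\<Prod>p\<in>J\<times>K. fact (N p))"
   using arg_cong[OF cT, of real] p1 by (simp add: field_simps)
  have c: "real (card C) = fact (card S)/(\<Prod>j\<in>J. fact (\<Sum>k\<in>K. N (j,k)))"
   using arg_cong[OF cC, of real] p1 by (simp add: field_simps)
  show ?thesis unfolding t c table_ratio_def sumN using p1 by (simp add: field_simps)
 qed
 have "(\<Sum>a\<in>tables S J K b N. prob {\<omega>\<in>E. A \<omega> = a}) = card (tables S J K b N)*prob {\<omega>\<in>E. A \<omega> = a0}"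
  using const sub by (subst sum.cong[OF refl, where h = "%_. prob {\<omega>\<in>E. A \<omega> = a0}"]) auto
 also have "\<dots> = table_ratio J K N*(card C*prob {\<omega>\<in>E. A \<omega> = a0})" by (simp add: ratio)
 also have "card C*prob {\<omega>\<in>E. A \<omega> = a0} = (\<Sum>a\<in>C. prob {\<omega>\<in>E. A \<omega> = a})"
  using const by (subst sum.cong[OF refl, where h = "%_. prob {\<omega>\<in>E. A \<omega> = a0}"]) auto
 also have "\<dots> = prob {\<omega>\<in>E. counts S J (A \<omega>) = r}" unfolding C_def by (rule prob_A[symmetric])
 finally show ?thesis .
qed

text \<open>Conditioning on the column labels b: the inner probability depends on b only through its
  counts, and vectors b with other counts cannot produce N at all.\<close>

lemma prob_table:
 assumes N: "N\<in>extensional (J\<times>K)"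
 shows "prob {\<omega>\<in>E\<inter>G. T \<omega> = N} =
  table_ratio J K N*prob {\<omega>\<in>E. counts S J (A \<omega>) = (\<lambda>j\<in>J. \<Sum>k\<in>K. N (j,k))} *
   prob {\<omega>\<in>G. counts S K (B \<omega>) = (\<lambda>k\<in>K. \<Sum>j\<in>J. N (j,k))}"
proof -
 let ?c = "\<lambda>k\<in>K. \<Sum>j\<in>J. N (j,k)" and ?r = "\<lambda>j\<in>J. \<Sum>k\<in>K. N (j,k)"
 have T: "{a\<in>S \<rightarrow>\<^sub>E J. table S J K a b = N} = tables S J K b N" for b
  using N by (auto simp: tables_def table_def fun_eq_iff extensional_def)
 have "(\<Sum>b\<in>S \<rightarrow>\<^sub>E K. prob {\<omega>\<in>G. B \<omega> = b} * (\<Sum>a\<in>{a\<in>S \<rightarrow>\<^sub>E J. table S J K a b = N}. prob {\<omega>\<in>E. A \<omega> = a})) =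
  (\<Sum>b\<in>{b\<in>S \<rightarrow>\<^sub>E K. counts S K b = ?c}. prob {\<omega>\<in>G. B \<omega> = b} * (\<Sum>a\<in>{a\<in>S \<rightarrow>\<^sub>E J. table S J K a b = N}. prob {\<omega>\<in>E. A \<omega> = a}))"
 proof (rule sum.mono_neutral_right)
  show "\<forall>b\<in>(S \<rightarrow>\<^sub>E K) - {b\<in>S \<rightarrow>\<^sub>E K. counts S K b = ?c}.
    prob {\<omega>\<in>G. B \<omega> = b} * (\<Sum>a\<in>{a\<in>S \<rightarrow>\<^sub>E J. table S J K a b = N}. prob {\<omega>\<in>E. A \<omega> = a}) = 0"
  proof
   fix b assume b: "b\<in>(S \<rightarrow>\<^sub>E K) - {b\<in>S \<rightarrow>\<^sub>E K. counts S K b = ?c}"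
   have "table S J K a b\<noteq>N" if "a\<in>S \<rightarrow>\<^sub>E J" for a
   proof
    assume tN: "table S J K a b = N"
    have ab: "a ` S\<subseteq>J" "b ` S\<subseteq>K" using that b by auto
    have "counts S K b = ?c"
     unfolding counts_def by (rule restrict_ext) (use table_margins(1)[OF fin ab] tN in auto)
    then show False using b by simp
   qed
   then have empty: "{a\<in>S \<rightarrow>\<^sub>E J. table S J K a b = N} = {}" by blast
   show "prob {\<omega>\<in>G. B \<omega> = b} * (\<Sum>a\<in>{a\<in>S \<rightarrow>\<^sub>E J. table S J K a b = N}. prob {\<omega>\<in>E. A \<omega> = a}) = 0" unfolding empty by simp
  qed
 qed (use finite_labels in auto)
 also have "\<dots> = (\<Sum>b\<in>{b\<in>S \<rightarrow>\<^sub>E K. counts S K b = ?c}. prob {\<omega>\<in>G. B \<omega> = b} * (table_ratio J K N*prob {\<omega>\<in>E. counts S J (A \<omega>) = ?r}))"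
 proof (rule sum.cong[OF refl])
  fix b assume b: "b\<in>{b\<in>S \<rightarrow>\<^sub>E K. counts S K b = ?c}"
  then have bK: "b\<in>S \<rightarrow>\<^sub>E K" and "counts S K b = ?c" by auto
  then have "(\<Sum>j\<in>J. N (j,k)) = card {i\<in>S. b i = k}" if "k\<in>K" for k
   using that by (auto simp: counts_def fun_eq_iff dest!: spec[of _ k])
  from prob_tables[OF bK this]
  show "prob {\<omega>\<in>G. B \<omega> = b} * (\<Sum>a\<in>{a\<in>S \<rightarrow>\<^sub>E J. table S J K a b = N}. prob {\<omega>\<in>E. A \<omega> = a}) =
    prob {\<omega>\<in>G. B \<omega> = b} * (table_ratio J K N*prob {\<omega>\<in>E. counts S J (A \<omega>) = ?r})" unfolding T by simp
 qed
 also have "\<dots> = prob {\<omega>\<in>G. counts S K (B \<omega>) = ?c} * (table_ratio J K N*prob {\<omega>\<in>E. counts S J (A \<omega>) = ?r})"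
  by (subst prob_B) (rule sum_distrib_right[symmetric])
 finally show ?thesis by (subst prob_AB[of "%a b. table S J K a b = N"]) simp
qed

text \<open>A union bound over tables: at most (n+1) to the number of cells occur, and each with
  mutual information above c has ratio at most exp (- n c) times a polynomial.\<close>

lemma upper_bound:
 defines "n \<equiv> card S"
 assumes c: "0\<le>c"
 shows "prob {\<omega>\<in>E\<inter>G. c < mutual_info J K (%p. T \<omega> p/n)}
 \<le>(real n + 1)^(card (J\<times>K) + 2*(card J + card K))*exp (- real n*c)*(prob E*prob G)"
proof -
 have n0: "n > 0" using S_ne fin by (auto simp: n_def card_gt_0_iff)
 define NN where "NN = {N\<in>J\<times>K \<rightarrow>\<^sub>E {..n}. (\<Sum>p\<in>J\<times>K. N p) = n \<and> c < mutual_info J K (%p. N p/n)}"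
 have cNN: "card NN\<le>(n + 1)^card (J\<times>K)" and fNN: "finite NN"
 proof -
  have f: "finite (J\<times>K \<rightarrow>\<^sub>E {..n})" using fin by (intro finite_PiE) auto
  then show "finite NN" unfolding NN_def by simp
  have "card NN\<le>card (J\<times>K \<rightarrow>\<^sub>E {..n})" unfolding NN_def by (rule card_mono[OF f]) auto
  also have "\<dots> = (n + 1)^card (J\<times>K)" using fin by (subst card_PiE) auto
  finally show "card NN\<le>(n + 1)^card (J\<times>K)" .
 qed
 have ev: "{\<omega>\<in>E\<inter>G. T \<omega> = N}\<in>events" for N
  by (rule AB_event[of "%a b. table S J K a b = N"])
 have "{\<omega>\<in>E\<inter>G. c < mutual_info J K (%p. T \<omega> p/n)}
   = (\<Union>N\<in>NN. {\<omega>\<in>E\<inter>G. T \<omega> = N})"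
 proof (intro equalityI subsetI)
  fix \<omega> assume w: "\<omega>\<in>{\<omega>\<in>E\<inter>G. c < mutual_info J K (%p. T \<omega> p/n)}"
  then have sp: "\<omega>\<in>space M" using E_space by auto
  have "A \<omega> ` S\<subseteq>J" "B \<omega> ` S\<subseteq>K" using A[OF sp] B[OF sp] by auto
  then have "T \<omega>\<in>NN" unfolding NN_def n_def
   using w table_bound[OF fin(1)] table_margins(3)[OF fin] by (simp add: n_def)
  then show "\<omega>\<in>(\<Union>N\<in>NN. {\<omega>\<in>E\<inter>G. T \<omega> = N})" using w by blast
 qed (auto simp: NN_def)
 then have "prob {\<omega>\<in>E\<inter>G. c < mutual_info J K (%p. T \<omega> p/n)}
  \<le>(\<Sum>N\<in>NN. prob {\<omega>\<in>E\<inter>G. T \<omega> = N})"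
  using finite_measure_subadditive_finite[OF fNN, of "%N. {\<omega>\<in>E\<inter>G. T \<omega> = N}"] ev by auto
 also have "\<dots>\<le>(\<Sum>N\<in>NN. (real n + 1)^(2*(card J + card K))*exp (- real n*c)*(prob E*prob G))"
 proof (rule sum_mono)
  fix N assume N: "N\<in>NN"
  then have Ne: "N\<in>extensional (J\<times>K)" and Ns: "(\<Sum>p\<in>J\<times>K. N p) = n" and Nc: "c < mutual_info J K (%p. N p/n)"
   by (auto simp: NN_def PiE_def)
  let ?a = "prob {\<omega>\<in>E. counts S J (A \<omega>) = (\<lambda>j\<in>J. \<Sum>k\<in>K. N (j,k))}"
  let ?b = "prob {\<omega>\<in>G. counts S K (B \<omega>) = (\<lambda>k\<in>K. \<Sum>j\<in>J. N (j,k))}"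
  have ab: "?a\<le>prob E" "?b\<le>prob G" using E G by (auto intro!: finite_measure_mono)
  have q0: "0\<le>table_ratio J K N" unfolding table_ratio_def by (auto intro!: divide_nonneg_nonneg mult_nonneg_nonneg prod_nonneg)
  have "table_ratio J K N\<le>exp (- (real n*mutual_info J K (%p. N p/n)))*(real n + 1)^(2*(card J + card K))"
   by (rule table_ratio_bounds(1)[OF fin(2,3) n0 Ns])
  also have "\<dots>\<le>exp (- real n*c)*(real n + 1)^(2*(card J + card K))"
   using Nc n0 by (intro mult_right_mono) auto
  finally have q: "table_ratio J K N\<le>(real n + 1)^(2*(card J + card K))*exp (- real n*c)" by (simp add: mult.commute)
  have "prob {\<omega>\<in>E\<inter>G. T \<omega> = N} = table_ratio J K N*(?a*?b)"
   unfolding prob_table[OF Ne] by simp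
  also have "\<dots>\<le>(real n + 1)^(2*(card J + card K))*exp (- real n*c)*(prob E*prob G)"
   by (intro mult_mono q ab) (auto intro!: mult_nonneg_nonneg)
  finally show "prob {\<omega>\<in>E\<inter>G. T \<omega> = N}\<le>(real n + 1)^(2*(card J + card K))*exp (- real n*c)*(prob E*prob G)" .
 qed
 also have "\<dots> = real (card NN)*((real n + 1)^(2*(card J + card K))*exp (- real n*c)*(prob E*prob G))" by simp
 also have "\<dots>\<le>(real n + 1)^card (J\<times>K)*((real n + 1)^(2*(card J + card K))*exp (- real n*c)*(prob E*prob G))"
 proof (rule mult_right_mono)
  have "real (card NN)\<le>real ((n + 1)^card (J\<times>K))" using cNN by (simp only: of_nat_le_iff)
  then show "real (card NN)\<le>(real n + 1)^card (J\<times>K)" by (simp del: card_cartesian_product add: add.commute)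
 qed simp
 also have "\<dots> = (real n + 1)^(card (J\<times>K) + 2*(card J + card K))*exp (- real n*c)*(prob E*prob G)"
  by (simp only: power_add mult.assoc)
 finally show ?thesis .
qed

text \<open>For every pair of margins that can occur one favourable table is selected, of ratio at
  least exp (- n h) up to a polynomial. Tables selected for different margins are different, so the
  events are disjoint and summing their probabilities restores prob E * prob G.\<close>

lemma lower_bound:
 defines "n \<equiv> card S"
 assumes good: "\<And>\<omega> \<omega>'. \<omega>\<in>E ==> \<omega>'\<in>G ==> \<exists>N\<in>NN. N\<in>extensional (J\<times>K) \<and>
   (\<lambda>j\<in>J. \<Sum>k\<in>K. N (j,k)) = counts S J (A \<omega>) \<and> (\<lambda>k\<in>K. \<Sum>j\<in>J. N (j,k)) = counts S K (B \<omega>') \<and>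
   mutual_info J K (%p. N p/n)\<le>h"
 shows "exp (- real n*h)*(prob E*prob G)\<le>(real n + 1)^(2*(1 + card (J\<times>K))) *
   prob {\<omega>\<in>E\<inter>G. T \<omega>\<in>NN}"
proof -
 have n0: "n > 0" using S_ne fin by (auto simp: n_def card_gt_0_iff)
 define RR where "RR = counts S J ` (S \<rightarrow>\<^sub>E J)"
 define CC where "CC = counts S K ` (S \<rightarrow>\<^sub>E K)"
 have fRC: "finite RR" "finite CC" using finite_labels by (auto simp: RR_def CC_def)
 define PE where "PE r = prob {\<omega>\<in>E. counts S J (A \<omega>) = r}" for r
 define PG where "PG c = prob {\<omega>\<in>G. counts S K (B \<omega>) = c}" for c
 have evA: "{\<omega>\<in>E. counts S J (A \<omega>) = r}\<in>events" for r
 proof -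
  have "{\<omega>\<in>E. counts S J (A \<omega>) = r} = (\<Union>a\<in>{a\<in>S \<rightarrow>\<^sub>E J. counts S J a = r}. {\<omega>\<in>E. A \<omega> = a})" using A E_space by auto
  then show ?thesis using finite_labels EA' by auto
 qed
 have evB: "{\<omega>\<in>G. counts S K (B \<omega>) = c}\<in>events" for c
 proof -
  have "{\<omega>\<in>G. counts S K (B \<omega>) = c} = (\<Union>b\<in>{b\<in>S \<rightarrow>\<^sub>E K. counts S K b = c}. {\<omega>\<in>G. B \<omega> = b})" using B G_space by auto
  then show ?thesis using finite_labels GB' by auto
 qed
 have "E = (\<Union>r\<in>RR. {\<omega>\<in>E. counts S J (A \<omega>) = r})" using A E_space by (auto simp: RR_def)
 moreover have "prob (\<Union>r\<in>RR. {\<omega>\<in>E. counts S J (A \<omega>) = r}) = (\<Sum>r\<in>RR. PE r)"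
  unfolding PE_def using fRC evA by (intro finite_measure_finite_Union) (auto simp: disjoint_family_on_def)
 ultimately have pE: "prob E = (\<Sum>r\<in>RR. PE r)" by simp
 have "G = (\<Union>c\<in>CC. {\<omega>\<in>G. counts S K (B \<omega>) = c})" using B G_space by (auto simp: CC_def)
 moreover have "prob (\<Union>c\<in>CC. {\<omega>\<in>G. counts S K (B \<omega>) = c}) = (\<Sum>c\<in>CC. PG c)"
  unfolding PG_def using fRC evB by (intro finite_measure_finite_Union) (auto simp: disjoint_family_on_def)
 ultimately have pG: "prob G = (\<Sum>c\<in>CC. PG c)" by simp
 \<comment> \<open>The hypothesis \<open>good\<close> offers tables only for margins realised in E
   and G; all other pairs have probability 0 and drop out of the sum.\<close>
 define Q where "Q = {(r,c)\<in>RR\<times>CC. (\<exists>\<omega>\<in>E. counts S J (A \<omega>) = r) \<and> (\<exists>\<omega>\<in>G. counts S K (B \<omega>) = c)}"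
 have fQ: "finite Q" unfolding Q_def using fRC by (auto intro: finite_subset[of _ "RR\<times>CC"])
 define ok where "ok q N \<longleftrightarrow> N\<in>NN \<and> N\<in>extensional (J\<times>K) \<and>
   (\<lambda>j\<in>J. \<Sum>k\<in>K. N (j,k)) = fst q \<and> (\<lambda>k\<in>K. \<Sum>j\<in>J. N (j,k)) = snd q \<and>
   mutual_info J K (%p. N p/n)\<le>h" for q N
 have "\<exists>N. ok q N" if q: "q\<in>Q" for q
 proof -
  obtain \<omega> \<omega>' where w: "\<omega>\<in>E" "\<omega>'\<in>G" "counts S J (A \<omega>) = fst q" "counts S K (B \<omega>') = snd q"
   using q by (auto simp: Q_def)
  show ?thesis using good[OF w(1,2)] unfolding ok_def w(3,4) by blast
 qed
 then have "\<forall>q\<in>Q. \<exists>N. ok q N" by blast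
 from bchoice[OF this] obtain N where ok: "\<And>q. q\<in>Q ==> ok q (N q)" by blast
 then have N: "\<And>q. q\<in>Q ==> N q\<in>NN" "\<And>q. q\<in>Q ==> N q\<in>extensional (J\<times>K)"
   "\<And>q. q\<in>Q ==> (\<lambda>j\<in>J. \<Sum>k\<in>K. N q (j,k)) = fst q" "\<And>q. q\<in>Q ==> (\<lambda>k\<in>K. \<Sum>j\<in>J. N q (j,k)) = snd q"
   "\<And>q. q\<in>Q ==> mutual_info J K (%p. N q p/n)\<le>h" unfolding ok_def by blast+
 \<comment> \<open>A table determines its two margins.\<close>
 have injN: "inj_on N Q" 
 proof (rule inj_onI)
  fix q q' assume q: "q\<in>Q" "q'\<in>Q" "N q = N q'"
  have "fst q = fst q'" using N(3)[OF q(1)] N(3)[OF q(2)] q(3) by simp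
  moreover have "snd q = snd q'" using N(4)[OF q(1)] N(4)[OF q(2)] q(3) by simp
  ultimately show "q = q'" by (rule prod_eqI)
 qed
 let ?P = "(real n + 1)^(2*(1 + card (J\<times>K)))"
 let ?T = "%N. prob {\<omega>\<in>E\<inter>G. T \<omega> = N}"
 have ev: "{\<omega>\<in>E\<inter>G. T \<omega> = N}\<in>events" for N
  by (rule AB_event[of "%a b. table S J K a b = N"])
 have step: "exp (- real n*h)*(PE (fst q)*PG (snd q))\<le>?P*?T (N q)" if q: "q\<in>Q" for q
 proof -
  obtain a where a: "a\<in>S \<rightarrow>\<^sub>E J" "fst q = counts S J a" using q by (auto simp: Q_def RR_def)
  have "(\<Sum>p\<in>J\<times>K. N q p) = (\<Sum>j\<in>J. \<Sum>k\<in>K. N q (j,k))" by (simp add: sum.cartesian_product)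
  also have "\<dots> = (\<Sum>j\<in>J. card {i\<in>S. a i = j})"
  proof (rule sum.cong[OF refl])
   fix j assume j: "j\<in>J"
   show "(\<Sum>k\<in>K. N q (j,k)) = card {i\<in>S. a i = j}"
    using fun_cong[OF N(3)[OF q], of j] a j by (simp add: counts_def)
  qed
  also have "\<dots> = card (\<Union>j\<in>J. {i\<in>S. a i = j})" using fin by (intro card_UN_disjoint[symmetric]) auto
  also have "(\<Union>j\<in>J. {i\<in>S. a i = j}) = S" using a by auto
  finally have s: "(\<Sum>p\<in>J\<times>K. N q p) = n" by (simp add: n_def)
  have "exp (- real n*h)\<le>exp (- (real n*mutual_info J K (%p. N q p/n)))"
   using N(5)[OF q] n0 by simp
  also have "\<dots>\<le>table_ratio J K (N q)*?P" by (rule table_ratio_bounds(2)[OF fin(2,3) n0 s])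
  finally have "exp (- real n*h)*(PE (fst q)*PG (snd q))\<le>table_ratio J K (N q)*?P*(PE (fst q)*PG (snd q))"
   by (rule mult_right_mono) (simp add: PE_def PG_def)
  also have "\<dots> = ?P*?T (N q)"
   unfolding prob_table[OF N(2)[OF q]] N(3,4)[OF q] PE_def PG_def by (simp add: ac_simps)
  finally show ?thesis .
 qed
 have "exp (- real n*h)*(prob E*prob G) = (\<Sum>(r,c)\<in>RR\<times>CC. exp (- real n*h)*(PE r*PG c))"
 proof -
  have "prob E*prob G = (\<Sum>q\<in>RR\<times>CC. PE (fst q)*PG (snd q))"
   by (simp only: pE pG sum_product sum.cartesian_product split_beta')
  then show ?thesis by (simp only: sum_distrib_left split_beta')
 qed
 also have "\<dots> = (\<Sum>(r,c)\<in>Q. exp (- real n*h)*(PE r*PG c))"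
 proof (rule sum.mono_neutral_right)
  show "\<forall>q\<in>RR\<times>CC - Q. (case q of (r,c) => exp (- real n*h)*(PE r*PG c)) = 0"
  proof
   fix q assume q: "q\<in>RR\<times>CC - Q"
   then have "{\<omega>\<in>E. counts S J (A \<omega>) = fst q} = {} \<or> {\<omega>\<in>G. counts S K (B \<omega>) = snd q} = {}"
    by (auto simp: Q_def)
   then have "PE (fst q) = 0 \<or> PG (snd q) = 0" unfolding PE_def PG_def by (elim disjE) (simp_all only: measure_empty simp_thms)
   then show "(case q of (r,c) => exp (- real n*h)*(PE r*PG c)) = 0" by (auto simp: case_prod_beta)
  qed
 qed (use fRC in \<open>auto simp: Q_def\<close>)
 also have "\<dots>\<le>(\<Sum>q\<in>Q. ?P*?T (N q))"
  unfolding split_beta' by (rule sum_mono) (rule step)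
 also have "\<dots> = ?P*(\<Sum>q\<in>Q. ?T (N q))" by (rule sum_distrib_left[symmetric])
 also have "\<dots>\<le>?P*prob {\<omega>\<in>E\<inter>G. T \<omega>\<in>NN}"
 proof (rule mult_left_mono)
  have "(\<Sum>q\<in>Q. ?T (N q)) = prob (\<Union>q\<in>Q. {\<omega>\<in>E\<inter>G. T \<omega> = N q})"
  proof (rule finite_measure_finite_Union[symmetric, OF fQ])
   show "disjoint_family_on (%q. {\<omega>\<in>E\<inter>G. T \<omega> = N q}) Q"
    unfolding disjoint_family_on_def
   proof (intro ballI impI)
    fix q q' assume "q\<in>Q" "q'\<in>Q" "q\<noteq>q'"
    then have "N q\<noteq>N q'" using inj_onD[OF injN] by blast
    then show "{\<omega>\<in>E\<inter>G. T \<omega> = N q}\<inter>{\<omega>\<in>E\<inter>G. T \<omega> = N q'} = {}" by auto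
   qed
  qed (use ev in auto)
  also have "\<dots>\<le>prob {\<omega>\<in>E\<inter>G. T \<omega>\<in>NN}"
   by (rule finite_measure_mono[OF _ AB_event[of "%a b. table S J K a b\<in>NN"]]) (use N(1) in auto)
  finally show "(\<Sum>q\<in>Q. ?T (N q))\<le>prob {\<omega>\<in>E\<inter>G. T \<omega>\<in>NN}" .
 qed simp
 finally show ?thesis .
qed

end

section \<open>Approximation of tables with given margins\<close>

lemma compact_unit_cube: "compact (PiE UNIV (%_. {0..1}) :: ('a => real) set)"
proof -
 have "compactin (product_topology (%_::'a. euclideanreal) UNIV) (PiE UNIV (%_. {0..1}))"
  by (subst compactin_PiE) auto
 then show ?thesis by (simp add: euclidean_product_topology)
qed

text \<open>Tychonoff's theorem, phrased with filters: it yields simultaneous limits of all coordinates.\<close>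

lemma cluster_point:
 fixes g :: "'i => 'a => real"
 assumes F: "F\<noteq>bot" and g: "\<And>i a. 0\<le>g i a \<and> g i a\<le>1"
 obtains F' l where "F'\<noteq>bot" "F'\<le>F" "\<And>a. ((%i. g i a) \<longlongrightarrow> l a) F'"
proof -
 have "filtermap g F\<noteq>bot" using F by (simp add: filtermap_bot_iff)
 moreover have "\<forall>\<^sub>F x in filtermap g F. x\<in>PiE UNIV (%_. {0..1})"
  using g by (simp add: eventually_filtermap PiE_iff)
 ultimately obtain l where l: "inf (nhds l) (filtermap g F)\<noteq>bot"
  using compact_unit_cube[where 'a = 'a] unfolding compact_filter by meson
 define F' where "F' = inf F (filtercomap g (nhds l))"
 have "F'\<noteq>bot"
 proof
  assume "F' = bot"
  then obtain P Q where PQ: "eventually P F" "eventually Q (filtercomap g (nhds l))" "\<And>i. P i ==> Q i ==> False"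
   unfolding F'_def trivial_limit_def eventually_inf by auto
  then obtain R where R: "eventually R (nhds l)" "\<And>i. R (g i) ==> Q i"
   unfolding eventually_filtercomap by auto
  have "eventually (%x. \<not> R x) (filtermap g F)"
   unfolding eventually_filtermap using PQ(1) by eventually_elim (use PQ(3) R(2) in blast)
  then have "inf (nhds l) (filtermap g F) = bot"
   unfolding trivial_limit_def eventually_inf using R(1) by blast
  then show False using l by simp
 qed
 moreover have "F'\<le>F" by (simp add: F'_def)
 moreover have "((%i. g i a) \<longlongrightarrow> l a) F'" for a
 proof (rule topological_tendstoI)
  fix V :: "real set" assume V: "open V" "l a\<in>V"
  have "open ((%f :: 'a => real. f a) -` V)"
   by (intro open_vimage V continuous_on_product_coordinates)
  then have "eventually (%f. f a\<in>V) (nhds l)"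
   using V(2) by (auto simp: eventually_nhds)
  then have "eventually (%i. g i a\<in>V) (filtercomap g (nhds l))"
   by (auto simp: eventually_filtercomap)
  then show "eventually (%i. g i a\<in>V) F'"
   unfolding F'_def by (rule filter_leD[rotated]) simp
 qed
 ultimately show thesis by (rule that)
qed

text \<open>Gives continuity of \<open>eta\<close> at 0, where the product rule for limits fails; it
  comes from ln u \<le> u - 1 at u = 1 / sqrt x.\<close>

lemma abs_eta_le: "0\<le>x ==> x\<le>1 ==> \<bar>eta x\<bar>\<le>2 * sqrt x"
proof (cases "x = 0")
 case False
 assume "0\<le>x" "x\<le>1"
 then have x: "0 < x" "x\<le>1" using False by auto
 have "ln (1/sqrt x)\<le>1/sqrt x - 1" using x by (intro ln_le_minus_one) auto
 then have "- ln x\<le>2/sqrt x" using x by (simp add: ln_div ln_sqrt)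
 then have "x*(- ln x)\<le>x*(2/sqrt x)" using x by (intro mult_left_mono) auto
 also have "\<dots> = 2 * sqrt x" using x by (simp add: field_simps)
 finally show ?thesis using x by (simp add: eta_def abs_mult)
qed (simp add: eta_def)

lemma tendsto_eta:
 assumes lim: "(f \<longlongrightarrow> x) F" and ev: "\<forall>\<^sub>F i in F. 0\<le>f i" and "F\<noteq>bot"
 shows "((%i. eta (f i)) \<longlongrightarrow> eta x) F"
proof -
 have "0\<le>x" by (rule tendsto_lowerbound[OF lim ev \<open>F \<noteq> bot\<close>])
 show ?thesis
 proof (cases "x = 0")
  case True
  have "\<forall>\<^sub>F i in F. f i < 1" using order_tendstoD(2)[OF lim, of 1] True by simp
  with ev have 1: "\<forall>\<^sub>F i in F. norm (eta (f i))\<le>2 * sqrt (f i)"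
   by eventually_elim (simp add: abs_eta_le)
  have "((%i. 2 * sqrt (f i)) \<longlongrightarrow> 2 * sqrt x) F"
   by (intro tendsto_intros lim)
  then have "((%i. 2 * sqrt (f i)) \<longlongrightarrow> 0) F" using True by simp
  from Lim_null_comparison[OF 1 this] show ?thesis using True by simp
 next
  case False
  then show ?thesis unfolding eta_def by (intro tendsto_intros lim)
 qed
qed

lemma tendsto_mutual_info:
 assumes lim: "\<And>p. p\<in>J\<times>K ==> ((%i. g i p) \<longlongrightarrow> t p) F"
  and nn: "\<And>p. p\<in>J\<times>K ==> \<forall>\<^sub>F i in F. 0\<le>g i p" and "finite J" "finite K" and F: "F\<noteq>bot"
 shows "((%i. mutual_info J K (g i)) \<longlongrightarrow> mutual_info J K t) F"
 unfolding mutual_info_def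
proof (intro tendsto_diff tendsto_sum tendsto_eta F)
 show "\<forall>\<^sub>F i in F. 0\<le>(\<Sum>k\<in>K. g i (j,k))" if "j\<in>J" for j
 proof -
  have "\<forall>\<^sub>F i in F. \<forall>k\<in>K. 0\<le>g i (j,k)" using that \<open>finite K\<close> nn by (auto intro!: eventually_ball_finite)
  then show ?thesis by eventually_elim (auto intro: sum_nonneg)
 qed
 show "\<forall>\<^sub>F i in F. 0\<le>(\<Sum>j\<in>J. g i (j,k))" if "k\<in>K" for k
 proof -
  have "\<forall>\<^sub>F i in F. \<forall>j\<in>J. 0\<le>g i (j,k)" using that \<open>finite J\<close> nn by (auto intro!: eventually_ball_finite)
  then show ?thesis by eventually_elim (auto intro: sum_nonneg)
 qed
qed (use lim nn in auto)

text \<open>If every radius 1/(m+1) failed, the counterexamples would converge to t entrywise and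
  contradict continuity of \<open>mutual_info\<close>.\<close>

lemma mutual_info_upper_nbhd:
 assumes fin: "finite J" "finite K" and t: "\<And>p. p\<in>J\<times>K ==> 0\<le>t p" and e: "0 < e"
 obtains d where "0 < d" "\<And>t'. (\<And>p. p\<in>J\<times>K ==> 0\<le>t' p \<and> \<bar>t' p - t p\<bar> < d) ==> mutual_info J K t' < mutual_info J K t + e"
proof (rule ccontr)
 assume neg: "\<not> thesis"
 define bad where "bad m t' \<longleftrightarrow> (\<forall>p\<in>J\<times>K. 0\<le>t' p \<and> \<bar>t' p - t p\<bar> < inverse (Suc m)) \<and> \<not> mutual_info J K t' < mutual_info J K t + e" for m :: nat and t'
 have "\<exists>t'. bad m t'" for m
 proof (rule ccontr)
  assume "\<not> (\<exists>t'. bad m t')"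
  then have thesis by (intro that[of "inverse (Suc m)"]) (auto simp: bad_def)
  then show False using neg by simp
 qed
 then obtain g where g: "\<And>m. bad m (g m)" by metis
 have "(%m. mutual_info J K (g m)) \<longlonglongrightarrow> mutual_info J K t"
 proof (rule tendsto_mutual_info[OF _ _ fin])
  fix p assume p: "p\<in>J\<times>K"
  show "\<forall>\<^sub>F m in sequentially. 0\<le>g m p" using g p by (auto simp: bad_def)
  have "(%m. g m p - t p) \<longlonglongrightarrow> 0"
   by (rule Lim_null_comparison[OF _ LIMSEQ_inverse_real_of_nat]) (use g p in \<open>force simp: bad_def intro!: always_eventually less_imp_le\<close>)
  then show "(%m. g m p) \<longlonglongrightarrow> t p" by (rule LIM_zero_cancel)
 qed simp
 from order_tendstoD(2)[OF this, of "mutual_info J K t + e"] e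
 have "\<forall>\<^sub>F m in sequentially. mutual_info J K (g m) < mutual_info J K t + e" by simp
 then obtain m where "mutual_info J K (g m) < mutual_info J K t + e" by (auto simp: eventually_sequentially)
 then show False using g[of m] by (auto simp: bad_def)
qed

text \<open>A compactness argument by contradiction. Tables of mass 1 whose margins approach a and b
  have a cluster point; its margins are exactly a and b, its mutual information is at most c', and
  it lies within e of some table of the sequence, for which it is the desired correction.\<close>

lemma table_adjust:
 assumes fin: "finite J" "finite K" and c: "c' < c''" and e: "0 < e"
 obtains d where "0 < d" "\<And>t'. [|\<And>p. p\<in>J\<times>K ==> 0\<le>t' p; (\<Sum>p\<in>J\<times>K. t' p) = 1;
   \<And>j. j\<in>J ==> \<bar>(\<Sum>k\<in>K. t' (j,k)) - a j\<bar> < d; \<And>k. k\<in>K ==> \<bar>(\<Sum>j\<in>J. t' (j,k)) - b k\<bar> < d;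
   mutual_info J K t'\<le>c'|] ==>
   \<exists>t. (\<forall>p\<in>J\<times>K. 0\<le>t p \<and> \<bar>t p - t' p\<bar> < e) \<and> (\<forall>j\<in>J. (\<Sum>k\<in>K. t (j,k)) = a j) \<and>
    (\<forall>k\<in>K. (\<Sum>j\<in>J. t (j,k)) = b k) \<and> mutual_info J K t\<le>c''"
proof (rule ccontr)
 assume neg: "\<not> thesis"
 define hyp where "hyp d t' \<longleftrightarrow> (\<forall>p\<in>J\<times>K. 0\<le>t' p) \<and> (\<Sum>p\<in>J\<times>K. t' p) = 1 \<and>
   (\<forall>j\<in>J. \<bar>(\<Sum>k\<in>K. t' (j,k)) - a j\<bar> < d) \<and> (\<forall>k\<in>K. \<bar>(\<Sum>j\<in>J. t' (j,k)) - b k\<bar> < d) \<and> mutual_info J K t'\<le>c'" for d :: real and t'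
 define con where "con t' t \<longleftrightarrow> (\<forall>p\<in>J\<times>K. 0\<le>t p \<and> \<bar>t p - t' p\<bar> < e) \<and> (\<forall>j\<in>J. (\<Sum>k\<in>K. t (j,k)) = a j) \<and>
    (\<forall>k\<in>K. (\<Sum>j\<in>J. t (j,k)) = b k) \<and> mutual_info J K t\<le>c''" for t' t
 have "\<exists>t'. hyp (inverse (Suc m)) t' \<and> \<not> (\<exists>t. con t' t)" for m
 proof (rule ccontr)
  assume n: "\<not> (\<exists>t'. hyp (inverse (Suc m)) t' \<and> \<not> (\<exists>t. con t' t))"
  have thesis
  proof (rule that[of "inverse (Suc m)"])
   fix t' assume "\<And>p. p\<in>J\<times>K ==> 0\<le>t' p" "(\<Sum>p\<in>J\<times>K. t' p) = 1"
    "\<And>j. j\<in>J ==> \<bar>(\<Sum>k\<in>K. t' (j,k)) - a j\<bar> < inverse (Suc m)"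
    "\<And>k. k\<in>K ==> \<bar>(\<Sum>j\<in>J. t' (j,k)) - b k\<bar> < inverse (Suc m)" "mutual_info J K t'\<le>c'"
   then have "hyp (inverse (Suc m)) t'" unfolding hyp_def by blast
   then have "\<exists>t. con t' t" using n by blast
   then show "\<exists>t. (\<forall>p\<in>J\<times>K. 0\<le>t p \<and> \<bar>t p - t' p\<bar> < e) \<and> (\<forall>j\<in>J. (\<Sum>k\<in>K. t (j,k)) = a j) \<and>
    (\<forall>k\<in>K. (\<Sum>j\<in>J. t (j,k)) = b k) \<and> mutual_info J K t\<le>c''" unfolding con_def .
  qed simp
  then show False using neg by simp
 qed
 then obtain g where g: "\<And>m. hyp (inverse (Suc m)) (g m)" "\<And>m t. \<not> con (g m) t" by metis
 \<comment> \<open>Entries outside the product set are arbitrary; setting them to 0 puts the whole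
   function into the cube, as \<open>cluster_point\<close> requires.\<close>
 define g' where "g' m p = (if p\<in>J\<times>K then g m p else 0)" for m p
 have g'01: "0\<le>g' m p \<and> g' m p\<le>1" for m p
 proof (cases "p\<in>J\<times>K")
  case True
  have "g m p\<le>(\<Sum>p\<in>J\<times>K. g m p)" using g(1)[of m] True fin by (intro member_le_sum) (auto simp: hyp_def)
  then show ?thesis using True g(1)[of m] by (auto simp: g'_def hyp_def)
 qed (simp add: g'_def)
 obtain F' l where F': "F'\<noteq>bot" "F'\<le>sequentially" "\<And>p. ((%m. g' m p) \<longlongrightarrow> l p) F'"
  by (rule cluster_point[where g = g', OF sequentially_bot g'01]) (rule that)
 have lim: "((%m. g m p) \<longlongrightarrow> l p) F'" if "p\<in>J\<times>K" for p
  using F'(3)[of p] that by (simp add: g'_def)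
 have inv: "((%m. inverse (real (Suc m))) \<longlongrightarrow> 0) F'"
  using LIMSEQ_inverse_real_of_nat F'(2) by (rule tendsto_mono[rotated])
 have l0: "0\<le>l p" if "p\<in>J\<times>K" for p
  by (rule tendsto_lowerbound[OF lim[OF that] _ F'(1)]) (use g(1) that in \<open>auto simp: hyp_def\<close>)
 have ma: "(\<Sum>k\<in>K. l (j,k)) = a j" if "j\<in>J" for j
 proof (rule tendsto_unique[OF F'(1)])
  show "((%m. \<Sum>k\<in>K. g m (j,k)) \<longlongrightarrow> (\<Sum>k\<in>K. l (j,k))) F'" using lim that by (intro tendsto_sum) auto
  have "((%m. (\<Sum>k\<in>K. g m (j,k)) - a j) \<longlongrightarrow> 0) F'"
   by (rule Lim_null_comparison[OF _ inv]) (use g(1) that in \<open>force simp: hyp_def intro!: always_eventually less_imp_le\<close>)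
  then show "((%m. \<Sum>k\<in>K. g m (j,k)) \<longlongrightarrow> a j) F'" by (rule LIM_zero_cancel)
 qed
 have mb: "(\<Sum>j\<in>J. l (j,k)) = b k" if "k\<in>K" for k
 proof (rule tendsto_unique[OF F'(1)])
  show "((%m. \<Sum>j\<in>J. g m (j,k)) \<longlongrightarrow> (\<Sum>j\<in>J. l (j,k))) F'" using lim that by (intro tendsto_sum) auto
  have "((%m. (\<Sum>j\<in>J. g m (j,k)) - b k) \<longlongrightarrow> 0) F'"
   by (rule Lim_null_comparison[OF _ inv]) (use g(1) that in \<open>force simp: hyp_def intro!: always_eventually less_imp_le\<close>)
  then show "((%m. \<Sum>j\<in>J. g m (j,k)) \<longlongrightarrow> b k) F'" by (rule LIM_zero_cancel)
 qed
 have "((%m. mutual_info J K (g m)) \<longlongrightarrow> mutual_info J K l) F'"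
  by (rule tendsto_mutual_info[OF lim _ fin F'(1)]) (use g(1) in \<open>auto simp: hyp_def intro!: always_eventually\<close>)
 then have "mutual_info J K l\<le>c'"
  by (rule tendsto_upperbound[OF _ _ F'(1)]) (use g(1) in \<open>auto simp: hyp_def intro!: always_eventually\<close>)
 moreover have "\<forall>\<^sub>F m in F'. \<forall>p\<in>J\<times>K. \<bar>l p - g m p\<bar> < e"
 proof (rule eventually_ball_finite)
  show "\<forall>p\<in>J\<times>K. \<forall>\<^sub>F m in F'. \<bar>l p - g m p\<bar> < e"
  proof
   fix p assume "p\<in>J\<times>K"
   from tendstoD[OF lim[OF this] e] show "\<forall>\<^sub>F m in F'. \<bar>l p - g m p\<bar> < e"
    by eventually_elim (simp add: dist_real_def abs_minus_commute)
  qed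
 qed (use fin in auto)
 then obtain m where "\<forall>p\<in>J\<times>K. \<bar>l p - g m p\<bar> < e" using F'(1) eventually_happens by blast
 ultimately have "con (g m) l" using l0 ma mb c by (auto simp: con_def)
 then show False using g(2) by blast
qed

text \<open>Induction on the total mass: as long as mass is left, some row and some column still
  have some, and a unit is placed where they cross.\<close>

lemma integer_table_exists:
 fixes R :: "'j => nat" and C :: "'k => nat"
 assumes fin: "finite J" "finite K" and eq: "(\<Sum>j\<in>J. R j) = (\<Sum>k\<in>K. C k)"
 shows "\<exists>N. (\<forall>j\<in>J. (\<Sum>k\<in>K. N (j,k)) = R j) \<and> (\<forall>k\<in>K. (\<Sum>j\<in>J. N (j,k)) = C k)"
 using eq
proof (induction "\<Sum>j\<in>J. R j" arbitrary: R C)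
 case 0
 then have "\<forall>j\<in>J. R j = 0" "\<forall>k\<in>K. C k = 0" using fin by auto
 then show ?case by (intro exI[of _ "%_. 0"]) simp
next
 case (Suc D)
 obtain j0 where j0: "j0\<in>J" "0 < R j0" using Suc.hyps(2) fin
  by (metis not_gr_zero sum.neutral Zero_not_Suc)
 obtain k0 where k0: "k0\<in>K" "0 < C k0" using Suc.hyps(2) Suc.prems fin
  by (metis not_gr_zero sum.neutral Zero_not_Suc)
 let ?R = "R(j0 := R j0 - 1)" and ?C = "C(k0 := C k0 - 1)"
 have sR: "(\<Sum>j\<in>J. R j) = Suc (\<Sum>j\<in>J. ?R j)"
 proof -
  have "(\<Sum>j\<in>J - {j0}. ?R j) = (\<Sum>j\<in>J - {j0}. R j)" by (rule sum.cong) auto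
  then show ?thesis using fin j0 by (simp add: sum.remove[of J j0])
 qed
 have sC: "(\<Sum>k\<in>K. C k) = Suc (\<Sum>k\<in>K. ?C k)"
 proof -
  have "(\<Sum>k\<in>K - {k0}. ?C k) = (\<Sum>k\<in>K - {k0}. C k)" by (rule sum.cong) auto
  then show ?thesis using fin k0 by (simp add: sum.remove[of K k0])
 qed
 obtain N where N: "\<forall>j\<in>J. (\<Sum>k\<in>K. N (j,k)) = ?R j" "\<forall>k\<in>K. (\<Sum>j\<in>J. N (j,k)) = ?C k"
 proof -
  have 1: "D = (\<Sum>j\<in>J. ?R j)" using sR Suc.hyps(2) by linarith
  have 2: "(\<Sum>j\<in>J. ?R j) = (\<Sum>k\<in>K. ?C k)" using sR sC Suc.prems by linarith
  show thesis using Suc.hyps(1)[OF 1 2] by (elim exE conjE) (rule that)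
 qed
 define N' where "N' p = N p + (if p = (j0,k0) then 1 else 0 :: nat)" for p
 have "(\<Sum>k\<in>K. N' (j,k)) = R j" if "j\<in>J" for j
 proof -
  have "(\<Sum>k\<in>K. N' (j,k)) = (\<Sum>k\<in>K. N (j,k)) + (\<Sum>k\<in>K. if k = k0 then (if j = j0 then 1 else 0) else 0)"
   unfolding N'_def sum.distrib by (intro arg_cong2[where f = "(+)"] sum.cong) auto
  then show ?thesis using N(1) that j0 k0 fin by (auto simp: sum.delta)
 qed
 moreover have "(\<Sum>j\<in>J. N' (j,k)) = C k" if "k\<in>K" for k
 proof -
  have "(\<Sum>j\<in>J. N' (j,k)) = (\<Sum>j\<in>J. N (j,k)) + (\<Sum>j\<in>J. if j = j0 then (if k = k0 then 1 else 0) else 0)"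
   unfolding N'_def sum.distrib by (intro arg_cong2[where f = "(+)"] sum.cong) auto
  then show ?thesis using N(2) that j0 k0 fin by (auto simp: sum.delta)
 qed
 ultimately show ?case by blast
qed

text \<open>Round \<open>n (1 - \<gamma>) t\<close> down, then distribute what is missing from the prescribed margins.\<close>

lemma integer_table_near:
 assumes fin: "finite J" "finite K" and t: "\<And>p. p\<in>J\<times>K ==> 0\<le>t p" and t1: "(\<Sum>p\<in>J\<times>K. t p) = 1"
  and e: "0 < e"
 obtains d n0 where "0 < d" "\<And>n r c. [|n0\<le>n; (\<Sum>j\<in>J. r j) = n; (\<Sum>k\<in>K. c k) = n;
   \<And>j. j\<in>J ==> \<bar>real (r j)/n - (\<Sum>k\<in>K. t (j,k))\<bar> < d;
   \<And>k. k\<in>K ==> \<bar>real (c k)/n - (\<Sum>j\<in>J. t (j,k))\<bar> < d|] ==>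
   \<exists>N :: 'j\<times>'k => nat. (\<forall>j\<in>J. (\<Sum>k\<in>K. N (j,k)) = r j) \<and> (\<forall>k\<in>K. (\<Sum>j\<in>J. N (j,k)) = c k) \<and>
    (\<forall>p\<in>J\<times>K. \<bar>real (N p)/n - t p\<bar> < e)"
proof -
 let ?a = "%j. \<Sum>k\<in>K. t (j,k)" and ?b = "%k. \<Sum>j\<in>J. t (j,k)"
 \<comment> \<open>The fraction of mass held back before rounding. It enters the final error twice,
   hence e/4; the bound 1/2 keeps it below 1.\<close>
 define g where "g = min (1/2) (e/4)"
 have g: "0 < g" "g < 1" "g\<le>e/4" using e by (auto simp: g_def)
 \<comment> \<open>The positive margins of t. If d is at most g times the smallest of them, the
   margins of (1 - g) t n stay below the prescribed ones; for a zero margin nothing is to be shown.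
   Inserting 1 keeps the minimum defined when P is empty.\<close>
 define P where "P = {x\<in>?a ` J\<union>?b ` K. 0 < x}"
 have fP: "finite P" using fin by (simp add: P_def)
 define d where "d = g*Min (insert 1 P)"
 have "0 < Min (insert 1 P)" using fP by (auto simp: P_def)
 then have d: "0 < d" using g by (simp add: d_def)
 have dP: "d\<le>g*x" if "x\<in>P" for x
  unfolding d_def using g fP that by (intro mult_left_mono Min_le) auto
 \<comment> \<open>From n0 on, the rounding losses, at most one unit per cell, amount to less than
   e/4 after division by n.\<close>
 obtain n0 :: nat where n0: "(2 + real (card (J\<times>K)))/(e/4) < real n0" using reals_Archimedean2 by blast
 show thesis
 proof (rule that[OF d])
  fix n :: nat and r :: "'j => nat" and c :: "'k => nat"
  assume n: "n0\<le>n" and r: "(\<Sum>j\<in>J. r j) = n" and c: "(\<Sum>k\<in>K. c k) = n"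
   and ra: "\<And>j. j\<in>J ==> \<bar>real (r j)/n - ?a j\<bar> < d" and cb: "\<And>k. k\<in>K ==> \<bar>real (c k)/n - ?b k\<bar> < d"
  have "0\<le>(2 + real (card (J\<times>K)))/(e/4)" using e by simp
  then have npos: "0 < n" using n0 n by linarith
  have nbig: "(2 + real (card (J\<times>K)))/n < e/4"
  proof -
   have "(2 + real (card (J\<times>K)))/(e/4) < real n" using n0 n by linarith
   then show ?thesis using npos e by (simp add: field_simps)
  qed
  define N0 where "N0 p = nat \<lfloor>real n*(1 - g)*t p\<rfloor>" for p
  have N0: "real (N0 p)\<le>real n*(1 - g)*t p" "real n*(1 - g)*t p < real (N0 p) + 1" if "p\<in>J\<times>K" for p
  proof -
   have "0\<le>real n*(1 - g)*t p" using t[OF that] g by (intro mult_nonneg_nonneg) auto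
   then show "real (N0 p)\<le>real n*(1 - g)*t p" "real n*(1 - g)*t p < real (N0 p) + 1"
    unfolding N0_def by (simp_all add: of_nat_nat)
  qed
  have a0: "0\<le>?a j" if "j\<in>J" for j using t that by (intro sum_nonneg) auto
  have b0: "0\<le>?b k" if "k\<in>K" for k using t that by (intro sum_nonneg) auto
  have key: "real n*(1 - g)*x\<le>real m" if "0\<le>x" "0 < x ==> x\<in>P" "\<bar>real m/n - x\<bar> < d" for x m
  proof (cases "x = 0")
   case False
   then have "d\<le>g*x" using that by (intro dP) auto
   then have "(1 - g)*x\<le>real m/n" using that(3) by (simp add: algebra_simps)
   then have "real n*((1 - g)*x)\<le>real n*(real m/n)" by (intro mult_left_mono) auto
   then show ?thesis using npos by (simp add: mult.assoc)
  qed simp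
  have rle: "(\<Sum>k\<in>K. N0 (j,k))\<le>r j" if j: "j\<in>J" for j
  proof -
   have "real (\<Sum>k\<in>K. N0 (j,k))\<le>(\<Sum>k\<in>K. real n*(1 - g)*t (j,k))"
    unfolding of_nat_sum using j by (intro sum_mono N0) auto
   also have "\<dots> = real n*(1 - g)*?a j" by (simp add: sum_distrib_left)
   also have "\<dots>\<le>real (r j)" by (rule key[OF a0[OF j] _ ra[OF j]]) (use j in \<open>auto simp: P_def\<close>)
   finally show ?thesis by (simp only: of_nat_le_iff)
  qed
  have cle: "(\<Sum>j\<in>J. N0 (j,k))\<le>c k" if k: "k\<in>K" for k
  proof -
   have "real (\<Sum>j\<in>J. N0 (j,k))\<le>(\<Sum>j\<in>J. real n*(1 - g)*t (j,k))"
    unfolding of_nat_sum using k by (intro sum_mono N0) auto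
   also have "\<dots> = real n*(1 - g)*?b k" by (simp add: sum_distrib_left)
   also have "\<dots>\<le>real (c k)" by (rule key[OF b0[OF k] _ cb[OF k]]) (use k in \<open>auto simp: P_def\<close>)
   finally show ?thesis by (simp only: of_nat_le_iff)
  qed
  define R where "R j = r j - (\<Sum>k\<in>K. N0 (j,k))" for j
  define C where "C k = c k - (\<Sum>j\<in>J. N0 (j,k))" for k
  have rR: "(\<Sum>j\<in>J. R j) = n - (\<Sum>p\<in>J\<times>K. N0 p)"
   unfolding R_def using rle r by (subst sum_subtractf_nat) (auto simp: sum.cartesian_product)
  have sw: "(\<Sum>k\<in>K. \<Sum>j\<in>J. N0 (j,k)) = (\<Sum>p\<in>J\<times>K. N0 p)"
   by (subst sum.swap) (simp add: sum.cartesian_product)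
  have cC: "(\<Sum>k\<in>K. C k) = n - (\<Sum>p\<in>J\<times>K. N0 p)"
   unfolding C_def using cle c sw by (subst sum_subtractf_nat) auto
  obtain N1 where N1: "\<And>j. j\<in>J ==> (\<Sum>k\<in>K. N1 (j,k)) = R j" "\<And>k. k\<in>K ==> (\<Sum>j\<in>J. N1 (j,k)) = C k"
   using integer_table_exists[OF fin, of R C] rR cC by auto
  have s1: "(\<Sum>p\<in>J\<times>K. N1 p) = n - (\<Sum>p\<in>J\<times>K. N0 p)"
  proof -
   have "(\<Sum>p\<in>J\<times>K. N1 p) = (\<Sum>j\<in>J. \<Sum>k\<in>K. N1 (j,k))" by (simp add: sum.cartesian_product)
   also have "\<dots> = (\<Sum>j\<in>J. R j)" using N1(1) by simp
   finally show ?thesis using rR by simp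
  qed
  have "real n*(1 - g) = (\<Sum>p\<in>J\<times>K. real n*(1 - g)*t p)" using t1 by (simp add: sum_distrib_left[symmetric])
  also have "\<dots>\<le>(\<Sum>p\<in>J\<times>K. real (N0 p) + 1)" using N0(2) by (intro sum_mono less_imp_le) auto
  also have "\<dots> = real (\<Sum>p\<in>J\<times>K. N0 p) + card (J\<times>K)" by (simp add: sum.distrib)
  finally have lo: "real n*(1 - g)\<le>real (\<Sum>p\<in>J\<times>K. N0 p) + card (J\<times>K)" .
  have N1le: "real (N1 p)\<le>real n*g + card (J\<times>K)" if p: "p\<in>J\<times>K" for p
  proof -
   have "N1 p\<le>n - (\<Sum>p\<in>J\<times>K. N0 p)" using s1 p fin member_le_sum[of p "J\<times>K" N1] by simp
   then have "real (N1 p)\<le>real (n - (\<Sum>p\<in>J\<times>K. N0 p))" by (simp only: of_nat_le_iff)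
   also have "\<dots>\<le>real n*g + card (J\<times>K)" 
   proof -
    have "0\<le>real n*g" using g by simp
    then show ?thesis using lo by (cases "(\<Sum>p\<in>J\<times>K. N0 p)\<le>n") (auto simp: of_nat_diff algebra_simps)
   qed
   finally show ?thesis .
  qed
  show "\<exists>N :: 'j\<times>'k => nat. (\<forall>j\<in>J. (\<Sum>k\<in>K. N (j,k)) = r j) \<and> (\<forall>k\<in>K. (\<Sum>j\<in>J. N (j,k)) = c k) \<and>
    (\<forall>p\<in>J\<times>K. \<bar>real (N p)/n - t p\<bar> < e)"
  proof (intro exI[of _ "%p. N0 p + N1 p"] conjI ballI)
   show "(\<Sum>k\<in>K. N0 (j,k) + N1 (j,k)) = r j" if "j\<in>J" for j
    using N1(1)[OF that] rle[OF that] by (simp add: sum.distrib R_def)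
   show "(\<Sum>j\<in>J. N0 (j,k) + N1 (j,k)) = c k" if "k\<in>K" for k
    using N1(2)[OF that] cle[OF that] by (simp add: sum.distrib C_def)
   fix p assume p: "p\<in>J\<times>K"
   have tp: "0\<le>t p" "t p\<le>1" using t[OF p] t1 member_le_sum[of p "J\<times>K" t] p t fin by auto
   have "g*t p\<le>g*1" using tp g by (intro mult_left_mono) auto
   then have ng: "real n*(g*t p)\<le>real n*g" by (intro mult_left_mono) auto
   have "\<bar>real (N0 p + N1 p) - real n*t p\<bar>\<le>real n*g + 1 + (real n*g + card (J\<times>K))"
   proof -
    have "0\<le>real n*(g*t p)" "0\<le>real n*g" using g tp by auto
    then show ?thesis using N0[OF p] N1le[OF p] ng by (simp add: algebra_simps abs_le_iff)
   qed
   then have "\<bar>real (N0 p + N1 p) - real n*t p\<bar>/n\<le>(real n*g + 1 + (real n*g + card (J\<times>K)))/n"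
    by (intro divide_right_mono) auto
   also have "\<dots> = 2*g + (1 + real (card (J\<times>K)))/n" using npos by (simp add: field_simps)
   also have "\<dots>\<le>2*(e/4) + (2 + real (card (J\<times>K)))/n" using g by (intro add_mono divide_right_mono) auto
   also have "\<dots> < e" using nbig e by linarith
   also have "\<bar>real (N0 p + N1 p) - real n*t p\<bar>/n = \<bar>(real (N0 p + N1 p) - real n*t p)/n\<bar>" by (simp add: abs_divide)
   also have "(real (N0 p + N1 p) - real n*t p)/n = real (N0 p + N1 p)/n - t p"
    using npos by (simp add: diff_divide_distrib)
   finally show "\<bar>real (N0 p + N1 p)/n - t p\<bar> < e" .
  qed
 qed
qed

section \<open>Labels whose cells have null boundary\<close>

text \<open>One grid index per function, so that a cell is an intersection of strips. Weights and
  points of any space then receive labels in the same countable type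
  \<open>int list\<close>.\<close>

definition lab :: "('a => real) list => real => real => 'a => int list" where
 "lab hs s \<eta> x = map (%h. \<lfloor>(h x - s)/\<eta>\<rfloor>) hs"

lemma lab_close:
 assumes "lab hs s \<eta> x = lab hs s \<eta> y" "h\<in>set hs" "0 < \<eta>"
 shows "\<bar>h x - h y\<bar>\<le>\<eta>"
proof -
 have "\<lfloor>(h x - s)/\<eta>\<rfloor> = \<lfloor>(h y - s)/\<eta>\<rfloor>" using assms by (auto simp: lab_def)
 then have "\<bar>(h x - s)/\<eta> - (h y - s)/\<eta>\<bar>\<le>1" by linarith
 then have "\<bar>(h x - h y)/\<eta>\<bar>\<le>1" by (simp add: diff_divide_distrib)
 then show ?thesis using assms(3) by (simp add: abs_divide)
qed

lemma finite_range_lab: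
 assumes "\<And>h. h\<in>set hs ==> bounded (range h)"
 shows "finite (range (lab hs s \<eta>))"
proof -
 have "finite (range (%x. \<lfloor>(h x - s)/\<eta>\<rfloor>))" if h: "h\<in>set hs" for h
 proof -
  obtain B where B: "\<And>x. \<bar>h x\<bar>\<le>B" using assms[OF h] by (auto simp: bounded_iff)
  have "\<bar>(h x - s)/\<eta>\<bar>\<le>(B + \<bar>s\<bar>)/\<bar>\<eta>\<bar>" for x
   unfolding abs_divide using B[of x] by (intro divide_right_mono) linarith+
  then have b: "- ((B + \<bar>s\<bar>)/\<bar>\<eta>\<bar>)\<le>(h x - s)/\<eta>" "(h x - s)/\<eta>\<le>(B + \<bar>s\<bar>)/\<bar>\<eta>\<bar>" for x
   using abs_le_iff by (fastforce simp: minus_le_iff)+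
  have "range (%x. \<lfloor>(h x - s)/\<eta>\<rfloor>)\<subseteq>{\<lfloor>- ((B + \<bar>s\<bar>)/\<bar>\<eta>\<bar>)\<rfloor> .. \<lfloor>(B + \<bar>s\<bar>)/\<bar>\<eta>\<bar>\<rfloor>}"
   using floor_mono[OF b(1)] floor_mono[OF b(2)] by auto
  then show ?thesis by (rule finite_subset) simp
 qed
 then have "finite (\<Union>h\<in>set hs. range (%x. \<lfloor>(h x - s)/\<eta>\<rfloor>))" by auto
 then have "finite {xs. set xs\<subseteq>(\<Union>h\<in>set hs. range (%x. \<lfloor>(h x - s)/\<eta>\<rfloor>)) \<and> length xs = length hs}"
  by (rule finite_lists_length_eq)
 then show ?thesis by (rule finite_subset[rotated]) (fastforce simp: lab_def)
qed

lemma lab_eq_iff: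
 assumes "0 < \<eta>"
 shows "lab hs s \<eta> x = l \<longleftrightarrow> length l = length hs \<and>
  (\<forall>i<length hs. s + \<eta>*l ! i\<le>(hs ! i) x \<and> (hs ! i) x < s + \<eta>*(l ! i + 1))"
proof -
 have "\<lfloor>(h x - s)/\<eta>\<rfloor> = k \<longleftrightarrow> s + \<eta>*k\<le>h x \<and> h x < s + \<eta>*(k + 1)" for h :: "'a => real" and k :: int
  using assms by (simp add: floor_eq_iff field_simps)
 then show ?thesis by (auto simp: lab_def list_eq_iff_nth_eq)
qed

lemma measurable_lab:
 assumes "\<And>h. h\<in>set hs ==> h\<in>borel_measurable M"
 shows "lab hs s \<eta>\<in>measurable M (count_space UNIV)"
proof -
 have "(%x. map (%h. \<lfloor>(h x - s)/\<eta>\<rfloor>) hs)\<in>measurable M (count_space UNIV)"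
  using assms
 proof (induction hs)
  case (Cons h hs)
  have [measurable]: "h\<in>borel_measurable M" "(%x. map (%h. \<lfloor>(h x - s)/\<eta>\<rfloor>) hs)\<in>measurable M (count_space UNIV)"
   using Cons by auto
  have "(%x. \<lfloor>(h x - s)/\<eta>\<rfloor> # map (%h. \<lfloor>(h x - s)/\<eta>\<rfloor>) hs)\<in>measurable M (count_space UNIV)" by measurable
  then show ?case by simp
 qed simp
 then show ?thesis by (simp add: lab_def[abs_def])
qed

text \<open>A distribution charges only countably many levels, so some grid avoids all of them.\<close>

lemma grid_offset:
 assumes "finite_measure M" and hs: "\<And>h. h\<in>set hs ==> h\<in>borel_measurable M" and "\<eta>\<noteq>0"
 obtains s :: real where "\<And>h k. h\<in>set hs ==> measure M {x\<in>space M. h x = s + \<eta>*real_of_int k} = 0"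
proof -
 interpret finite_measure M by fact
 define bad where "bad h = {r. measure (distr M borel h) {r}\<noteq>0}" for h :: "'a => real"
 have "countable (bad h)" if "h\<in>set hs" for h
 proof -
  interpret D: finite_measure "distr M borel h" by (rule finite_measure_distr) (rule hs[OF that])
  show ?thesis unfolding bad_def by (rule D.countable_support)
 qed
 then have "countable (\<Union>h\<in>set hs. \<Union>k::int. (%r. r - \<eta>*real_of_int k) ` bad h)"
  by (intro countable_UN countable_image) (auto intro: countable_finite)
 then have "(\<Union>h\<in>set hs. \<Union>k::int. (%r. r - \<eta>*real_of_int k) ` bad h)\<noteq>UNIV"
  using uncountable_UNIV_real by (intro notI) simp
 then obtain s where s: "s\<notin>(\<Union>h\<in>set hs. \<Union>k::int. (%r. r - \<eta>*real_of_int k) ` bad h)" by blast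
 have "measure M {x\<in>space M. h x = s + \<eta>*real_of_int k} = 0" if h: "h\<in>set hs" for h k
 proof -
  have "s + \<eta>*real_of_int k\<notin>bad h"
  proof
   assume "s + \<eta>*real_of_int k\<in>bad h"
   then have "s\<in>(%r. r - \<eta>*real_of_int k) ` bad h" by (auto intro!: image_eqI[where x = "s + \<eta>*real_of_int k"])
   then show False using s h by blast
  qed
  then have "measure (distr M borel h) {s + \<eta>*real_of_int k} = 0" by (simp add: bad_def)
  moreover have "measure (distr M borel h) {s + \<eta>*real_of_int k} = measure M (h -` {s + \<eta>*real_of_int k}\<inter>space M)"
   by (rule measure_distr[OF hs[OF h]]) simp
  moreover have "h -` {s + \<eta>*real_of_int k}\<inter>space M = {x\<in>space M. h x = s + \<eta>*real_of_int k}" by auto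
  ultimately show ?thesis by simp
 qed
 then show thesis by (rule that)
qed

text \<open>The portmanteau theorem for continuity sets. With strict inequalities everywhere a cell
  contains an open set O1 and its complement an open set O2, and both together carry all of \<nu>.
  The lower bounds for O1 and O2 squeeze the measure of the cell from both sides.\<close>

lemma lab_cell_tendsto:
 fixes \<mu> :: "'i => 'a::metric_space measure"
 assumes K: "K = restrict_space borel X"
  and \<mu>: "\<forall>\<^sub>F i in F. \<mu> i\<in>space (prob_algebra K)" and \<nu>: "\<nu>\<in>space (prob_algebra K)"
  and lim: "\<And>(f :: 'a => real) L. L-lipschitz_on UNIV f ==> bounded (range f) ==> ((%i. \<integral>x. f x\<partial>\<mu> i) \<longlongrightarrow> (mean \<nu> f)) F"
  and hs: "\<And>h. h\<in>set hs ==> continuous_on UNIV h" and \<eta>: "0 < \<eta>"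
  and null: "\<And>h k. h\<in>set hs ==> measure \<nu> {x\<in>space \<nu>. h x = s + \<eta>*real_of_int k} = 0"
 shows "((%i. measure (\<mu> i) (lab hs s \<eta> -` {l}\<inter>X)) \<longlongrightarrow> measure \<nu> (lab hs s \<eta> -` {l}\<inter>X)) F"
proof (cases "length l = length hs")
 case False
 then have "lab hs s \<eta> -` {l} = {}" by (auto simp: lab_def)
 then show ?thesis by simp
next
 case len: True
 define O1 where "O1 = (\<Inter>i<length hs. {x. s + \<eta>*l ! i < (hs ! i) x}\<inter>{x. (hs ! i) x < s + \<eta>*(l ! i + 1)})"
 define O2 where "O2 = (\<Union>i<length hs. {x. (hs ! i) x < s + \<eta>*l ! i}\<union>{x. s + \<eta>*(l ! i + 1) < (hs ! i) x})"
 define cell where "cell = lab hs s \<eta> -` {l}\<inter>X"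
 have c: "continuous_on UNIV (hs ! i)" if "i < length hs" for i using hs that by simp
 have o: "open O1" "open O2" unfolding O1_def O2_def
  by (intro open_INT open_UN open_Int open_Un ballI open_Collect_less continuous_on_const c; simp)+
 have hm: "hs ! i\<in>borel_measurable K" if "i < length hs" for i
  unfolding K by (intro measurable_restrict_space1 borel_measurable_continuous_onI c[OF that])
 have sX: "space K = X" by (simp add: K space_restrict_space)
 have lm: "lab hs s \<eta>\<in>measurable K (count_space UNIV)"
  by (rule measurable_lab) (use hm in \<open>auto simp: in_set_conv_nth\<close>)
 have cm: "cell\<in>sets K" using measurable_sets[OF lm, of "{l}"] by (simp add: cell_def sX)
 have om: "O1\<inter>X\<in>sets K" "O2\<inter>X\<in>sets K" 
 proof -
  have "V\<inter>X\<in>sets K" if V: "open V" for V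
   unfolding K sets_restrict_space by (rule image_eqI[where x = V]) (use borel_open[OF V] in \<open>simp_all add: Int_commute\<close>)
  then show "O1\<inter>X\<in>sets K" "O2\<inter>X\<in>sets K" using o by simp_all
 qed
 have sub: "O1\<inter>X\<subseteq>cell" "O2\<inter>X\<subseteq>X - cell"
 proof -
  show "O1\<inter>X\<subseteq>cell"
  proof
   fix x assume "x\<in>O1\<inter>X"
   then have "\<forall>i<length hs. s + \<eta>*l ! i < (hs ! i) x \<and> (hs ! i) x < s + \<eta>*(l ! i + 1)" "x\<in>X"
    unfolding O1_def by blast+
   then have "lab hs s \<eta> x = l" using len unfolding lab_eq_iff[OF \<eta>] by (simp add: less_imp_le)
   then show "x\<in>cell" using \<open>x \<in> X\<close> by (simp add: cell_def)
  qed
  show "O2\<inter>X\<subseteq>X - cell"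
  proof
   fix x assume x: "x\<in>O2\<inter>X"
   then obtain i where i: "i < length hs" "(hs ! i) x < s + \<eta>*l ! i \<or> s + \<eta>*(l ! i + 1) < (hs ! i) x"
    unfolding O2_def by blast
   then have "\<not> (s + \<eta>*l ! i\<le>(hs ! i) x \<and> (hs ! i) x < s + \<eta>*(l ! i + 1))" by linarith
   then have "lab hs s \<eta> x\<noteq>l" using i(1) unfolding lab_eq_iff[OF \<eta>] by blast
   then show "x\<in>X - cell" using x by (simp add: cell_def)
  qed
 qed
 have mono: "measure M (O1\<inter>X)\<le>measure M cell" "measure M (O2\<inter>X)\<le>1 - measure M cell"
  if M: "M\<in>space (prob_algebra K)" for M
 proof -
  note P = prob_algebraD[OF M]
  interpret prob_space M by fact
  have e: "cell\<in>events" using cm P(2) by simp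
  show "measure M (O1\<inter>X)\<le>measure M cell" by (rule finite_measure_mono[OF sub(1) e])
  have "measure M (O2\<inter>X)\<le>measure M (space M - cell)"
   by (rule finite_measure_mono) (use sub(2) P(3) sX e in auto)
  then show "measure M (O2\<inter>X)\<le>1 - measure M cell" using prob_compl[OF e] by simp
 qed
 \<comment> \<open>A point outside O1 and O2 lies on a grid level of one of the functions, and these
   levels are \<nu>-null by \<open>null\<close>.\<close>
 have ge: "1\<le>measure \<nu> (O1\<inter>X) + measure \<nu> (O2\<inter>X)"
 proof -
  note P = prob_algebraD[OF \<nu>]
  interpret prob_space \<nu> by fact
  define Z where "Z i k = {x\<in>space \<nu>. (hs ! i) x = s + \<eta>*real_of_int k}" for i k
  have hm': "hs ! i\<in>borel_measurable \<nu>" if "i < length hs" for i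
   using hm[OF that] unfolding measurable_cong_sets[OF P(2) refl] .
  have Zm: "Z i k\<in>events" if "i < length hs" for i k
   unfolding Z_def using hm'[OF that] by measurable
  have Z0: "prob (Z i k) = 0" if "i < length hs" for i k
   unfolding Z_def by (rule null) (use that in simp)
  define ZZ where "ZZ = (\<Union>i<length hs. Z i (l ! i)\<union>Z i (l ! i + 1))"
  have ZZm: "ZZ\<in>events" unfolding ZZ_def using Zm by (intro sets.finite_UN) auto
  have "prob ZZ\<le>(\<Sum>i<length hs. prob (Z i (l ! i)\<union>Z i (l ! i + 1)))"
   unfolding ZZ_def using Zm by (intro finite_measure_subadditive_finite) auto
  also have "\<dots>\<le>(\<Sum>i<length hs. 0)"
  proof (rule sum_mono)
   fix i assume "i\<in>{..<length hs}"
   then have i: "i < length hs" by simp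
   have "prob (Z i (l ! i)\<union>Z i (l ! i + 1))\<le>prob (Z i (l ! i)) + prob (Z i (l ! i + 1))"
    by (rule measure_Un_le) (rule Zm[OF i])+
   then show "prob (Z i (l ! i)\<union>Z i (l ! i + 1))\<le>0" using Z0[OF i] by simp
  qed
  finally have ZZ0: "prob ZZ = 0" by (simp add: antisym)
  have "space \<nu>\<subseteq>(O1\<inter>X)\<union>((O2\<inter>X)\<union>ZZ)"
  proof
   fix x assume x: "x\<in>space \<nu>"
   then have xX: "x\<in>X" using P(3) sX by simp
   show "x\<in>(O1\<inter>X)\<union>((O2\<inter>X)\<union>ZZ)"
   proof (rule ccontr)
    assume n: "\<not> ?thesis"
    then have "x\<notin>O1" using xX by simp
    then obtain i where i: "i < length hs" "\<not> (s + \<eta>*l ! i < (hs ! i) x \<and> (hs ! i) x < s + \<eta>*(l ! i + 1))"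
     unfolding O1_def by auto
    have "x\<notin>Z i (l ! i)" "x\<notin>Z i (l ! i + 1)" using n i by (auto simp: ZZ_def)
    then have "(hs ! i) x\<noteq>s + \<eta>*l ! i" "(hs ! i) x\<noteq>s + \<eta>*(l ! i + 1)" using x by (auto simp: Z_def)
    then have "(hs ! i) x < s + \<eta>*l ! i \<or> s + \<eta>*(l ! i + 1) < (hs ! i) x" using i(2) by linarith
    then have "x\<in>O2" unfolding O2_def using i(1) by blast
    then show False using n xX by simp
   qed
  qed
  then have "prob (space \<nu>)\<le>prob ((O1\<inter>X)\<union>((O2\<inter>X)\<union>ZZ))"
   by (rule finite_measure_mono) (use om ZZm P(2) in auto)
  also have "\<dots>\<le>prob (O1\<inter>X) + prob ((O2\<inter>X)\<union>ZZ)"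
   by (rule measure_Un_le) (use om ZZm P(2) in auto)
  also have "prob ((O2\<inter>X)\<union>ZZ)\<le>prob (O2\<inter>X) + prob ZZ"
   by (rule measure_Un_le) (use om ZZm P(2) in auto)
  finally show ?thesis using ZZ0 by (simp add: prob_space)
 qed
 show ?thesis unfolding cell_def[symmetric]
 proof (rule tendstoI)
  fix e :: real assume e: "0 < e"
  have "\<forall>\<^sub>F i in F. measure \<nu> (O1\<inter>X) - e < measure (\<mu> i) (O1\<inter>X)"
   by (rule open_measure_liminf[OF K \<mu> \<nu> lim o(1)]) (use e in auto)
  moreover have "\<forall>\<^sub>F i in F. measure \<nu> (O2\<inter>X) - e < measure (\<mu> i) (O2\<inter>X)"
   by (rule open_measure_liminf[OF K \<mu> \<nu> lim o(2)]) (use e in auto)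
  ultimately show "\<forall>\<^sub>F i in F. dist (measure (\<mu> i) cell) (measure \<nu> cell) < e"
   using \<mu>
  proof eventually_elim
   case (elim i)
   then show ?case using mono[OF elim(3)] mono[OF \<nu>] ge unfolding dist_real_def by linarith
  qed
 qed
qed

section \<open>Couplings of bounded entropy\<close>

lemma M11D:
 fixes \<rho> :: "(real\<times>'s::topological_space) measure"
 assumes "\<rho>\<in>M11"
 shows "\<rho>\<in>space (prob_algebra RS)" "prob_space \<rho>" "sets \<rho> = sets RS" "space \<rho> = {0..}\<times>UNIV"
  "(\<integral>\<^sup>+x. ennreal x\<partial>marg1 \<rho>) = 1"
proof -
 show p: "\<rho>\<in>space (prob_algebra RS)" and "(\<integral>\<^sup>+x. ennreal x\<partial>marg1 \<rho>) = 1"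
  using assms unfolding M11_def by blast+
 show "prob_space \<rho>" "sets \<rho> = sets RS" by (rule prob_algebraD[OF p])+
 show "space \<rho> = {0..}\<times>UNIV" using prob_algebraD(3)[OF p] by (simp add: space_pair_measure)
qed

lemma joint_measurable:
 fixes \<rho> :: "(real\<times>'s::topological_space) measure"
 assumes "sets \<rho> = sets RS"
 shows "fst\<in>measurable \<rho> Rplus" "snd\<in>measurable \<rho> borel" "fst\<in>borel_measurable \<rho>"
proof -
 show f: "fst\<in>measurable \<rho> Rplus" and "snd\<in>measurable \<rho> borel"
  unfolding measurable_cong_sets[OF assms refl] by measurable
 show "fst\<in>borel_measurable \<rho>" using measurable_compose[OF f measurable_Rplus_real] by simp
qed

lemma marg_prob:
 fixes \<rho> :: "(real\<times>'s::topological_space) measure"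
 assumes \<rho>: "\<rho>\<in>space (prob_algebra RS)"
 shows "marg1 \<rho>\<in>space (prob_algebra Rplus)" "marg2 \<rho>\<in>M1"
proof -
 note P = prob_algebraD[OF \<rho>]
 interpret prob_space \<rho> by fact
 note m = joint_measurable[OF P(2)]
 show "marg1 \<rho>\<in>space (prob_algebra Rplus)" "marg2 \<rho>\<in>M1"
  unfolding marg1_def marg2_def space_prob_algebra using prob_space_distr[OF m(1)] prob_space_distr[OF m(2)] by simp_all
qed

lemma marg1_M11_Rplus: "\<rho>\<in>M11 ==> marg1 \<rho>\<in>M11_Rplus"
 unfolding M11_Rplus_def by (intro CollectI conjI marg_prob(1) M11D)

lemma marg2_M1: "\<rho>\<in>M11 ==> marg2 \<rho>\<in>M1"
 by (intro marg_prob(2) M11D)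

lemma M11I:
 assumes "\<rho>\<in>space (prob_algebra RS)" "marg1 \<rho>\<in>M11_Rplus"
 shows "\<rho>\<in>M11"
 unfolding M11_def using assms(1) M11_RplusD(4)[OF assms(2)] by blast

lemma integral_marg1:
 fixes \<rho> :: "(real\<times>'s::topological_space) measure" and f :: "real => real"
 assumes \<rho>: "\<rho>\<in>space (prob_algebra RS)" and f: "f\<in>borel_measurable borel"
 shows "(mean (marg1 \<rho>) f) = (\<integral>p. f (fst p)\<partial>\<rho>)" "integrable (marg1 \<rho>) f \<longleftrightarrow> integrable \<rho> (%p. f (fst p))"
 unfolding marg1_def
 by (rule integral_distr[OF joint_measurable(1)[OF prob_algebraD(2)[OF \<rho>]] borel_measurable_Rplus[OF f]],
   rule integrable_distr_eq[OF joint_measurable(1)[OF prob_algebraD(2)[OF \<rho>]] borel_measurable_Rplus[OF f]])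

lemma integrable_fst_M11:
 assumes "\<rho>\<in>M11"
 shows "integrable \<rho> (%p. fst p)" "(mean \<rho> fst) = 1"
proof -
 note I = integral_marg1[OF M11D(1)[OF assms] measurable_ident[unfolded id_def]]
 show "integrable \<rho> (%p. fst p)" by (rule iffD1[OF I(2) M11_RplusD(6)[OF marg1_M11_Rplus[OF assms]]])
 show "(mean \<rho> fst) = 1" by (rule trans[OF I(1)[symmetric] M11_RplusD(7)[OF marg1_M11_Rplus[OF assms]]])
qed

lemma integrable_fst_mult:
 fixes h :: "'s::topological_space => real" and f :: "real => real"
 assumes \<rho>: "\<rho>\<in>M11" and h: "h\<in>borel_measurable borel" and B: "\<And>x. \<bar>h x\<bar>\<le>B"
  and f: "f\<in>borel_measurable borel" "\<And>x. 0\<le>x ==> \<bar>f x\<bar>\<le>x + C"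
 shows "integrable \<rho> (%p. f (fst p)*h (snd p))"
proof -
 note m = joint_measurable[OF M11D(3)[OF \<rho>]]
 interpret prob_space \<rho> by (rule M11D(2)[OF \<rho>])
 have m1: "(%p. f (fst p)*h (snd p))\<in>borel_measurable \<rho>"
  using measurable_compose[OF m(3) f(1)] measurable_compose[OF m(2) h] by simp
 have B0: "0\<le>B" using B[of undefined] by linarith
 have i: "integrable \<rho> (%p. (fst p + C)*B)" using integrable_fst_M11(1)[OF \<rho>] by simp
 show ?thesis
 proof (rule Bochner_Integration.integrable_bound[OF i m1], rule AE_I2)
  fix p assume "p\<in>space \<rho>"
  then have "0\<le>fst p" using M11D(4)[OF \<rho>] by auto
  then have "\<bar>f (fst p)\<bar>*\<bar>h (snd p)\<bar>\<le>(fst p + C)*B"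
   using f(2)[of "fst p"] B[of "snd p"] by (intro mult_mono) auto
  also have "\<dots>\<le>\<bar>(fst p + C)*B\<bar>" by (rule abs_ge_self)
  finally show "norm (f (fst p)*h (snd p))\<le>norm ((fst p + C)*B)" by (simp only: abs_mult real_norm_def)
 qed
qed

lemma Fmap_M1:
 fixes \<rho> :: "(real\<times>'s::topological_space) measure"
 assumes \<rho>: "\<rho>\<in>M11"
 shows "Fmap \<rho>\<in>M1"
proof -
 note m = joint_measurable[OF M11D(3)[OF \<rho>]]
 have f: "(%(w,x). ennreal w)\<in>borel_measurable \<rho>"
  using m(3) by (simp add: split_beta')
 have "emeasure (density \<rho> (%(w,x). ennreal w)) (space \<rho>) = (\<integral>\<^sup>+p. ennreal (fst p)\<partial>\<rho>)"
  using f by (subst emeasure_density) (auto simp: split_beta' intro!: nn_integral_cong)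
 also have "\<dots> = (\<integral>\<^sup>+x. ennreal x\<partial>marg1 \<rho>)"
  unfolding marg1_def by (subst nn_integral_distr[OF m(1)]) (use measurable_Rplus_real in auto)
 also have "\<dots> = 1" by (rule M11D(5)[OF \<rho>])
 finally have "prob_space (density \<rho> (%(w,x). ennreal w))" by (intro prob_spaceI) simp
 then have "prob_space (Fmap \<rho>)" unfolding Fmap_def
  by (rule prob_space.prob_space_distr) (use m(2) in simp)
 then show ?thesis unfolding space_prob_algebra Fmap_def by simp
qed

lemma integral_Fmap:
 fixes \<rho> :: "(real\<times>'s::topological_space) measure" and h :: "'s => real"
 assumes \<rho>: "\<rho>\<in>M11" and h: "h\<in>borel_measurable borel"
 shows "(mean (Fmap \<rho>) h) = (\<integral>p. fst p*h (snd p)\<partial>\<rho>)"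
proof -
 note m = joint_measurable[OF M11D(3)[OF \<rho>]]
 have "(mean (Fmap \<rho>) h) = (\<integral>p. h (snd p)\<partial>density \<rho> (%p. ennreal (fst p)))"
  unfolding Fmap_def using m(2) h by (subst integral_distr) (auto simp: split_beta')
 also have "\<dots> = (\<integral>p. fst p*h (snd p)\<partial>\<rho>)"
  using m(3) measurable_compose[OF m(2) h] M11D(4)[OF \<rho>] by (subst integral_density) (auto intro!: AE_I2)
 finally show ?thesis .
qed

text \<open>Rounding f down to multiples of d = e/4 changes its integral by at most d under every
  probability measure at once, and the rounded function takes finitely many values. Three errors of
  size e/4 remain below e.\<close>

lemma bounded_integral_setwise:
 fixes f :: "'a => real"
 assumes pr: "\<And>i. prob_space (\<rho> i)" "prob_space \<rho>0" and s: "\<And>i. sets (\<rho> i) = sets m" "sets \<rho>0 = sets m"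
  and lim: "\<And>A. A\<in>sets m ==> ((%i. measure (\<rho> i) A) \<longlongrightarrow> measure \<rho>0 A) F"
  and f: "f\<in>borel_measurable m" and B: "\<And>x. x\<in>space m ==> \<bar>f x\<bar>\<le>B"
 shows "((%i. \<integral>x. f x\<partial>\<rho> i) \<longlongrightarrow> (mean \<rho>0 f)) F"
proof (rule tendstoI)
 fix e :: real assume e: "0 < e"
 define d where "d = e/4"
 have d: "0 < d" using e by (simp add: d_def)
 define K where "K = {\<lfloor>- (B/d)\<rfloor> .. \<lfloor>B/d\<rfloor>}"
 define cell where "cell k = {x\<in>space m. \<lfloor>f x/d\<rfloor> = k}" for k :: int
 have cm: "cell k\<in>sets m" for k unfolding cell_def using f by measurable
 have approx: "\<bar>(mean P f) - (\<Sum>k\<in>K. d * of_int k*measure P (cell k))\<bar>\<le>d" if P: "prob_space P" "sets P = sets m" for P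
 proof -
  interpret prob_space P by fact
  have sp: "space P = space m" by (rule sets_eq_imp_space_eq[OF P(2)])
  have fm: "f\<in>borel_measurable P" using f unfolding measurable_cong_sets[OF P(2) refl] .
  have fi: "integrable P f" by (rule integrable_const_bound[where B = B]) (use B sp fm in auto)
  have ci: "integrable P (%x. d * of_int k*indicator (cell k) x)" for k
   using cm P(2) by (intro integrable_mult_right integrable_real_indicator) (auto simp: emeasure_eq_measure)
  have "(\<Sum>k\<in>K. d * of_int k*measure P (cell k)) = (\<integral>x. (\<Sum>k\<in>K. d * of_int k*indicator (cell k) x)\<partial>P)"
   using ci cm P(2) by (subst Bochner_Integration.integral_sum) auto
  then have "(mean P f) - (\<Sum>k\<in>K. d * of_int k*measure P (cell k)) = (\<integral>x. f x - (\<Sum>k\<in>K. d * of_int k*indicator (cell k) x)\<partial>P)"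
   using fi ci by (subst Bochner_Integration.integral_diff) auto
  also have "\<bar>\<dots>\<bar>\<le>(\<integral>x. \<bar>f x - (\<Sum>k\<in>K. d * of_int k*indicator (cell k) x)\<bar>\<partial>P)"
   by (rule integral_abs_bound)
  also have "\<dots>\<le>(\<integral>x. d\<partial>P)"
  proof (rule integral_mono)
   show "integrable P (%x. \<bar>f x - (\<Sum>k\<in>K. d * of_int k*indicator (cell k) x)\<bar>)"
    using fi ci by auto
   fix x assume x: "x\<in>space P"
   let ?k = "\<lfloor>f x/d\<rfloor>"
   have "- B\<le>f x" "f x\<le>B" using B[of x] x sp by auto
   then have "- (B/d)\<le>f x/d" "f x/d\<le>B/d" using d by (simp_all add: field_simps)
   then have k: "?k\<in>K" unfolding K_def by (simp add: floor_mono)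
   have "(\<Sum>k\<in>K. d * of_int k*indicator (cell k) x) = (\<Sum>k\<in>K. if k = ?k then d * of_int ?k else 0)"
    using x sp by (intro sum.cong) (auto simp: cell_def indicator_def)
   also have "\<dots> = d * of_int ?k" using k by (simp add: K_def)
   finally have "(\<Sum>k\<in>K. d * of_int k*indicator (cell k) x) = d * of_int ?k" .
   moreover have "d * of_int ?k\<le>f x" "f x\<le>d * of_int ?k + d"
   proof -
    have "of_int ?k\<le>f x/d" "f x/d\<le>of_int ?k + 1" by linarith+
    then have "d * of_int ?k\<le>d*(f x/d)" "d*(f x/d)\<le>d*(of_int ?k + 1)"
     using d by (intro mult_left_mono; simp)+
    then show "d * of_int ?k\<le>f x" "f x\<le>d * of_int ?k + d" using d by (simp_all add: algebra_simps)
   qed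
   ultimately show "\<bar>f x - (\<Sum>k\<in>K. d * of_int k*indicator (cell k) x)\<bar>\<le>d" by simp
  qed simp
  finally show ?thesis by (simp add: prob_space)
 qed
 have "((%i. \<Sum>k\<in>K. d * of_int k*measure (\<rho> i) (cell k)) \<longlongrightarrow> (\<Sum>k\<in>K. d * of_int k*measure \<rho>0 (cell k))) F"
  by (intro tendsto_sum tendsto_mult_left lim cm)
 from tendstoD[OF this d]
 show "\<forall>\<^sub>F i in F. dist (mean (\<rho> i) f) (mean \<rho>0 f) < e"
 proof eventually_elim
  case (elim i)
  show ?case using elim approx[OF pr(1) s(1), of i] approx[OF pr(2) s(2)] e
   unfolding dist_real_def d_def by linarith
 qed
qed

text \<open>Bounded relative entropy with respect to a fixed measure makes a family of measures uniformly
 absolutely continuous, hence the setwise limit is countably additive.\<close>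

lemma setwise_cluster_measure:
 assumes pm: "prob_space m" and pr: "\<And>i. prob_space (\<rho> i)" and s: "\<And>i. sets (\<rho> i) = sets m"
  and H: "\<And>i. rel_entropy (\<rho> i) m\<le>ennreal (c i)" and c: "\<And>i. 0\<le>c i" and lim: "(c \<longlongrightarrow> c0) F" and F: "F\<noteq>bot"
 obtains F' \<rho>0 where "F'\<noteq>bot" "F'\<le>F" "prob_space \<rho>0" "sets \<rho>0 = sets m" "rel_entropy \<rho>0 m\<le>ennreal c0"
  "\<And>A. A\<in>sets m ==> ((%i. measure (\<rho> i) A) \<longlongrightarrow> measure \<rho>0 A) F'"
proof -
 interpret m: prob_space m by fact
 have c0: "0\<le>c0" by (rule tendsto_lowerbound[OF lim _ F]) (use c in simp)
 have m01: "0\<le>measure (\<rho> i) A \<and> measure (\<rho> i) A\<le>1" for i A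
  by (simp add: prob_space.prob_le_1[OF pr])
 obtain F' l where F': "F'\<noteq>bot" "F'\<le>F" and l: "\<And>A. ((%i. measure (\<rho> i) A) \<longlongrightarrow> l A) F'"
  by (rule cluster_point[where g = "%i A. measure (\<rho> i) A", OF F m01]) (rule that)
 have lim': "(c \<longlongrightarrow> c0) F'" by (rule tendsto_mono[OF F'(2) lim])
 have l0: "0\<le>l A" for A by (rule tendsto_lowerbound[OF l _ F'(1)]) simp
 have l1: "l (space m) = 1"
 proof (rule tendsto_unique[OF F'(1) l])
  have "measure (\<rho> i) (space m) = 1" for i
   using prob_space.prob_space[OF pr[of i]] sets_eq_imp_space_eq[OF s[of i]] by simp
  then show "((%i. measure (\<rho> i) (space m)) \<longlongrightarrow> 1) F'" by simp
 qed
 have le: "l {} = 0" by (rule tendsto_unique[OF F'(1) l]) simp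
 have ladd: "l (A\<union>B) = l A + l B" if AB: "A\<in>sets m" "B\<in>sets m" "A\<inter>B = {}" for A B
 proof (rule tendsto_unique[OF F'(1) l])
  have "measure (\<rho> i) (A\<union>B) = measure (\<rho> i) A + measure (\<rho> i) B" for i
   using AB s by (intro finite_measure.finite_measure_Union prob_space.finite_measure pr) auto
  then show "((%i. measure (\<rho> i) (A\<union>B)) \<longlongrightarrow> l A + l B) F'" using tendsto_add[OF l l] by simp
 qed
 \<comment> \<open>The variational inequality for t times the indicator of A, with ln (1 + u) \<le>
   u, in the limit. Sets of small m-measure have small l-value, uniformly.\<close>
 have bound: "t*l A\<le>c0 + measure m A*(exp t - 1)" if A: "A\<in>sets m" and t: "0\<le>t" for A t
 proof -
  have "t*measure (\<rho> i) A\<le>c i + measure m A*(exp t - 1)" for i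
  proof -
   have i1: "integrable m (%x. (exp t - 1)*indicator A x)" using A by (intro integrable_mult_right integrable_real_indicator) (auto simp: m.emeasure_eq_measure)
   have "(\<integral>x. t*indicator A x\<partial>\<rho> i)\<le>c i + ln (\<integral>x. exp (t*indicator A x)\<partial>m)"
    by (rule rel_entropy_le_imp_variational[OF pm pr s H c, of _ t]) (use A t in \<open>auto simp: indicator_def\<close>)
   also have "(\<integral>x. exp (t*indicator A x)\<partial>m) = (\<integral>x. 1 + (exp t - 1)*indicator A x\<partial>m)"
    by (rule Bochner_Integration.integral_cong) (auto simp: indicator_def)
   also have "\<dots> = 1 + measure m A*(exp t - 1)"
    using i1 A by (simp add: m.prob_space)
   also have "ln \<dots>\<le>measure m A*(exp t - 1)" using t by (intro ln_add_one_self_le_self) auto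
   finally show ?thesis using A s by simp
  qed
  then have ev: "\<forall>\<^sub>F i in F'. t*measure (\<rho> i) A\<le>c i + measure m A*(exp t - 1)" by simp
  have 1: "((%i. c i + measure m A*(exp t - 1)) \<longlongrightarrow> c0 + measure m A*(exp t - 1)) F'"
   by (intro tendsto_intros lim')
  have 2: "((%i. t*measure (\<rho> i) A) \<longlongrightarrow> t*l A) F'" by (intro tendsto_intros l)
  show ?thesis by (rule tendsto_le[OF F'(1) 1 2 ev])
 qed
 define \<rho>0 where "\<rho>0 = measure_of (space m) (sets m) (%A. ennreal (l A))"
 have pos: "positive (sets m) (%A. ennreal (l A))" by (simp add: positive_def le)
 have add: "additive (sets m) (%A. ennreal (l A))"
  unfolding additive_def using ladd l0 by simp
 have "countably_additive (sets m) (%A. ennreal (l A))"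
 proof (rule sets.empty_continuous_imp_countably_additive[OF pos add])
  fix A :: "nat => 'a set" assume A: "range A\<subseteq>sets m" "decseq A" "(\<Inter>i. A i) = {}"
  have mA: "(%n. measure m (A n)) \<longlonglongrightarrow> 0"
   using m.finite_Lim_measure_decseq[OF A(1,2)] A(3) by simp
  have "(%n. l (A n)) \<longlonglongrightarrow> 0"
  proof (rule LIMSEQ_I)
   fix e :: real assume e: "0 < e"
   \<comment> \<open>Once m (A n) < exp (- t), the bound yields t l (A n) < c0 + 1, and c0 + 1 = t e
     by this choice.\<close>
   define t where "t = (c0 + 1)/e"
   have t: "0 < t" using e c0 by (simp add: t_def)
   have "\<forall>\<^sub>F n in sequentially. measure m (A n) < 1/exp t" by (rule order_tendstoD(2)[OF mA]) simp
   then obtain N where N: "\<And>n. n \<ge> N ==> measure m (A n) < 1/exp t" by (auto simp: eventually_sequentially)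
   have "norm (l (A n) - 0) < e" if "n \<ge> N" for n
   proof -
    have "measure m (A n)*(exp t - 1)\<le>measure m (A n)*exp t" by (intro mult_left_mono) auto
    also have "\<dots> < 1" using N[OF that] by (simp add: field_simps)
    finally have "t*l (A n) < c0 + 1" using bound[of "A n" t] A(1) t by (simp add: range_subsetD) 
    also have "\<dots> = t*e" using e by (simp add: t_def)
    finally show ?thesis using t l0 by simp
   qed
   then show "\<exists>N. \<forall>n\<ge>N. norm (l (A n) - 0) < e" by blast
  qed
  then show "(%n. ennreal (l (A n))) \<longlonglongrightarrow> 0" by (metis ennreal_0 tendsto_ennrealI)
 qed simp
 then have em: "emeasure \<rho>0 A = ennreal (l A)" if "A\<in>sets m" for A
  unfolding \<rho>0_def using pos that by (intro emeasure_measure_of_sigma sets.sigma_algebra_axioms)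
 have s0: "sets \<rho>0 = sets m" "space \<rho>0 = space m" by (simp_all add: \<rho>0_def)
 have p0: "prob_space \<rho>0" by (rule prob_spaceI) (simp add: s0 em l1)
 have conv: "((%i. measure (\<rho> i) A) \<longlongrightarrow> measure \<rho>0 A) F'" if "A\<in>sets m" for A
  using l[of A] em[OF that] l0 by (simp add: measure_def)
 have "rel_entropy \<rho>0 m\<le>ennreal c0"
 proof (rule variational_imp_rel_entropy_le[OF pm p0 s0(1) c0])
  fix f :: "'a => real" and B assume f: "f\<in>borel_measurable m" "\<And>x. \<bar>f x\<bar>\<le>B"
  have ev: "\<forall>\<^sub>F i in F'. (mean (\<rho> i) f)\<le>c i + ln (\<integral>x. exp (f x)\<partial>m)"
   by (intro always_eventually allI rel_entropy_le_imp_variational[OF pm pr s H c f(1), where B = B] f(2))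
  have 1: "((%i. c i + ln (\<integral>x. exp (f x)\<partial>m)) \<longlongrightarrow> c0 + ln (\<integral>x. exp (f x)\<partial>m)) F'"
   by (intro tendsto_intros lim')
  have 2: "((%i. \<integral>x. f x\<partial>\<rho> i) \<longlongrightarrow> (mean \<rho>0 f)) F'"
   by (rule bounded_integral_setwise[OF pr p0 s s0(1) conv f(1) f(2)])
  show "(mean \<rho>0 f)\<le>c0 + ln (\<integral>x. exp (f x)\<partial>m)" by (rule tendsto_le[OF F'(1) 1 2 ev])
 qed
 from that[OF F' p0 s0(1) this conv] show thesis .
qed

definition entropy_couplings :: "real measure => 's::topological_space measure => real => (real\<times>'s) measure set" where
 "entropy_couplings \<alpha> \<beta> c = {\<rho>\<in>space (prob_algebra RS).
   marg1 \<rho> = \<alpha> \<and> marg2 \<rho> = \<beta> \<and> rel_entropy \<rho> (\<alpha>\<Otimes>\<^sub>M\<beta>)\<le>ennreal c}"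

lemma entropy_couplingsD:
 assumes "\<rho>\<in>entropy_couplings \<alpha> \<beta> c"
 shows "\<rho>\<in>space (prob_algebra RS)" "marg1 \<rho> = \<alpha>" "marg2 \<rho> = \<beta>"
  "rel_entropy \<rho> (\<alpha>\<Otimes>\<^sub>M\<beta>)\<le>ennreal c"
 using assms unfolding entropy_couplings_def by blast+

lemma entropy_couplings_M11: "\<rho>\<in>entropy_couplings \<alpha> \<beta> c ==> \<alpha>\<in>M11_Rplus ==> \<rho>\<in>M11"
 by (rule M11I) (simp_all add: entropy_couplingsD)

lemma prob_product:
 assumes \<alpha>: "\<alpha>\<in>space (prob_algebra Rplus)" and \<beta>: "(\<beta> :: 's::topological_space measure)\<in>M1"
 shows "prob_space (\<alpha>\<Otimes>\<^sub>M\<beta>)" "sets (\<alpha>\<Otimes>\<^sub>M\<beta>) = sets RS" "space (\<alpha>\<Otimes>\<^sub>M\<beta>) = {0..}\<times>UNIV"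
proof -
 note a = prob_algebraD[OF \<alpha>] and b = prob_algebraD[OF \<beta>]
 interpret a: prob_space \<alpha> by fact
 interpret b: prob_space \<beta> by fact
 interpret P: pair_prob_space \<alpha> \<beta> ..
 show "prob_space (\<alpha>\<Otimes>\<^sub>M\<beta>)" by (rule P.prob_space_axioms)
 show "sets (\<alpha>\<Otimes>\<^sub>M\<beta>) = sets RS" by (rule sets_pair_measure_cong[OF a(2) b(2)])
 show "space (\<alpha>\<Otimes>\<^sub>M\<beta>) = {0..}\<times>UNIV" by (simp only: space_pair_measure a(3) b(3) space_Rplus space_borel)
qed

section \<open>Truncation of the weights and compactness of entropy-bounded couplings\<close>

lemma excess_to_zero:
 assumes \<alpha>: "\<alpha>\<in>M11_Rplus"
 shows "(%n. \<integral>w. max 0 (w - real n)\<partial>\<alpha>) \<longlonglongrightarrow> 0"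
proof -
 note a = M11_RplusD[OF \<alpha>]
 have idm: "(%w. w)\<in>borel_measurable \<alpha>" unfolding measurable_cong_sets[OF a(2) refl] by (rule measurable_Rplus_real)
 have "(%n. \<integral>w. max 0 (w - real n)\<partial>\<alpha>) \<longlonglongrightarrow> (\<integral>w. 0\<partial>\<alpha>)"
 proof (rule integral_dominated_convergence[where w = "%w. w"])
  show "(%w. max 0 (w - real n))\<in>borel_measurable \<alpha>" for n using idm by simp
  show "AE w in \<alpha>. norm (max 0 (w - real n))\<le>w" for n by (rule AE_I2) (simp add: a(3))
  show "AE w in \<alpha>. (%n. max 0 (w - real n)) \<longlonglongrightarrow> 0"
  proof (rule AE_I2)
   fix w :: real
   obtain N :: nat where "w\<le>real N" using real_arch_simple by blast
   then have "\<forall>\<^sub>F n in sequentially. max 0 (w - real n) = 0"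
    by (auto simp: eventually_sequentially intro!: exI[of _ N])
   then show "(%n. max 0 (w - real n)) \<longlonglongrightarrow> 0" by (rule tendsto_eventually)
  qed
 qed (simp_all add: a(6))
 then show ?thesis by simp
qed

text \<open>The bound sees \<rho> only through its first marginal; this makes the truncation uniform
  over all couplings of a given \<alpha> and over a Wasserstein neighbourhood of it.\<close>

lemma truncation_error:
 fixes h :: "'s::topological_space => real"
 assumes \<rho>: "\<rho>\<in>M11" and h: "h\<in>borel_measurable borel" and B: "\<And>x. \<bar>h x\<bar>\<le>B" and R: "0\<le>R"
 shows "\<bar>(\<integral>p. fst p*h (snd p)\<partial>\<rho>) - (\<integral>p. min (fst p) R*h (snd p)\<partial>\<rho>)\<bar>\<le>B*(\<integral>w. max 0 (w - R)\<partial>marg1 \<rho>)"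
proof -
 have 1: "integrable \<rho> (%p. fst p*h (snd p))"
  by (rule integrable_fst_mult[OF \<rho> h B, where f = "%x. x" and C = 0]) auto
 have 2: "integrable \<rho> (%p. min (fst p) R*h (snd p))"
  by (rule integrable_fst_mult[OF \<rho> h B, where f = "%x. min x R" and C = R]) (use R in auto)
 have "(\<integral>w. max 0 (w - R)\<partial>marg1 \<rho>) = (\<integral>p. max 0 (fst p - R)\<partial>\<rho>)"
  by (rule integral_marg1[OF M11D(1)[OF \<rho>]]) simp
 have 3: "integrable \<rho> (%p. max 0 (fst p - R)*1)"
  by (rule integrable_fst_mult[OF \<rho>, where f = "%x. max 0 (x - R)" and C = R and B = 1 and h = "%_. 1"]) (use R in auto)
 have "\<bar>(\<integral>p. fst p*h (snd p)\<partial>\<rho>) - (\<integral>p. min (fst p) R*h (snd p)\<partial>\<rho>)\<bar> = \<bar>\<integral>p. fst p*h (snd p) - min (fst p) R*h (snd p)\<partial>\<rho>\<bar>"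
  using 1 2 by simp
 also have "\<dots>\<le>(\<integral>p. \<bar>fst p*h (snd p) - min (fst p) R*h (snd p)\<bar>\<partial>\<rho>)" by (rule integral_abs_bound)
 also have "\<dots>\<le>(\<integral>p. B*max 0 (fst p - R)\<partial>\<rho>)"
 proof (rule integral_mono)
  show "integrable \<rho> (%p. \<bar>fst p*h (snd p) - min (fst p) R*h (snd p)\<bar>)" using 1 2 by auto
  show "integrable \<rho> (%p. B*max 0 (fst p - R))" using 3 by simp
  fix p :: "real\<times>'s"
  have "\<bar>fst p*h (snd p) - min (fst p) R*h (snd p)\<bar> = max 0 (fst p - R)*\<bar>h (snd p)\<bar>"
   by (auto simp: abs_mult max_def min_def simp flip: left_diff_distrib)
  also have "\<dots>\<le>max 0 (fst p - R)*B" using B by (intro mult_left_mono) auto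
  finally show "\<bar>fst p*h (snd p) - min (fst p) R*h (snd p)\<bar>\<le>B*max 0 (fst p - R)" by (simp add: mult.commute)
 qed
 also have "\<dots> = B*(\<integral>p. max 0 (fst p - R)\<partial>\<rho>)" by simp
 finally show ?thesis using integral_marg1(1)[OF M11D(1)[OF \<rho>], of "%w. max 0 (w - R)"] by simp
qed

text \<open>Common marginals mean a common reference measure, so
  \<open>setwise_cluster_measure\<close> applies, and setwise limits preserve both marginals. The
  integrals against the images under \<open>Fmap\<close> converge after truncating the weight at a
  level where the excess of \<alpha> is small.\<close>

lemma entropy_couplings_cluster:
 fixes \<beta> :: "'s::topological_space measure"
 assumes \<alpha>: "\<alpha>\<in>M11_Rplus" and \<beta>: "\<beta>\<in>M1"
  and \<rho>: "\<And>i. \<rho> i\<in>entropy_couplings \<alpha> \<beta> (c i)" and c: "\<And>i. 0\<le>c i" and lim: "(c \<longlongrightarrow> c0) F" and F: "F\<noteq>bot"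
 obtains F' \<rho>0 where "F'\<noteq>bot" "F'\<le>F" "\<rho>0\<in>entropy_couplings \<alpha> \<beta> c0"
  "\<And>h. continuous_on UNIV h ==> bounded (range h) ==> ((%i. \<integral>x. h x\<partial>Fmap (\<rho> i)) \<longlongrightarrow> (\<integral>x. (h x :: real)\<partial>Fmap \<rho>0)) F'"
proof -
 note P = prob_product[OF M11_RplusD(5)[OF \<alpha>] \<beta>]
 note r = entropy_couplingsD[OF \<rho>]
 have pr: "prob_space (\<rho> i)" and s: "sets (\<rho> i) = sets (\<alpha>\<Otimes>\<^sub>M\<beta>)" for i
  using prob_algebraD(1,2)[OF r(1)] by (simp_all only: P(2))
 obtain F' \<rho>0 where F': "F'\<noteq>bot" "F'\<le>F" and \<rho>0: "prob_space \<rho>0" "sets \<rho>0 = sets (\<alpha>\<Otimes>\<^sub>M\<beta>)" "rel_entropy \<rho>0 (\<alpha>\<Otimes>\<^sub>M\<beta>)\<le>ennreal c0"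
  and conv: "\<And>A. A\<in>sets (\<alpha>\<Otimes>\<^sub>M\<beta>) ==> ((%i. measure (\<rho> i) A) \<longlongrightarrow> measure \<rho>0 A) F'"
  by (rule setwise_cluster_measure[OF P(1) pr s r(4) c lim F]) (rule that)
 have s0: "sets \<rho>0 = sets RS" using \<rho>0(2) P(2) by simp
 have pa: "\<rho>0\<in>space (prob_algebra RS)" unfolding space_prob_algebra using \<rho>0(1) s0 by simp
 note m0 = joint_measurable[OF s0]
 note mi = joint_measurable[OF prob_algebraD(2)[OF r(1)]]
 interpret r0: prob_space \<rho>0 by fact
 have sp: "space (\<rho> i) = space \<rho>0" for i
  by (rule sets_eq_imp_space_eq) (simp only: s \<rho>0(2))
 have a0: "marg1 \<rho>0 = \<alpha>"
 proof (rule measure_eqI)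
  fix A assume "A\<in>sets (marg1 \<rho>0)"
  then have A: "A\<in>sets Rplus" by (simp add: marg1_def)
  have eqi: "measure (\<rho> i) (fst -` A\<inter>space \<rho>0) = measure \<alpha> A" for i
   using measure_distr[OF mi(1)[of i] A] r(2)[of i] by (simp add: marg1_def sp)
  have "fst -` A\<inter>space \<rho>0\<in>sets (\<alpha>\<Otimes>\<^sub>M\<beta>)" using measurable_sets[OF m0(1) A] \<rho>0(2) by simp
  from tendsto_unique[OF F'(1) conv[OF this, unfolded eqi] tendsto_const]
  have "measure \<rho>0 (fst -` A\<inter>space \<rho>0) = measure \<alpha> A" .
  then have "measure (marg1 \<rho>0) A = measure \<alpha> A" using measure_distr[OF m0(1) A] by (simp add: marg1_def)
  then show "emeasure (marg1 \<rho>0) A = emeasure \<alpha> A"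
   by (simp add: finite_measure.emeasure_eq_measure[OF prob_space.finite_measure[OF M11_RplusD(1)[OF \<alpha>]]]
     finite_measure.emeasure_eq_measure[OF prob_space.finite_measure[OF prob_algebraD(1)[OF marg_prob(1)[OF pa]]]])
 qed (simp add: marg1_def M11_RplusD(2)[OF \<alpha>])
 have b0: "marg2 \<rho>0 = \<beta>"
 proof (rule measure_eqI)
  fix A assume "A\<in>sets (marg2 \<rho>0)"
  then have A: "A\<in>sets borel" by (simp add: marg2_def)
  have eqi: "measure (\<rho> i) (snd -` A\<inter>space \<rho>0) = measure \<beta> A" for i
   using measure_distr[OF mi(2)[of i] A] r(3)[of i] by (simp add: marg2_def sp)
  have "snd -` A\<inter>space \<rho>0\<in>sets (\<alpha>\<Otimes>\<^sub>M\<beta>)" using measurable_sets[OF m0(2) A] \<rho>0(2) by simp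
  from tendsto_unique[OF F'(1) conv[OF this, unfolded eqi] tendsto_const]
  have "measure \<rho>0 (snd -` A\<inter>space \<rho>0) = measure \<beta> A" .
  then have "measure (marg2 \<rho>0) A = measure \<beta> A" using measure_distr[OF m0(2) A] by (simp add: marg2_def)
  then show "emeasure (marg2 \<rho>0) A = emeasure \<beta> A"
   by (simp add: finite_measure.emeasure_eq_measure[OF prob_space.finite_measure[OF prob_algebraD(1)[OF \<beta>]]]
     finite_measure.emeasure_eq_measure[OF prob_space.finite_measure[OF prob_algebraD(1)[OF marg_prob(2)[OF pa]]]])
 qed (simp add: marg2_def prob_algebraD(2)[OF \<beta>])
 have in0: "\<rho>0\<in>entropy_couplings \<alpha> \<beta> c0"
  unfolding entropy_couplings_def using pa a0 b0 \<rho>0(3) by blast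
 have M: "\<rho>0\<in>M11" "\<rho> i\<in>M11" for i
  by (rule entropy_couplings_M11[OF in0 \<alpha>], rule entropy_couplings_M11[OF \<rho> \<alpha>])
 have "((%i. \<integral>x. h x\<partial>Fmap (\<rho> i)) \<longlongrightarrow> (mean (Fmap \<rho>0) h)) F'"
  if ch: "continuous_on UNIV h" and bh: "bounded (range h)" for h :: "'s => real"
 proof (rule tendstoI)
  fix e :: real assume e: "0 < e"
  have hm: "h\<in>borel_measurable borel" by (rule borel_measurable_continuous_onI[OF ch])
  obtain B where B: "0 < B" "\<And>x. \<bar>h x\<bar>\<le>B" using bh unfolding bounded_pos by auto
  have "\<forall>\<^sub>F n in sequentially. (\<integral>w. max 0 (w - real n)\<partial>\<alpha>) < e/(3*B)"
   by (rule order_tendstoD(2)[OF excess_to_zero[OF \<alpha>]]) (use e B in simp)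
  then obtain R :: nat where R: "(\<integral>w. max 0 (w - real R)\<partial>\<alpha>) < e/(3*B)" by (auto simp: eventually_sequentially)
  then have R': "B*(\<integral>w. max 0 (w - real R)\<partial>\<alpha>) < e/3" using B(1) by (simp add: field_simps)
  have tr: "\<bar>(mean (Fmap \<rho>') h) - (\<integral>p. min (fst p) (real R)*h (snd p)\<partial>\<rho>')\<bar> < e/3" if "\<rho>'\<in>M11" "marg1 \<rho>' = \<alpha>" for \<rho>'
   using truncation_error[OF that(1) hm B(2), of "real R"] R' that(2) unfolding integral_Fmap[OF that(1) hm] by simp
  have "((%i. \<integral>p. min (fst p) (real R)*h (snd p)\<partial>\<rho> i) \<longlongrightarrow> (\<integral>p. min (fst p) (real R)*h (snd p)\<partial>\<rho>0)) F'"
  proof (rule bounded_integral_setwise[OF pr \<rho>0(1) s \<rho>0(2) conv])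
   have "(%p. min (fst p) (real R)*h (snd p))\<in>borel_measurable \<rho>0"
    using m0(3) measurable_compose[OF m0(2) hm] by simp
   then show "(%p. min (fst p) (real R)*h (snd p))\<in>borel_measurable (\<alpha>\<Otimes>\<^sub>M\<beta>)"
    unfolding measurable_cong_sets[OF \<rho>0(2) refl] .
   fix p assume "p\<in>space (\<alpha>\<Otimes>\<^sub>M\<beta>)"
   then have "0\<le>fst p" using P(3) by auto
   then show "\<bar>min (fst p) (real R)*h (snd p)\<bar>\<le>real R*B"
    unfolding abs_mult using B(2) by (intro mult_mono) auto
  qed
  from tendstoD[OF this, of "e/3"] e
  have "\<forall>\<^sub>F i in F'. dist (\<integral>p. min (fst p) (real R)*h (snd p)\<partial>\<rho> i) (\<integral>p. min (fst p) (real R)*h (snd p)\<partial>\<rho>0) < e/3" by simp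
  then show "\<forall>\<^sub>F i in F'. dist (mean (Fmap (\<rho> i)) h) (mean (Fmap \<rho>0) h) < e"
  proof eventually_elim
   case (elim i)
   show ?case using elim tr[OF M(2)[of i] r(2)] tr[OF M(1) a0] unfolding dist_real_def by linarith
  qed
 qed
 from that[OF F' in0 this] show thesis .
qed

text \<open>Both the entropy bound and the image may be perturbed slightly. If not, there would be
  couplings of entropy at most c0 + 1/(k+1) together with measures outside G that agree with their
  images up to 1/(k+1) on any finite set of test functions; a cluster point has entropy at most c0
  and its image would lie outside the open set G.\<close>

lemma entropy_couplings_nbhd:
 fixes \<beta> :: "'s::topological_space measure"
 assumes \<alpha>: "\<alpha>\<in>M11_Rplus" and \<beta>: "\<beta>\<in>M1" and c0: "0\<le>c0" and G: "openin weak_topology G"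
  and sub: "\<And>\<rho>. \<rho>\<in>entropy_couplings \<alpha> \<beta> c0 ==> Fmap \<rho>\<in>G"
 obtains c hs and e :: real where "c0 < c" "finite hs" "0 < e"
  "\<forall>h\<in>hs. bdd_cont (h :: 's => real)"
  "\<forall>\<rho>\<in>entropy_couplings \<alpha> \<beta> c. \<forall>\<nu>\<in>M1.
    (near hs e \<nu> (Fmap \<rho>)) --> \<nu>\<in>G"
proof (rule ccontr)
 assume neg: "\<not> thesis"
 define CB where "CB = {h :: 's => real. bdd_cont h}"
 \<comment> \<open>Discards inadmissible test functions, so that a counterexample can be chosen for
   every index and not only for admissible ones.\<close>
 define H where "H Hs = (if finite Hs then Hs\<inter>CB else {})" for Hs :: "('s => real) set"
 define u where "u k = inverse (real (Suc k))" for k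
 have u: "0 < u k" for k by (simp add: u_def)
 have ex: "\<exists>q. fst q\<in>entropy_couplings \<alpha> \<beta> (c0 + u k) \<and> snd q\<in>M1 \<and> snd q\<notin>G \<and>
   (\<forall>h\<in>H Hs. \<bar>(mean (snd q) h) - (mean (Fmap (fst q)) h)\<bar> < u k)" for Hs k
 proof (rule ccontr)
  assume n: "\<not> ?thesis"
  have thesis
  proof (rule that[of "c0 + u k" "H Hs" "u k"])
   show "c0 < c0 + u k" "0 < u k" using u by simp_all
   show "finite (H Hs)" by (simp add: H_def)
   show "\<forall>h\<in>H Hs. bdd_cont h"
    by (simp add: H_def CB_def split: if_splits)
   show "\<forall>\<rho>\<in>entropy_couplings \<alpha> \<beta> (c0 + u k). \<forall>\<nu>\<in>M1.
    (\<forall>h\<in>H Hs. \<bar>(mean \<nu> h) - (mean (Fmap \<rho>) h)\<bar> < u k) --> \<nu>\<in>G"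
   proof (intro ballI impI, rule ccontr)
    fix \<rho> \<nu> assume r: "\<rho>\<in>entropy_couplings \<alpha> \<beta> (c0 + u k)" "\<nu>\<in>M1"
     "\<forall>h\<in>H Hs. \<bar>(mean \<nu> h) - (mean (Fmap \<rho>) h)\<bar> < u k"
    assume "\<nu>\<notin>G"
    with r have "fst (\<rho>,\<nu>)\<in>entropy_couplings \<alpha> \<beta> (c0 + u k) \<and> snd (\<rho>,\<nu>)\<in>M1 \<and> snd (\<rho>,\<nu>)\<notin>G \<and>
     (\<forall>h\<in>H Hs. \<bar>(\<integral>x. h x\<partial>snd (\<rho>,\<nu>)) - (\<integral>x. h x\<partial>Fmap (fst (\<rho>,\<nu>)))\<bar> < u k)" by simp
    then show False using n by blast
   qed
  qed
  then show False using neg by simp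
 qed
 define q where "q i = (SOME q. fst q\<in>entropy_couplings \<alpha> \<beta> (c0 + u (snd i)) \<and> snd q\<in>M1 \<and> snd q\<notin>G \<and>
   (\<forall>h\<in>H (fst i). \<bar>(mean (snd q) h) - (mean (Fmap (fst q)) h)\<bar> < u (snd i)))" for i :: "('s => real) set\<times>nat"
 have q: "fst (q i)\<in>entropy_couplings \<alpha> \<beta> (c0 + u (snd i))" "snd (q i)\<in>M1" "snd (q i)\<notin>G"
  "\<And>h. h\<in>H (fst i) ==> \<bar>(\<integral>x. h x\<partial>snd (q i)) - (\<integral>x. h x\<partial>Fmap (fst (q i)))\<bar> < u (snd i)" for i
  using someI_ex[OF ex[of "snd i" "fst i"]] unfolding q_def[symmetric] by blast+
 \<comment> \<open>Indices are a growing finite set of test functions and a shrinking tolerance;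
   along the product filter both become arbitrarily good.\<close>
 define F :: "(('s => real) set\<times>nat) filter" where "F = prod_filter (finite_subsets_at_top UNIV) sequentially"
 have Fne: "F\<noteq>bot" unfolding F_def by (simp add: prod_filter_eq_bot)
 have snd_lim: "filterlim snd sequentially F" unfolding F_def by (rule filterlim_snd)
 have ulim: "((%i. u (snd i)) \<longlongrightarrow> 0) F"
  unfolding u_def by (rule filterlim_compose[OF LIMSEQ_inverse_real_of_nat snd_lim])
 then have clim: "((%i. c0 + u (snd i)) \<longlongrightarrow> c0) F" using tendsto_add[OF tendsto_const[of c0] ulim] by simp
 have c_nn: "0\<le>c0 + u (snd i)" for i :: "('s => real) set\<times>nat" using c0 u[of "snd i"] by simp
 obtain F' \<rho>0 where F': "F'\<noteq>bot" "F'\<le>F" and \<rho>0: "\<rho>0\<in>entropy_couplings \<alpha> \<beta> c0"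
  and conv: "\<And>h. continuous_on UNIV h ==> bounded (range h) ==> ((%i. \<integral>x. h x\<partial>Fmap (fst (q i))) \<longlongrightarrow> (\<integral>x. (h x :: real)\<partial>Fmap \<rho>0)) F'"
  by (rule entropy_couplings_cluster[OF \<alpha> \<beta> q(1) c_nn clim Fne]) (rule that)
 obtain hs and e :: real where hs: "finite hs" "0 < e"
  "\<forall>h\<in>hs. bdd_cont (h :: 's => real)"
  "\<forall>\<nu>'\<in>M1. (near hs e \<nu>' (Fmap \<rho>0)) --> \<nu>'\<in>G"
  by (rule weak_nhds_basic[OF G sub[OF \<rho>0]]) (rule that)
 have "\<forall>\<^sub>F i in F. hs\<subseteq>H (fst i)"
 proof -
  have "\<forall>\<^sub>F Hs in finite_subsets_at_top UNIV. hs\<subseteq>H Hs"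
   unfolding eventually_finite_subsets_at_top
   using hs(1,3) by (intro exI[of _ hs]) (auto simp: H_def CB_def)
  then show ?thesis unfolding F_def using filterlim_fst unfolding filterlim_iff by fast
 qed
 then have e1: "\<forall>\<^sub>F i in F'. hs\<subseteq>H (fst i)" using F'(2) by (rule filter_leD[rotated])
 have e2: "\<forall>\<^sub>F i in F'. u (snd i) < e/2"
  by (rule filter_leD[OF F'(2)], rule order_tendstoD(2)[OF ulim]) (use hs(2) in simp)
 have e3: "\<forall>\<^sub>F i in F'. \<forall>h\<in>hs. \<bar>(\<integral>x. h x\<partial>Fmap (fst (q i))) - (mean (Fmap \<rho>0) h)\<bar> < e/2"
 proof (rule eventually_ball_finite[OF hs(1)], rule ballI)
  fix h assume "h\<in>hs"
  then have "continuous_on UNIV h" "bounded (range h)" using hs(3) by blast+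
  from tendstoD[OF conv[OF this], of "e/2"] hs(2)
  show "\<forall>\<^sub>F i in F'. \<bar>(\<integral>x. h x\<partial>Fmap (fst (q i))) - (mean (Fmap \<rho>0) h)\<bar> < e/2"
   by (simp add: dist_real_def)
 qed
 from e1 e2 e3 have "\<forall>\<^sub>F i in F'. False"
 proof eventually_elim
  case (elim i)
  have "snd (q i)\<in>G"
  proof (rule hs(4)[rule_format, OF q(2)])
   fix h assume h: "h\<in>hs"
   have "\<bar>(\<integral>x. h x\<partial>snd (q i)) - (\<integral>x. h x\<partial>Fmap (fst (q i)))\<bar> < u (snd i)" by (rule q(4)) (use elim(1) h in blast)
   moreover have "\<bar>(\<integral>x. h x\<partial>Fmap (fst (q i))) - (mean (Fmap \<rho>0) h)\<bar> < e/2" using elim(3) h by blast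
   ultimately show "\<bar>(\<integral>x. h x\<partial>snd (q i)) - (mean (Fmap \<rho>0) h)\<bar> < e" using elim(2) by linarith
  qed
  then show False using q(3) by blast
 qed
 then show False using F'(1) by simp
qed

section \<open>Cell tables of couplings\<close>

lemma integral_labels:
 fixes f :: "'q => real"
 assumes m: "prob_space m" and L: "L\<in>measurable m (count_space UNIV)" and P: "finite P" "\<And>p. p\<in>space m ==> L p\<in>P"
  and C: "C\<in>sets m"
 shows "integrable m (%p. f (L p)*indicator C p)"
  "(\<integral>p. f (L p)*indicator C p\<partial>m) = (\<Sum>q\<in>P. f q*measure m ({p\<in>space m. L p = q}\<inter>C))"
proof -
 interpret prob_space m by fact
 have cell: "{p\<in>space m. L p = q}\<in>sets m" for q using L by measurable
 have i: "integrable m (%p. f q*indicator ({p\<in>space m. L p = q}\<inter>C) p)" for q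
  using cell C by (intro integrable_mult_right integrable_real_indicator) (auto simp: emeasure_eq_measure)
 have eq: "f (L p)*indicator C p = (\<Sum>q\<in>P. f q*indicator ({p\<in>space m. L p = q}\<inter>C) p)" if "p\<in>space m" for p
 proof -
  have "(\<Sum>q\<in>P. f q*indicator ({p\<in>space m. L p = q}\<inter>C) p) = (\<Sum>q\<in>P. if q = L p then f (L p)*indicator C p else 0)"
   using that by (intro sum.cong) (auto simp: indicator_def)
  also have "\<dots> = f (L p)*indicator C p" using P that by simp
  finally show ?thesis by simp
 qed
 have isum: "integrable m (%p. \<Sum>q\<in>P. f q*indicator ({p\<in>space m. L p = q}\<inter>C) p)"
  by (rule Bochner_Integration.integrable_sum) (rule i)
 show "integrable m (%p. f (L p)*indicator C p)"
  by (rule iffD2[OF Bochner_Integration.integrable_cong[OF refl eq] isum])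
 have "(\<integral>p. f (L p)*indicator C p\<partial>m) = (\<integral>p. (\<Sum>q\<in>P. f q*indicator ({p\<in>space m. L p = q}\<inter>C) p)\<partial>m)"
  by (rule Bochner_Integration.integral_cong[OF refl eq])
 also have "\<dots> = (\<Sum>q\<in>P. \<integral>p. f q*indicator ({p\<in>space m. L p = q}\<inter>C) p\<partial>m)"
  by (rule Bochner_Integration.integral_sum) (rule i)
 also have "\<dots> = (\<Sum>q\<in>P. f q*measure m ({p\<in>space m. L p = q}\<inter>C))"
 proof (rule sum.cong[OF refl])
  fix q
  have "{p\<in>space m. L p = q}\<inter>C\<inter>space m = {p\<in>space m. L p = q}\<inter>C" by auto
  then show "(\<integral>p. f q*indicator ({p\<in>space m. L p = q}\<inter>C) p\<partial>m) = f q*measure m ({p\<in>space m. L p = q}\<inter>C)" by simp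
 qed
 finally show "(\<integral>p. f (L p)*indicator C p\<partial>m) = (\<Sum>q\<in>P. f q*measure m ({p\<in>space m. L p = q}\<inter>C))" .
qed

lemma integral_labels':
 fixes f :: "'q => real"
 assumes m: "prob_space m" and L: "L\<in>measurable m (count_space UNIV)" and P: "finite P" "\<And>p. p\<in>space m ==> L p\<in>P"
 shows "integrable m (%p. f (L p))" "(\<integral>p. f (L p)\<partial>m) = (\<Sum>q\<in>P. f q*measure m {p\<in>space m. L p = q})"
proof -
 note I = integral_labels[OF m L P sets.top, of f]
 have eq: "f (L p)*indicator (space m) p = f (L p)" if "p\<in>space m" for p using that by simp
 show "integrable m (%p. f (L p))" by (rule iffD1[OF Bochner_Integration.integrable_cong[OF refl eq] I(1)])
 have "{p\<in>space m. L p = q}\<inter>space m = {p\<in>space m. L p = q}" for q by auto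
 with I(2) show "(\<integral>p. f (L p)\<partial>m) = (\<Sum>q\<in>P. f q*measure m {p\<in>space m. L p = q})"
  by (simp cong: Bochner_Integration.integral_cong)
qed

definition tab :: "(real => 'j) => ('s => 'k) => (real\<times>'s) measure => 'j\<times>'k => real" where
 "tab lw lx \<rho> q = measure \<rho> {p\<in>space \<rho>. (lw (fst p),lx (snd p)) = q}"

text \<open>Computes a marginal of the density t / (a b) that is constant on product cells: summing
  a row of t gives back the mass of its cell. Cells of mass 0 cause no harm, since t vanishes there
  and division by 0 gives 0.\<close>

lemma (in prob_space) sum_over_cells:
 fixes t :: "'j => 'k => real"
 assumes fin: "finite J" "finite K" and c: "\<And>j. j\<in>J ==> c j\<in>events" "disjoint_family_on c J" "(\<Union>j\<in>J. c j) = space M"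
  and t: "\<And>j. j\<in>J ==> (\<Sum>k\<in>K. t j k) = prob (c j)" "\<And>j k. j\<in>J ==> k\<in>K ==> b k = 0 ==> t j k = 0"
  and A: "A\<in>events"
 shows "(\<Sum>j\<in>J. \<Sum>k\<in>K. t j k/(prob (c j)*b k)*(prob (c j\<inter>A)*b k)) = prob A"
proof -
 have "(\<Sum>k\<in>K. t j k/(prob (c j)*b k)*(prob (c j\<inter>A)*b k)) = prob (c j\<inter>A)" if j: "j\<in>J" for j
 proof -
  have "(\<Sum>k\<in>K. t j k/(prob (c j)*b k)*(prob (c j\<inter>A)*b k)) = (\<Sum>k\<in>K. t j k*(prob (c j\<inter>A)/prob (c j)))"
   using t(2)[OF j] by (intro sum.cong) auto
  also have "\<dots> = prob (c j)*(prob (c j\<inter>A)/prob (c j))" by (simp only: sum_distrib_right[symmetric] t(1)[OF j])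
  also have "\<dots> = prob (c j\<inter>A)"
   using finite_measure_mono[of "c j\<inter>A" "c j"] c(1)[OF j] by (cases "prob (c j) = 0") (auto simp: measure_le_0_iff)
  finally show ?thesis .
 qed
 then have "(\<Sum>j\<in>J. \<Sum>k\<in>K. t j k/(prob (c j)*b k)*(prob (c j\<inter>A)*b k)) = (\<Sum>j\<in>J. prob (c j\<inter>A))" by simp
 also have "\<dots> = prob (\<Union>j\<in>J. c j\<inter>A)"
  using fin c A by (intro finite_measure_finite_Union[symmetric]) (auto simp: disjoint_family_on_def)
 also have "(\<Union>j\<in>J. c j\<inter>A) = A" using c(3) sets.sets_into_space[OF A] by blast
 finally show ?thesis .
qed

text \<open>Countable label types make the pair of labels measurable for the discrete
  \<sigma>-algebra. \<open>rng\<close> is imposed on the whole type \<open>real\<close>, so that no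
  case distinction on the sign of a weight arises.\<close>

locale cells =
 fixes lw :: "real => 'j::countable" and lx :: "'s::topological_space => 'k::countable" and J :: "'j set" and K :: "'k set"
 assumes lw: "lw\<in>measurable Rplus (count_space UNIV)" and lx: "lx\<in>measurable borel (count_space UNIV)"
  and fin: "finite J" "finite K" and rng: "\<And>w. lw w\<in>J" "\<And>x. lx x\<in>K"
begin

definition cw :: "'j => real set" where "cw j = {w\<in>{0..}. lw w = j}"
definition cx :: "'k => 's set" where "cx k = {x. lx x = k}"

lemma cw_sets: "cw j\<in>sets Rplus" and cx_sets: "cx k\<in>sets borel"
proof -
 have "cw j = lw -` {j}\<inter>space Rplus" by (auto simp: cw_def)
 then show "cw j\<in>sets Rplus" using measurable_sets[OF lw, of "{j}"] by simp
 have "cx k = lx -` {k}\<inter>space borel" by (auto simp: cx_def)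
 then show "cx k\<in>sets borel" using measurable_sets[OF lx, of "{k}"] by simp
qed

lemma label_measurable:
 assumes s: "sets \<rho> = sets RS"
 shows "(%p. (lw (fst p),lx (snd p)))\<in>measurable \<rho> (count_space UNIV)"
proof -
 note m = joint_measurable[OF s]
 have "(%p. lw (fst p))\<in>measurable \<rho> (count_space UNIV)" "(%p. lx (snd p))\<in>measurable \<rho> (count_space UNIV)"
  by (rule measurable_compose[OF m(1) lw], rule measurable_compose[OF m(2) lx])
 then have "(%p. (lw (fst p),lx (snd p)))\<in>measurable \<rho> (count_space UNIV\<Otimes>\<^sub>Mcount_space UNIV)" by (rule measurable_Pair)
 then show ?thesis by (simp add: pair_measure_countable)
qed

lemma tab_nonneg: "0\<le>tab lw lx \<rho> q" by (simp add: tab_def)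

lemma cell_times:
 assumes "space \<rho> = {0..}\<times>UNIV"
 shows "{p\<in>space \<rho>. (lw (fst p),lx (snd p)) = (j,k)} = cw j\<times>cx k"
 using assms by (auto simp: cw_def cx_def)

lemma tab_margins:
 assumes \<rho>: "\<rho>\<in>space (prob_algebra RS)"
 shows "(\<Sum>k\<in>K. tab lw lx \<rho> (j,k)) = measure (marg1 \<rho>) (cw j)"
  "(\<Sum>j\<in>J. tab lw lx \<rho> (j,k)) = measure (marg2 \<rho>) (cx k)"
  "(\<Sum>q\<in>J\<times>K. tab lw lx \<rho> q) = 1"
proof -
 note P = prob_algebraD[OF \<rho>]
 interpret prob_space \<rho> by fact
 note m = joint_measurable[OF P(2)]
 have sp: "space \<rho> = {0..}\<times>UNIV" using P(3) by (simp add: space_pair_measure)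
 have ev: "{p\<in>space \<rho>. (lw (fst p),lx (snd p)) = q}\<in>events" for q
  using measurable_sets[OF label_measurable[OF P(2)], of "{q}"] by (simp add: vimage_def Int_def conj_commute)
 have "(\<Sum>k\<in>K. tab lw lx \<rho> (j,k)) = measure \<rho> (\<Union>k\<in>K. {p\<in>space \<rho>. (lw (fst p),lx (snd p)) = (j,k)})"
  unfolding tab_def using fin ev by (intro finite_measure_finite_Union[symmetric]) (auto simp: disjoint_family_on_def)
 also have "(\<Union>k\<in>K. {p\<in>space \<rho>. (lw (fst p),lx (snd p)) = (j,k)}) = fst -` cw j\<inter>space \<rho>"
  using rng sp by (auto simp: cw_def)
 finally show "(\<Sum>k\<in>K. tab lw lx \<rho> (j,k)) = measure (marg1 \<rho>) (cw j)"
  unfolding marg1_def by (subst measure_distr[OF m(1) cw_sets])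
 have "(\<Sum>j\<in>J. tab lw lx \<rho> (j,k)) = measure \<rho> (\<Union>j\<in>J. {p\<in>space \<rho>. (lw (fst p),lx (snd p)) = (j,k)})"
  unfolding tab_def using fin ev by (intro finite_measure_finite_Union[symmetric]) (auto simp: disjoint_family_on_def)
 also have "(\<Union>j\<in>J. {p\<in>space \<rho>. (lw (fst p),lx (snd p)) = (j,k)}) = snd -` cx k\<inter>space \<rho>"
  using rng sp by (auto simp: cx_def)
 finally show "(\<Sum>j\<in>J. tab lw lx \<rho> (j,k)) = measure (marg2 \<rho>) (cx k)"
  unfolding marg2_def by (subst measure_distr[OF m(2) cx_sets])
 have "(\<Sum>q\<in>J\<times>K. tab lw lx \<rho> q) = measure \<rho> (\<Union>q\<in>J\<times>K. {p\<in>space \<rho>. (lw (fst p),lx (snd p)) = q})"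
  unfolding tab_def using fin ev by (intro finite_measure_finite_Union[symmetric]) (auto simp: disjoint_family_on_def)
 also have "(\<Union>q\<in>J\<times>K. {p\<in>space \<rho>. (lw (fst p),lx (snd p)) = q}) = space \<rho>"
  using rng by auto
 finally show "(\<Sum>q\<in>J\<times>K. tab lw lx \<rho> q) = 1" by (simp add: prob_space)
qed

lemma product_cell:
 assumes \<alpha>: "\<alpha>\<in>space (prob_algebra Rplus)" and \<beta>: "\<beta>\<in>M1" and A: "A\<in>sets Rplus" and B: "B\<in>sets borel"
 shows "measure (\<alpha>\<Otimes>\<^sub>M\<beta>) (A\<times>B) = measure \<alpha> A*measure \<beta> B"
proof -
 note a = prob_algebraD[OF \<alpha>] and b = prob_algebraD[OF \<beta>]
 interpret a: prob_space \<alpha> by fact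
 interpret b: prob_space \<beta> by fact
 interpret P: pair_prob_space \<alpha> \<beta> ..
 have "emeasure (\<alpha>\<Otimes>\<^sub>M\<beta>) (A\<times>B) = emeasure \<alpha> A*emeasure \<beta> B"
  by (rule b.emeasure_pair_measure_Times) (simp_all add: a(2) b(2) A B)
 then show ?thesis by (simp add: measure_def enn2real_mult)
qed

text \<open>The data processing inequality, read off the variational formula with the cellwise
  log-density ln (t / (a b)) as test function. It would be -\<infinity> on empty cells; a large
  negative constant replaces it there, at an arbitrarily small price.\<close>

lemma mutual_info_tab_le:
 assumes \<rho>: "\<rho>\<in>space (prob_algebra RS)"
  and H: "rel_entropy \<rho> (marg1 \<rho>\<Otimes>\<^sub>Mmarg2 \<rho>)\<le>ennreal c" and c: "0\<le>c"
 shows "mutual_info J K (tab lw lx \<rho>)\<le>c"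
proof (rule field_le_epsilon)
 fix e :: real assume e: "0 < e"
 \<comment> \<open>Then exp (- T) = e: empty cells contribute at most e to the exponential integral,
   and ln (1 + e) \<le> e is the final loss.\<close>
 define T where "T = - ln e"
 note P = prob_algebraD[OF \<rho>] and mp = marg_prob[OF \<rho>]
 note Q = prob_product[OF mp]
 let ?m = "marg1 \<rho>\<Otimes>\<^sub>Mmarg2 \<rho>"
 let ?L = "%p. (lw (fst p),lx (snd p))"
 have s: "sets \<rho> = sets ?m" using P(2) Q(2) by simp
 define a where "a j = measure (marg1 \<rho>) (cw j)" for j
 define b where "b k = measure (marg2 \<rho>) (cx k)" for k
 let ?t = "tab lw lx \<rho>"
 have a: "(\<Sum>k\<in>K. ?t (j,k)) = a j" and b: "(\<Sum>j\<in>J. ?t (j,k)) = b k" for j k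
  unfolding a_def b_def by (rule tab_margins[OF \<rho>])+
 have a0: "0\<le>a j" and b0: "0\<le>b k" for j k by (simp_all add: a_def b_def)
 have ta: "?t (j,k)\<le>a j" if "k\<in>K" for j k
  unfolding a[symmetric] using that fin tab_nonneg member_le_sum[of k K "%k. ?t (j,k)"] by simp
 have tb: "?t (j,k)\<le>b k" if "j\<in>J" for j k
  unfolding b[symmetric] using that fin tab_nonneg member_le_sum[of j J "%j. ?t (j,k)"] by simp
 define f where "f q = (if 0 < ?t q then ln (?t q/(a (fst q)*b (snd q))) else - T)" for q
 have Lm: "?L\<in>measurable ?m (count_space UNIV)" by (rule label_measurable[OF Q(2)])
 have LP: "finite (J\<times>K)" "\<And>p. p\<in>space ?m ==> ?L p\<in>J\<times>K" "\<And>p. p\<in>space \<rho> ==> ?L p\<in>J\<times>K"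
  using fin rng by auto
 have fm: "(%p. f (?L p))\<in>borel_measurable ?m" by (rule measurable_compose[OF Lm]) simp
 have fB: "\<bar>f (?L p)\<bar>\<le>(\<Sum>q\<in>J\<times>K. \<bar>f q\<bar>)" if "p\<in>space ?m" for p
  using LP(1) LP(2)[OF that] by (intro member_le_sum) auto
 have pos: "0 < a j \<and> 0 < b k" if "0 < ?t (j,k)" "j\<in>J" "k\<in>K" for j k
  using ta[OF that(3)] tb[OF that(2)] that(1) by (meson less_le_trans)
 have "(\<integral>p. f (?L p)\<partial>\<rho>)\<le>c + ln (\<integral>p. exp (f (?L p))\<partial>?m)"
  by (rule rel_entropy_le_imp_variational[OF Q(1) P(1) s H c fm fB])
 moreover have "(\<integral>p. f (?L p)\<partial>\<rho>) = mutual_info J K ?t"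
 proof -
  have "(\<integral>p. f (?L p)\<partial>\<rho>) = (\<Sum>q\<in>J\<times>K. f q*?t q)"
   unfolding tab_def by (rule integral_labels'(2)[OF P(1) label_measurable[OF P(2)] LP(1,3)])
  also have "\<dots> = (\<Sum>q\<in>J\<times>K. eta (?t q) - ?t q*ln (a (fst q)) - ?t q*ln (b (snd q)))"
  proof (rule sum.cong[OF refl])
   fix q assume q: "q\<in>J\<times>K"
   show "f q*?t q = eta (?t q) - ?t q*ln (a (fst q)) - ?t q*ln (b (snd q))"
   proof (cases "0 < ?t q")
    case True
    then have "0 < a (fst q) \<and> 0 < b (snd q)" using pos[of "fst q" "snd q"] q by auto
    then show ?thesis using True by (simp add: f_def eta_def ln_div ln_mult algebra_simps)
   next
    case False
    then have "?t q = 0" using tab_nonneg[of \<rho> q] by simp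
    then show ?thesis by simp
   qed
  qed
  also have "\<dots> = (\<Sum>q\<in>J\<times>K. eta (?t q)) - (\<Sum>j\<in>J. \<Sum>k\<in>K. ?t (j,k)*ln (a j)) - (\<Sum>j\<in>J. \<Sum>k\<in>K. ?t (j,k)*ln (b k))"
   by (simp add: sum_subtractf sum.cartesian_product split_beta')
  also have "(\<Sum>j\<in>J. \<Sum>k\<in>K. ?t (j,k)*ln (b k)) = (\<Sum>k\<in>K. \<Sum>j\<in>J. ?t (j,k)*ln (b k))" by (rule sum.swap)
  finally show ?thesis by (simp add: mutual_info_def a b eta_def flip: sum_distrib_right)
 qed
 moreover have "(\<integral>p. exp (f (?L p))\<partial>?m)\<le>1 + e"
 proof -
  have "(\<integral>p. exp (f (?L p))\<partial>?m) = (\<Sum>q\<in>J\<times>K. exp (f q)*measure ?m {p\<in>space ?m. ?L p = q})"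
   by (rule integral_labels'(2)[OF Q(1) Lm LP(1,2)])
  also have "\<dots>\<le>(\<Sum>q\<in>J\<times>K. ?t q + e*(a (fst q)*b (snd q)))"
  proof (rule sum_mono)
   fix q assume q: "q\<in>J\<times>K"
   obtain j k where jk: "q = (j,k)" "j\<in>J" "k\<in>K" using q by auto
   have "measure ?m {p\<in>space ?m. ?L p = q} = a j*b k"
    unfolding jk(1) cell_times[OF Q(3)] a_def b_def by (rule product_cell[OF mp cw_sets cx_sets])
   moreover have "exp (f q)*(a j*b k)\<le>?t q + e*(a j*b k)"
   proof (cases "0 < ?t q")
    case True
    then have "0 < a j \<and> 0 < b k" using pos jk by simp
    then show ?thesis using True e by (simp add: f_def jk(1))
   next
    case False
    then show ?thesis using e tab_nonneg[of \<rho> q] by (simp add: f_def T_def)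
   qed
   ultimately show "exp (f q)*measure ?m {p\<in>space ?m. ?L p = q}\<le>?t q + e*(a (fst q)*b (snd q))"
    by (simp add: jk(1))
  qed
  also have "\<dots> = 1 + e*(\<Sum>q\<in>J\<times>K. a (fst q)*b (snd q))"
   by (simp only: sum.distrib tab_margins(3)[OF \<rho>] sum_distrib_left)
  also have "(\<Sum>q\<in>J\<times>K. a (fst q)*b (snd q)) = (\<Sum>j\<in>J. a j)*(\<Sum>k\<in>K. b k)"
   by (simp only: sum_product sum.cartesian_product split_beta')
  also have "(\<Sum>j\<in>J. a j) = 1"
   unfolding a[symmetric] using tab_margins(3)[OF \<rho>] by (simp add: sum.cartesian_product)
  also have "(\<Sum>k\<in>K. b k) = 1"
   unfolding b[symmetric] using tab_margins(3)[OF \<rho>] by (subst sum.swap) (simp add: sum.cartesian_product)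
  finally show ?thesis by simp
 qed
 moreover have "0 < (\<integral>p. exp (f (?L p))\<partial>?m)"
 proof -
  interpret m: prob_space ?m by (rule Q(1))
  have "(\<integral>p. exp (- (\<Sum>q\<in>J\<times>K. \<bar>f q\<bar>))\<partial>?m)\<le>(\<integral>p. exp (f (?L p))\<partial>?m)"
  proof (rule integral_mono)
   show "integrable ?m (%p. exp (f (?L p)))" by (rule integral_labels'(1)[OF Q(1) Lm LP(1,2), of "%q. exp (f q)"])
   show "exp (- (\<Sum>q\<in>J\<times>K. \<bar>f q\<bar>))\<le>exp (f (?L p))" if "p\<in>space ?m" for p
    using fB[OF that] by (simp add: abs_le_iff)
  qed simp
  then show ?thesis by (simp add: m.prob_space) (meson exp_gt_zero less_le_trans)
 qed
 ultimately have "mutual_info J K ?t\<le>c + ln (1 + e)"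
  by (smt (verit) ln_mono)
 also have "ln (1 + e)\<le>e" using e by (intro ln_add_one_self_le_self) simp
 finally show "mutual_info J K ?t\<le>c + e" by simp
qed

text \<open>A table with the margins of \<open>\<alpha>\<close> and \<open>\<beta>\<close> is realised by a density that is constant on cells;
 its relative entropy is the mutual information of the table.\<close>

lemma step_coupling:
 fixes \<beta> :: "'s measure"
 assumes \<alpha>: "\<alpha>\<in>space (prob_algebra Rplus)" and \<beta>: "\<beta>\<in>M1"
  and t: "\<And>q. q\<in>J\<times>K ==> 0\<le>t q"
  and ta: "\<And>j. j\<in>J ==> (\<Sum>k\<in>K. t (j,k)) = measure \<alpha> (cw j)"
  and tb: "\<And>k. k\<in>K ==> (\<Sum>j\<in>J. t (j,k)) = measure \<beta> (cx k)"
 obtains \<rho> where "\<rho>\<in>entropy_couplings \<alpha> \<beta> (mutual_info J K t)" "\<And>q. q\<in>J\<times>K ==> tab lw lx \<rho> q = t q"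
proof -
 define m where "m = \<alpha>\<Otimes>\<^sub>M\<beta>"
 note Q = prob_product[OF \<alpha> \<beta>, folded m_def]
 interpret m: prob_space m by (rule Q(1))
 let ?L = "%p. (lw (fst p),lx (snd p))"
 define a where "a j = measure \<alpha> (cw j)" for j
 define b where "b k = measure \<beta> (cx k)" for k
 have a0: "0\<le>a j" and b0: "0\<le>b k" for j k by (simp_all add: a_def b_def)
 have t_a: "t (j,k)\<le>a j" if "j\<in>J" "k\<in>K" for j k
  unfolding a_def ta[OF that(1), symmetric] using that fin t member_le_sum[of k K "%k. t (j,k)"] by simp
 have t_b: "t (j,k)\<le>b k" if "j\<in>J" "k\<in>K" for j k
  unfolding b_def tb[OF that(2), symmetric] using that fin t member_le_sum[of j J "%j. t (j,k)"] by simp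
 \<comment> \<open>Where a or b vanishes the quotient is 0 by convention, which is the right value
   because t is dominated by both margins and vanishes too.\<close>
 define d where "d q = t q/(a (fst q)*b (snd q))" for q
 define g where "g p = (if p\<in>space m then d (?L p) else 0)" for p
 have Lm: "?L\<in>measurable m (count_space UNIV)" by (rule label_measurable[OF Q(2)])
 have LP: "finite (J\<times>K)" "\<And>p. p\<in>space m ==> ?L p\<in>J\<times>K" using fin rng by auto
 have "(%p. d (?L p))\<in>borel_measurable m" by (rule measurable_compose[OF Lm]) simp
 then have gm: "g\<in>borel_measurable m" unfolding g_def by (rule measurable_If) auto
 have d0: "0\<le>d q" if "q\<in>J\<times>K" for q unfolding d_def using t[OF that] a0 b0 by simp
 have g0: "0\<le>g p" for p unfolding g_def using d0 rng by simp
 define \<rho> where "\<rho> = density m (%p. ennreal (g p))"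
 have s\<rho>: "sets \<rho> = sets RS" "space \<rho> = {0..}\<times>UNIV"
  using Q(2,3) by (simp_all add: \<rho>_def)
 have em: "emeasure \<rho> C = ennreal (\<Sum>q\<in>J\<times>K. d q*measure m ({p\<in>space m. ?L p = q}\<inter>C))" if C: "C\<in>sets m" for C
 proof -
  have i: "integrable m (%p. d (?L p)*indicator C p)" by (rule integral_labels(1)[OF Q(1) Lm LP C])
  have "emeasure \<rho> C = (\<integral>\<^sup>+p. ennreal (g p)*indicator C p\<partial>m)"
   unfolding \<rho>_def using C gm by (intro emeasure_density) auto
  also have "\<dots> = (\<integral>\<^sup>+p. ennreal (d (?L p)*indicator C p)\<partial>m)"
   by (rule nn_integral_cong) (simp add: g_def indicator_def)
  also have "\<dots> = ennreal (\<integral>p. d (?L p)*indicator C p\<partial>m)"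
   by (rule nn_integral_eq_integral[OF i]) (rule AE_I2, use d0 LP(2) in simp)
  also have "(\<integral>p. d (?L p)*indicator C p\<partial>m) = (\<Sum>q\<in>J\<times>K. d q*measure m ({p\<in>space m. ?L p = q}\<inter>C))"
   by (rule integral_labels(2)[OF Q(1) Lm LP C])
  finally show ?thesis .
 qed
 have cells_eq: "{p\<in>space m. ?L p = (j,k)} = cw j\<times>cx k" for j k by (rule cell_times[OF Q(3)])
 have t0: "t (j,k) = 0" if "j\<in>J" "k\<in>K" "a j = 0 \<or> b k = 0" for j k
  using t_a[OF that(1,2)] t_b[OF that(1,2)] t[of "(j,k)"] that by auto
 interpret a: prob_space \<alpha> by (rule prob_algebraD(1)[OF \<alpha>])
 interpret b: prob_space \<beta> by (rule prob_algebraD(1)[OF \<beta>])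
 have em1: "emeasure \<rho> (A\<times>UNIV) = emeasure \<alpha> A" if A: "A\<in>sets Rplus" for A
 proof -
  have AU: "A\<times>UNIV\<in>sets m" unfolding Q(2) using A by (intro pair_measureI) auto
  have mc: "measure m ({p\<in>space m. ?L p = (j,k)}\<inter>A\<times>UNIV) = measure \<alpha> (cw j\<inter>A)*b k" for j k
  proof -
   have cA: "cw j\<inter>A\<in>sets Rplus" using cw_sets A by auto
   have "{p\<in>space m. ?L p = (j,k)}\<inter>A\<times>UNIV = (cw j\<inter>A)\<times>cx k" unfolding cells_eq by auto
   then show ?thesis unfolding m_def b_def by (simp add: product_cell[OF \<alpha> \<beta> cA cx_sets])
  qed
  have "(\<Sum>q\<in>J\<times>K. d q*measure m ({p\<in>space m. ?L p = q}\<inter>A\<times>UNIV)) =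
    (\<Sum>j\<in>J. \<Sum>k\<in>K. d (j,k)*measure m ({p\<in>space m. ?L p = (j,k)}\<inter>A\<times>UNIV))"
   by (simp only: sum.cartesian_product split_beta' prod.collapse)
  also have "\<dots> = (\<Sum>j\<in>J. \<Sum>k\<in>K. t (j,k)/(measure \<alpha> (cw j)*b k)*(measure \<alpha> (cw j\<inter>A)*b k))"
   by (simp only: mc d_def a_def fst_conv snd_conv)
  also have "\<dots> = measure \<alpha> A"
   by (rule a.sum_over_cells[OF fin]) (use cw_sets prob_algebraD(2,3)[OF \<alpha>] ta rng A t0 in \<open>auto simp: disjoint_family_on_def cw_def intro: antisym\<close>)
  finally show ?thesis unfolding em[OF AU] by (simp add: a.emeasure_eq_measure)
 qed
 have em2: "emeasure \<rho> ({0..}\<times>B) = emeasure \<beta> B" if B: "B\<in>sets borel" for B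
 proof -
  have UB: "{0..}\<times>B\<in>sets m" unfolding Q(2) using B sets.top[of Rplus] by (intro pair_measureI) auto
  have mc: "measure m ({p\<in>space m. ?L p = (j,k)}\<inter>{0..}\<times>B) = measure \<beta> (cx k\<inter>B)*a j" for j k
  proof -
   have cB: "cx k\<inter>B\<in>sets borel" using cx_sets B by auto
   have "{p\<in>space m. ?L p = (j,k)}\<inter>{0..}\<times>B = cw j\<times>(cx k\<inter>B)" unfolding cells_eq by (auto simp: cw_def)
   then show ?thesis unfolding m_def a_def by (simp add: product_cell[OF \<alpha> \<beta> cw_sets cB])
  qed
  have dc: "d (j,k) = t (j,k)/(measure \<beta> (cx k)*a j)" for j k by (simp add: d_def b_def mult.commute)
  have "(\<Sum>q\<in>J\<times>K. d q*measure m ({p\<in>space m. ?L p = q}\<inter>{0..}\<times>B)) =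
    (\<Sum>j\<in>J. \<Sum>k\<in>K. d (j,k)*measure m ({p\<in>space m. ?L p = (j,k)}\<inter>{0..}\<times>B))"
   by (simp only: sum.cartesian_product split_beta' prod.collapse)
  also have "\<dots> = (\<Sum>k\<in>K. \<Sum>j\<in>J. t (j,k)/(measure \<beta> (cx k)*a j)*(measure \<beta> (cx k\<inter>B)*a j))"
   unfolding mc dc by (rule sum.swap)
  also have "\<dots> = measure \<beta> B"
   by (rule b.sum_over_cells[OF fin(2,1)]) (use cx_sets prob_algebraD(2,3)[OF \<beta>] tb rng B t0 in \<open>auto simp: disjoint_family_on_def cx_def intro: antisym\<close>)
  finally show ?thesis unfolding em[OF UB] by (simp add: b.emeasure_eq_measure)
 qed
 have p\<rho>: "prob_space \<rho>"
 proof (rule prob_spaceI)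
  have "emeasure \<rho> ({0..}\<times>UNIV) = emeasure \<beta> UNIV" by (rule em2) simp
  also have "\<dots> = 1" using prob_space.emeasure_space_1[OF prob_algebraD(1)[OF \<beta>]] prob_algebraD(3)[OF \<beta>] by simp
  finally show "emeasure \<rho> (space \<rho>) = 1" by (simp only: s\<rho>(2))
 qed
 have \<rho>pa: "\<rho>\<in>space (prob_algebra RS)" unfolding space_prob_algebra using p\<rho> s\<rho>(1) by simp
 note jm = joint_measurable[OF s\<rho>(1)]
 have m1: "marg1 \<rho> = \<alpha>"
 proof (rule measure_eqI)
  fix A assume "A\<in>sets (marg1 \<rho>)"
  then have A: "A\<in>sets Rplus" by (simp add: marg1_def)
  have "fst -` A\<inter>space \<rho> = A\<times>UNIV" using sets.sets_into_space[OF A] by (auto simp: s\<rho>(2))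
  then show "emeasure (marg1 \<rho>) A = emeasure \<alpha> A"
   unfolding marg1_def emeasure_distr[OF jm(1) A] by (simp add: em1[OF A])
 qed (simp add: marg1_def prob_algebraD(2)[OF \<alpha>])
 have m2: "marg2 \<rho> = \<beta>"
 proof (rule measure_eqI)
  fix B assume "B\<in>sets (marg2 \<rho>)"
  then have B: "B\<in>sets borel" by (simp add: marg2_def)
  have "snd -` B\<inter>space \<rho> = {0..}\<times>B" by (auto simp: s\<rho>(2))
  then show "emeasure (marg2 \<rho>) B = emeasure \<beta> B"
   unfolding marg2_def emeasure_distr[OF jm(2) B] by (simp add: em2[OF B])
 qed (simp add: marg2_def prob_algebraD(2)[OF \<beta>])
 have mcell: "measure m {p\<in>space m. ?L p = q} = a (fst q)*b (snd q)" for q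
 proof -
  obtain j k where q: "q = (j,k)" by (cases q)
  show ?thesis unfolding q cells_eq unfolding m_def a_def b_def fst_conv snd_conv by (rule product_cell[OF \<alpha> \<beta> cw_sets cx_sets])
 qed
 have dm: "d q*(a (fst q)*b (snd q)) = t q" if "q\<in>J\<times>K" for q
  using t_a[of "fst q" "snd q"] t_b[of "fst q" "snd q"] t[OF that] that a0 b0 by (auto simp: d_def)
 have tab: "tab lw lx \<rho> q = t q" if q: "q\<in>J\<times>K" for q
 proof -
  have C: "{p\<in>space m. ?L p = q}\<in>sets m" using measurable_sets[OF Lm, of "{q}"] by (simp add: vimage_def Int_def conj_commute)
  have "(\<Sum>r\<in>J\<times>K. d r*measure m ({p\<in>space m. ?L p = r}\<inter>{p\<in>space m. ?L p = q})) = (\<Sum>r\<in>J\<times>K. if r = q then t q else 0)"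
  proof (rule sum.cong[OF refl])
   fix r
   show "d r*measure m ({p\<in>space m. ?L p = r}\<inter>{p\<in>space m. ?L p = q}) = (if r = q then t q else 0)"
   proof (cases "r = q")
    case True
    then show ?thesis using dm[OF q] mcell[of q] by simp
   next
    case False
    then have "{p\<in>space m. ?L p = r}\<inter>{p\<in>space m. ?L p = q} = {}" by blast
    then show ?thesis using False by simp
   qed
  qed
  also have "\<dots> = t q" using q LP(1) by simp
  finally have "emeasure \<rho> {p\<in>space m. ?L p = q} = ennreal (t q)" unfolding em[OF C] by simp
  then show ?thesis unfolding tab_def using t[OF q] by (simp add: measure_def \<rho>_def)
 qed
 have H: "rel_entropy \<rho> m\<le>ennreal (mutual_info J K t)"
 proof -
  have eq: "g p*ln (g p) = (%q. d q*ln (d q)) (?L p)" if "p\<in>space m" for p using that by (simp add: g_def)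
  note I = integral_labels'[OF Q(1) Lm LP, of "%q. d q*ln (d q)"]
  have i: "integrable m (%p. g p*ln (g p))"
   by (rule iffD2[OF Bochner_Integration.integrable_cong[OF refl eq] I(1)])
  have "(\<integral>p. g p*ln (g p)\<partial>m) = (\<integral>p. d (?L p)*ln (d (?L p))\<partial>m)"
   by (rule Bochner_Integration.integral_cong[OF refl eq])
  also have "\<dots> = (\<Sum>q\<in>J\<times>K. d q*ln (d q)*measure m {p\<in>space m. ?L p = q})" by (rule I(2))
  also have "\<dots> = (\<Sum>q\<in>J\<times>K. eta (t q) - t q*ln (a (fst q)) - t q*ln (b (snd q)))"
  proof (rule sum.cong[OF refl])
   fix q assume q: "q\<in>J\<times>K"
   obtain j k where jk: "q = (j,k)" "j\<in>J" "k\<in>K" using q by auto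
   have "d q*ln (d q)*measure m {p\<in>space m. ?L p = q} = t q*ln (d q)"
    unfolding mcell using dm[OF q] by (metis mult.commute mult.assoc)
   also have "\<dots> = eta (t q) - t q*ln (a (fst q)) - t q*ln (b (snd q))"
   proof (cases "t q = 0")
    case False
    then have tp: "0 < t q" using t[OF q] by simp
    then have "0 < a j" "0 < b k" using t_a[OF jk(2,3)] t_b[OF jk(2,3)] jk(1) by (simp_all add: less_le_trans)
    then show ?thesis using tp by (simp add: d_def jk(1) eta_def ln_div ln_mult algebra_simps)
   qed simp
   finally show "d q*ln (d q)*measure m {p\<in>space m. ?L p = q} = eta (t q) - t q*ln (a (fst q)) - t q*ln (b (snd q))" .
  qed
  also have "\<dots> = (\<Sum>q\<in>J\<times>K. eta (t q)) - (\<Sum>j\<in>J. \<Sum>k\<in>K. t (j,k)*ln (a j)) - (\<Sum>j\<in>J. \<Sum>k\<in>K. t (j,k)*ln (b k))"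
   by (simp add: sum_subtractf sum.cartesian_product split_beta')
  also have "(\<Sum>j\<in>J. \<Sum>k\<in>K. t (j,k)*ln (b k)) = (\<Sum>k\<in>K. \<Sum>j\<in>J. t (j,k)*ln (b k))" by (rule sum.swap)
  also have "(\<Sum>j\<in>J. \<Sum>k\<in>K. t (j,k)*ln (a j)) = (\<Sum>j\<in>J. eta (\<Sum>k\<in>K. t (j,k)))"
   by (rule sum.cong[OF refl]) (simp add: ta a_def eta_def flip: sum_distrib_right)
  also have "(\<Sum>k\<in>K. \<Sum>j\<in>J. t (j,k)*ln (b k)) = (\<Sum>k\<in>K. eta (\<Sum>j\<in>J. t (j,k)))"
   by (rule sum.cong[OF refl]) (simp add: tb b_def eta_def flip: sum_distrib_right)
  finally have "(\<integral>p. g p*ln (g p)\<partial>m) = mutual_info J K t" by (simp add: mutual_info_def)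
  moreover have "rel_entropy \<rho> m = (if integrable m (%p. g p*ln (g p)) then ennreal (\<integral>p. g p*ln (g p)\<partial>m) else \<infinity>)"
   unfolding \<rho>_def by (rule rel_entropy_density[OF Q(1) gm g0])
  ultimately show ?thesis using i by simp
 qed
 show thesis
 proof (rule that[OF _ tab])
  show "\<rho>\<in>entropy_couplings \<alpha> \<beta> (mutual_info J K t)"
   unfolding entropy_couplings_def using \<rho>pa m1 m2 H[unfolded m_def] by blast
 qed
qed

end

section \<open>Comparison of tables near a pair of marginals\<close>

lemma eventually_nhdsin_topspace: "\<forall>\<^sub>F x in nhdsin T a. x\<in>topspace T"
 unfolding eventually_nhdsin by (cases "a\<in>topspace T") auto

lemma nhdsinE:
 assumes "\<forall>\<^sub>F x in nhdsin T a. P x" "a\<in>topspace T"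
 obtains U where "openin T U" "a\<in>U" "\<forall>x\<in>U. P x"
 using assms unfolding eventually_nhdsin by blast

text \<open>Two kinds of control with different tolerances: marginals in U and V have cell masses
  within \<delta> of those of \<alpha> and \<beta>, and tables within d of each other give images
  within e. They are kept apart because \<delta> is chosen later, depending on d, by the lemmas that
  adjust or round tables.\<close>

definition controls where
 "controls lw lx J K hs e d \<delta> \<alpha> \<beta> U V \<longleftrightarrow>
  openin W1_topology U \<and> \<alpha>\<in>U \<and> openin weak_topology V \<and> (\<beta> :: 's::metric_space measure)\<in>V \<and>
  (\<forall>\<alpha>'\<in>U. (\<forall>j\<in>J. \<bar>measure \<alpha>' {w\<in>{0..}. lw w = j} - measure \<alpha> {w\<in>{0..}. lw w = j}\<bar> < \<delta>) \<and>
   (\<forall>\<rho>'\<in>M11. marg1 \<rho>' = \<alpha>' --> (\<forall>\<rho>\<in>M11. marg1 \<rho> = \<alpha> -->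
    (\<forall>q\<in>J\<times>K. \<bar>tab lw lx \<rho>' q - tab lw lx \<rho> q\<bar> < (d :: real)) --> near hs e (Fmap \<rho>') (Fmap \<rho>)))) \<and>
  (\<forall>\<beta>'\<in>V. \<forall>k\<in>K. \<bar>measure \<beta>' {x. lx x = k} - measure \<beta> {x. lx x = k}\<bar> < \<delta>)"

text \<open>Cells are grid cells of the truncated weight and of the test functions, so both factors
  of the integrand w h(x) are nearly constant on them. The tail above R costs e/8 and the
  discretisation e/8 for each of the two couplings, the difference of tables e/4; together this is
  3e/4.\<close>

lemma cells_exist:
 fixes \<beta> :: "'s::metric_space measure" and hs :: "('s => real) set"
 assumes \<alpha>: "\<alpha>\<in>M11_Rplus" and \<beta>: "\<beta>\<in>M1" and hs: "finite hs" "\<forall>h\<in>hs. bdd_cont h"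
  and e: "0 < e"
 obtains lw :: "real => int list" and lx :: "'s => int list" and J K d where "cells lw lx J K" "0 < d"
  "\<forall>\<delta>>0. \<exists>U V. controls lw lx J K hs e d \<delta> \<alpha> \<beta> U V"
proof -
 note a = M11_RplusD[OF \<alpha>] and b = prob_algebraD[OF \<beta>]
 obtain hl where hl: "set hl = hs" using finite_list[OF hs(1)] by blast
 obtain B where B: "1\<le>B" "\<And>h x. h\<in>hs ==> \<bar>h x\<bar>\<le>B"
 proof -
  have "bounded (\<Union>h\<in>hs. range h)" using hs by (intro bounded_UN) auto
  then obtain C where "\<And>y. y\<in>(\<Union>h\<in>hs. range h) ==> norm y\<le>C" unfolding bounded_iff by blast
  then have "\<bar>h x\<bar>\<le>max 1 C" if "h\<in>hs" for h x using that by (fastforce simp: le_max_iff_disj)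
  then show thesis by (intro that[of "max 1 C"]) auto
 qed
 have hc: "continuous_on UNIV h" "bounded (range h)" "h\<in>borel_measurable borel" if "h\<in>hs" for h
  using hs(2) that borel_measurable_continuous_onI by blast+
 have "\<forall>\<^sub>F n in sequentially. (\<integral>w. max 0 (w - real n)\<partial>\<alpha>) < e/(8*B)"
  by (rule order_tendstoD(2)[OF excess_to_zero[OF \<alpha>]]) (use e B in simp)
 then obtain R0 :: nat where R0: "\<And>n. n \<ge> R0 ==> (\<integral>w. max 0 (w - real n)\<partial>\<alpha>) < e/(8*B)" by (auto simp: eventually_sequentially)
 define R where "R = real (max 1 R0)"
 have R: "1\<le>R" and Ra: "(\<integral>w. max 0 (w - R)\<partial>\<alpha>) < e/(8*B)" using R0[of "max 1 R0"] by (auto simp: R_def)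
 \<comment> \<open>Clipping from both sides makes the function bounded on all of
   \<open>real\<close>, so that it produces finitely many labels; on nonnegative weights it is the
   truncation at R.\<close>
 define \<phi> where "\<phi> w = max 0 (min w R)" for w :: real
 have \<phi>: "0\<le>\<phi> w" "\<phi> w\<le>R" "\<bar>\<phi> w\<bar>\<le>R" for w using R by (auto simp: \<phi>_def)
 have \<phi>_min: "\<phi> w = min w R" if "0\<le>w" for w using that R by (simp add: \<phi>_def)
 have \<phi>c: "continuous_on UNIV \<phi>" unfolding \<phi>_def by (intro continuous_intros)
 have \<phi>b: "bounded (range \<phi>)" using \<phi>(3) by (intro boundedI[of _ R]) auto
 have \<phi>m: "\<phi>\<in>borel_measurable borel" by (rule borel_measurable_continuous_onI[OF \<phi>c])
 have \<phi>m\<alpha>: "\<phi>\<in>borel_measurable \<alpha>" unfolding measurable_cong_sets[OF a(2) refl] by (rule borel_measurable_Rplus[OF \<phi>m])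
 \<comment> \<open>The meshes satisfy \<eta>1 B + R \<eta>2 = e/8, the variation of a product of
   factors bounded by R and B.\<close>
 define \<eta>1 where "\<eta>1 = e/(16*B)"
 define \<eta>2 where "\<eta>2 = e/(16*R)"
 have \<eta>: "0 < \<eta>1" "0 < \<eta>2" using e B R by (simp_all add: \<eta>1_def \<eta>2_def)
 obtain s1 where s1: "\<And>h k. h\<in>set [\<phi>] ==> measure \<alpha> {x\<in>space \<alpha>. h x = s1 + \<eta>1*real_of_int k} = 0"
  by (rule grid_offset[of \<alpha> "[\<phi>]" \<eta>1]) (use \<phi>m\<alpha> \<eta> prob_space.finite_measure[OF a(1)] in \<open>auto\<close>)
 have hm\<beta>: "h\<in>borel_measurable \<beta>" if "h\<in>set hl" for h
  unfolding measurable_cong_sets[OF b(2) refl] using hc(3) that hl by blast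
 obtain s2 where s2: "\<And>h k. h\<in>set hl ==> measure \<beta> {x\<in>space \<beta>. h x = s2 + \<eta>2*real_of_int k} = 0"
  by (rule grid_offset[of \<beta> hl \<eta>2]) (use hm\<beta> \<eta> prob_space.finite_measure[OF b(1)] in \<open>auto\<close>)
 define lw where "lw = lab [\<phi>] s1 \<eta>1"
 define lx where "lx = lab hl s2 \<eta>2"
 define J where "J = range lw"
 define K where "K = range lx"
 have cells: "cells lw lx J K"
 proof
  show "lw\<in>measurable Rplus (count_space UNIV)" unfolding lw_def
   by (rule measurable_lab) (use borel_measurable_Rplus[OF \<phi>m] in auto)
  show "lx\<in>measurable borel (count_space UNIV)" unfolding lx_def
   by (rule measurable_lab) (use hc(3) hl in blast)
  show "finite J" unfolding J_def lw_def by (rule finite_range_lab) (use \<phi>b in auto)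
  show "finite K" unfolding K_def lx_def by (rule finite_range_lab) (use hc(2) hl in blast)
 qed (simp_all add: J_def K_def)
 interpret cells lw lx J K by (rule cells)
 \<comment> \<open>The added 1 keeps the denominator of d at least R B; summing R B d over all cells
   then gives at most e/4.\<close>
 define N where "N = real (card (J\<times>K)) + 1"
 have N: "1\<le>N" by (simp add: N_def)
 define d where "d = e/(4*(R*B*N))"
 have d: "0 < d" unfolding d_def using e R B N by simp
 have t1: "((%\<alpha>'. measure \<alpha>' {w\<in>{0..}. lw w = j}) \<longlongrightarrow> measure \<alpha> {w\<in>{0..}. lw w = j}) (nhdsin W1_topology \<alpha>)" for j
 proof -
  have "((%\<alpha>'. measure \<alpha>' (lab [\<phi>] s1 \<eta>1 -` {j}\<inter>{0..})) \<longlongrightarrow> measure \<alpha> (lab [\<phi>] s1 \<eta>1 -` {j}\<inter>{0..})) (nhdsin W1_topology \<alpha>)"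
  proof (rule lab_cell_tendsto[OF Rplus_def _ a(5) _ _ \<eta>(1) s1])
   show "\<forall>\<^sub>F \<alpha>' in nhdsin W1_topology \<alpha>. \<alpha>'\<in>space (prob_algebra Rplus)"
    using eventually_nhdsin_topspace by (rule eventually_mono) (simp add: M11_RplusD(5))
   show "((%\<alpha>'. \<integral>x. f x\<partial>\<alpha>') \<longlongrightarrow> (mean \<alpha> f)) (nhdsin W1_topology \<alpha>)" if "L-lipschitz_on UNIV f" for f :: "real => real" and L
    by (rule tendsto_W1_nhdsin[OF that])
   show "continuous_on UNIV h" if "h\<in>set [\<phi>]" for h using that \<phi>c by simp
  qed
  moreover have "lab [\<phi>] s1 \<eta>1 -` {j}\<inter>{0..} = {w\<in>{0..}. lw w = j}" by (auto simp: lw_def)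
  ultimately show ?thesis by simp
 qed
 have t2: "((%\<beta>'. measure \<beta>' {x. lx x = k}) \<longlongrightarrow> measure \<beta> {x. lx x = k}) (nhdsin weak_topology \<beta>)" for k
 proof -
  have "((%\<beta>'. measure \<beta>' (lab hl s2 \<eta>2 -` {k}\<inter>UNIV)) \<longlongrightarrow> measure \<beta> (lab hl s2 \<eta>2 -` {k}\<inter>UNIV)) (nhdsin weak_topology \<beta>)"
  proof (rule lab_cell_tendsto[OF borel_restrict_UNIV _ \<beta> _ _ \<eta>(2) s2])
   show "\<forall>\<^sub>F \<beta>' in nhdsin weak_topology \<beta>. \<beta>'\<in>M1"
    using eventually_nhdsin_topspace by (rule eventually_mono) simp
   show "((%\<beta>'. \<integral>x. f x\<partial>\<beta>') \<longlongrightarrow> (mean \<beta> f)) (nhdsin weak_topology \<beta>)" if "L-lipschitz_on UNIV f" "bounded (range f)" for f :: "'s => real" and L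
    by (rule tendsto_weak_nhdsin[OF lipschitz_on_continuous_on[OF that(1)] that(2)])
   show "continuous_on UNIV h" if "h\<in>set hl" for h using that hc(1) hl by blast
  qed
  moreover have "lab hl s2 \<eta>2 -` {k}\<inter>UNIV = {x. lx x = k}" by (auto simp: lx_def)
  ultimately show ?thesis by simp
 qed
 \<comment> \<open>Values at an arbitrary representative of the cell. The representative may be a
   negative number, but clipping makes its value admissible all the same.\<close>
 define rw where "rw j = \<phi> (SOME w. lw w = j)" for j
 define rx where "rx h k = (h (SOME x. lx x = k) :: real)" for h :: "'s => real" and k
 have rw: "\<bar>\<phi> w - rw (lw w)\<bar>\<le>\<eta>1" for w
 proof -
  have "lw (SOME w'. lw w' = lw w) = lw w" by (rule someI[of _ w]) simp
  then have "lab [\<phi>] s1 \<eta>1 w = lab [\<phi>] s1 \<eta>1 (SOME w'. lw w' = lw w)" by (simp add: lw_def)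
  from lab_close[OF this, of \<phi>] \<eta> show ?thesis by (simp add: rw_def)
 qed
 have rx: "\<bar>h x - rx h (lx x)\<bar>\<le>\<eta>2" if "h\<in>hs" for h x
 proof -
  have "lx (SOME x'. lx x' = lx x) = lx x" by (rule someI[of _ x]) simp
  then have "lab hl s2 \<eta>2 x = lab hl s2 \<eta>2 (SOME x'. lx x' = lx x)" by (simp add: lx_def)
  from lab_close[OF this, of h] \<eta> that hl show ?thesis by (simp add: rx_def)
 qed
 have rwB: "0\<le>rw j" "rw j\<le>R" for j by (simp_all add: rw_def \<phi>)
 have rxB: "\<bar>rx h k\<bar>\<le>B" if "h\<in>hs" for h k using B(2)[OF that] by (simp add: rx_def)
 define S where "S h \<rho> = (\<Sum>q\<in>J\<times>K. rw (fst q)*rx h (snd q)*tab lw lx \<rho> q)" for h \<rho>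
 have Fapprox: "\<bar>(mean (Fmap \<rho>) h) - S h \<rho>\<bar> < e/8 + e/8"
  if h: "h\<in>hs" and \<rho>: "\<rho>\<in>M11" and m: "(\<integral>w. max 0 (w - R)\<partial>marg1 \<rho>) < e/(8*B)" for h \<rho>
 proof -
  note P = M11D[OF \<rho>]
  interpret r: prob_space \<rho> by (rule P(2))
  have "\<bar>(mean (Fmap \<rho>) h) - (\<integral>p. min (fst p) R*h (snd p)\<partial>\<rho>)\<bar>\<le>B*(\<integral>w. max 0 (w - R)\<partial>marg1 \<rho>)"
   unfolding integral_Fmap[OF \<rho> hc(3)[OF h]] by (rule truncation_error[OF \<rho> hc(3)[OF h] B(2)[OF h]]) (use R in simp)
  also have "\<dots> < e/8" using m B(1) by (simp add: field_simps)
  finally have 1: "\<bar>(mean (Fmap \<rho>) h) - (\<integral>p. min (fst p) R*h (snd p)\<partial>\<rho>)\<bar> < e/8" .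
  let ?L = "%p. (lw (fst p),lx (snd p))"
  define f where "f q = rw (fst q)*rx h (snd q)" for q
  have LP: "finite (J\<times>K)" "\<And>p. p\<in>space \<rho> ==> ?L p\<in>J\<times>K" using fin rng by auto
  note I = integral_labels'[OF P(2) label_measurable[OF P(3)] LP, of f]
  have S: "S h \<rho> = (\<integral>p. f (?L p)\<partial>\<rho>)" unfolding S_def tab_def f_def[symmetric] by (rule I(2)[symmetric])
  have i: "integrable \<rho> (%p. min (fst p) R*h (snd p))"
   by (rule integrable_fst_mult[OF \<rho> hc(3)[OF h] B(2)[OF h], where f = "%x. min x R" and C = R]) (use R in auto)
  have "\<bar>(\<integral>p. min (fst p) R*h (snd p)\<partial>\<rho>) - S h \<rho>\<bar> = \<bar>\<integral>p. min (fst p) R*h (snd p) - f (?L p)\<partial>\<rho>\<bar>"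
   unfolding S by (rule arg_cong[where f = abs], rule Bochner_Integration.integral_diff[OF i I(1), symmetric])
  also have "\<dots>\<le>(\<integral>p. \<bar>min (fst p) R*h (snd p) - f (?L p)\<bar>\<partial>\<rho>)" by (rule integral_abs_bound)
  also have "\<dots>\<le>(\<integral>p. e/8\<partial>\<rho>)"
  proof (rule integral_mono)
   show "integrable \<rho> (%p. \<bar>min (fst p) R*h (snd p) - f (?L p)\<bar>)"
    by (rule integrable_abs[OF Bochner_Integration.integrable_diff[OF i I(1)]])
   show "integrable \<rho> (%p. e/8)" by simp
   fix p assume "p\<in>space \<rho>"
   then have p0: "0\<le>fst p" using P(4) by auto
   let ?w = "fst p" and ?x = "snd p"
   have "min ?w R*h ?x - f (?L p) = (\<phi> ?w - rw (lw ?w))*h ?x + rw (lw ?w)*(h ?x - rx h (lx ?x))"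
    by (simp add: \<phi>_min[OF p0] f_def algebra_simps)
   then have "\<bar>min ?w R*h ?x - f (?L p)\<bar>\<le>\<bar>\<phi> ?w - rw (lw ?w)\<bar>*\<bar>h ?x\<bar> + \<bar>rw (lw ?w)\<bar>*\<bar>h ?x - rx h (lx ?x)\<bar>"
    by (metis abs_mult abs_triangle_ineq)
   also have "\<dots>\<le>\<eta>1*B + R*\<eta>2"
    using rw rx[OF h] rwB B(1) B(2)[OF h] \<eta> R by (intro add_mono mult_mono) auto
   also have "\<dots> = e/8" using B R by (simp add: \<eta>1_def \<eta>2_def)
   finally show "\<bar>min ?w R*h ?x - f (?L p)\<bar>\<le>e/8" .
  qed
  also have "\<dots> = e/8" by (simp add: r.prob_space)
  finally show ?thesis using 1 by linarith
 qed
 have t3: "\<forall>\<^sub>F \<alpha>' in nhdsin W1_topology \<alpha>. \<forall>\<rho>'\<in>M11. marg1 \<rho>' = \<alpha>' --> (\<forall>\<rho>\<in>M11. marg1 \<rho> = \<alpha> -->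
    (\<forall>q\<in>J\<times>K. \<bar>tab lw lx \<rho>' q - tab lw lx \<rho> q\<bar> < d) -->
    (near hs e (Fmap \<rho>') (Fmap \<rho>)))"
 proof -
  \<comment> \<open>The excess over R is Lipschitz, so the strict bound on the excess of \<alpha>
    persists for all \<alpha>' in a Wasserstein neighbourhood.\<close>
  have "1-lipschitz_on UNIV (%w. max 0 (w - R))"
   by (rule lipschitz_onI) (auto simp: dist_real_def max_def)
  from order_tendstoD(2)[OF tendsto_W1_nhdsin[OF this] Ra]
  show ?thesis
  proof eventually_elim
   case (elim \<alpha>')
   show ?case
   proof (intro ballI impI)
    fix \<rho>' \<rho> h assume r: "\<rho>'\<in>M11" "marg1 \<rho>' = \<alpha>'" "\<rho>\<in>M11" "marg1 \<rho> = \<alpha>"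
     and q: "\<forall>q\<in>J\<times>K. \<bar>tab lw lx \<rho>' q - tab lw lx \<rho> q\<bar> < d" and h: "h\<in>hs"
    have "\<bar>(mean (Fmap \<rho>') h) - S h \<rho>'\<bar> < e/8 + e/8" by (rule Fapprox[OF h r(1)]) (use elim r(2) in simp)
    moreover have "\<bar>(mean (Fmap \<rho>) h) - S h \<rho>\<bar> < e/8 + e/8" by (rule Fapprox[OF h r(3)]) (use Ra r(4) in simp)
    moreover have "\<bar>S h \<rho>' - S h \<rho>\<bar>\<le>e/4"
    proof -
     have "S h \<rho>' - S h \<rho> = (\<Sum>q\<in>J\<times>K. rw (fst q)*rx h (snd q)*(tab lw lx \<rho>' q - tab lw lx \<rho> q))"
      by (simp add: S_def right_diff_distrib sum_subtractf)
     also have "\<bar>\<dots>\<bar>\<le>(\<Sum>q\<in>J\<times>K. \<bar>rw (fst q)*rx h (snd q)*(tab lw lx \<rho>' q - tab lw lx \<rho> q)\<bar>)" by (rule sum_abs)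
     also have "\<dots>\<le>(\<Sum>q\<in>J\<times>K. R*B*d)"
     proof (rule sum_mono)
      fix p assume p: "p\<in>J\<times>K"
      show "\<bar>rw (fst p)*rx h (snd p)*(tab lw lx \<rho>' p - tab lw lx \<rho> p)\<bar>\<le>R*B*d"
       unfolding abs_mult using rwB rxB[OF h] q[rule_format, OF p] R B d by (intro mult_mono) auto
     qed
     also have "\<dots> = real (card (J\<times>K))*(R*B*d)" by simp
     also have "\<dots>\<le>N*(R*B*d)" using R B d by (intro mult_right_mono) (auto simp: N_def)
     also have "\<dots> = e/4" using R B N by (simp add: d_def field_simps)
     finally show ?thesis .
    qed
    ultimately show "\<bar>(mean (Fmap \<rho>') h) - (mean (Fmap \<rho>) h)\<bar> < e" using e by linarith
   qed
  qed
 qed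
 have "\<exists>U V. controls lw lx J K hs e d \<delta> \<alpha> \<beta> U V" if \<delta>: "0 < \<delta>" for \<delta>
 proof -
  have "\<forall>\<^sub>F \<alpha>' in nhdsin W1_topology \<alpha>. \<forall>j\<in>J. \<bar>measure \<alpha>' {w\<in>{0..}. lw w = j} - measure \<alpha> {w\<in>{0..}. lw w = j}\<bar> < \<delta>"
   unfolding dist_real_def[symmetric] by (rule eventually_ball_finite[OF fin(1)], rule ballI, rule tendstoD[OF t1 \<delta>])
  note ev1 = eventually_conj[OF this t3]
  have ev2: "\<forall>\<^sub>F \<beta>' in nhdsin weak_topology \<beta>. \<forall>k\<in>K. \<bar>measure \<beta>' {x. lx x = k} - measure \<beta> {x. lx x = k}\<bar> < \<delta>"
   unfolding dist_real_def[symmetric] by (rule eventually_ball_finite[OF fin(2)], rule ballI, rule tendstoD[OF t2 \<delta>])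
  show ?thesis
   by (rule nhdsinE[OF ev1], use \<alpha> in simp, rule nhdsinE[OF ev2], use \<beta> in simp, unfold controls_def, intro exI conjI; assumption)
 qed
 then show thesis by (intro that[OF cells d]) blast
qed

lemma entropy_couplings_mono: "\<rho>\<in>entropy_couplings \<alpha> \<beta> c ==> c\<le>c' ==> \<rho>\<in>entropy_couplings \<alpha> \<beta> c'"
 unfolding entropy_couplings_def using ennreal_leI[of c c'] by (auto intro: order_trans)

text \<open>Only the mutual information of a finite table is assumed to be small here, so that the lemma also
 applies to empirical measures, whose relative entropy is useless.\<close>

lemma local_upper:
 fixes \<beta> :: "'s::metric_space measure"
 assumes \<alpha>: "\<alpha>\<in>M11_Rplus" and \<beta>: "\<beta>\<in>M1" and c0: "0\<le>c0" and G: "openin weak_topology G"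
  and sub: "\<And>\<rho>. \<rho>\<in>entropy_couplings \<alpha> \<beta> c0 ==> Fmap \<rho>\<in>G"
 obtains c and lw :: "real => int list" and lx :: "'s => int list" and J K U V where "c0 < c" "cells lw lx J K"
  "openin W1_topology U" "\<alpha>\<in>U" "openin weak_topology V" "\<beta>\<in>V"
  "\<forall>\<rho>\<in>M11. marg1 \<rho>\<in>U --> marg2 \<rho>\<in>V --> mutual_info J K (tab lw lx \<rho>)\<le>c --> Fmap \<rho>\<in>G"
proof -
 obtain c1 hs and e :: real where c1: "c0 < c1" and hs: "finite hs" "0 < e"
  "\<forall>h\<in>hs. bdd_cont (h :: 's => real)"
  "\<forall>\<rho>\<in>entropy_couplings \<alpha> \<beta> c1. \<forall>\<nu>\<in>M1. (near hs e \<nu> (Fmap \<rho>)) --> \<nu>\<in>G"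
  by (rule entropy_couplings_nbhd[OF \<alpha> \<beta> c0 G sub]) (assumption, rule that)
 obtain lw :: "real => int list" and lx :: "'s => int list" and J K d where cells: "cells lw lx J K" and d: "0 < d"
  and nb: "\<forall>\<delta>>0. \<exists>U V. controls lw lx J K hs e d \<delta> \<alpha> \<beta> U V"
  by (rule cells_exist[OF \<alpha> \<beta> hs(1,3,2)]) (rule that)
 interpret cells lw lx J K by (rule cells)
 \<comment> \<open>The budget from c0 to c1 is used twice: mutual information up to c is allowed for
   the given table, and correcting its margins may raise it to c1.\<close>
 define c where "c = (c0 + c1)/2"
 have c: "c0 < c" "c < c1" using c1 by (simp_all add: c_def)
 define a where "a j = measure \<alpha> (cw j)" for j
 define b where "b k = measure \<beta> (cx k)" for k
 obtain \<delta> where \<delta>: "0 < \<delta>" and adj: "\<And>t'. [|\<And>p. p\<in>J\<times>K ==> 0\<le>t' p; (\<Sum>p\<in>J\<times>K. t' p) = 1;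
   \<And>j. j\<in>J ==> \<bar>(\<Sum>k\<in>K. t' (j,k)) - a j\<bar> < \<delta>; \<And>k. k\<in>K ==> \<bar>(\<Sum>j\<in>J. t' (j,k)) - b k\<bar> < \<delta>;
   mutual_info J K t'\<le>c|] ==>
   \<exists>t. (\<forall>p\<in>J\<times>K. 0\<le>t p \<and> \<bar>t p - t' p\<bar> < d) \<and> (\<forall>j\<in>J. (\<Sum>k\<in>K. t (j,k)) = a j) \<and>
    (\<forall>k\<in>K. (\<Sum>j\<in>J. t (j,k)) = b k) \<and> mutual_info J K t\<le>c1"
  using table_adjust[OF fin c(2) d, of a b] by blast
 obtain U V where ctl: "controls lw lx J K hs e d \<delta> \<alpha> \<beta> U V" using nb \<delta> by blast
 then have U: "openin W1_topology U" "\<alpha>\<in>U" and V: "openin weak_topology V" "\<beta>\<in>V" unfolding controls_def by blast+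
 note U1 = ctl[unfolded controls_def, folded cw_def cx_def, THEN conjunct2, THEN conjunct2, THEN conjunct2, THEN conjunct2, THEN conjunct1]
  and V1 = ctl[unfolded controls_def, folded cw_def cx_def, THEN conjunct2, THEN conjunct2, THEN conjunct2, THEN conjunct2, THEN conjunct2]
 have "Fmap \<rho>'\<in>G" if \<rho>': "\<rho>'\<in>M11" "marg1 \<rho>'\<in>U" "marg2 \<rho>'\<in>V" "mutual_info J K (tab lw lx \<rho>')\<le>c" for \<rho>'
 proof -
  note tm = tab_margins[OF M11D(1)[OF \<rho>'(1)]]
  have 1: "\<bar>(\<Sum>k\<in>K. tab lw lx \<rho>' (j,k)) - a j\<bar> < \<delta>" if "j\<in>J" for j
   using U1[rule_format, OF \<rho>'(2)] that unfolding tm(1) a_def dist_real_def by blast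
  have 2: "\<bar>(\<Sum>j\<in>J. tab lw lx \<rho>' (j,k)) - b k\<bar> < \<delta>" if "k\<in>K" for k
   using V1[rule_format, OF \<rho>'(3) that] unfolding tm(2) b_def dist_real_def .
  obtain t where t: "\<forall>p\<in>J\<times>K. 0\<le>t p \<and> \<bar>t p - tab lw lx \<rho>' p\<bar> < d" "\<forall>j\<in>J. (\<Sum>k\<in>K. t (j,k)) = a j"
    "\<forall>k\<in>K. (\<Sum>j\<in>J. t (j,k)) = b k" "mutual_info J K t\<le>c1"
   using adj[OF tab_nonneg tm(3) 1 2 \<rho>'(4)] by blast
  have t0: "0\<le>t q" if "q\<in>J\<times>K" for q using t(1) that by blast
  \<comment> \<open>The corrected table is realised by a genuine coupling of \<alpha> and \<beta>
    with entropy at most c1, whose image is well inside G. The image of \<rho>' is compared with it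
    through the tables.\<close>
  obtain \<rho> where \<rho>: "\<rho>\<in>entropy_couplings \<alpha> \<beta> (mutual_info J K t)" "\<And>q. q\<in>J\<times>K ==> tab lw lx \<rho> q = t q"
   by (rule step_coupling[OF M11_RplusD(5)[OF \<alpha>] \<beta> t0 t(2)[unfolded a_def, rule_format] t(3)[unfolded b_def, rule_format]]) (assumption+, rule that)
  have \<rho>c: "\<rho>\<in>entropy_couplings \<alpha> \<beta> c1" by (rule entropy_couplings_mono[OF \<rho>(1) t(4)])
  have \<rho>M: "\<rho>\<in>M11" by (rule entropy_couplings_M11[OF \<rho>c \<alpha>])
  have "\<forall>q\<in>J\<times>K. \<bar>tab lw lx \<rho>' q - tab lw lx \<rho> q\<bar> < d"
   using t(1) \<rho>(2) by (simp add: abs_minus_commute)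
  then have "near hs e (Fmap \<rho>') (Fmap \<rho>)"
   using U1[rule_format, OF \<rho>'(2)] \<rho>'(1) \<rho>M entropy_couplingsD(2)[OF \<rho>c] by blast
  then show ?thesis using hs(4)[rule_format, OF \<rho>c Fmap_M1[OF \<rho>'(1)]] by blast
 qed
 then show thesis by (intro that[OF c(1) cells U V]) blast
qed

text \<open>The deterministic input of the lower bound, in the form in which it is used: any pair of
  realised margins is completed to an integer table of mutual information at most h that forces the
  image into G. The measures \<alpha>' and \<beta>' serve only to say which margins are
  realised.\<close>

definition roundable where
 "roundable lw lx J K U V G h n \<longleftrightarrow> (\<forall>\<alpha>'\<in>U. \<forall>\<beta>'\<in>V. \<forall>r c. (\<Sum>j\<in>J. r j) = (n :: nat) --> (\<Sum>k\<in>K. c k) = n -->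
  (\<forall>j\<in>J. real (r j)/n = measure \<alpha>' {w\<in>{0..}. lw w = j}) --> (\<forall>k\<in>K. real (c k)/n = measure \<beta>' {x. lx x = k}) -->
  (\<exists>N :: int list\<times>int list => nat. N\<in>extensional (J\<times>K) \<and> (\<forall>j\<in>J. (\<Sum>k\<in>K. N (j,k)) = r j) \<and> (\<forall>k\<in>K. (\<Sum>j\<in>J. N (j,k)) = c k) \<and>
   mutual_info J K (%p. N p/n)\<le>h \<and>
   (\<forall>\<rho>'\<in>M11. marg1 \<rho>'\<in>U --> (\<forall>q\<in>J\<times>K. tab lw lx \<rho>' q = real (N q)/n) --> Fmap \<rho>'\<in>(G :: 's::metric_space measure set))))"

text \<open>The table of \<rho> itself is rounded to the prescribed margins. Its mutual information
  is at most the entropy of \<rho> by data processing, and rounding raises it by less than c' -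
  c.\<close>

lemma local_lower:
 fixes \<rho> :: "(real\<times>'s::metric_space) measure"
 assumes \<rho>: "\<rho>\<in>M11" and H: "rel_entropy \<rho> (marg1 \<rho>\<Otimes>\<^sub>Mmarg2 \<rho>)\<le>ennreal c" and c: "0\<le>c" "c < c'"
  and G: "openin weak_topology G" "Fmap \<rho>\<in>G"
 obtains lw :: "real => int list" and lx :: "'s => int list" and J K U V n0 where "cells lw lx J K"
  "openin W1_topology U" "marg1 \<rho>\<in>U" "openin weak_topology V" "marg2 \<rho>\<in>V"
  "\<forall>n. n0\<le>n --> roundable lw lx J K U V G c' n"
proof -
 define \<alpha> where "\<alpha> = marg1 \<rho>"
 define \<beta> where "\<beta> = marg2 \<rho>"
 have \<alpha>: "\<alpha>\<in>M11_Rplus" and \<beta>: "\<beta>\<in>M1" unfolding \<alpha>_def \<beta>_def by (rule marg1_M11_Rplus[OF \<rho>], rule marg2_M1[OF \<rho>])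
 obtain hs and e :: real where hs: "finite hs" "0 < e"
  "\<forall>h\<in>hs. bdd_cont (h :: 's => real)"
  "\<forall>\<nu>'\<in>M1. (near hs e \<nu>' (Fmap \<rho>)) --> \<nu>'\<in>G"
  by (rule weak_nhds_basic[OF G]) (rule that)
 obtain lw :: "real => int list" and lx :: "'s => int list" and J K d where cells: "cells lw lx J K" and d: "0 < d"
  and nb: "\<forall>\<delta>>0. \<exists>U V. controls lw lx J K hs e d \<delta> \<alpha> \<beta> U V"
  by (rule cells_exist[OF \<alpha> \<beta> hs(1,3,2)]) (rule that)
 interpret cells lw lx J K by (rule cells)
 let ?t = "tab lw lx \<rho>"
 note tm = tab_margins[OF M11D(1)[OF \<rho>], folded \<alpha>_def \<beta>_def]
 have MI: "mutual_info J K ?t\<le>c" by (rule mutual_info_tab_le[OF M11D(1)[OF \<rho>] H c(1)])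
 have "\<exists>d2>0. \<forall>t'. (\<forall>p\<in>J\<times>K. 0\<le>t' p \<and> \<bar>t' p - ?t p\<bar> < d2) --> mutual_info J K t' < mutual_info J K ?t + (c' - c)"
 proof (rule mutual_info_upper_nbhd[where e = "c' - c" and t = ?t, OF fin tab_nonneg])
  show "0 < c' - c" using c(2) by simp
  fix d assume "0 < d" and m: "\<And>t'. (\<And>p. p\<in>J\<times>K ==> 0\<le>t' p \<and> \<bar>t' p - ?t p\<bar> < d) ==> mutual_info J K t' < mutual_info J K ?t + (c' - c)"
  show ?thesis
  proof (intro exI conjI allI impI)
   show "0 < d" by fact
   fix t' assume "\<forall>p\<in>J\<times>K. 0\<le>t' p \<and> \<bar>t' p - ?t p\<bar> < d"
   then show "mutual_info J K t' < mutual_info J K ?t + (c' - c)" by (intro m) (rule bspec)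
  qed
 qed
 then obtain d2 where d2: "0 < d2" and MI2: "\<And>t'. \<forall>p\<in>J\<times>K. 0\<le>t' p \<and> \<bar>t' p - ?t p\<bar> < d2 ==> mutual_info J K t' < mutual_info J K ?t + (c' - c)"
  by (elim exE conjE) (rule that, assumption, elim allE impE)
 \<comment> \<open>Within d the images stay close, within d2 the mutual information; the rounded
   table has to satisfy both.\<close>
 have dd: "0 < min d d2" using d d2 by simp
 obtain \<delta> n0 where \<delta>: "0 < \<delta>" and near: "\<And>n r c. [|n0\<le>n; (\<Sum>j\<in>J. r j) = n; (\<Sum>k\<in>K. c k) = n;
   \<And>j. j\<in>J ==> \<bar>real (r j)/n - (\<Sum>k\<in>K. ?t (j,k))\<bar> < \<delta>;
   \<And>k. k\<in>K ==> \<bar>real (c k)/n - (\<Sum>j\<in>J. ?t (j,k))\<bar> < \<delta>|] ==>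
   \<exists>N :: int list\<times>int list => nat. (\<forall>j\<in>J. (\<Sum>k\<in>K. N (j,k)) = r j) \<and> (\<forall>k\<in>K. (\<Sum>j\<in>J. N (j,k)) = c k) \<and>
    (\<forall>p\<in>J\<times>K. \<bar>real (N p)/n - ?t p\<bar> < min d d2)"
  using integer_table_near[OF fin tab_nonneg tm(3) dd] by blast
 obtain U V where ctl: "controls lw lx J K hs e d \<delta> \<alpha> \<beta> U V" using nb \<delta> by blast
 then have U: "openin W1_topology U" "\<alpha>\<in>U" and V: "openin weak_topology V" "\<beta>\<in>V" unfolding controls_def by blast+
 note U1 = ctl[unfolded controls_def, folded cw_def cx_def, THEN conjunct2, THEN conjunct2, THEN conjunct2, THEN conjunct2, THEN conjunct1]
  and V1 = ctl[unfolded controls_def, folded cw_def cx_def, THEN conjunct2, THEN conjunct2, THEN conjunct2, THEN conjunct2, THEN conjunct2]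
 have main: "\<exists>N :: int list\<times>int list => nat. N\<in>extensional (J\<times>K) \<and> (\<forall>j\<in>J. (\<Sum>k\<in>K. N (j,k)) = r j) \<and> (\<forall>k\<in>K. (\<Sum>j\<in>J. N (j,k)) = cc k) \<and>
     mutual_info J K (%p. N p/n)\<le>c' \<and>
     (\<forall>\<rho>'\<in>M11. marg1 \<rho>'\<in>U --> (\<forall>q\<in>J\<times>K. tab lw lx \<rho>' q = real (N q)/n) --> Fmap \<rho>'\<in>G)"
  if n: "n0\<le>n" and ab: "\<alpha>'\<in>U" "\<beta>'\<in>V" and s: "(\<Sum>j\<in>J. r j) = n" "(\<Sum>k\<in>K. cc k) = n"
   and m: "\<forall>j\<in>J. real (r j)/n = measure \<alpha>' {w\<in>{0..}. lw w = j}" "\<forall>k\<in>K. real (cc k)/n = measure \<beta>' {x. lx x = k}"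
  for n \<alpha>' \<beta>' r cc
 proof -
  have 1: "\<bar>real (r j)/n - (\<Sum>k\<in>K. ?t (j,k))\<bar> < \<delta>" if "j\<in>J" for j
   using U1[rule_format, OF ab(1)] that m(1) unfolding tm(1) dist_real_def cw_def by simp
  have 2: "\<bar>real (cc k)/n - (\<Sum>j\<in>J. ?t (j,k))\<bar> < \<delta>" if "k\<in>K" for k
   using V1[rule_format, OF ab(2) that] m(2) that unfolding tm(2) dist_real_def cx_def by simp
  obtain N0 :: "int list\<times>int list => nat" where N0: "\<forall>j\<in>J. (\<Sum>k\<in>K. N0 (j,k)) = r j" "\<forall>k\<in>K. (\<Sum>j\<in>J. N0 (j,k)) = cc k"
    "\<forall>p\<in>J\<times>K. \<bar>real (N0 p)/n - ?t p\<bar> < min d d2"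
   using near[OF n s 1 2] by blast
  define N where "N = restrict N0 (J\<times>K)"
  have N: "\<forall>j\<in>J. (\<Sum>k\<in>K. N (j,k)) = r j" "\<forall>k\<in>K. (\<Sum>j\<in>J. N (j,k)) = cc k"
    "\<forall>p\<in>J\<times>K. \<bar>real (N p)/n - ?t p\<bar> < min d d2" "N\<in>extensional (J\<times>K)"
   using N0 by (simp_all add: N_def)
  have "mutual_info J K (%p. N p/n) < mutual_info J K ?t + (c' - c)"
   by (rule MI2) (use N(3) in auto)
  then have MIc: "mutual_info J K (%p. N p/n)\<le>c'" using MI by simp
  have FG: "Fmap \<rho>'\<in>G" if \<rho>': "\<rho>'\<in>M11" "marg1 \<rho>'\<in>U" "\<forall>q\<in>J\<times>K. tab lw lx \<rho>' q = real (N q)/n" for \<rho>'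
  proof -
   have "\<forall>q\<in>J\<times>K. \<bar>tab lw lx \<rho>' q - tab lw lx \<rho> q\<bar> < d" using \<rho>'(3) N(3) by simp
   then have "near hs e (Fmap \<rho>') (Fmap \<rho>)"
    using U1[rule_format, OF \<rho>'(2)] \<rho>'(1) \<rho> \<alpha>_def[symmetric] by blast
   then show ?thesis using hs(4)[rule_format, OF Fmap_M1[OF \<rho>'(1)]] by blast
  qed
  then have FG': "\<forall>\<rho>'\<in>M11. marg1 \<rho>'\<in>U --> (\<forall>q\<in>J\<times>K. tab lw lx \<rho>' q = real (N q)/n) --> Fmap \<rho>'\<in>G" by blast
  show ?thesis by (intro exI[of _ N] conjI N(1,2,4) MIc FG')
 qed
 show thesis by (rule that[OF cells U[unfolded \<alpha>_def] V[unfolded \<beta>_def], of n0], unfold roundable_def, intro allI impI ballI, rule main)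
qed

section \<open>Empirical measures\<close>

lemma measurable_point_measure: "x ` A\<subseteq>space K ==> x\<in>measurable (point_measure A f) K"
 by (auto simp: space_point_measure measurable_def sets_point_measure)

lemma nn_integral_weighted_empirical:
 assumes x: "\<And>i. i\<in>{1..n} ==> x i\<in>space K" and h: "h\<in>borel_measurable K"
 shows "(\<integral>\<^sup>+y. h y\<partial>weighted_empirical K n w x) = (\<Sum>i=1..n. ennreal (w i/real n)*h (x i))"
proof -
 have m: "x\<in>measurable (point_measure {1..n} (%i. ennreal (w i/real n))) K"
  by (rule measurable_point_measure) (use x in auto)
 show ?thesis unfolding weighted_empirical_def
  by (subst nn_integral_distr[OF m]) (simp_all add: h nn_integral_point_measure_finite)
qed

lemma integral_weighted_empirical:
 fixes h :: "'a => real"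
 assumes x: "\<And>i. i\<in>{1..n} ==> x i\<in>space K" and h: "h\<in>borel_measurable K" and w: "\<And>i. i\<in>{1..n} ==> 0\<le>w i"
 shows "(\<integral>y. h y\<partial>weighted_empirical K n w x) = (\<Sum>i=1..n. w i*h (x i))/n"
proof -
 have m: "x\<in>measurable (point_measure {1..n} (%i. ennreal (w i/real n))) K"
  by (rule measurable_point_measure) (use x in auto)
 have "(\<integral>y. h y\<partial>weighted_empirical K n w x) = (\<integral>i. h (x i)\<partial>point_measure {1..n} (%i. ennreal (w i/real n)))"
  unfolding weighted_empirical_def by (rule integral_distr[OF m h])
 also have "\<dots> = (\<Sum>i=1..n. w i/n*h (x i))"
  by (subst lebesgue_integral_point_measure_finite) (use w in auto)
 finally show ?thesis by (simp add: sum_divide_distrib)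
qed

lemma weighted_empirical_prob:
 fixes w :: "nat => real"
 assumes x: "\<And>i. i\<in>{1..n} ==> x i\<in>space K" and w: "\<And>i. i\<in>{1..n} ==> 0\<le>w i" and s: "(\<Sum>i=1..n. w i) = n" and n: "1\<le>n"
 shows "weighted_empirical K n w x\<in>space (prob_algebra K)"
proof -
 let ?P = "weighted_empirical K n w x"
 have sets: "sets ?P = sets K" by (simp add: weighted_empirical_def)
 have "emeasure ?P (space K) = (\<Sum>i=1..n. ennreal (w i/real n)*emeasure (return K (x i)) (space K))"
  by (rule emeasure_weighted_empirical[OF x]) auto
 also have "\<dots> = (\<Sum>i=1..n. ennreal (w i/real n))"
  by (rule sum.cong) (use x in auto)
 also have "\<dots> = ennreal (\<Sum>i=1..n. w i/real n)" by (rule sum_ennreal) (use w in auto)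
 also have "(\<Sum>i=1..n. w i/real n) = 1" using s n by (simp flip: sum_divide_distrib)
 finally have "emeasure ?P (space ?P) = 1" using sets_eq_imp_space_eq[OF sets] by simp
 then have "prob_space ?P" by (rule prob_spaceI)
 then show ?thesis unfolding space_prob_algebra using sets by simp
qed

abbreviation empirical :: "'a measure => nat => (nat => 'a) => 'a measure" where
 "empirical K n x \<equiv> weighted_empirical K n (%_. 1) x"

lemma empirical_prob: "(\<And>i. i\<in>{1..n} ==> x i\<in>space K) ==> 1\<le>n ==> empirical K n x\<in>space (prob_algebra K)"
 by (rule weighted_empirical_prob) auto

lemma measure_empirical:
 assumes x: "\<And>i. i\<in>{1..n} ==> x i\<in>space K" and A: "A\<in>sets K" and n: "1\<le>n"
 shows "measure (empirical K n x) A = real (card {i\<in>{1..n}. x i\<in>A})/n"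
proof -
 have "emeasure (empirical K n x) A = (\<Sum>i=1..n. ennreal (1/real n)*emeasure (return K (x i)) A)"
  by (rule emeasure_weighted_empirical[OF x A])
 also have "\<dots> = (\<Sum>i=1..n. ennreal (1/real n*indicator A (x i)))"
  using A by (intro sum.cong) (auto simp: indicator_def)
 also have "\<dots> = ennreal (\<Sum>i=1..n. 1/real n*indicator A (x i))" by (rule sum_ennreal) auto
 also have "(\<Sum>i=1..n. 1/real n*indicator A (x i)) = (\<Sum>i\<in>{i\<in>{1..n}. x i\<in>A}. 1/real n)"
  by (rule sum.mono_neutral_cong_right) (auto simp: indicator_def)
 also have "\<dots> = real (card {i\<in>{1..n}. x i\<in>A})/n" by simp
 finally show ?thesis by (simp add: measure_def)
qed

lemma distr_empirical:
 assumes x: "\<And>i. i\<in>{1..n} ==> x i\<in>space K" and f: "f\<in>measurable K K'"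
 shows "distr (empirical K n x) K' f = empirical K' n (%i. f (x i))"
proof -
 have m: "x\<in>measurable (point_measure {1..n} (%i. ennreal (1/real n))) K"
  by (rule measurable_point_measure) (use x in auto)
 show ?thesis unfolding weighted_empirical_def
  by (subst distr_distr[OF f m]) (simp add: comp_def)
qed

lemma empirical_M11_Rplus:
 fixes w :: "nat => real"
 assumes w: "\<And>i. i\<in>{1..n} ==> 0\<le>w i" and s: "(\<Sum>i=1..n. w i) = n" and n: "1\<le>n"
 shows "empirical Rplus n w\<in>M11_Rplus"
proof -
 have wR: "w i\<in>space Rplus" if "i\<in>{1..n}" for i using w[OF that] by simp
 have "(\<integral>\<^sup>+x. ennreal x\<partial>empirical Rplus n w) = (\<Sum>i=1..n. ennreal (1/real n)*ennreal (w i))"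
  by (rule nn_integral_weighted_empirical[OF wR]) (use measurable_Rplus_real in auto)
 also have "\<dots> = (\<Sum>i=1..n. ennreal (w i/real n))"
  by (rule sum.cong[OF refl]) (use w in \<open>simp add: ennreal_mult[symmetric]\<close>)
 also have "\<dots> = ennreal (\<Sum>i=1..n. w i/real n)" by (rule sum_ennreal) (use w in auto)
 also have "(\<Sum>i=1..n. w i/real n) = 1" using s n by (simp flip: sum_divide_distrib)
 finally show ?thesis unfolding M11_Rplus_def using empirical_prob[OF wR n] by simp
qed

definition joint :: "nat => (nat => real) => (nat => 's::topological_space) => (real\<times>'s) measure" where
 "joint n w x = empirical RS n (%i. (w i,x i))"

context
 fixes n :: nat and w :: "nat => real" and x :: "nat => 's::topological_space"
 assumes w: "\<And>i. i\<in>{1..n} ==> 0\<le>w i" and s: "(\<Sum>i=1..n. w i) = n" and n: "1\<le>n"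
begin

lemma joint_space: "i\<in>{1..n} ==> (w i,x i)\<in>space RS"
 using w[of i] by (simp add: space_pair_measure)

lemma marg1_joint: "marg1 (joint n w x) = empirical Rplus n w"
 unfolding marg1_def joint_def by (subst distr_empirical[OF joint_space measurable_fst]) simp_all

lemma marg2_joint: "marg2 (joint n w x) = empirical borel n x"
 unfolding marg2_def joint_def by (subst distr_empirical[OF joint_space measurable_snd]) simp_all

lemma joint_M11: "joint n w x\<in>M11"
proof (rule M11I)
 show "joint n w x\<in>space (prob_algebra RS)" unfolding joint_def by (rule empirical_prob[OF joint_space n])
 show "marg1 (joint n w x)\<in>M11_Rplus" unfolding marg1_joint by (rule empirical_M11_Rplus[OF w s n])
qed

lemma Fmap_joint: "Fmap (joint n w x) = weighted_empirical borel n w x"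
proof (rule measure_eqI)
 fix A assume "A\<in>sets (Fmap (joint n w x))"
 then have A: "A\<in>sets borel" by (simp add: Fmap_def)
 have m1: "(%p. ennreal (fst p))\<in>borel_measurable RS"
  using measurable_compose[OF measurable_fst measurable_Rplus_real] by simp
 have m2: "(%p. indicator ({0..}\<times>A) p :: ennreal)\<in>borel_measurable RS"
  by (rule borel_measurable_indicator) (use A sets.top[of Rplus] in \<open>auto intro: pair_measureI\<close>)
 have m: "(%(w,x). ennreal w*indicator ({0..}\<times>A) (w,x))\<in>borel_measurable RS"
  using borel_measurable_times_ennreal[OF m1 m2] by (simp add: split_beta')
 have "emeasure (Fmap (joint n w x)) A = (\<integral>\<^sup>+(w,x). ennreal w*indicator ({0..}\<times>A) (w,x)\<partial>joint n w x)"
  by (rule emeasure_Fmap[OF joint_M11 A])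
 also have "\<dots> = (\<Sum>i=1..n. ennreal (1/real n)*(ennreal (w i)*indicator ({0..}\<times>A) (w i,x i)))"
  unfolding joint_def by (subst nn_integral_weighted_empirical[OF joint_space m]) simp_all
 also have "\<dots> = (\<Sum>i=1..n. ennreal (w i/real n)*emeasure (return borel (x i)) A)"
 proof (rule sum.cong[OF refl])
  fix i assume i: "i\<in>{1..n}"
  have "ennreal (1/real n)*ennreal (w i) = ennreal (w i/real n)"
   using w[OF i] by (simp add: ennreal_mult[symmetric])
  then show "ennreal (1/real n)*(ennreal (w i)*indicator ({0..}\<times>A) (w i,x i)) = ennreal (w i/real n)*emeasure (return borel (x i)) A"
   using w[OF i] A by (simp add: mult.assoc[symmetric] indicator_def)
 qed
 also have "\<dots> = emeasure (weighted_empirical borel n w x) A"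
  by (rule emeasure_weighted_empirical[symmetric]) (use A in auto)
 finally show "emeasure (Fmap (joint n w x)) A = emeasure (weighted_empirical borel n w x) A" .
qed (simp add: Fmap_def weighted_empirical_def)

lemma cell_empirical:
 assumes "cells lw lx J K"
 shows "j\<in>J ==> measure (empirical Rplus n w) {w\<in>{0..}. lw w = j} = real (counts {1..n} J (\<lambda>i\<in>{1..n}. lw (w i)) j)/n"
  "k\<in>K ==> measure (empirical borel n x) {x. lx x = k} = real (counts {1..n} K (\<lambda>i\<in>{1..n}. lx (x i)) k)/n"
  "q\<in>J\<times>K ==> tab lw lx (joint n w x) q = real (table {1..n} J K (\<lambda>i\<in>{1..n}. lw (w i)) (\<lambda>i\<in>{1..n}. lx (x i)) q)/n"
proof -
 interpret cells lw lx J K by fact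
 show "measure (empirical Rplus n w) {w\<in>{0..}. lw w = j} = real (counts {1..n} J (\<lambda>i\<in>{1..n}. lw (w i)) j)/n" if "j\<in>J"
 proof -
  have "measure (empirical Rplus n w) (cw j) = real (card {i\<in>{1..n}. w i\<in>cw j})/n"
   by (rule measure_empirical[OF _ cw_sets n]) (use w in simp)
  also have "{i\<in>{1..n}. w i\<in>cw j} = {i\<in>{1..n}. (\<lambda>i\<in>{1..n}. lw (w i)) i = j}" using w by (auto simp: cw_def)
  finally show ?thesis using that by (simp add: counts_def cw_def)
 qed
 show "measure (empirical borel n x) {x. lx x = k} = real (counts {1..n} K (\<lambda>i\<in>{1..n}. lx (x i)) k)/n" if "k\<in>K"
 proof -
  have "measure (empirical borel n x) (cx k) = real (card {i\<in>{1..n}. x i\<in>cx k})/n"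
   by (rule measure_empirical[OF _ cx_sets n]) simp
  also have "{i\<in>{1..n}. x i\<in>cx k} = {i\<in>{1..n}. (\<lambda>i\<in>{1..n}. lx (x i)) i = k}" by (auto simp: cx_def)
  finally show ?thesis using that by (simp add: counts_def cx_def)
 qed
 show "tab lw lx (joint n w x) q = real (table {1..n} J K (\<lambda>i\<in>{1..n}. lw (w i)) (\<lambda>i\<in>{1..n}. lx (x i)) q)/n" if q: "q\<in>J\<times>K"
 proof -
  obtain j k where jk: "q = (j,k)" "j\<in>J" "k\<in>K" using q by auto
  have "tab lw lx (joint n w x) q = measure (joint n w x) (cw j\<times>cx k)"
   unfolding tab_def jk(1) cell_times[OF M11D(4)[OF joint_M11]] ..
  also have "\<dots> = real (card {i\<in>{1..n}. (w i,x i)\<in>cw j\<times>cx k})/n"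
   unfolding joint_def by (rule measure_empirical[OF joint_space _ n]) (auto intro!: pair_measureI cw_sets cx_sets)
  also have "{i\<in>{1..n}. (w i,x i)\<in>cw j\<times>cx k} = {i\<in>{1..n}. (\<lambda>i\<in>{1..n}. lw (w i)) i = j \<and> (\<lambda>i\<in>{1..n}. lx (x i)) i = k}"
   using w by (auto simp: cw_def cx_def)
  finally show ?thesis using jk by (simp add: table_def)
 qed
qed

end

text \<open>This invariance makes events about the empirical measure compatible with
  exchangeability.\<close>

lemma empirical_permute:
 assumes \<sigma>: "\<sigma> permutes {1..n}" and x: "\<And>i. i\<in>{1..n} ==> x i\<in>space K"
 shows "empirical K n (%i. x (\<sigma> i)) = empirical K n x"
proof (rule measure_eqI)
 fix A assume "A\<in>sets (empirical K n (%i. x (\<sigma> i)))"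
 then have A: "A\<in>sets K" by (simp add: weighted_empirical_def)
 have x': "x (\<sigma> i)\<in>space K" if "i\<in>{1..n}" for i using x permutes_in_image[OF \<sigma>] that by simp
 have "emeasure (empirical K n (%i. x (\<sigma> i))) A = (\<Sum>i=1..n. ennreal (1/real n)*emeasure (return K (x (\<sigma> i))) A)"
  by (rule emeasure_weighted_empirical[OF x' A])
 also have "\<dots> = (\<Sum>i=1..n. ennreal (1/real n)*emeasure (return K (x i)) A)"
  using sum.permute[OF \<sigma>, of "%i. ennreal (1/real n)*emeasure (return K (x i)) A"] by (simp add: comp_def)
 also have "\<dots> = emeasure (empirical K n x) A"
  by (rule emeasure_weighted_empirical[OF x A, symmetric])
 finally show "emeasure (empirical K n (%i. x (\<sigma> i))) A = emeasure (empirical K n x) A" .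
qed (simp add: weighted_empirical_def)

lemma weighted_empirical_cong:
 assumes x: "\<And>i. i\<in>{1..n} ==> x i\<in>space K" and eq: "\<And>i. i\<in>{1..n} ==> x i = x' i" "\<And>i. i\<in>{1..n} ==> w i = w' i"
 shows "weighted_empirical K n w x = weighted_empirical K n w' x'"
proof (rule measure_eqI)
 fix A assume "A\<in>sets (weighted_empirical K n w x)"
 then have A: "A\<in>sets K" by (simp add: weighted_empirical_def)
 have x': "x' i\<in>space K" if "i\<in>{1..n}" for i using x[OF that] eq(1)[OF that] by simp
 have "emeasure (weighted_empirical K n w x) A = (\<Sum>i=1..n. ennreal (w i/real n)*emeasure (return K (x i)) A)"
  by (rule emeasure_weighted_empirical[OF x A])
 also have "\<dots> = (\<Sum>i=1..n. ennreal (w' i/real n)*emeasure (return K (x' i)) A)"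
  by (rule sum.cong[OF refl]) (use eq in simp)
 also have "\<dots> = emeasure (weighted_empirical K n w' x') A"
  by (rule emeasure_weighted_empirical[OF x' A, symmetric])
 finally show "emeasure (weighted_empirical K n w x) A = emeasure (weighted_empirical K n w' x') A" .
qed (simp add: weighted_empirical_def)

text \<open>The union of all open sets whose part in D is mapped into U. Measurability of empirical
  measures is reduced in this way to open sets of vectors, while \<Phi> needs to be controlled on D
  only.\<close>

lemma open_preimage:
 fixes \<Phi> :: "'z::topological_space => 'y"
 assumes "\<And>z. z\<in>D ==> \<Phi> z\<in>U ==> \<exists>Q. open Q \<and> z\<in>Q \<and> (\<forall>z'\<in>Q\<inter>D. \<Phi> z'\<in>U)"
 obtains Q where "open Q" "\<forall>z\<in>D. z\<in>Q \<longleftrightarrow> \<Phi> z\<in>U"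
proof (rule that[of "\<Union>{Q. open Q \<and> (\<forall>z'\<in>Q\<inter>D. \<Phi> z'\<in>U)}"])
 show "\<forall>z\<in>D. z\<in>\<Union>{Q. open Q \<and> (\<forall>z'\<in>Q\<inter>D. \<Phi> z'\<in>U)} \<longleftrightarrow> \<Phi> z\<in>U"
  using assms by fast
qed auto

lemma open_abs_less:
 fixes f :: "'z::topological_space => real"
 assumes "continuous_on UNIV f"
 shows "open {z. \<bar>f z - c\<bar> < e}"
 by (intro open_Collect_less continuous_intros assms)

text \<open>The integral of a test function is a finite sum, continuous in weights and points, and a
  weak neighbourhood involves finitely many of them. With all weights equal to 1 the ordinary
  empirical measure is covered as well.\<close>

lemma weak_preimage:
 fixes U :: "'s::topological_space measure set"
 assumes U: "openin weak_topology U" and n: "1\<le>n"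
 obtains Q :: "(nat => real\<times>'s) set" where "open Q"
  "\<forall>z\<in>{z. (\<forall>i\<in>{1..n}. 0\<le>fst (z i)) \<and> (\<Sum>i=1..n. fst (z i)) = real n}.
    z\<in>Q \<longleftrightarrow> weighted_empirical borel n (%i. fst (z i)) (%i. snd (z i))\<in>U"
proof (rule open_preimage[where U = U and D = "{z :: nat => real\<times>'s. (\<forall>i\<in>{1..n}. 0\<le>fst (z i)) \<and> (\<Sum>i=1..n. fst (z i)) = real n}"
   and \<Phi> = "%z. weighted_empirical borel n (%i. fst (z i)) (%i. snd (z i))"])
 let ?D = "{z :: nat => real\<times>'s. (\<forall>i\<in>{1..n}. 0\<le>fst (z i)) \<and> (\<Sum>i=1..n. fst (z i)) = real n}"
 let ?\<Phi> = "%z :: nat => real\<times>'s. weighted_empirical borel n (%i. fst (z i)) (%i. snd (z i))"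
 have pr: "?\<Phi> z\<in>M1" if "z\<in>?D" for z
  by (rule weighted_empirical_prob[OF _ _ _ n]) (use that in auto)
 have int: "(mean (?\<Phi> z) h) = (\<Sum>i=1..n. fst (z i)*h (snd (z i)))/n" if "z\<in>?D" "continuous_on UNIV h" for z and h :: "'s => real"
  by (rule integral_weighted_empirical) (use that borel_measurable_continuous_onI in auto)
 fix z assume z: "z\<in>?D" "?\<Phi> z\<in>U"
 obtain hs and e :: real where hs: "finite hs" "0 < e"
  "\<forall>h\<in>hs. bdd_cont (h :: 's => real)"
  "\<forall>\<nu>'\<in>M1. (near hs e \<nu>' (?\<Phi> z)) --> \<nu>'\<in>U"
  by (rule weak_nhds_basic[OF U z(2)]) (rule that)
 define I where "I h z' = (\<Sum>i=1..n. fst (z' i)*h (snd (z' i)))/n" for h :: "'s => real" and z' :: "nat => real\<times>'s"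
 have Ic: "continuous_on UNIV (I h)" if "continuous_on UNIV h" for h :: "'s => real"
 proof -
  have c1: "continuous_on UNIV (%z :: nat => real\<times>'s. fst (z i))" "continuous_on UNIV (%z :: nat => real\<times>'s. snd (z i))" for i
   by (intro continuous_on_fst continuous_on_snd continuous_on_product_coordinates)+
  have "continuous_on UNIV (%z :: nat => real\<times>'s. h (snd (z i)))" for i
   using continuous_on_compose2[OF that c1(2)] by simp
  then show ?thesis unfolding I_def using n by (intro continuous_intros c1) auto
 qed
 show "\<exists>Q. open Q \<and> z\<in>Q \<and> (\<forall>z'\<in>Q\<inter>?D. ?\<Phi> z'\<in>U)"
 proof (intro exI conjI ballI)
  show "open (\<Inter>h\<in>hs. {z'. \<bar>I h z' - I h z\<bar> < e})"
   using hs by (intro open_INT ballI open_abs_less Ic) auto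
  show "z\<in>(\<Inter>h\<in>hs. {z'. \<bar>I h z' - I h z\<bar> < e})" using hs(2) by simp
  fix z' assume z': "z'\<in>(\<Inter>h\<in>hs. {z'. \<bar>I h z' - I h z\<bar> < e})\<inter>?D"
  then have "z'\<in>?D" by blast
  have "near hs e (?\<Phi> z') (?\<Phi> z)"
  proof
   fix h assume h: "h\<in>hs"
   then have "\<bar>I h z' - I h z\<bar> < e" using z' by blast
   then show "\<bar>(mean (?\<Phi> z') h) - (mean (?\<Phi> z) h)\<bar> < e"
    using hs(3) h int[OF \<open>z' \<in> ?D\<close>, of h] int[OF z(1), of h] by (simp add: I_def)
  qed
  then show "?\<Phi> z'\<in>U" using hs(4) pr[OF \<open>z' \<in> ?D\<close>] by blast
 qed
qed (rule that)

text \<open>The coupling that moves z i to z' i for each index.\<close>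

lemma W1_empirical_le:
 assumes z: "\<And>i. i\<in>{1..n} ==> 0\<le>z i" "\<And>i. i\<in>{1..n} ==> 0\<le>z' i" and n: "1\<le>n"
 shows "W1 (empirical Rplus n z) (empirical Rplus n z')\<le>(\<Sum>i=1..n. \<bar>z i - z' i\<bar>)/n"
proof (rule W1_le)
 let ?\<pi> = "empirical (Rplus\<Otimes>\<^sub>MRplus) n (%i. (z i,z' i))"
 have sp: "(z i,z' i)\<in>space (Rplus\<Otimes>\<^sub>MRplus)" if "i\<in>{1..n}" for i using z that by (simp add: space_pair_measure)
 have d: "distr ?\<pi> Rplus fst = empirical Rplus n z" "distr ?\<pi> Rplus snd = empirical Rplus n z'"
  by (subst distr_empirical[OF sp measurable_fst]; simp)
    (subst distr_empirical[OF sp measurable_snd]; simp)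
 have p: "?\<pi>\<in>space (prob_algebra (Rplus\<Otimes>\<^sub>MRplus))" by (rule empirical_prob[OF sp n])
 show "?\<pi>\<in>couplings (empirical Rplus n z) (empirical Rplus n z')"
  unfolding couplings_def using p d by blast
 have "(%p. fst p)\<in>borel_measurable (Rplus\<Otimes>\<^sub>MRplus)" "(%p. snd p)\<in>borel_measurable (Rplus\<Otimes>\<^sub>MRplus)"
  using measurable_compose[OF measurable_fst measurable_Rplus_real]
    measurable_compose[OF measurable_snd measurable_Rplus_real] by simp_all
 then have cm: "(%p. ennreal \<bar>fst p - snd p\<bar>)\<in>borel_measurable (Rplus\<Otimes>\<^sub>MRplus)" by measurable
 have "cost ?\<pi> = (\<Sum>i=1..n. ennreal (1/real n)*ennreal \<bar>fst (z i,z' i) - snd (z i,z' i)\<bar>)"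
  unfolding cost_def by (rule nn_integral_weighted_empirical[OF sp cm])
 also have "\<dots> = (\<Sum>i=1..n. ennreal (\<bar>z i - z' i\<bar>/n))"
  by (rule sum.cong[OF refl]) (simp add: ennreal_mult[symmetric])
 also have "\<dots> = ennreal ((\<Sum>i=1..n. \<bar>z i - z' i\<bar>)/n)"
  by (subst sum_ennreal) (auto simp: sum_divide_distrib)
 finally show "cost ?\<pi>\<le>ennreal ((\<Sum>i=1..n. \<bar>z i - z' i\<bar>)/n)" by simp
qed (simp add: sum_nonneg)

lemma W1_preimage:
 assumes U: "openin W1_topology U" and n: "1\<le>n"
 obtains Q :: "(nat => real) set" where "open Q"
  "\<forall>z\<in>{z. (\<forall>i\<in>{1..n}. 0\<le>z i) \<and> (\<Sum>i=1..n. z i) = real n}. z\<in>Q \<longleftrightarrow> empirical Rplus n z\<in>U"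
proof (rule open_preimage[where U = U and D = "{z :: nat => real. (\<forall>i\<in>{1..n}. 0\<le>z i) \<and> (\<Sum>i=1..n. z i) = real n}"
   and \<Phi> = "empirical Rplus n"])
 let ?D = "{z :: nat => real. (\<forall>i\<in>{1..n}. 0\<le>z i) \<and> (\<Sum>i=1..n. z i) = real n}"
 fix z assume z: "z\<in>?D" "empirical Rplus n z\<in>U"
 obtain r where r: "0 < r" "W1_space.mball (empirical Rplus n z) r\<subseteq>U"
  using U z(2) unfolding W1_topology_def W1_space.openin_mtopology by blast
 have M: "empirical Rplus n z'\<in>M11_Rplus" if "z'\<in>?D" for z'
  by (rule empirical_M11_Rplus[OF _ _ n]) (use that in auto)
 let ?d = "%z'. (\<Sum>i=1..n. \<bar>z i - z' i\<bar>)/n"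
 show "\<exists>Q. open Q \<and> z\<in>Q \<and> (\<forall>z'\<in>Q\<inter>?D. empirical Rplus n z'\<in>U)"
 proof (intro exI conjI ballI)
  show "open {z'. ?d z' < r}"
   using n by (intro open_Collect_less continuous_intros continuous_on_product_coordinates) auto
  show "z\<in>{z'. ?d z' < r}" using r(1) by simp
  fix z' assume z': "z'\<in>{z'. ?d z' < r}\<inter>?D"
  then have z'D: "z'\<in>?D" and "?d z' < r" by blast+
  have "W1 (empirical Rplus n z) (empirical Rplus n z')\<le>?d z'"
   by (rule W1_empirical_le[OF _ _ n]) (use z(1) z'D in auto)
  then have "empirical Rplus n z'\<in>W1_space.mball (empirical Rplus n z) r"
   using \<open>?d z' < r\<close> M[OF z(1)] M[OF z'D] by simp
  then show "empirical Rplus n z'\<in>U" using r(2) by blast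
 qed
qed (rule that)

text \<open>The open sets above consist of full sequences, but only finitely many coordinates are
  random; a constant fills the rest. Second countability identifies the product \<sigma>-algebra
  with the Borel one.\<close>

lemma extend_measurable:
 fixes g :: "nat => 'w => 'b::second_countable_topology"
 assumes g: "\<And>i. i\<in>S ==> g i\<in>borel_measurable N"
 shows "(%\<omega> i. if i\<in>S then g i \<omega> else c)\<in>borel_measurable N"
proof -
 have "(%\<omega> i. if i\<in>S then g i \<omega> else c)\<in>measurable N (Pi\<^sub>M UNIV (%_. borel))"
 proof (rule measurable_PiM_single')
  show "(%\<omega>. if i\<in>S then g i \<omega> else c)\<in>borel_measurable N" for i using g[of i] by (cases "i\<in>S") auto
 qed (auto simp: space_PiM)
 then show ?thesis unfolding measurable_cong_sets[OF refl sets_PiM_equal_borel] .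
qed

section \<open>Exchangeable weights\<close>

lemma label_event:
 assumes l: "l\<in>measurable N (count_space (UNIV :: 'j::countable set))" and n: "1\<le>n"
 shows "{f\<in>space (Pi\<^sub>M {1..n::nat} (%_. N)). (\<lambda>i\<in>{1..n}. l (f i)) = a}\<in>sets (Pi\<^sub>M {1..n} (%_. N))"
  (is "{f\<in>space ?P. _}\<in>_")
proof (cases "a\<in>extensional {1..n}")
 case True
 have m: "(%f. l (f i))\<in>measurable ?P (count_space UNIV)" if "i\<in>{1..n}" for i
  by (rule measurable_compose[OF measurable_component_singleton[OF that] l])
 have "{f\<in>space ?P. (\<lambda>i\<in>{1..n}. l (f i)) = a} = space ?P\<inter>(\<Inter>i\<in>{1..n}. (%f. l (f i)) -` {a i}\<inter>space ?P)"
  using True n by (auto simp: fun_eq_iff extensional_def)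
 moreover have "(\<Inter>i\<in>{1..n}. (%f. l (f i)) -` {a i}\<inter>space ?P)\<in>sets ?P"
  using n measurable_sets[OF m] by (intro sets.finite_INT) auto
 ultimately show ?thesis by auto
next
 case False
 then have "{f\<in>space ?P. (\<lambda>i\<in>{1..n}. l (f i)) = a} = {}" by auto
 then show ?thesis by (simp only: sets.empty_sets)
qed

locale weighted_array = prob_space M for M :: "'w measure" +
 fixes n :: nat and W :: "nat => 'w => real" and X :: "nat => 'w => 's::polish_space"
 assumes n: "1\<le>n"
  and Wm: "\<And>i. i\<in>{1..n} ==> W i\<in>measurable M Rplus"
  and Xm: "\<And>i. i\<in>{1..n} ==> X i\<in>measurable M borel"
  and Wsum: "\<And>\<omega>. \<omega>\<in>space M ==> (\<Sum>i=1..n. W i \<omega>) = real n"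
  and exch: "exchangeable M Rplus n W"
  and ind: "independent_rv M (Pi\<^sub>M {1..n} (%_. borel)) (%\<omega>. \<lambda>i\<in>{1..n}. X i \<omega>)
      (Pi\<^sub>M {1..n} (%_. Rplus)) (%\<omega>. \<lambda>i\<in>{1..n}. W i \<omega>)"
begin

lemma W_nonneg: "\<omega>\<in>space M ==> i\<in>{1..n} ==> 0\<le>W i \<omega>"
 using measurable_space[OF Wm] by simp

abbreviation "alpha \<omega> \<equiv> empirical Rplus n (%i. W i \<omega>)"
abbreviation "beta \<omega> \<equiv> empirical borel n (%i. X i \<omega>)"
abbreviation "L \<omega> \<equiv> weighted_empirical borel n (%i. W i \<omega>) (%i. X i \<omega>)"
abbreviation "inW U \<equiv> {\<omega>\<in>space M. alpha \<omega>\<in>U}"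
abbreviation "inX V \<equiv> {\<omega>\<in>space M. beta \<omega>\<in>V}"
abbreviation "inL G \<equiv> {\<omega>\<in>space M. L \<omega>\<in>G}"
abbreviation "WP \<equiv> Pi\<^sub>M {1..n} (%_. Rplus)"
abbreviation "XP \<equiv> Pi\<^sub>M {1..n} (%_. borel :: 's measure)"
abbreviation "Wv \<omega> \<equiv> \<lambda>i\<in>{1..n}. W i \<omega>"
abbreviation "Xv \<omega> \<equiv> \<lambda>i\<in>{1..n}. X i \<omega>"

lemma Wv_measurable: "Wv\<in>measurable M WP" and Xv_measurable: "Xv\<in>measurable M XP"
 by (intro measurable_restrict Wm Xm; assumption)+

lemma alpha_M11: "\<omega>\<in>space M ==> alpha \<omega>\<in>M11_Rplus"
 by (rule empirical_M11_Rplus[OF W_nonneg Wsum n])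

text \<open>\<open>borel_of\<close> is generated by open sets, and their preimages are preimages of
  open sets of vectors.\<close>

lemma L_measurable: "L\<in>measurable M (borel_of weak_topology)"
 unfolding borel_of_def
proof (rule measurable_measure_of)
 show "{U. openin weak_topology U}\<subseteq>Pow (topspace (weak_topology :: 's measure topology))"
  by (rule subsetI) (simp only: mem_Collect_eq Pow_iff openin_subset)
 show "L\<in>space M \<rightarrow> topspace weak_topology"
  unfolding topspace_weak by (intro funcsetI weighted_empirical_prob[OF _ W_nonneg Wsum n]) simp_all
 fix U :: "'s measure set" assume "U\<in>{U. openin weak_topology U}"
 then have U: "openin weak_topology U" by simp
 obtain Q :: "(nat => real\<times>'s) set" where Q: "open Q"
  "\<forall>z\<in>{z. (\<forall>i\<in>{1..n}. 0\<le>fst (z i)) \<and> (\<Sum>i=1..n. fst (z i)) = real n}.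
    z\<in>Q \<longleftrightarrow> weighted_empirical borel n (%i. fst (z i)) (%i. snd (z i))\<in>U"
  by (rule weak_preimage[OF U n]) (rule that)
 define z where "z \<omega> = (%i. if i\<in>{1..n} then (W i \<omega>,X i \<omega>) else undefined)" for \<omega>
 have "(%\<omega>. (W i \<omega>,X i \<omega>))\<in>borel_measurable M" if "i\<in>{1..n}" for i
  using measurable_compose[OF Wm[OF that] measurable_Rplus_real] Xm[OF that] by (rule borel_measurable_Pair)
 then have zm: "z\<in>borel_measurable M" unfolding z_def[abs_def] by (rule extend_measurable)
 have "L \<omega>\<in>U \<longleftrightarrow> z \<omega>\<in>Q" if \<omega>: "\<omega>\<in>space M" for \<omega>
 proof -
  have "(\<Sum>i=1..n. fst (z \<omega> i)) = (\<Sum>i=1..n. W i \<omega>)" by (rule sum.cong) (auto simp: z_def)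
  then have "z \<omega>\<in>Q \<longleftrightarrow> weighted_empirical borel n (%i. fst (z \<omega> i)) (%i. snd (z \<omega> i))\<in>U"
   using W_nonneg[OF \<omega>] Wsum[OF \<omega>] by (intro Q(2)[rule_format]) (simp add: z_def)
  also have "weighted_empirical borel n (%i. fst (z \<omega> i)) (%i. snd (z \<omega> i)) = L \<omega>"
   by (rule weighted_empirical_cong) (auto simp: z_def)
  finally show ?thesis by simp
 qed
 then have "L -` U\<inter>space M = z -` Q\<inter>space M" by blast
 also have "\<dots>\<in>events" by (rule measurable_sets[OF zm]) (use Q(1) in simp)
 finally show "L -` U\<inter>space M\<in>events" .
qed

text \<open>Moves the event to the product space on which exchangeability and independence are
  formulated. The condition on the sum is carried along because only then does the empirical measure
  belong to \<open>M11_Rplus\<close>.\<close>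

lemma W_event:
 assumes U: "openin W1_topology U"
 obtains D where "D\<in>sets WP"
  "\<forall>f\<in>space WP. (\<Sum>i=1..n. f i) = real n --> (f\<in>D \<longleftrightarrow> empirical Rplus n f\<in>U)"
proof -
 obtain Q :: "(nat => real) set" where Q: "open Q"
  "\<forall>z\<in>{z. (\<forall>i\<in>{1..n}. 0\<le>z i) \<and> (\<Sum>i=1..n. z i) = real n}. z\<in>Q \<longleftrightarrow> empirical Rplus n z\<in>U"
  by (rule W1_preimage[OF U n]) (rule that)
 define z where "z f = (%i. if i\<in>{1..n} then f i else 0)" for f :: "nat => real"
 have "(%f. f i)\<in>borel_measurable WP" if "i\<in>{1..n}" for i
  using measurable_compose[OF measurable_component_singleton[OF that] measurable_Rplus_real] by simp
 then have zm: "z\<in>borel_measurable WP" unfolding z_def[abs_def] by (rule extend_measurable)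
 show thesis
 proof (rule that[of "z -` Q\<inter>space WP"])
  show "z -` Q\<inter>space WP\<in>sets WP" by (rule measurable_sets[OF zm]) (use Q(1) in simp)
  show "\<forall>f\<in>space WP. (\<Sum>i=1..n. f i) = real n --> (f\<in>z -` Q\<inter>space WP \<longleftrightarrow> empirical Rplus n f\<in>U)"
  proof (intro ballI impI)
   fix f assume f: "f\<in>space WP" "(\<Sum>i=1..n. f i) = real n"
   have f0: "0\<le>f i" if "i\<in>{1..n}" for i using f(1) that by (auto simp: space_PiM)
   have "(\<Sum>i=1..n. z f i) = (\<Sum>i=1..n. f i)" by (rule sum.cong) (auto simp: z_def)
   then have "z f\<in>Q \<longleftrightarrow> empirical Rplus n (z f)\<in>U"
    using f0 f(2) by (intro Q(2)[rule_format]) (simp add: z_def)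
   also have "empirical Rplus n (z f) = empirical Rplus n f"
    by (rule weighted_empirical_cong) (use f0 in \<open>auto simp: z_def\<close>)
   finally show "f\<in>z -` Q\<inter>space WP \<longleftrightarrow> empirical Rplus n f\<in>U" using f(1) by simp
  qed
 qed
qed

lemma X_event:
 assumes V: "openin weak_topology V"
 obtains D where "D\<in>sets XP" "\<forall>f\<in>space XP. f\<in>D \<longleftrightarrow> empirical borel n f\<in>V"
proof -
 obtain Q :: "(nat => real\<times>'s) set" where Q: "open Q"
  "\<forall>z\<in>{z. (\<forall>i\<in>{1..n}. 0\<le>fst (z i)) \<and> (\<Sum>i=1..n. fst (z i)) = real n}.
    z\<in>Q \<longleftrightarrow> weighted_empirical borel n (%i. fst (z i)) (%i. snd (z i))\<in>V"
  by (rule weak_preimage[OF V n]) (rule that)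
 \<comment> \<open>Constant weights 1 have sum n, so the weighted statement specialises to the
   points alone.\<close>
 define z :: "(nat => 's) => nat => real\<times>'s" where "z f = (%i. if i\<in>{1..n} then (1,f i) else undefined)" for f
 have "(%f. (1 :: real,f i))\<in>borel_measurable XP" if "i\<in>{1..n}" for i
  by (intro borel_measurable_Pair measurable_const measurable_component_singleton[OF that]) simp
 then have zm: "z\<in>borel_measurable XP" unfolding z_def[abs_def] by (rule extend_measurable)
 show thesis
 proof (rule that[of "z -` Q\<inter>space XP"])
  show "z -` Q\<inter>space XP\<in>sets XP" by (rule measurable_sets[OF zm]) (use Q(1) in simp)
  show "\<forall>f\<in>space XP. f\<in>z -` Q\<inter>space XP \<longleftrightarrow> empirical borel n f\<in>V"
  proof
   fix f assume f: "f\<in>space XP"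
   have "(\<Sum>i=1..n. fst (z f i)) = (\<Sum>i=1..n. 1)" by (rule sum.cong) (auto simp: z_def)
   then have "z f\<in>Q \<longleftrightarrow> weighted_empirical borel n (%i. fst (z f i)) (%i. snd (z f i))\<in>V"
    by (intro Q(2)[rule_format]) (simp add: z_def)
   also have "weighted_empirical borel n (%i. fst (z f i)) (%i. snd (z f i)) = empirical borel n f"
    by (rule weighted_empirical_cong) (auto simp: z_def)
   finally show "f\<in>z -` Q\<inter>space XP \<longleftrightarrow> empirical borel n f\<in>V" using f by simp
  qed
 qed
qed

lemma W_label_event:
 assumes U: "openin W1_topology U" and lw: "lw\<in>measurable Rplus (count_space (UNIV :: 'j::countable set))"
 obtains D where "D\<in>sets WP"
  "\<forall>f\<in>space WP. (\<Sum>i=1..n. f i) = real n --> (f\<in>D \<longleftrightarrow> empirical Rplus n f\<in>U \<and> (\<lambda>i\<in>{1..n}. lw (f i)) = a)"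
proof -
 obtain D where D: "D\<in>sets WP" "\<forall>f\<in>space WP. (\<Sum>i=1..n. f i) = real n --> (f\<in>D \<longleftrightarrow> empirical Rplus n f\<in>U)"
  by (rule W_event[OF U]) (rule that)
 then show thesis using D label_event[OF lw n, of a]
  by (intro that[of "D\<inter>{f\<in>space WP. (\<lambda>i\<in>{1..n}. lw (f i)) = a}"]) auto
qed

lemma X_label_event:
 assumes V: "openin weak_topology V" and lx: "lx\<in>measurable borel (count_space (UNIV :: 'k::countable set))"
 obtains D where "D\<in>sets XP"
  "\<forall>f\<in>space XP. f\<in>D \<longleftrightarrow> empirical borel n f\<in>V \<and> (\<lambda>i\<in>{1..n}. lx (f i)) = b"
proof -
 obtain D where D: "D\<in>sets XP" "\<forall>f\<in>space XP. f\<in>D \<longleftrightarrow> empirical borel n f\<in>V"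
  by (rule X_event[OF V]) (rule that)
 then show thesis using D label_event[OF lx n, of b]
  by (intro that[of "D\<inter>{f\<in>space XP. (\<lambda>i\<in>{1..n}. lx (f i)) = b}"]) auto
qed

lemma alpha_Wv: "\<omega>\<in>space M ==> empirical Rplus n (Wv \<omega>) = alpha \<omega>"
 by (rule weighted_empirical_cong) (use W_nonneg in auto)

lemma beta_Xv: "empirical borel n (Xv \<omega>) = beta \<omega>"
 by (rule weighted_empirical_cong) auto

text \<open>Each event is written as a preimage of a measurable set under the vector of weights or
  of points, since the hypotheses on W and X speak about these vectors only. The empirical measure
  of the weights is unchanged by permutations, so E may be kept in the exchangeability
  statement.\<close>

lemma labels:
 fixes lw :: "real => int list" and lx :: "'s => int list"
 assumes cells: "cells lw lx J K" and U: "openin W1_topology U" and V: "openin weak_topology V"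
 shows "random_labels M {1..n} J K (%\<omega>. \<lambda>i\<in>{1..n}. lw (W i \<omega>)) (%\<omega>. \<lambda>i\<in>{1..n}. lx (X i \<omega>))
  (inW U) (inX V)"
proof -
 interpret cells lw lx J K by fact
 let ?A = "%\<omega>. \<lambda>i\<in>{1..n}. lw (W i \<omega>)" and ?B = "%\<omega>. \<lambda>i\<in>{1..n}. lx (X i \<omega>)"
 let ?E = "(inW U)" and ?G = "(inX V)"
 have Wsp: "Wv \<omega>\<in>space WP" if "\<omega>\<in>space M" for \<omega> by (rule measurable_space[OF Wv_measurable that])
 have Xsp: "Xv \<omega>\<in>space XP" if "\<omega>\<in>space M" for \<omega> by (rule measurable_space[OF Xv_measurable that])
 have Ws: "(\<Sum>i=1..n. Wv \<omega> i) = real n" if "\<omega>\<in>space M" for \<omega>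
  using Wsum[OF that] by simp
 have AW: "(\<lambda>i\<in>{1..n}. lw (Wv \<omega> i)) = ?A \<omega>" and BX: "(\<lambda>i\<in>{1..n}. lx (Xv \<omega> i)) = ?B \<omega>" for \<omega>
  by (auto simp: fun_eq_iff)
 have evA: "\<exists>D\<in>sets WP. (\<forall>f\<in>space WP. (\<Sum>i=1..n. f i) = real n --> (f\<in>D \<longleftrightarrow> empirical Rplus n f\<in>U' \<and> (\<lambda>i\<in>{1..n}. lw (f i)) = a)) \<and>
   {\<omega>\<in>space M. alpha \<omega>\<in>U' \<and> ?A \<omega> = a} = Wv -` D\<inter>space M" if U': "openin W1_topology U'" for a U'
 proof -
  obtain D where D: "D\<in>sets WP" "\<forall>f\<in>space WP. (\<Sum>i=1..n. f i) = real n --> (f\<in>D \<longleftrightarrow> empirical Rplus n f\<in>U' \<and> (\<lambda>i\<in>{1..n}. lw (f i)) = a)"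
   by (rule W_label_event[OF U' lw]) (rule that)
  have "Wv \<omega>\<in>D \<longleftrightarrow> alpha \<omega>\<in>U' \<and> ?A \<omega> = a" if \<omega>: "\<omega>\<in>space M" for \<omega>
   using D(2)[rule_format, OF Wsp[OF \<omega>] Ws[OF \<omega>]] unfolding AW alpha_Wv[OF \<omega>] .
  then have "{\<omega>\<in>space M. alpha \<omega>\<in>U' \<and> ?A \<omega> = a} = Wv -` D\<inter>space M" by blast
  then show ?thesis using D by blast
 qed
 have evB: "\<exists>D\<in>sets XP. {\<omega>\<in>space M. beta \<omega>\<in>V' \<and> ?B \<omega> = b} = Xv -` D\<inter>space M" if V': "openin weak_topology V'" for b V'
 proof -
  obtain D where D: "D\<in>sets XP" "\<forall>f\<in>space XP. f\<in>D \<longleftrightarrow> empirical borel n f\<in>V' \<and> (\<lambda>i\<in>{1..n}. lx (f i)) = b"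
   by (rule X_label_event[OF V' lx]) (rule that)
  have "Xv \<omega>\<in>D \<longleftrightarrow> beta \<omega>\<in>V' \<and> ?B \<omega> = b" if \<omega>: "\<omega>\<in>space M" for \<omega>
   using D(2)[rule_format, OF Xsp[OF \<omega>]] unfolding BX beta_Xv .
  then have "{\<omega>\<in>space M. beta \<omega>\<in>V' \<and> ?B \<omega> = b} = Xv -` D\<inter>space M" by blast
  then show ?thesis using D(1) by blast
 qed
 have Eev: "?E\<in>events"
 proof -
  obtain D where D: "D\<in>sets WP" "\<forall>f\<in>space WP. (\<Sum>i=1..n. f i) = real n --> (f\<in>D \<longleftrightarrow> empirical Rplus n f\<in>U)"
   by (rule W_event[OF U]) (rule that)
  have "Wv \<omega>\<in>D \<longleftrightarrow> alpha \<omega>\<in>U" if \<omega>: "\<omega>\<in>space M" for \<omega>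
   using D(2)[rule_format, OF Wsp[OF \<omega>] Ws[OF \<omega>]] unfolding alpha_Wv[OF \<omega>] .
  then have "?E = Wv -` D\<inter>space M" by blast
  then show ?thesis using measurable_sets[OF Wv_measurable D(1)] by simp
 qed
 have Gev: "?G\<in>events"
 proof -
  obtain D where D: "D\<in>sets XP" "\<forall>f\<in>space XP. f\<in>D \<longleftrightarrow> empirical borel n f\<in>V"
   by (rule X_event[OF V]) (rule that)
  have "Xv \<omega>\<in>D \<longleftrightarrow> beta \<omega>\<in>V" if \<omega>: "\<omega>\<in>space M" for \<omega>
   using D(2)[rule_format, OF Xsp[OF \<omega>]] unfolding beta_Xv .
  then have "?G = Xv -` D\<inter>space M" by blast
  then show ?thesis using measurable_sets[OF Xv_measurable D(1)] by simp
 qed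
 show ?thesis
 proof
  show "finite {1..n}" "finite J" "finite K" using fin by auto
  show "{1..n}\<noteq>{}" using n by simp
  show "?A \<omega>\<in>{1..n} \<rightarrow>\<^sub>E J" "?B \<omega>\<in>{1..n} \<rightarrow>\<^sub>E K" for \<omega> using rng by auto
  show "?E\<in>events" "?G\<in>events" by fact+
  show "{\<omega>\<in>space M. ?A \<omega> = a}\<in>events" for a
  proof -
   \<comment> \<open>Taking the whole space for the open set makes the condition on the empirical
     measure vacuous.\<close>
   obtain D where D: "D\<in>sets WP" "{\<omega>\<in>space M. alpha \<omega>\<in>topspace W1_topology \<and> ?A \<omega> = a} = Wv -` D\<inter>space M"
    using evA[OF openin_topspace, of a] by blast
   moreover have "{\<omega>\<in>space M. alpha \<omega>\<in>topspace W1_topology \<and> ?A \<omega> = a} = {\<omega>\<in>space M. ?A \<omega> = a}"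
    using alpha_M11 by auto
   ultimately show ?thesis using measurable_sets[OF Wv_measurable D(1)] by simp
  qed
  show "{\<omega>\<in>space M. ?B \<omega> = b}\<in>events" for b
  proof -
   obtain D where D: "D\<in>sets XP" "{\<omega>\<in>space M. beta \<omega>\<in>topspace weak_topology \<and> ?B \<omega> = b} = Xv -` D\<inter>space M"
    using evB[OF openin_topspace, of b] by blast
   moreover have "{\<omega>\<in>space M. beta \<omega>\<in>topspace weak_topology \<and> ?B \<omega> = b} = {\<omega>\<in>space M. ?B \<omega> = b}"
    using empirical_prob[OF _ n, of _ borel] by (auto simp: topspace_weak)
   ultimately show ?thesis using measurable_sets[OF Xv_measurable D(1)] by simp
  qed
  show "prob {\<omega>\<in>?E. ?A \<omega> = (\<lambda>i\<in>{1..n}. a (\<sigma> i))} = prob {\<omega>\<in>?E. ?A \<omega> = a}"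
   if \<sigma>: "\<sigma> permutes {1..n}" and a: "a\<in>{1..n} \<rightarrow>\<^sub>E J" for \<sigma> a
  proof -
   \<comment> \<open>Prescribing the label vector a permuted by \<sigma> is the same as prescribing
     a for the weights permuted by the inverse.\<close>
   define \<tau> where "\<tau> = inv \<sigma>"
   have \<tau>: "\<tau> permutes {1..n}" unfolding \<tau>_def by (rule permutes_inv[OF \<sigma>])
   have \<sigma>\<tau>: "\<sigma> (\<tau> i) = i" "\<tau> (\<sigma> i) = i" for i unfolding \<tau>_def using permutes_inverses[OF \<sigma>] by auto
   obtain D where D: "D\<in>sets WP"
    "\<forall>f\<in>space WP. (\<Sum>i=1..n. f i) = real n --> (f\<in>D \<longleftrightarrow> empirical Rplus n f\<in>U \<and> (\<lambda>i\<in>{1..n}. lw (f i)) = a)"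
    by (rule W_label_event[OF U lw]) (rule that)
   let ?Wt = "%\<omega>. \<lambda>i\<in>{1..n}. W (\<tau> i) \<omega>"
   have \<tau>in: "\<tau> i\<in>{1..n}" if "i\<in>{1..n}" for i using permutes_in_image[OF \<tau>] that by simp
   have Wtm: "?Wt\<in>measurable M WP" by (intro measurable_restrict Wm \<tau>in)
   have "prob (?Wt -` D\<inter>space M) = measure (distr M WP ?Wt) D" by (rule measure_distr[OF Wtm D(1), symmetric])
   also have "\<dots> = measure (distr M WP Wv) D" using exch \<tau> unfolding exchangeable_def by simp
   also have "\<dots> = prob (Wv -` D\<inter>space M)" by (rule measure_distr[OF Wv_measurable D(1)])
   finally have eq: "prob (?Wt -` D\<inter>space M) = prob (Wv -` D\<inter>space M)" .
   have "Wv \<omega>\<in>D \<longleftrightarrow> alpha \<omega>\<in>U \<and> ?A \<omega> = a" if \<omega>: "\<omega>\<in>space M" for \<omega>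
    using D(2)[rule_format, OF Wsp[OF \<omega>] Ws[OF \<omega>]] unfolding AW alpha_Wv[OF \<omega>] .
   then have 1: "Wv -` D\<inter>space M = {\<omega>\<in>?E. ?A \<omega> = a}" by blast
   have 2: "?Wt -` D\<inter>space M = {\<omega>\<in>?E. ?A \<omega> = (\<lambda>i\<in>{1..n}. a (\<sigma> i))}"
   proof -
    have "?Wt \<omega>\<in>D \<longleftrightarrow> alpha \<omega>\<in>U \<and> ?A \<omega> = (\<lambda>i\<in>{1..n}. a (\<sigma> i))" if \<omega>: "\<omega>\<in>space M" for \<omega>
    proof -
     have "(\<Sum>i=1..n. ?Wt \<omega> i) = (\<Sum>i=1..n. W (\<tau> i) \<omega>)" by simp
     also have "\<dots> = (\<Sum>i=1..n. W i \<omega>)" using sum.permute[OF \<tau>, of "%i. W i \<omega>"] by (simp add: comp_def)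
     finally have s: "(\<Sum>i=1..n. ?Wt \<omega> i) = real n" using Wsum[OF \<omega>] by simp
     have "empirical Rplus n (?Wt \<omega>) = empirical Rplus n (%i. W (\<tau> i) \<omega>)"
      by (rule weighted_empirical_cong) (use W_nonneg[OF \<omega> \<tau>in] in auto)
     also have "\<dots> = alpha \<omega>" by (rule empirical_permute[OF \<tau>]) (use W_nonneg[OF \<omega>] in auto)
     finally have al: "empirical Rplus n (?Wt \<omega>) = alpha \<omega>" .
     have "(\<lambda>i\<in>{1..n}. lw (?Wt \<omega> i)) = a \<longleftrightarrow> (\<forall>i\<in>{1..n}. lw (W (\<tau> i) \<omega>) = a i)"
      using a by (auto simp: fun_eq_iff PiE_iff extensional_def)
     also have "\<dots> \<longleftrightarrow> (\<forall>i\<in>{1..n}. lw (W i \<omega>) = a (\<sigma> i))"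
      using \<sigma>\<tau> permutes_in_image[OF \<sigma>] permutes_in_image[OF \<tau>] by metis
     also have "\<dots> \<longleftrightarrow> ?A \<omega> = (\<lambda>i\<in>{1..n}. a (\<sigma> i))" by (auto simp: fun_eq_iff)
     finally show ?thesis
      using D(2)[rule_format, OF measurable_space[OF Wtm \<omega>] s] unfolding al by blast
    qed
    then show ?thesis by blast
   qed
   show ?thesis using eq unfolding 1 2 .
  qed
  show "prob {\<omega>\<in>?E\<inter>?G. ?A \<omega> = a \<and> ?B \<omega> = b} = prob {\<omega>\<in>?E. ?A \<omega> = a} * prob {\<omega>\<in>?G. ?B \<omega> = b}" for a b
  proof -
   obtain D where D: "D\<in>sets WP" "{\<omega>\<in>space M. alpha \<omega>\<in>U \<and> ?A \<omega> = a} = Wv -` D\<inter>space M"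
    using evA[OF U, of a] by blast
   obtain D' where D': "D'\<in>sets XP" "{\<omega>\<in>space M. beta \<omega>\<in>V \<and> ?B \<omega> = b} = Xv -` D'\<inter>space M"
    using evB[OF V, of b] by blast
   have isx: "indep_set {Xv -` S\<inter>space M |S. S\<in>sets XP} {Wv -` S\<inter>space M |S. S\<in>sets WP}"
    using ind unfolding independent_rv_def by blast
   have "prob ((Xv -` D'\<inter>space M)\<inter>(Wv -` D\<inter>space M)) = prob (Xv -` D'\<inter>space M)*prob (Wv -` D\<inter>space M)"
    by (rule indep_setD[OF isx]) (use D(1) D'(1) in blast)+
   moreover have "{\<omega>\<in>?E\<inter>?G. ?A \<omega> = a \<and> ?B \<omega> = b} = (Xv -` D'\<inter>space M)\<inter>(Wv -` D\<inter>space M)"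
    unfolding D(2)[symmetric] D'(2)[symmetric] by auto
   moreover have "{\<omega>\<in>?E. ?A \<omega> = a} = Wv -` D\<inter>space M" "{\<omega>\<in>?G. ?B \<omega> = b} = Xv -` D'\<inter>space M"
    unfolding D(2)[symmetric] D'(2)[symmetric] by auto
   ultimately show ?thesis by (simp only: mult.commute)
  qed
 qed
qed

end

lemma mutual_info_cong: "(\<And>p. p\<in>J\<times>K ==> t p = t' p) ==> mutual_info J K t = mutual_info J K t'"
 unfolding mutual_info_def by (intro arg_cong2[of _ _ _ _ minus] sum.cong refl arg_cong[of _ _ eta]) auto

lemma sum_counts:
 assumes "finite S" "finite J" "a ` S\<subseteq>J"
 shows "(\<Sum>j\<in>J. counts S J a j) = card S"
proof -
 have "(\<Sum>j\<in>J. counts S J a j) = (\<Sum>j\<in>J. \<Sum>i\<in>{i\<in>S. a i = j}. 1)" by (simp add: counts_def)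
 also have "\<dots> = (\<Sum>i\<in>S. 1)" by (rule sum.group) (use assms in auto)
 finally show ?thesis by simp
qed

context weighted_array
begin

lemma L_event: "openin weak_topology G ==> (inL G)\<in>events"
 using measurable_sets[OF L_measurable openin_sets_borel_of, of G] by (simp add: vimage_def Int_def conj_commute)

text \<open>The implication \<open>imp\<close> is deterministic and is applied to the joint
  empirical measure of each outcome: if L misses G although both marginals are near, the mutual
  information of the table must exceed c.\<close>

lemma prob_upper:
 fixes lw :: "real => int list" and lx :: "'s => int list"
 assumes cells: "cells lw lx J K" and U: "openin W1_topology U" and V: "openin weak_topology V" and c: "0\<le>c"
  and imp: "\<forall>\<rho>\<in>M11. marg1 \<rho>\<in>U --> marg2 \<rho>\<in>V --> mutual_info J K (tab lw lx \<rho>)\<le>c --> Fmap \<rho>\<in>G"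
 shows "prob {\<omega>\<in>space M. alpha \<omega>\<in>U \<and> beta \<omega>\<in>V \<and> L \<omega>\<notin>G} \<le>
  (real n + 1)^(card (J\<times>K) + 2*(card J + card K))*exp (- real n*c) *
   (prob (inW U)*prob (inX V))"
proof -
 let ?A = "%\<omega>. \<lambda>i\<in>{1..n}. lw (W i \<omega>)" and ?B = "%\<omega>. \<lambda>i\<in>{1..n}. lx (X i \<omega>)"
 let ?E = "(inW U)" and ?G = "(inX V)"
 interpret R: random_labels M "{1..n}" J K ?A ?B ?E ?G by (rule labels[OF cells U V])
 let ?T = "%\<omega>. %p. real (table {1..n} J K (?A \<omega>) (?B \<omega>) p)/real n"
 have sub: "{\<omega>\<in>space M. alpha \<omega>\<in>U \<and> beta \<omega>\<in>V \<and> L \<omega>\<notin>G}\<subseteq>{\<omega>\<in>?E\<inter>?G. c < mutual_info J K (?T \<omega>)}"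
 proof
  fix \<omega> assume "\<omega>\<in>{\<omega>\<in>space M. alpha \<omega>\<in>U \<and> beta \<omega>\<in>V \<and> L \<omega>\<notin>G}"
  then have \<omega>: "\<omega>\<in>space M" "alpha \<omega>\<in>U" "beta \<omega>\<in>V" "L \<omega>\<notin>G" by blast+
  note J = W_nonneg[OF \<omega>(1)] Wsum[OF \<omega>(1)] n
  let ?\<rho> = "joint n (%i. W i \<omega>) (%i. X i \<omega>)"
  have m: "?\<rho>\<in>M11" "marg1 ?\<rho> = alpha \<omega>" "marg2 ?\<rho> = beta \<omega>" "Fmap ?\<rho> = L \<omega>"
   by (rule joint_M11[OF J] marg1_joint[OF J] marg2_joint[OF J] Fmap_joint[OF J]; assumption)+
  have "mutual_info J K (?T \<omega>) = mutual_info J K (tab lw lx ?\<rho>)"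
   by (rule mutual_info_cong, rule cell_empirical(3)[OF J cells, symmetric]; assumption)
  moreover have "\<not> mutual_info J K (tab lw lx ?\<rho>)\<le>c"
  proof
   assume "mutual_info J K (tab lw lx ?\<rho>)\<le>c"
   then have "Fmap ?\<rho>\<in>G" using imp m(1) \<omega>(2,3) unfolding m(2,3)[symmetric] by blast
   then show False using \<omega>(4) m(4) by simp
  qed
  ultimately show "\<omega>\<in>{\<omega>\<in>?E\<inter>?G. c < mutual_info J K (?T \<omega>)}" using \<omega> by simp
 qed
 have "prob {\<omega>\<in>space M. alpha \<omega>\<in>U \<and> beta \<omega>\<in>V \<and> L \<omega>\<notin>G}\<le>prob {\<omega>\<in>?E\<inter>?G. c < mutual_info J K (?T \<omega>)}"
  by (rule finite_measure_mono[OF sub R.AB_event])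
 also have "\<dots>\<le>(real n + 1)^(card (J\<times>K) + 2*(card J + card K))*exp (- real n*c)*(prob ?E*prob ?G)"
  using R.upper_bound[OF c] unfolding card_atLeastAtMost diff_Suc_1 .
 finally show ?thesis .
qed

text \<open>The favourable tables are those which force the image of every coupling with first
  marginal in U into G, in particular that of the joint empirical measure. \<open>roundable\<close>
  provides such a table for every realised pair of margins.\<close>

lemma prob_lower:
 fixes lw :: "real => int list" and lx :: "'s => int list"
 assumes cells: "cells lw lx J K" and U: "openin W1_topology U" and V: "openin weak_topology V" and G: "openin weak_topology G"
  and good: "roundable lw lx J K U V G h n"
 shows "exp (- real n*h)*(prob (inW U)*prob (inX V)) \<le>
  (real n + 1)^(2*(1 + card (J\<times>K)))*prob (inL G)"
proof -
 let ?A = "%\<omega>. \<lambda>i\<in>{1..n}. lw (W i \<omega>)" and ?B = "%\<omega>. \<lambda>i\<in>{1..n}. lx (X i \<omega>)"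
 let ?E = "(inW U)" and ?G = "(inX V)"
 define NN :: "(int list\<times>int list => nat) set" where "NN = {N. \<forall>\<rho>'\<in>M11. marg1 \<rho>'\<in>U --> (\<forall>q\<in>J\<times>K. tab lw lx \<rho>' q = real (N q)/n) --> Fmap \<rho>'\<in>G}"
 interpret cells lw lx J K by (rule cells)
 interpret R: random_labels M "{1..n}" J K ?A ?B ?E ?G by (rule labels[OF cells U V])
 have sub: "{\<omega>\<in>?E\<inter>?G. table {1..n} J K (?A \<omega>) (?B \<omega>)\<in>NN}\<subseteq>(inL G)"
 proof
  fix \<omega> assume "\<omega>\<in>{\<omega>\<in>?E\<inter>?G. table {1..n} J K (?A \<omega>) (?B \<omega>)\<in>NN}"
  then have \<omega>: "\<omega>\<in>space M" "alpha \<omega>\<in>U" "table {1..n} J K (?A \<omega>) (?B \<omega>)\<in>NN" by blast+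
  note J = W_nonneg[OF \<omega>(1)] Wsum[OF \<omega>(1)] n
  let ?\<rho> = "joint n (%i. W i \<omega>) (%i. X i \<omega>)"
  have m: "?\<rho>\<in>M11" "marg1 ?\<rho> = alpha \<omega>" "Fmap ?\<rho> = L \<omega>"
   by (rule joint_M11[OF J] marg1_joint[OF J] Fmap_joint[OF J]; assumption)+
  have "\<forall>q\<in>J\<times>K. tab lw lx ?\<rho> q = real (table {1..n} J K (?A \<omega>) (?B \<omega>) q)/n"
   by (rule ballI, rule cell_empirical(3)[OF J cells]; assumption)
  then have "Fmap ?\<rho>\<in>G" using \<omega>(3) m(1) \<omega>(2) unfolding NN_def m(2)[symmetric] by blast
  then show "\<omega>\<in>(inL G)" unfolding m(3) using \<omega>(1) by blast
 qed
 have lower: "exp (- real (card {1..n})*h)*(prob ?E*prob ?G)\<le>(real (card {1..n}) + 1)^(2*(1 + card (J\<times>K))) *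
   prob {\<omega>\<in>?E\<inter>?G. table {1..n} J K (?A \<omega>) (?B \<omega>)\<in>NN}"
 proof (rule R.lower_bound)
  fix \<omega> \<omega>' assume "\<omega>\<in>?E" "\<omega>'\<in>?G"
  then have \<omega>: "\<omega>\<in>space M" "alpha \<omega>\<in>U" and \<omega>': "\<omega>'\<in>space M" "beta \<omega>'\<in>V" by blast+
  let ?r = "counts {1..n} J (?A \<omega>)" and ?c = "counts {1..n} K (?B \<omega>')"
  note Jw = W_nonneg[OF \<omega>(1)] Wsum[OF \<omega>(1)] n
  note Jx = W_nonneg[OF \<omega>'(1)] Wsum[OF \<omega>'(1)] n
  have "(\<Sum>j\<in>J. ?r j) = n" "(\<Sum>k\<in>K. ?c k) = n"
   using sum_counts[of "{1..n}" J "?A \<omega>"] sum_counts[of "{1..n}" K "?B \<omega>'"] fin rng by auto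
  moreover have "\<forall>j\<in>J. real (?r j)/n = measure (alpha \<omega>) {w\<in>{0..}. lw w = j}"
   by (rule ballI, rule cell_empirical(1)[OF Jw cells, symmetric]; assumption)
  moreover have "\<forall>k\<in>K. real (?c k)/n = measure (beta \<omega>') {x. lx x = k}"
   by (rule ballI, rule cell_empirical(2)[OF Jx cells, symmetric]; assumption)
  ultimately obtain N where N: "N\<in>extensional (J\<times>K)" "\<forall>j\<in>J. (\<Sum>k\<in>K. N (j,k)) = ?r j" "\<forall>k\<in>K. (\<Sum>j\<in>J. N (j,k)) = ?c k"
    "mutual_info J K (%p. N p/n)\<le>h" "N\<in>NN"
   using good[unfolded roundable_def, rule_format, OF \<omega>(2) \<omega>'(2), of ?r ?c] unfolding NN_def mem_Collect_eq by blast
  have "(\<lambda>j\<in>J. \<Sum>k\<in>K. N (j,k)) = restrict ?r J" "(\<lambda>k\<in>K. \<Sum>j\<in>J. N (j,k)) = restrict ?c K"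
   using N(2,3) by (auto intro!: restrict_ext)
  moreover have "restrict ?r J = ?r" "restrict ?c K = ?c" unfolding counts_def by simp_all
  ultimately show "\<exists>N\<in>NN. N\<in>extensional (J\<times>K) \<and> (\<lambda>j\<in>J. \<Sum>k\<in>K. N (j,k)) = ?r \<and> (\<lambda>k\<in>K. \<Sum>j\<in>J. N (j,k)) = ?c \<and>
   mutual_info J K (%p. real (N p)/real (card {1..n}))\<le>h"
   using N(1,4) by (intro bexI[OF _ N(5)] conjI) simp_all
 qed
 have "exp (- real n*h)*(prob ?E*prob ?G)\<le>(real n + 1)^(2*(1 + card (J\<times>K))) *
   prob {\<omega>\<in>?E\<inter>?G. table {1..n} J K (?A \<omega>) (?B \<omega>)\<in>NN}"
  using lower unfolding card_atLeastAtMost diff_Suc_1 .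
 also have "\<dots>\<le>(real n + 1)^(2*(1 + card (J\<times>K)))*prob (inL G)"
  by (intro mult_left_mono finite_measure_mono[OF sub L_event[OF G]]) simp
 finally show ?thesis .
qed

end

section \<open>Goodness of the rate function\<close>

text \<open>Lower semicontinuity at a point of finite rate. When x - e is negative,
  \<open>ennreal\<close> maps it to 0 and the whole space serves.\<close>

lemma rate_nbhd:
 assumes l: "lower_semicontinuous T I" and y: "y\<in>topspace T" and x: "I y = ennreal x" "0\<le>x" and e: "0 < e"
 obtains U where "openin T U" "y\<in>U" "\<forall>z\<in>U. ennreal (x - e)\<le>I z"
proof (cases "0\<le>x - e")
 case True
 have "ennreal (x - e) < I y" unfolding x(1) using True e by (simp add: ennreal_less_iff)
 then show thesis using l y unfolding lower_semicontinuous_def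
  by (intro that[of "{z\<in>topspace T. ennreal (x - e) < I z}"]) auto
next
 case False
 then show thesis using y by (intro that[of "topspace T"]) (simp_all add: ennreal_neg)
qed

text \<open>A product of two compact level sets is compact, so local statements about pairs of
  marginals need be used for finitely many boxes only.\<close>

lemma level_cover:
 assumes g: "good_rate T I" "good_rate T' I'"
  and ex: "\<And>y z. y\<in>topspace T ==> z\<in>topspace T' ==> I y\<le>ennreal a ==> I' z\<le>ennreal a ==>
   \<exists>U V. openin T U \<and> y\<in>U \<and> openin T' V \<and> z\<in>V \<and> P U V"
 obtains Q where "finite Q" "\<forall>(U,V)\<in>Q. openin T U \<and> openin T' V \<and> P U V"
  "{y\<in>topspace T. I y\<le>ennreal a}\<times>{z\<in>topspace T'. I' z\<le>ennreal a}\<subseteq>(\<Union>(U,V)\<in>Q. U\<times>V)"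
proof -
 let ?S = "{y\<in>topspace T. I y\<le>ennreal a}" and ?S' = "{z\<in>topspace T'. I' z\<le>ennreal a}"
 define R where "R = {(U,V). openin T U \<and> openin T' V \<and> P U V}"
 have "compactin T ?S" "compactin T' ?S'" using g unfolding good_rate_def by (auto simp: less_top[symmetric])
 then have c: "compactin (prod_topology T T') (?S\<times>?S')" by (simp add: compactin_Times)
 have "\<exists>\<F>. finite \<F> \<and> \<F>\<subseteq>(%(U,V). U\<times>V) ` R \<and> ?S\<times>?S'\<subseteq>\<Union>\<F>"
 proof (rule compactinD[OF c])
  show "openin (prod_topology T T') O'" if "O'\<in>(%(U,V). U\<times>V) ` R" for O'
   using that by (auto simp: R_def openin_prod_Times_iff)
  show "?S\<times>?S'\<subseteq>\<Union> ((%(U,V). U\<times>V) ` R)"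
  proof
   fix p assume "p\<in>?S\<times>?S'"
   then obtain U V where "openin T U" "fst p\<in>U" "openin T' V" "snd p\<in>V" "P U V" using ex[of "fst p" "snd p"] by auto
   then show "p\<in>\<Union> ((%(U,V). U\<times>V) ` R)" by (intro UnionI[of "U\<times>V"] image_eqI[of _ _ "(U,V)"]) (auto simp: R_def mem_Times_iff)
  qed
 qed
 then obtain Q where "Q\<subseteq>R" "finite Q" "?S\<times>?S'\<subseteq>\<Union> ((%(U,V). U\<times>V) ` Q)"
  by (metis (no_types, lifting) finite_subset_image)
 then show thesis by (intro that[of Q]) (auto simp: R_def)
qed

text \<open>Compactness of the set of images, phrased with covers: choose for each finite subfamily
  a coupling whose image escapes it. The image of a cluster point lies in some G of the family,
  hence so do images of couplings chosen for subfamilies that contain G.\<close>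

lemma entropy_couplings_finite_cover:
 fixes \<beta> :: "'s::topological_space measure"
 assumes \<alpha>: "\<alpha>\<in>M11_Rplus" and \<beta>: "\<beta>\<in>M1" and c: "0\<le>c"
  and \<G>: "\<And>G. G\<in>\<G> ==> openin weak_topology G" and cov: "\<And>\<rho>. \<rho>\<in>entropy_couplings \<alpha> \<beta> c ==> Fmap \<rho>\<in>\<Union>\<G>"
 obtains \<F> where "finite \<F>" "\<F>\<subseteq>\<G>" "\<forall>\<rho>\<in>entropy_couplings \<alpha> \<beta> c. Fmap \<rho>\<in>\<Union>\<F>"
proof (rule ccontr)
 assume neg: "\<not> thesis"
 \<comment> \<open>For sets that are not finite subfamilies any coupling will do; one exists,
   because otherwise the empty subfamily would suffice.\<close>
 have "\<exists>\<rho>\<in>entropy_couplings \<alpha> \<beta> c. finite \<F> \<and> \<F>\<subseteq>\<G> --> Fmap \<rho>\<notin>\<Union>\<F>" for \<F>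
 proof (cases "finite \<F> \<and> \<F>\<subseteq>\<G>")
  case True
  then show ?thesis using neg that[of \<F>] by blast
 next
  case False
  have "entropy_couplings \<alpha> \<beta> c\<noteq>{}" using neg that[of "{}"] by auto
  then show ?thesis using False by blast
 qed
 then obtain \<rho> where \<rho>: "\<And>\<F>. \<rho> \<F>\<in>entropy_couplings \<alpha> \<beta> c" "\<And>\<F>. finite \<F> ==> \<F>\<subseteq>\<G> ==> Fmap (\<rho> \<F>)\<notin>\<Union>\<F>" by metis
 obtain F' \<rho>0 where F': "F'\<noteq>bot" "F'\<le>finite_subsets_at_top \<G>" "\<rho>0\<in>entropy_couplings \<alpha> \<beta> c"
  and lim: "\<And>h. continuous_on UNIV h ==> bounded (range h) ==> ((%\<F>. \<integral>x. h x\<partial>Fmap (\<rho> \<F>)) \<longlongrightarrow> (\<integral>x. (h x :: real)\<partial>Fmap \<rho>0)) F'"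
  by (rule entropy_couplings_cluster[OF \<alpha> \<beta> \<rho>(1) c tendsto_const, of "finite_subsets_at_top \<G>"]) (simp, rule that)
 obtain G where G: "G\<in>\<G>" "Fmap \<rho>0\<in>G" using cov[OF F'(3)] by blast
 obtain hs and e :: real where hs: "finite hs" "0 < e"
  "\<forall>h\<in>hs. bdd_cont (h :: 's => real)"
  "\<forall>\<nu>'\<in>M1. (near hs e \<nu>' (Fmap \<rho>0)) --> \<nu>'\<in>G"
  by (rule weak_nhds_basic[OF \<G>[OF G(1)] G(2)]) (rule that)
 have "\<forall>\<^sub>F \<F> in F'. near hs e (Fmap (\<rho> \<F>)) (Fmap \<rho>0)"
  using hs(1,3) tendstoD[OF lim hs(2)] by (subst eventually_ball_finite_distrib) (auto simp: dist_real_def)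
 moreover have "\<forall>\<^sub>F \<F> in F'. finite \<F> \<and> {G}\<subseteq>\<F> \<and> \<F>\<subseteq>\<G>"
  by (rule filter_leD[OF F'(2)], unfold eventually_finite_subsets_at_top, rule exI[of _ "{G}"], use G(1) in auto)
 ultimately have "\<forall>\<^sub>F \<F> in F'. False"
 proof eventually_elim
  case (elim \<F>)
  have "Fmap (\<rho> \<F>)\<in>M1" by (rule Fmap_M1[OF entropy_couplings_M11[OF \<rho>(1) \<alpha>]])
  then have "Fmap (\<rho> \<F>)\<in>G" using hs(4) elim(1) by blast
  then show False using \<rho>(2)[of \<F>] elim(2) by blast
 qed
 then show False using F'(1) by (simp add: eventually_False)
qed

lemma entropy_couplings_Jrate:
 assumes "\<rho>\<in>entropy_couplings \<alpha> \<beta> c" "0\<le>c" "0\<le>x" "0\<le>y" "IW \<alpha> = ennreal x" "IX \<beta> = ennreal y" "\<alpha>\<in>M11_Rplus"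
 shows "Krate IW IX (Fmap \<rho>)\<le>ennreal (c + x + y)"
proof -
 note r = entropy_couplingsD[OF assms(1)]
 have "Krate IW IX (Fmap \<rho>)\<le>Jrate IW IX \<rho>"
  unfolding Krate_def by (rule INF_lower) (use entropy_couplings_M11[OF assms(1,7)] in blast)
 also have "\<dots>\<le>ennreal c + ennreal x + ennreal y"
  unfolding Jrate_def r(2,3) assms(5,6) by (intro add_right_mono r(4))
 also have "\<dots> = ennreal (c + x + y)" using assms(2-4) by (simp add: ennreal_plus)
 finally show ?thesis .
qed

locale rate_functions =
 fixes IW :: "real measure => ennreal" and IX :: "'s::polish_space measure => ennreal"
 assumes lscW: "lower_semicontinuous W1_topology IW" and goodW: "good_rate W1_topology IW"
  and lscX: "lower_semicontinuous weak_topology IX" and goodX: "good_rate weak_topology IX"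
begin

text \<open>The infimum defining \<open>Krate\<close> is not known to be attained, so a point of
  level a is reached only by couplings of rate slightly above a. The local cover is therefore built
  with slack \<eta>, and the minimum of finitely many slacks is used at the end.\<close>

lemma good_rate_Krate: "good_rate weak_topology (Krate IW IX)"
 unfolding good_rate_def
proof (intro allI impI)
 fix a' :: ennreal assume "a' < \<infinity>"
 then obtain a where a: "a' = ennreal a" "0\<le>a" by (cases a') auto
 show "compactin weak_topology {\<nu>\<in>topspace weak_topology. Krate IW IX \<nu>\<le>a'}"
  unfolding compactin_def a(1)
 proof (intro conjI allI impI)
  fix \<G> :: "'s measure set set"
  assume "Ball \<G> (openin weak_topology) \<and> {\<nu>\<in>topspace weak_topology. Krate IW IX \<nu>\<le>ennreal a}\<subseteq>\<Union>\<G>"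
  then have op: "\<And>G. G\<in>\<G> ==> openin weak_topology G"
   and cov: "\<And>\<nu>. \<nu>\<in>M1 ==> Krate IW IX \<nu>\<le>ennreal a ==> \<nu>\<in>\<Union>\<G>" unfolding topspace_weak by blast+
  define good where "good U V \<longleftrightarrow> (\<exists>\<F> \<eta>. finite \<F> \<and> \<F>\<subseteq>\<G> \<and> 0 < \<eta> \<and> (\<forall>\<rho>\<in>M11. marg1 \<rho>\<in>U --> marg2 \<rho>\<in>V -->
   Jrate IW IX \<rho>\<le>ennreal (a + \<eta>) --> Fmap \<rho>\<in>\<Union>\<F>))" for U V
  \<comment> \<open>Level a + 1 instead of a leaves room for the marginals of nearly optimal
    couplings, whose rate is below a plus a slack of at most 1.\<close>
  have ex: "\<exists>U V. openin W1_topology U \<and> \<alpha>\<in>U \<and> openin weak_topology V \<and> \<beta>\<in>V \<and> good U V"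
   if \<alpha>': "\<alpha>\<in>topspace W1_topology" and \<beta>': "\<beta>\<in>topspace weak_topology"
    and l: "IW \<alpha>\<le>ennreal (a + 1)" "IX \<beta>\<le>ennreal (a + 1)" for \<alpha> \<beta>
  proof -
   have \<alpha>: "\<alpha>\<in>M11_Rplus" and \<beta>: "\<beta>\<in>M1" using \<alpha>' \<beta>' by simp_all
   obtain x y where x: "IW \<alpha> = ennreal x" "0\<le>x" and y: "IX \<beta> = ennreal y" "0\<le>y"
    using l by (cases "IW \<alpha>"; cases "IX \<beta>") (auto simp: top_unique)
   have nb: "\<exists>U V. openin W1_topology U \<and> \<alpha>\<in>U \<and> openin weak_topology V \<and> \<beta>\<in>V \<and>
    (\<forall>\<rho>\<in>M11. marg1 \<rho>\<in>U --> marg2 \<rho>\<in>V --> Jrate IW IX \<rho>\<le>ennreal r -->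
      rel_entropy \<rho> (marg1 \<rho>\<Otimes>\<^sub>Mmarg2 \<rho>)\<le>ennreal (r - x - y + 2*e) \<and> 0\<le>r - x - y + 2*e)"
    if e: "0 < e" and r: "0\<le>r" for e r
   proof -
    obtain U where U: "openin W1_topology U" "\<alpha>\<in>U" "\<forall>z\<in>U. ennreal (x - e)\<le>IW z"
     by (rule rate_nbhd[OF lscW \<alpha>' x e]) (rule that)
    obtain V where V: "openin weak_topology V" "\<beta>\<in>V" "\<forall>z\<in>V. ennreal (y - e)\<le>IX z"
     by (rule rate_nbhd[OF lscX \<beta>' y e]) (rule that)
    have "rel_entropy \<rho> (marg1 \<rho>\<Otimes>\<^sub>Mmarg2 \<rho>)\<le>ennreal (r - x - y + 2*e) \<and> 0\<le>r - x - y + 2*e"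
     if \<rho>: "marg1 \<rho>\<in>U" "marg2 \<rho>\<in>V" and J: "Jrate IW IX \<rho>\<le>ennreal r" for \<rho> :: "(real\<times>'s) measure"
    proof -
     let ?H = "rel_entropy \<rho> (marg1 \<rho>\<Otimes>\<^sub>Mmarg2 \<rho>)"
     have "?H + ennreal (x - e) + ennreal (y - e)\<le>ennreal r"
      using J U(3)[rule_format, OF \<rho>(1)] V(3)[rule_format, OF \<rho>(2)] unfolding Jrate_def
      by (meson add_mono order_refl order_trans)
     moreover from this obtain h where h: "?H = ennreal h" "0\<le>h" by (cases ?H) (auto simp: top_unique)
     ultimately have "ennreal (h + max 0 (x - e) + max 0 (y - e))\<le>ennreal r"
      using h(2) by (simp add: ennreal_plus)
     then have "h + max 0 (x - e) + max 0 (y - e)\<le>r" using r by simp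
     then have "h\<le>r - x - y + 2*e" by linarith
     then show ?thesis using h by (auto intro: ennreal_leI)
    qed
    then show ?thesis using U(1,2) V(1,2) by blast
   qed
   show ?thesis
   proof (cases "x + y\<le>a")
    case True
    define c0 where "c0 = a - x - y"
    have c0: "0\<le>c0" using True by (simp add: c0_def)
    have K: "Fmap \<rho>\<in>\<Union>\<G>" if \<rho>: "\<rho>\<in>entropy_couplings \<alpha> \<beta> c0" for \<rho>
     using entropy_couplings_Jrate[of _ _ _ _ _ _ IW IX, OF \<rho> c0 x(2) y(2) x(1) y(1) \<alpha>] Fmap_M1[OF entropy_couplings_M11[OF \<rho> \<alpha>]]
     by (intro cov) (simp_all add: c0_def)
    obtain \<F> where \<F>: "finite \<F>" "\<F>\<subseteq>\<G>" "\<forall>\<rho>\<in>entropy_couplings \<alpha> \<beta> c0. Fmap \<rho>\<in>\<Union>\<F>"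
     by (rule entropy_couplings_finite_cover[OF \<alpha> \<beta> c0 op K]) (assumption | rule that)+
    have "openin weak_topology (\<Union>\<F>)" using op \<F>(2) by blast
    then obtain c and lw :: "real => int list" and lx :: "'s => int list" and J K U V where c: "c0 < c"
     and cells: "cells lw lx J K" and U: "openin W1_topology U" "\<alpha>\<in>U" and V: "openin weak_topology V" "\<beta>\<in>V"
     and imp: "\<forall>\<rho>\<in>M11. marg1 \<rho>\<in>U --> marg2 \<rho>\<in>V --> mutual_info J K (tab lw lx \<rho>)\<le>c --> Fmap \<rho>\<in>\<Union>\<F>"
     by (rule local_upper[OF \<alpha> \<beta> c0 _ \<F>(3)[rule_format]]) (assumption | rule that)+
    \<comment> \<open>Rate at most a + e near (\<alpha>, \<beta>) leaves entropy at most a + e - x -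
      y + 2 e, which equals c.\<close>
    define e where "e = (c - c0)/3"
    have e: "0 < e" and ea: "0\<le>a + e" using c a(2) by (simp_all add: e_def)
    obtain U' V' where UV': "openin W1_topology U'" "\<alpha>\<in>U'" "openin weak_topology V'" "\<beta>\<in>V'"
     "\<forall>\<rho>\<in>M11. marg1 \<rho>\<in>U' --> marg2 \<rho>\<in>V' --> Jrate IW IX \<rho>\<le>ennreal (a + e) -->
       rel_entropy \<rho> (marg1 \<rho>\<Otimes>\<^sub>Mmarg2 \<rho>)\<le>ennreal (a + e - x - y + 2*e) \<and> 0\<le>a + e - x - y + 2*e"
     using nb[OF e ea] by blast
    have "good (U\<inter>U') (V\<inter>V')"
     unfolding good_def
    proof (intro exI conjI ballI impI)
     show "finite \<F>" "\<F>\<subseteq>\<G>" "0 < e" by fact+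
     fix \<rho> :: "(real\<times>'s) measure" assume \<rho>: "\<rho>\<in>M11" "marg1 \<rho>\<in>U\<inter>U'" "marg2 \<rho>\<in>V\<inter>V'" "Jrate IW IX \<rho>\<le>ennreal (a + e)"
     have eq: "a + e - x - y + 2*e = c" by (simp add: e_def c0_def field_simps)
     have "rel_entropy \<rho> (marg1 \<rho>\<Otimes>\<^sub>Mmarg2 \<rho>)\<le>ennreal c" "0\<le>c"
      using UV'(5) \<rho> unfolding eq by blast+
     then have "mutual_info J K (tab lw lx \<rho>)\<le>c" by (rule cells.mutual_info_tab_le[OF cells M11D(1)[OF \<rho>(1)]])
     then show "Fmap \<rho>\<in>\<Union>\<F>" using imp \<rho>(1-3) by blast
    qed
    then show ?thesis using U V UV'(1-4) by (intro exI[of _ "U\<inter>U'"] exI[of _ "V\<inter>V'"]) (simp add: openin_Int)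
   next
    case False
    \<comment> \<open>Now a + e - x - y + 2 e = - e is negative, so no coupling near (\<alpha>,
      \<beta>) has rate at most a + e and the empty subfamily suffices.\<close>
    define e where "e = (x + y - a)/4"
    have e: "0 < e" and ea: "0\<le>a + e" using False a(2) by (simp_all add: e_def)
    obtain U' V' where UV': "openin W1_topology U'" "\<alpha>\<in>U'" "openin weak_topology V'" "\<beta>\<in>V'"
     "\<forall>\<rho>\<in>M11. marg1 \<rho>\<in>U' --> marg2 \<rho>\<in>V' --> Jrate IW IX \<rho>\<le>ennreal (a + e) -->
       rel_entropy \<rho> (marg1 \<rho>\<Otimes>\<^sub>Mmarg2 \<rho>)\<le>ennreal (a + e - x - y + 2*e) \<and> 0\<le>a + e - x - y + 2*e"
     using nb[OF e ea] by blast
    have "\<not> 0\<le>a + e - x - y + 2*e" using False by (simp add: e_def field_simps)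
    then have "good U' V'" unfolding good_def using UV'(5) e by (intro exI[of _ "{}"] exI[of _ e]) blast
    then show ?thesis using UV'(1-4) by blast
   qed
  qed
  obtain Q where Q: "finite Q" "\<forall>(U,V)\<in>Q. openin W1_topology U \<and> openin weak_topology V \<and> good U V"
   "{\<alpha>\<in>topspace W1_topology. IW \<alpha>\<le>ennreal (a + 1)}\<times>{\<beta>\<in>topspace weak_topology. IX \<beta>\<le>ennreal (a + 1)}\<subseteq>(\<Union>(U,V)\<in>Q. U\<times>V)"
   by (rule level_cover[OF goodW goodX ex]) (assumption | rule that)+
  have "\<forall>q\<in>Q. \<exists>\<F> \<eta>. finite \<F> \<and> \<F>\<subseteq>\<G> \<and> 0 < (\<eta>::real) \<and> (\<forall>\<rho>\<in>M11. marg1 \<rho>\<in>fst q --> marg2 \<rho>\<in>snd q -->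
   Jrate IW IX \<rho>\<le>ennreal (a + \<eta>) --> Fmap \<rho>\<in>\<Union>\<F>)" using Q(2) unfolding good_def by (simp add: split_beta)
  then obtain \<F> \<eta> where F: "\<forall>q\<in>Q. finite (\<F> q) \<and> \<F> q\<subseteq>\<G> \<and> 0 < (\<eta> q :: real) \<and> (\<forall>\<rho>\<in>M11. marg1 \<rho>\<in>fst q --> marg2 \<rho>\<in>snd q -->
   Jrate IW IX \<rho>\<le>ennreal (a + \<eta> q) --> Fmap \<rho>\<in>\<Union>(\<F> q))" unfolding bchoice_iff by blast
  define \<eta>0 where "\<eta>0 = Min (insert 1 (\<eta> ` Q))"
  have \<eta>0: "0 < \<eta>0" "\<eta>0\<le>1" "\<And>q. q\<in>Q ==> \<eta>0\<le>\<eta> q" using Q(1) F by (auto simp: \<eta>0_def)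
  show "\<exists>\<F>. finite \<F> \<and> \<F>\<subseteq>\<G> \<and> {\<nu>\<in>topspace weak_topology. Krate IW IX \<nu>\<le>ennreal a}\<subseteq>\<Union>\<F>"
  proof (intro exI conjI)
   show "finite (\<Union>q\<in>Q. \<F> q)" "(\<Union>q\<in>Q. \<F> q)\<subseteq>\<G>" using Q(1) F by blast+
   show "{\<nu>\<in>topspace weak_topology. Krate IW IX \<nu>\<le>ennreal a}\<subseteq>\<Union>(\<Union>q\<in>Q. \<F> q)"
   proof
    fix \<nu> assume "\<nu>\<in>{\<nu>\<in>topspace (weak_topology :: 's measure topology). Krate IW IX \<nu>\<le>ennreal a}"
    then have "Krate IW IX \<nu>\<le>ennreal a" by blast
    also have "\<dots> < ennreal (a + \<eta>0)" using a(2) \<eta>0(1) by (simp add: ennreal_less_iff)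
    finally obtain \<rho> where \<rho>: "\<rho>\<in>M11" "Fmap \<rho> = \<nu>" "Jrate IW IX \<rho> < ennreal (a + \<eta>0)"
     unfolding Krate_def INF_less_iff by blast
    have "Jrate IW IX \<rho>\<le>ennreal (a + 1)"
     using \<rho>(3) \<eta>0(2) by (meson add_left_mono ennreal_leI less_imp_le order_trans)
    then have "IW (marg1 \<rho>)\<le>ennreal (a + 1)" "IX (marg2 \<rho>)\<le>ennreal (a + 1)"
     unfolding Jrate_def by (auto elim: order_trans[rotated] simp: add.commute add.left_commute intro: add_increasing2)
    moreover have "marg1 \<rho>\<in>topspace W1_topology" "marg2 \<rho>\<in>topspace weak_topology"
     unfolding topspace_W1 topspace_weak by (rule marg1_M11_Rplus[OF \<rho>(1)], rule marg2_M1[OF \<rho>(1)])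
    ultimately have "(marg1 \<rho>,marg2 \<rho>)\<in>(\<Union>(U,V)\<in>Q. U\<times>V)" by (intro subsetD[OF Q(3)]) simp
    then obtain q where q: "q\<in>Q" "marg1 \<rho>\<in>fst q" "marg2 \<rho>\<in>snd q" by auto
    have "Jrate IW IX \<rho>\<le>ennreal (a + \<eta> q)"
     using \<rho>(3) \<eta>0(3)[OF q(1)] by (meson add_left_mono ennreal_leI less_imp_le order_trans)
    then have "Fmap \<rho>\<in>\<Union>(\<F> q)" using F q \<rho>(1) by blast
    then show "\<nu>\<in>\<Union>(\<Union>q\<in>Q. \<F> q)" using q(1) unfolding \<rho>(2) by blast
   qed
  qed
 qed simp
qed

lemma lower_semicontinuous_Krate: "lower_semicontinuous weak_topology (Krate IW IX)"
 unfolding lower_semicontinuous_def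
proof
 fix a :: ennreal
 show "openin weak_topology {\<nu>\<in>topspace weak_topology. a < Krate IW IX \<nu>}"
 proof (cases "a < \<infinity>")
  case True
  then have "compactin weak_topology {\<nu>\<in>topspace weak_topology. Krate IW IX \<nu>\<le>a}"
   using good_rate_Krate unfolding good_rate_def by blast
  then have "closedin weak_topology {\<nu>\<in>topspace weak_topology. Krate IW IX \<nu>\<le>a}"
   by (rule compactin_imp_closedin[OF Hausdorff_weak])
  then have "openin weak_topology (topspace weak_topology - {\<nu>\<in>topspace weak_topology. Krate IW IX \<nu>\<le>a})"
   by (rule openin_diff[OF openin_topspace])
  moreover have "topspace weak_topology - {\<nu>\<in>topspace weak_topology. Krate IW IX \<nu>\<le>a} = {\<nu>\<in>topspace weak_topology. a < Krate IW IX \<nu>}"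
   unfolding not_le[symmetric] by blast
  ultimately show ?thesis by simp
 next
  case False
  then have "{\<nu>\<in>topspace weak_topology. a < Krate IW IX \<nu>} = {}" by (auto simp: less_top[symmetric])
  then show ?thesis by (simp only: openin_empty)
 qed
qed

end

section \<open>The large deviation principle\<close>

lemma eventually_power_le_exp:
 assumes d: "0 < d"
 shows "\<forall>\<^sub>F n in sequentially. C*(real n + 1)^k\<le>exp (real n*d)"
proof -
 have "filterlim (%n. d*(1 + real n)) at_top sequentially"
  by (intro filterlim_tendsto_pos_mult_at_top[OF tendsto_const d] filterlim_tendsto_add_at_top[OF tendsto_const] filterlim_real_sequentially)
 then have "((%n. (d*(1 + real n))^k/exp (d*(1 + real n))) \<longlongrightarrow> 0) sequentially"
  by (rule filterlim_compose[OF tendsto_power_div_exp_0])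
 then have "((%n. C*exp d/d^k*((d*(1 + real n))^k/exp (d*(1 + real n)))) \<longlongrightarrow> 0) sequentially"
  by (rule tendsto_mult_right_zero)
 moreover have "C*exp d/d^k*((d*(1 + real n))^k/exp (d*(1 + real n))) = C*(real n + 1)^k/exp (real n*d)" for n
 proof -
  have "exp (d*(1 + real n)) = exp d*exp (real n*d)" unfolding exp_add[symmetric] by (simp add: algebra_simps)
  then show ?thesis using d unfolding power_mult_distrib by (simp add: add.commute)
 qed
 ultimately have "((%n. C*(real n + 1)^k/exp (real n*d)) \<longlongrightarrow> 0) sequentially" by simp
 then have "\<forall>\<^sub>F n in sequentially. C*(real n + 1)^k/exp (real n*d) < 1" by (rule order_tendstoD) simp
 then show ?thesis by eventually_elim (simp add: divide_less_eq less_imp_le)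
qed

text \<open>\<open>LDP_local_upper\<close> at threshold x - e, shrunk into U0. A negative threshold
  gives a bound of at least 1, which any probability satisfies.\<close>

lemma LDP_rate_nbhd:
 assumes L: "LDP T P I" and H: "Hausdorff_space T" and g: "good_rate T I" and U0: "openin T U0" "y\<in>U0"
  and x: "I y = ennreal x" "0\<le>x" and e: "0 < e"
 obtains U where "openin T U" "y\<in>U" "U\<subseteq>U0" "\<forall>\<^sub>F n in sequentially. measure (P n) U\<le>exp (- real n*(x - e))"
proof -
 have y: "y\<in>topspace T" using openin_subset[OF U0(1)] U0(2) by blast
 have P: "prob_space (P n) \<and> sets (P n) = sets (borel_of T)" if "1\<le>n" for n
  using L that unfolding LDP_def space_prob_algebra by blast
 obtain U where U: "openin T U" "y\<in>U" "\<forall>\<^sub>F n in sequentially. measure (P n) U\<le>exp (- real n*(x - e))"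
 proof (cases "0\<le>x - e")
  case True
  then have "ennreal (x - e) < I y" using e unfolding x(1) by (simp add: ennreal_less_iff)
  then show thesis by (rule LDP_local_upper[OF L H g y _ True]) (rule that)
 next
  case False
  have "\<forall>\<^sub>F n in sequentially. measure (P n) (topspace T)\<le>exp (- real n*(x - e))"
   using eventually_ge_at_top[of 1]
  proof eventually_elim
   case (elim n)
   have "measure (P n) (topspace T)\<le>1" using P[OF elim] by (simp add: prob_space.prob_le_1)
   also have "\<dots>\<le>exp (- real n*(x - e))" using False by (simp add: mult_nonneg_nonpos)
   finally show ?case .
  qed
  then show thesis by (rule that[OF openin_topspace y])
 qed
 have "\<forall>\<^sub>F n in sequentially. measure (P n) (U\<inter>U0)\<le>exp (- real n*(x - e))"
  using U(3) eventually_ge_at_top[of 1]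
 proof eventually_elim
  case (elim n)
  have "measure (P n) (U\<inter>U0)\<le>measure (P n) U"
   by (rule finite_measure.finite_measure_mono) (use P[OF elim(2)] openin_sets_borel_of[OF U(1)] in \<open>auto simp: prob_space.finite_measure\<close>)
  then show ?case using elim(1) by linarith
 qed
 then show thesis using U(1,2) U0 by (intro that[of "U\<inter>U0"]) auto
qed

text \<open>Labelling everything by a single label reduces independence of the two events to the
  product formula for label vectors.\<close>

lemma (in weighted_array) prob_indep:
 assumes U: "openin W1_topology U" and V: "openin weak_topology V"
 shows "prob {\<omega>\<in>space M. alpha \<omega>\<in>U \<and> beta \<omega>\<in>V} = prob (inW U)*prob (inX V)"
proof -
 have "cells (%_. [] :: int list) (%_ :: 's. [] :: int list) {[]} {[]}" by unfold_locales auto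
 then interpret R: random_labels M "{1..n}" "{[] :: int list}" "{[] :: int list}" "%\<omega>. \<lambda>i\<in>{1..n}. []" "%\<omega>. \<lambda>i\<in>{1..n}. []"
  "(inW U)" "(inX V)"
  by (rule labels[OF _ U V])
 have "{\<omega>\<in>space M. alpha \<omega>\<in>U \<and> beta \<omega>\<in>V} = (inW U)\<inter>(inX V)" by blast
 moreover have "{\<omega>\<in>space M. alpha \<omega>\<in>U \<and> \<omega>\<in>space M \<and> beta \<omega>\<in>V} = (inW U)\<inter>(inX V)" by blast
 ultimately show ?thesis using R.indep[of "\<lambda>i\<in>{1..n}. []" "\<lambda>i\<in>{1..n}. []"] by simp
qed

locale weighted_arrays = prob_space M for M :: "'w measure" +
 fixes W :: "nat => nat => 'w => real" and X :: "nat => nat => 'w => 's::polish_space"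
  and IW :: "real measure => ennreal" and IX :: "'s measure => ennreal"
 assumes array: "\<And>n. 1\<le>n ==> weighted_array M n (W n) (X n)"
  and LDPW: "LDP_rv M W1_topology (%n \<omega>. empirical Rplus n (%i. W n i \<omega>)) IW" and gW: "good_rate W1_topology IW"
  and LDPX: "LDP_rv M weak_topology (%n \<omega>. empirical borel n (%i. X n i \<omega>)) IX" and gX: "good_rate weak_topology IX"

sublocale weighted_arrays \<subseteq> rate_functions IW IX
 using LDPW gW LDPX gX unfolding LDP_rv_def LDP_def by unfold_locales blast+

context weighted_arrays
begin

abbreviation "alpha n \<omega> \<equiv> empirical Rplus n (%i. W n i \<omega>)"
abbreviation "beta n \<omega> \<equiv> empirical borel n (%i. X n i \<omega>)"
abbreviation "L n \<omega> \<equiv> weighted_empirical borel n (%i. W n i \<omega>) (%i. X n i \<omega>)"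
abbreviation "inW n U \<equiv> {\<omega>\<in>space M. alpha n \<omega>\<in>U}"
abbreviation "inX n V \<equiv> {\<omega>\<in>space M. beta n \<omega>\<in>V}"
abbreviation "inL n G \<equiv> {\<omega>\<in>space M. L n \<omega>\<in>G}"

lemma measure_distr_rv:
 assumes "Y\<in>measurable M (borel_of T)" "A\<in>sets (borel_of T)"
 shows "measure (distr M (borel_of T) Y) A = prob {\<omega>\<in>space M. Y \<omega>\<in>A}" "{\<omega>\<in>space M. Y \<omega>\<in>A}\<in>events"
proof -
 have "Y -` A\<inter>space M = {\<omega>\<in>space M. Y \<omega>\<in>A}" by blast
 then show "measure (distr M (borel_of T) Y) A = prob {\<omega>\<in>space M. Y \<omega>\<in>A}" "{\<omega>\<in>space M. Y \<omega>\<in>A}\<in>events"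
  using measure_distr[OF assms] measurable_sets[OF assms] by simp_all
qed

lemma alpha_measurable: "1\<le>n ==> alpha n\<in>measurable M (borel_of W1_topology)"
 and beta_measurable: "1\<le>n ==> beta n\<in>measurable M (borel_of weak_topology)"
 using LDPW LDPX unfolding LDP_rv_def by blast+

lemma L_measurable: "1\<le>n ==> L n\<in>measurable M (borel_of weak_topology)"
 by (rule weighted_array.L_measurable[OF array])

lemma eventually_alpha:
 assumes "\<forall>\<^sub>F n in sequentially. Q n (measure (distr M (borel_of W1_topology) (alpha n)) A)" "A\<in>sets (borel_of W1_topology)"
 shows "\<forall>\<^sub>F n in sequentially. Q n (prob (inW n A))"
 using assms(1) eventually_ge_at_top[of 1]
 by eventually_elim (simp only: measure_distr_rv(1)[OF alpha_measurable assms(2)])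

lemma eventually_beta:
 assumes "\<forall>\<^sub>F n in sequentially. Q n (measure (distr M (borel_of weak_topology) (beta n)) A)" "A\<in>sets (borel_of weak_topology)"
 shows "\<forall>\<^sub>F n in sequentially. Q n (prob (inX n A))"
 using assms(1) eventually_ge_at_top[of 1]
 by eventually_elim (simp only: measure_distr_rv(1)[OF beta_measurable assms(2)])

lemmas LDPW' = LDPW[unfolded LDP_rv_def, THEN conjunct2] and LDPX' = LDPX[unfolded LDP_rv_def, THEN conjunct2]

text \<open>Take a coupling \<rho> of rate below s. The marginals come near its marginals with
  exponents x and y, and given that, a favourable table has exponent h.\<close>

lemma eventually_L_open:
 assumes G: "openin weak_topology G" "\<nu>\<in>G" and K: "Krate IW IX \<nu> < ennreal s" and s: "0\<le>s"
 shows "\<forall>\<^sub>F n in sequentially. exp (- real n * s)\<le>prob (inL n G)"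
proof -
 obtain \<rho> where \<rho>: "\<rho>\<in>M11" "Fmap \<rho> = \<nu>" "Jrate IW IX \<rho> < ennreal s"
  using K unfolding Krate_def INF_less_iff by blast
 let ?H = "rel_entropy \<rho> (marg1 \<rho>\<Otimes>\<^sub>Mmarg2 \<rho>)"
 obtain h x y where h: "?H = ennreal h" "0\<le>h" and x: "IW (marg1 \<rho>) = ennreal x" "0\<le>x" and y: "IX (marg2 \<rho>) = ennreal y" "0\<le>y"
  using \<rho>(3) unfolding Jrate_def by (cases ?H; cases "IW (marg1 \<rho>)"; cases "IX (marg2 \<rho>)") auto
 have "ennreal (h + x + y) < ennreal s" using \<rho>(3) h(2) x(2) y(2) unfolding Jrate_def h(1) x(1) y(1) by (simp add: ennreal_plus)
 then have hxy: "h + x + y < s" using h(2) x(2) y(2) by (simp add: ennreal_less_iff del: ennreal_plus)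
 \<comment> \<open>Three of the four parts are added to h, x and y; the fourth absorbs the
   polynomial factor.\<close>
 define e where "e = (s - h - x - y)/4"
 have e: "0 < e" "h < h + e" and eq: "(h + e) + (x + e) + (y + e) = s - e" using hxy by (simp_all add: e_def field_simps)
 obtain lw :: "real => int list" and lx :: "'s => int list" and J K U V n0 where cells: "cells lw lx J K"
  and U: "openin W1_topology U" "marg1 \<rho>\<in>U" and V: "openin weak_topology V" "marg2 \<rho>\<in>V"
  and imp: "\<forall>n. n0\<le>n --> roundable lw lx J K U V G (h + e) n"
  by (rule local_lower[OF \<rho>(1) eq_refl[OF h(1)] h(2) e(2) G(1)], unfold \<rho>(2), rule G(2)) (rule that)
 have "\<forall>\<^sub>F n in sequentially. exp (- real n*(x + e))\<le>prob (inW n U)"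
  by (rule eventually_alpha[where Q = "%n p. exp (- real n*(x + e))\<le>p", OF LDP_open_lower[OF LDPW' U] openin_sets_borel_of[OF U(1)]]) (use e x in \<open>simp_all add: ennreal_less_iff\<close>)
 moreover have "\<forall>\<^sub>F n in sequentially. exp (- real n*(y + e))\<le>prob (inX n V)"
  by (rule eventually_beta[where Q = "%n p. exp (- real n*(y + e))\<le>p", OF LDP_open_lower[OF LDPX' V] openin_sets_borel_of[OF V(1)]]) (use e y in \<open>simp_all add: ennreal_less_iff\<close>)
 moreover have "\<forall>\<^sub>F n in sequentially. 1*(real n + 1)^(2*(1 + card (J\<times>K)))\<le>exp (real n*e)"
  by (rule eventually_power_le_exp[OF e(1)])
 ultimately show ?thesis using eventually_ge_at_top[of 1] eventually_ge_at_top[of n0]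
 proof eventually_elim
  case (elim n)
  let ?PL = "prob (inL n G)"
  have "exp (- real n * s)*exp (real n*e) = exp (- real n*(h + e))*(exp (- real n*(x + e))*exp (- real n*(y + e)))"
  proof -
   have "- real n * s + real n*e = - real n*(s - e)" by (simp add: algebra_simps)
   also have "\<dots> = - real n*(h + e) + (- real n*(x + e) + - real n*(y + e))"
    unfolding eq[symmetric] by (simp add: algebra_simps)
   finally show ?thesis unfolding exp_add[symmetric] by (rule arg_cong)
  qed
  also have "\<dots>\<le>exp (- real n*(h + e))*(prob (inW n U)*prob (inX n V))"
   by (intro mult_left_mono mult_mono elim) simp_all
  also have "\<dots>\<le>(real n + 1)^(2*(1 + card (J\<times>K)))*?PL"
   by (rule weighted_array.prob_lower[OF array[OF elim(4)] cells U(1) V(1) G(1) imp[THEN spec, THEN mp, OF elim(5)]])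
  also have "\<dots>\<le>exp (real n*e)*?PL"
   by (rule mult_right_mono) (use elim(3) in simp_all)
  finally show ?case by (simp add: mult.commute)
 qed
qed

text \<open>Two ways to reach the exponent a: if x + y \<le> a, the missing part is the entropy cost
  of tables exceeding the budget; otherwise the neighbourhoods of the marginals are rare enough by
  themselves.\<close>

lemma upper_nbhd:
 assumes \<alpha>: "\<alpha>\<in>M11_Rplus" and \<beta>: "\<beta>\<in>M1" and G: "openin weak_topology G"
  and lev: "\<And>\<nu>. \<nu>\<in>M1 ==> Krate IW IX \<nu>\<le>ennreal a ==> \<nu>\<in>G"
  and x: "IW \<alpha> = ennreal x" "0\<le>x" and y: "IX \<beta> = ennreal y" "0\<le>y"
 obtains U V k where "openin W1_topology U" "\<alpha>\<in>U" "openin weak_topology V" "\<beta>\<in>V"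
  "\<forall>\<^sub>F n in sequentially. prob {\<omega>\<in>space M. alpha n \<omega>\<in>U \<and> beta n \<omega>\<in>V \<and> L n \<omega>\<notin>G}\<le>(real n + 1)^k*exp (- real n*a)"
proof -
 have \<alpha>': "\<alpha>\<in>topspace W1_topology" and \<beta>': "\<beta>\<in>topspace weak_topology" using \<alpha> \<beta> by simp_all
 have nb: "\<exists>U V. openin W1_topology U \<and> \<alpha>\<in>U \<and> openin weak_topology V \<and> \<beta>\<in>V \<and> U\<subseteq>U0 \<and> V\<subseteq>V0 \<and>
  (\<forall>\<^sub>F n in sequentially. prob (inW n U)*prob (inX n V)\<le>exp (- real n*(x + y - 2*e)))"
  if e: "0 < e" and U0: "openin W1_topology U0" "\<alpha>\<in>U0" and V0: "openin weak_topology V0" "\<beta>\<in>V0" for e U0 V0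
 proof -
  obtain U where U: "openin W1_topology U" "\<alpha>\<in>U" "U\<subseteq>U0"
   "\<forall>\<^sub>F n in sequentially. measure (distr M (borel_of W1_topology) (alpha n)) U\<le>exp (- real n*(x - e))"
   by (rule LDP_rate_nbhd[OF LDPW' Hausdorff_W1 gW U0 x e]) (rule that)
  obtain V where V: "openin weak_topology V" "\<beta>\<in>V" "V\<subseteq>V0"
   "\<forall>\<^sub>F n in sequentially. measure (distr M (borel_of weak_topology) (beta n)) V\<le>exp (- real n*(y - e))"
   by (rule LDP_rate_nbhd[OF LDPX' Hausdorff_weak gX V0 y e]) (rule that)
  have "\<forall>\<^sub>F n in sequentially. prob (inW n U)*prob (inX n V)\<le>exp (- real n*(x + y - 2*e))"
   using eventually_alpha[where Q = "%n p. p\<le>exp (- real n*(x - e))", OF U(4) openin_sets_borel_of[OF U(1)]]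
    eventually_beta[where Q = "%n p. p\<le>exp (- real n*(y - e))", OF V(4) openin_sets_borel_of[OF V(1)]]
  proof eventually_elim
   case (elim n)
   then have "prob (inW n U)*prob (inX n V)\<le>exp (- real n*(x - e))*exp (- real n*(y - e))"
    by (intro mult_mono) simp_all
   also have "\<dots> = exp (- real n*(x + y - 2*e))" unfolding exp_add[symmetric] by (simp add: algebra_simps)
   finally show ?case .
  qed
  then show ?thesis using U(1-3) V(1-3) by blast
 qed
 show thesis
 proof (cases "x + y\<le>a")
  case True
  define c0 where "c0 = a - x - y"
  have c0: "0\<le>c0" using True by (simp add: c0_def)
  have K: "Fmap \<rho>\<in>G" if \<rho>: "\<rho>\<in>entropy_couplings \<alpha> \<beta> c0" for \<rho>
   using entropy_couplings_Jrate[of _ _ _ _ _ _ IW IX, OF \<rho> c0 x(2) y(2) x(1) y(1) \<alpha>] Fmap_M1[OF entropy_couplings_M11[OF \<rho> \<alpha>]]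
   by (intro lev) (simp_all add: c0_def)
  obtain c and lw :: "real => int list" and lx :: "'s => int list" and J K U V where c: "c0 < c"
   and cells: "cells lw lx J K" and U: "openin W1_topology U" "\<alpha>\<in>U" and V: "openin weak_topology V" "\<beta>\<in>V"
   and imp: "\<forall>\<rho>\<in>M11. marg1 \<rho>\<in>U --> marg2 \<rho>\<in>V --> mutual_info J K (tab lw lx \<rho>)\<le>c --> Fmap \<rho>\<in>G"
   by (rule local_upper[OF \<alpha> \<beta> c0 G K]) (assumption | rule that)+
  \<comment> \<open>The loss 2 e from the two neighbourhoods equals the surplus c - c0, so the
    exponents add up to exactly a.\<close>
  define e where "e = (c - c0)/2"
  have e: "0 < e" and eq: "c + (x + y - 2*e) = a" using c by (simp_all add: e_def c0_def field_simps)
  obtain U' V' where UV': "openin W1_topology U'" "\<alpha>\<in>U'" "openin weak_topology V'" "\<beta>\<in>V'" "U'\<subseteq>U" "V'\<subseteq>V"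
   "\<forall>\<^sub>F n in sequentially. prob (inW n U')*prob (inX n V')\<le>exp (- real n*(x + y - 2*e))"
   using nb[OF e U V] by blast
  have imp': "\<forall>\<rho>\<in>M11. marg1 \<rho>\<in>U' --> marg2 \<rho>\<in>V' --> mutual_info J K (tab lw lx \<rho>)\<le>c --> Fmap \<rho>\<in>G"
   using imp UV'(5,6) by blast
  show thesis
  proof (rule that[OF UV'(1-4), of "card (J\<times>K) + 2*(card J + card K)"])
   let ?k = "card (J\<times>K) + 2*(card J + card K)"
   show "\<forall>\<^sub>F n in sequentially. prob {\<omega>\<in>space M. alpha n \<omega>\<in>U' \<and> beta n \<omega>\<in>V' \<and> L n \<omega>\<notin>G}\<le>(real n + 1)^?k*exp (- real n*a)"
    using UV'(7) eventually_ge_at_top[of 1]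
   proof eventually_elim
    case (elim n)
    have "prob {\<omega>\<in>space M. alpha n \<omega>\<in>U' \<and> beta n \<omega>\<in>V' \<and> L n \<omega>\<notin>G} \<le>
      (real n + 1)^?k*exp (- real n*c)*(prob (inW n U')*prob (inX n V'))"
     using c0 c by (intro weighted_array.prob_upper[OF array[OF elim(2)] cells UV'(1,3) _ imp']) simp
    also have "\<dots>\<le>(real n + 1)^?k*exp (- real n*c)*exp (- real n*(x + y - 2*e))"
     by (intro mult_left_mono elim(1)) simp
    also have "\<dots> = (real n + 1)^?k*exp (- real n*(c + (x + y - 2*e)))"
     by (simp add: mult.assoc exp_add[symmetric] algebra_simps)
    finally show ?case unfolding eq .
   qed
  qed
 next
  case False
  \<comment> \<open>The exponent x + y - 2 e of the two neighbourhoods is then exactly a.\<close>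
  define e where "e = (x + y - a)/2"
  have e: "0 < e" and eq: "x + y - 2*e = a" using False by (simp_all add: e_def field_simps)
  obtain U V where UV: "openin W1_topology U" "\<alpha>\<in>U" "openin weak_topology V" "\<beta>\<in>V"
   "\<forall>\<^sub>F n in sequentially. prob (inW n U)*prob (inX n V)\<le>exp (- real n*(x + y - 2*e))"
   using nb[OF e openin_topspace \<alpha>' openin_topspace \<beta>'] by blast
  show thesis
  proof (rule that[OF UV(1-4), of 0])
   show "\<forall>\<^sub>F n in sequentially. prob {\<omega>\<in>space M. alpha n \<omega>\<in>U \<and> beta n \<omega>\<in>V \<and> L n \<omega>\<notin>G}\<le>(real n + 1)^0*exp (- real n*a)"
    using UV(5) eventually_ge_at_top[of 1]
   proof eventually_elim
    case (elim n)
    have i: "{\<omega>\<in>space M. alpha n \<omega>\<in>U \<and> beta n \<omega>\<in>V} = (inW n U)\<inter>(inX n V)" by blast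
    have "prob {\<omega>\<in>space M. alpha n \<omega>\<in>U \<and> beta n \<omega>\<in>V \<and> L n \<omega>\<notin>G}\<le>prob {\<omega>\<in>space M. alpha n \<omega>\<in>U \<and> beta n \<omega>\<in>V}"
     by (rule finite_measure_mono, blast, unfold i, intro sets.Int measure_distr_rv(2)[OF alpha_measurable[OF elim(2)] openin_sets_borel_of[OF UV(1)]]
       measure_distr_rv(2)[OF beta_measurable[OF elim(2)] openin_sets_borel_of[OF UV(3)]])
    also have "\<dots> = prob (inW n U)*prob (inX n V)"
     by (rule weighted_array.prob_indep[OF array[OF elim(2)] UV(1,3)])
    also have "\<dots>\<le>(real n + 1)^0*exp (- real n*a)" using elim(1) unfolding eq by simp
    finally show ?case .
   qed
  qed
 qed
qed

text \<open>Outcomes in C have their pair of empirical measures either in one of finitely many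
  boxes, where missing the complement G of C is expensive, or off the level sets of one marginal,
  where the marginal LDP applies.\<close>

lemma eventually_L_closed:
 assumes C: "closedin weak_topology C" and s: "0\<le>s" and K: "\<And>\<nu>. \<nu>\<in>C ==> ennreal s < Krate IW IX \<nu>" and s': "s' < s"
 shows "\<forall>\<^sub>F n in sequentially. prob (inL n C)\<le>exp (- real n * s')"
proof -
 define G where "G = topspace weak_topology - C"
 have G: "openin weak_topology G" unfolding G_def by (rule openin_diff[OF openin_topspace C])
 have lev: "\<nu>\<in>G" if "\<nu>\<in>M1" "Krate IW IX \<nu>\<le>ennreal s" for \<nu>
  using K[of \<nu>] that unfolding G_def topspace_weak by (meson DiffI not_le)
 define P where "P U V \<longleftrightarrow> (\<exists>k. \<forall>\<^sub>F n in sequentially. prob {\<omega>\<in>space M. alpha n \<omega>\<in>U \<and> beta n \<omega>\<in>V \<and> L n \<omega>\<notin>G}\<le>(real n + 1)^k*exp (- real n * s))" for U V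
 have ex: "\<exists>U V. openin W1_topology U \<and> \<alpha>\<in>U \<and> openin weak_topology V \<and> \<beta>\<in>V \<and> P U V"
  if ab: "\<alpha>\<in>topspace W1_topology" "\<beta>\<in>topspace weak_topology" "IW \<alpha>\<le>ennreal s" "IX \<beta>\<le>ennreal s" for \<alpha> \<beta>
 proof -
  obtain x y where x: "IW \<alpha> = ennreal x" "0\<le>x" and y: "IX \<beta> = ennreal y" "0\<le>y"
   using ab(3,4) by (cases "IW \<alpha>"; cases "IX \<beta>") (auto simp: top_unique)
  obtain U V k where "openin W1_topology U" "\<alpha>\<in>U" "openin weak_topology V" "\<beta>\<in>V"
    "\<forall>\<^sub>F n in sequentially. prob {\<omega>\<in>space M. alpha n \<omega>\<in>U \<and> beta n \<omega>\<in>V \<and> L n \<omega>\<notin>G}\<le>(real n + 1)^k*exp (- real n * s)"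
   by (rule upper_nbhd[OF ab(1,2)[unfolded topspace_W1 topspace_weak] G lev x y]) (assumption | rule that)+
  then show ?thesis unfolding P_def by blast
 qed
 let ?\<Gamma>W = "{\<alpha>\<in>topspace W1_topology. IW \<alpha>\<le>ennreal s}" and ?\<Gamma>X = "{\<beta>\<in>topspace weak_topology. IX \<beta>\<le>ennreal s}"
 obtain Q where Q: "finite Q" "\<forall>(U,V)\<in>Q. openin W1_topology U \<and> openin weak_topology V \<and> P U V"
   "?\<Gamma>W\<times>?\<Gamma>X\<subseteq>(\<Union>(U,V)\<in>Q. U\<times>V)"
  by (rule level_cover[OF goodW goodX ex]) (assumption | rule that)+
 have c: "compactin W1_topology ?\<Gamma>W" "compactin weak_topology ?\<Gamma>X"
  using gW gX unfolding good_rate_def by (auto simp: less_top[symmetric])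
 have "openin (prod_topology W1_topology weak_topology) (\<Union>(U,V)\<in>Q. U\<times>V)"
 proof (rule openin_Union)
  fix S assume "S\<in>(%(U,V). U\<times>V) ` Q"
  then obtain U V where q: "(U,V)\<in>Q" "S = U\<times>V" by auto
  have "openin W1_topology U" "openin weak_topology V" using bspec[OF Q(2) q(1)] by simp_all
  then show "openin (prod_topology W1_topology weak_topology) S" unfolding q(2) openin_prod_Times_iff by blast
 qed
 \<comment> \<open>Wallace's theorem fits a single open rectangle between the compact product of
   level sets and the union of boxes, so that leaving the boxes means leaving OW or OX, a closed
   event for one marginal.\<close>
 then obtain OW OX where OW: "openin W1_topology OW" "?\<Gamma>W\<subseteq>OW" and OX: "openin weak_topology OX" "?\<Gamma>X\<subseteq>OX"
  and OO: "OW\<times>OX\<subseteq>(\<Union>(U,V)\<in>Q. U\<times>V)"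
  by (rule Wallace_theorem_prod_topology[OF c _ Q(3)]) (assumption | rule that)+
 have "\<forall>q\<in>Q. \<exists>k. \<forall>\<^sub>F n in sequentially. prob {\<omega>\<in>space M. alpha n \<omega>\<in>fst q \<and> beta n \<omega>\<in>snd q \<and> L n \<omega>\<notin>G}\<le>(real n + 1)^k*exp (- real n * s)"
  using Q(2) unfolding P_def by (simp add: split_beta)
 then obtain k where k: "\<forall>q\<in>Q. \<forall>\<^sub>F n in sequentially. prob {\<omega>\<in>space M. alpha n \<omega>\<in>fst q \<and> beta n \<omega>\<in>snd q \<and> L n \<omega>\<notin>G}\<le>(real n + 1)^k q*exp (- real n * s)"
  unfolding bchoice_iff by blast
 \<comment> \<open>The gap s - t absorbs the polynomial factors of the boxes, the gap t - s' the
   number of summands.\<close>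
 define t where "t = (s' + s)/2"
 have t: "s' < t" "t < s" using s' by (simp_all add: t_def)
 have cW: "closedin W1_topology (topspace W1_topology - OW)" and cX: "closedin weak_topology (topspace weak_topology - OX)"
  by (rule closedin_diff[OF closedin_topspace OW(1)], rule closedin_diff[OF closedin_topspace OX(1)])
 have hW: "ennreal s\<le>IW \<alpha>" if "\<alpha>\<in>topspace W1_topology - OW" for \<alpha>
  using subsetD[OF OW(2), of \<alpha>] that linear[of "IW \<alpha>" "ennreal s"] by blast
 have hX: "ennreal s\<le>IX \<beta>" if "\<beta>\<in>topspace weak_topology - OX" for \<beta>
  using subsetD[OF OX(2), of \<beta>] that linear[of "IX \<beta>" "ennreal s"] by blast
 have "\<forall>\<^sub>F n in sequentially. prob (inW n (topspace W1_topology - OW))\<le>exp (- real n*t)"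
  by (rule eventually_alpha[where Q = "%n p. p\<le>exp (- real n*t)", OF LDP_closed_upper[OF LDPW' cW _ s t(2)] closedin_sets_borel_of[OF cW]])
   (rule hW)
 moreover have "\<forall>\<^sub>F n in sequentially. prob (inX n (topspace weak_topology - OX))\<le>exp (- real n*t)"
  by (rule eventually_beta[where Q = "%n p. p\<le>exp (- real n*t)", OF LDP_closed_upper[OF LDPX' cX _ s t(2)] closedin_sets_borel_of[OF cX]])
   (rule hX)
 moreover have "\<forall>\<^sub>F n in sequentially. \<forall>q\<in>Q. prob {\<omega>\<in>space M. alpha n \<omega>\<in>fst q \<and> beta n \<omega>\<in>snd q \<and> L n \<omega>\<notin>G}\<le>exp (- real n*t)"
 proof (rule eventually_ball_finite[OF Q(1)], rule ballI)
  fix q assume q: "q\<in>Q"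
  have "\<forall>\<^sub>F n in sequentially. 1*(real n + 1)^k q\<le>exp (real n*(s - t))" by (rule eventually_power_le_exp) (use t in simp)
  with k[rule_format, OF q]
  show "\<forall>\<^sub>F n in sequentially. prob {\<omega>\<in>space M. alpha n \<omega>\<in>fst q \<and> beta n \<omega>\<in>snd q \<and> L n \<omega>\<notin>G}\<le>exp (- real n*t)"
  proof eventually_elim
   case (elim n)
   have "(real n + 1)^k q*exp (- real n * s)\<le>exp (real n*(s - t))*exp (- real n * s)"
    using elim(2) by (intro mult_right_mono) simp_all
   also have "\<dots> = exp (- real n*t)" unfolding exp_add[symmetric] by (simp add: algebra_simps)
   finally show ?case using elim(1) by linarith
  qed
 qed
 moreover have "\<forall>\<^sub>F n in sequentially. (2 + real (card Q))*(real n + 1)^0\<le>exp (real n*(t - s'))"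
  by (rule eventually_power_le_exp) (use t in simp)
 ultimately show ?thesis using eventually_ge_at_top[of 1]
 proof eventually_elim
  case (elim n)
  let ?A = "(inW n (topspace W1_topology - OW))" and ?B = "(inX n (topspace weak_topology - OX))"
  let ?C = "%q. {\<omega>\<in>space M. alpha n \<omega>\<in>fst q \<and> beta n \<omega>\<in>snd q \<and> L n \<omega>\<notin>G}"
  note mA = measure_distr_rv(2)[OF alpha_measurable[OF elim(5)]] and mB = measure_distr_rv(2)[OF beta_measurable[OF elim(5)]]
   and mL = measure_distr_rv(2)[OF L_measurable[OF elim(5)]]
  have A: "?A\<in>events" by (rule mA[OF closedin_sets_borel_of[OF cW]])
  have B: "?B\<in>events" by (rule mB[OF closedin_sets_borel_of[OF cX]])
  have Cq: "?C q\<in>events" if q: "q\<in>Q" for q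
  proof -
   have "openin W1_topology (fst q)" "openin weak_topology (snd q)" using bspec[OF Q(2) q] by (simp_all add: split_beta)
   then have "(inW n (fst q))\<inter>(inX n (snd q))\<inter>(space M - (inL n G))\<in>events"
    by (intro sets.Int sets.Diff sets.top mA mB mL openin_sets_borel_of G)
   moreover have "?C q = (inW n (fst q))\<inter>(inX n (snd q))\<inter>(space M - (inL n G))" by blast
   ultimately show ?thesis by simp
  qed
  have sub: "(inL n C)\<subseteq>(?A\<union>?B)\<union>(\<Union>q\<in>Q. ?C q)"
  proof
   fix \<omega> assume "\<omega>\<in>(inL n C)"
   then have \<omega>: "\<omega>\<in>space M" "L n \<omega>\<notin>G" by (auto simp: G_def)
   have at: "alpha n \<omega>\<in>topspace W1_topology" and bt: "beta n \<omega>\<in>topspace weak_topology"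
    using measurable_space[OF alpha_measurable[OF elim(5)] \<omega>(1)] measurable_space[OF beta_measurable[OF elim(5)] \<omega>(1)] unfolding space_borel_of .
   show "\<omega>\<in>(?A\<union>?B)\<union>(\<Union>q\<in>Q. ?C q)"
   proof (cases "alpha n \<omega>\<in>OW \<and> beta n \<omega>\<in>OX")
    case True
    then have "(alpha n \<omega>,beta n \<omega>)\<in>(\<Union>(U,V)\<in>Q. U\<times>V)" by (intro subsetD[OF OO] SigmaI) (rule conjunct1, assumption, rule conjunct2)
    then obtain q where "q\<in>Q" "alpha n \<omega>\<in>fst q" "beta n \<omega>\<in>snd q" by auto
    then show ?thesis using \<omega> by blast
   next
    case False
    then show ?thesis using at bt \<omega>(1) by blast
   qed
  qed
  have "prob (inL n C)\<le>prob ((?A\<union>?B)\<union>(\<Union>q\<in>Q. ?C q))"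
   by (rule finite_measure_mono[OF sub]) (intro sets.Un sets.finite_UN A B Cq Q(1))
  also have "\<dots>\<le>prob (?A\<union>?B) + prob (\<Union>q\<in>Q. ?C q)"
   by (rule measure_Un_le) (intro sets.Un sets.finite_UN A B Cq Q(1))+
  also have "\<dots>\<le>(prob ?A + prob ?B) + (\<Sum>q\<in>Q. prob (?C q))"
   by (intro add_mono measure_Un_le[OF A B] finite_measure_subadditive_finite[OF Q(1)]) (use Cq in blast)
  also have "\<dots>\<le>(exp (- real n*t) + exp (- real n*t)) + (\<Sum>q\<in>Q. exp (- real n*t))"
   by (intro add_mono sum_mono elim(1,2) elim(3)[rule_format])
  also have "\<dots> = (2 + real (card Q))*exp (- real n*t)" by (simp add: algebra_simps)
  also have "\<dots>\<le>exp (real n*(t - s'))*exp (- real n*t)" using elim(4) by (intro mult_right_mono) simp_all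
  also have "\<dots> = exp (- real n * s')" unfolding exp_add[symmetric] by (simp add: algebra_simps)
  finally show ?case .
 qed
qed

theorem LDP_weighted: "LDP_rv M weak_topology L (Krate IW IX)"
 unfolding LDP_rv_def
proof (intro conjI allI impI L_measurable)
 let ?P = "%n. distr M (borel_of weak_topology) (L n)"
 show "LDP weak_topology ?P (Krate IW IX)"
  unfolding LDP_def
 proof (intro conjI allI impI ballI lower_semicontinuous_Krate)
  show "?P n\<in>space (prob_algebra (borel_of weak_topology))" if "1\<le>n" for n
   unfolding space_prob_algebra using prob_space_distr[OF L_measurable[OF that]] by simp
  fix A :: "'s measure set" assume A: "A\<in>sets (borel_of weak_topology)"
  have m: "measure (?P n) B = prob (inL n B)" if "1\<le>n" "B\<in>sets (borel_of weak_topology)" for n B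
   by (rule measure_distr_rv(1)[OF L_measurable[OF that(1)] that(2)])
  show "- enn2ereal (INF y\<in>weak_topology interior_of A. Krate IW IX y)\<le>liminf (%n. ereal (1/real n)*elog (measure (?P n) A))"
  proof (rule liminf_elog_ge)
   fix s assume s: "enn2ereal (INF y\<in>weak_topology interior_of A. Krate IW IX y) < ereal s"
   have "0\<le>enn2ereal (INF y\<in>weak_topology interior_of A. Krate IW IX y)" by simp
   then have s0: "0\<le>s" using s by (metis ereal_less_eq(5) less_imp_le order_trans)
   then obtain \<nu> where \<nu>: "\<nu>\<in>weak_topology interior_of A" "Krate IW IX \<nu> < ennreal s"
    using s unfolding enn2ereal_less_ereal[OF s0] INF_less_iff by blast
   show "\<forall>\<^sub>F n in sequentially. exp (- real n * s)\<le>measure (?P n) A"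
    using eventually_L_open[OF openin_interior_of \<nu> s0] eventually_ge_at_top[of 1]
   proof eventually_elim
    case (elim n)
    have "prob (inL n (weak_topology interior_of A))\<le>prob (inL n A)"
     using interior_of_subset[of weak_topology A]
     by (intro finite_measure_mono measure_distr_rv(2)[OF L_measurable[OF elim(2)] A]) blast
    then show ?case using elim(1) m[OF elim(2) A] by linarith
   qed
  qed simp
  show "limsup (%n. ereal (1/real n)*elog (measure (?P n) A))\<le>- enn2ereal (INF y\<in>weak_topology closure_of A. Krate IW IX y)"
  proof (rule limsup_elog_le)
   fix s' assume s': "ereal s' < enn2ereal (INF y\<in>weak_topology closure_of A. Krate IW IX y)"
   show "\<forall>\<^sub>F n in sequentially. measure (?P n) A\<le>exp (- real n * s')"
   \<comment> \<open>For negative s' the bound exceeds 1 and nothing is to be shown; otherwise s' is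
     a legitimate level in \<open>ennreal\<close>.\<close>
   proof (cases "0\<le>s'")
    case True
    then have "ennreal s' < (INF y\<in>weak_topology closure_of A. Krate IW IX y)" using s' by (simp add: ereal_less_enn2ereal)
    then obtain r where r: "ennreal s' < r" "r < (INF y\<in>weak_topology closure_of A. Krate IW IX y)" using dense by blast
    then obtain s where s: "r = ennreal s" "0\<le>s" by (cases r) auto
    have "s' < s" using r(1) True unfolding s(1) by (simp add: ennreal_less_iff)
    have K: "ennreal s < Krate IW IX \<nu>" if "\<nu>\<in>weak_topology closure_of A" for \<nu>
     using r(2) INF_lower[OF that, of "Krate IW IX"] unfolding s(1) by (rule less_le_trans)
    have sub: "A\<subseteq>weak_topology closure_of A"
     using sets.sets_into_space[OF A] closure_of_subset by (simp only: space_borel_of)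
    have "\<forall>\<^sub>F n in sequentially. prob (inL n (weak_topology closure_of A))\<le>exp (- real n * s')"
     by (rule eventually_L_closed[OF closedin_closure_of s(2) K \<open>s' < s\<close>])
    then show ?thesis using eventually_ge_at_top[of 1]
    proof eventually_elim
     case (elim n)
     have "prob (inL n A)\<le>prob (inL n (weak_topology closure_of A))"
      using sub by (intro finite_measure_mono measure_distr_rv(2)[OF L_measurable[OF elim(2)] closedin_sets_borel_of[OF closedin_closure_of]]) blast
     then show ?case using elim(1) m[OF elim(2) A] by linarith
    qed
   next
    case False
    show ?thesis using eventually_ge_at_top[of 1]
    proof eventually_elim
     case (elim n)
     have "measure (?P n) A\<le>1" unfolding m[OF elim A] by simp
     also have "1\<le>exp (- real n * s')" using False by (simp add: mult_nonneg_nonpos)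
     finally show ?case .
    qed
   qed
  qed simp
 qed
qed

end

section \<open>Kernels and disintegration\<close>

context
 fixes \<kappa> :: "'s::topological_space => real measure" and \<mu> :: "'s measure"
 assumes \<kappa>: "\<kappa>\<in>measurable borel (prob_algebra Rplus)" and \<mu>: "\<mu>\<in>M1"
begin

lemma kernel_D: "prob_space (\<kappa> x)" "sets (\<kappa> x) = sets Rplus" "space (\<kappa> x) = {0..}"
proof -
 have k: "\<kappa> x\<in>space (prob_algebra Rplus)" using measurable_space[OF \<kappa>, of x] by simp
 show "prob_space (\<kappa> x)" "sets (\<kappa> x) = sets Rplus" "space (\<kappa> x) = {0..}"
  using prob_algebraD[OF k] by simp_all
qed

lemma kernel_measurable: "(%x. distr (\<kappa> x) RS (%w. (w,x)))\<in>measurable \<mu> (subprob_algebra RS)"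
proof -
 have "(%x. distr (\<kappa> x) RS (%w. (w,x)))\<in>measurable borel (subprob_algebra RS)"
  by (rule measurable_distr2[OF _ measurable_prob_algebraD[OF \<kappa>]]) measurable
 then show ?thesis unfolding measurable_cong_sets[OF prob_algebraD(2)[OF \<mu>] refl] .
qed

lemma sets_kernel_prod: "sets (kernel_prod \<kappa> \<mu>) = sets RS"
 unfolding kernel_prod_def by (rule sets_bind[OF sets_kernel[OF kernel_measurable] prob_space.not_empty[OF prob_algebraD(1)[OF \<mu>]]])

lemma nn_integral_kernel_prod:
 assumes f: "f\<in>borel_measurable RS"
 shows "(%x. \<integral>\<^sup>+w. f (w,x)\<partial>\<kappa> x)\<in>borel_measurable borel"
  "(\<integral>\<^sup>+p. f p\<partial>kernel_prod \<kappa> \<mu>) = (\<integral>\<^sup>+x. \<integral>\<^sup>+w. f (w,x)\<partial>\<kappa> x\<partial>\<mu>)"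
proof -
 have "(%(x,w). f (w,x))\<in>borel_measurable (borel\<Otimes>\<^sub>MRplus)"
  using measurable_pair_swap[OF f] by simp
 then show "(%x. \<integral>\<^sup>+w. f (w,x)\<partial>\<kappa> x)\<in>borel_measurable borel"
  by (rule nn_integral_measurable_subprob_algebra2[OF _ measurable_prob_algebraD[OF \<kappa>]])
 have "(\<integral>\<^sup>+p. f p\<partial>kernel_prod \<kappa> \<mu>) = (\<integral>\<^sup>+x. \<integral>\<^sup>+p. f p\<partial>distr (\<kappa> x) RS (%w. (w,x))\<partial>\<mu>)"
  unfolding kernel_prod_def by (rule nn_integral_bind[OF f kernel_measurable])
 also have "\<dots> = (\<integral>\<^sup>+x. \<integral>\<^sup>+w. f (w,x)\<partial>\<kappa> x\<partial>\<mu>)"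
 proof (rule nn_integral_cong)
  fix x
  have "(%w. (w,x))\<in>measurable (\<kappa> x) RS"
   unfolding measurable_cong_sets[OF kernel_D(2) refl] by measurable
  then show "(\<integral>\<^sup>+p. f p\<partial>distr (\<kappa> x) RS (%w. (w,x))) = (\<integral>\<^sup>+w. f (w,x)\<partial>\<kappa> x)"
   by (rule nn_integral_distr) (use f in simp)
 qed
 finally show "(\<integral>\<^sup>+p. f p\<partial>kernel_prod \<kappa> \<mu>) = (\<integral>\<^sup>+x. \<integral>\<^sup>+w. f (w,x)\<partial>\<kappa> x\<partial>\<mu>)" .
qed

lemma kernel_prod_prob: "kernel_prod \<kappa> \<mu>\<in>space (prob_algebra RS)"
proof -
 have sp: "space (kernel_prod \<kappa> \<mu>) = space RS" by (rule sets_eq_imp_space_eq[OF sets_kernel_prod])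
 have "emeasure (kernel_prod \<kappa> \<mu>) (space (kernel_prod \<kappa> \<mu>)) = (\<integral>\<^sup>+p. 1\<partial>kernel_prod \<kappa> \<mu>)" by simp
 also have "\<dots> = (\<integral>\<^sup>+x. \<integral>\<^sup>+w. 1\<partial>\<kappa> x\<partial>\<mu>)" by (rule nn_integral_kernel_prod(2)) simp
 also have "\<dots> = 1" using prob_space.emeasure_space_1[OF kernel_D(1)] prob_space.emeasure_space_1[OF prob_algebraD(1)[OF \<mu>]] by simp
 finally have "prob_space (kernel_prod \<kappa> \<mu>)" by (rule prob_spaceI)
 then show ?thesis unfolding space_prob_algebra using sets_kernel_prod by simp
qed

lemma marg2_kernel_prod: "marg2 (kernel_prod \<kappa> \<mu>) = \<mu>"
proof (rule measure_eqI)
 show "sets (marg2 (kernel_prod \<kappa> \<mu>)) = sets \<mu>" unfolding marg2_def using prob_algebraD(2)[OF \<mu>] by simp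
 fix A assume "A\<in>sets (marg2 (kernel_prod \<kappa> \<mu>))"
 then have A: "A\<in>sets borel" by (simp add: marg2_def)
 note m = joint_measurable(2)[OF sets_kernel_prod]
 have m2: "(%p :: real\<times>'s. indicator A (snd p) :: ennreal)\<in>borel_measurable RS"
  using A by (intro measurable_compose[OF measurable_snd borel_measurable_indicator])
 have "emeasure (marg2 (kernel_prod \<kappa> \<mu>)) A = (\<integral>\<^sup>+y. indicator A y\<partial>marg2 (kernel_prod \<kappa> \<mu>))"
  using A by (simp add: marg2_def)
 also have "\<dots> = (\<integral>\<^sup>+p. indicator A (snd p)\<partial>kernel_prod \<kappa> \<mu>)"
  unfolding marg2_def by (rule nn_integral_distr[OF m]) (use A in simp)
 also have "\<dots> = (\<integral>\<^sup>+x. \<integral>\<^sup>+w. indicator A (snd (w,x))\<partial>\<kappa> x\<partial>\<mu>)" by (rule nn_integral_kernel_prod(2)[OF m2])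
 also have "\<dots> = (\<integral>\<^sup>+x. indicator A x\<partial>\<mu>)"
  using prob_space.emeasure_space_1[OF kernel_D(1)] by simp
 also have "\<dots> = emeasure \<mu> A" using A prob_algebraD(2)[OF \<mu>] by simp
 finally show "emeasure (marg2 (kernel_prod \<kappa> \<mu>)) A = emeasure \<mu> A" .
qed

text \<open>Adding B makes the integrand nonnegative, so that the statement follows from
  \<open>nn_integral_kernel_prod\<close>.\<close>

lemma integral_kernel_prod:
 fixes f :: "real\<times>'s => real"
 assumes f: "f\<in>borel_measurable RS" and B: "\<And>p. \<bar>f p\<bar>\<le>B"
 shows "(%x. \<integral>w. f (w,x)\<partial>\<kappa> x)\<in>borel_measurable borel" "\<bar>\<integral>w. f (w,x)\<partial>\<kappa> x\<bar>\<le>B"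
  "integrable (\<kappa> x) (%w. f (w,x))"
  "(\<integral>p. f p\<partial>kernel_prod \<kappa> \<mu>) = (\<integral>x. \<integral>w. f (w,x)\<partial>\<kappa> x\<partial>\<mu>)"
proof -
 have f0: "0\<le>f p + B" for p using B[of p] by linarith
 have fx: "(%w. f (w,x))\<in>borel_measurable (\<kappa> x)" for x
  unfolding measurable_cong_sets[OF kernel_D(2) refl] by (rule measurable_compose[OF _ f]) measurable
 have int: "integrable (\<kappa> x) (%w. f (w,x))" for x
  by (rule finite_measure.integrable_const_bound[OF prob_space.finite_measure[OF kernel_D(1)], of _ B]) (use fx B in auto)
 then show "integrable (\<kappa> x) (%w. f (w,x))" .
 have bd: "\<bar>\<integral>w. f (w,x)\<partial>\<kappa> x\<bar>\<le>B" for x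
 proof -
  have "\<bar>\<integral>w. f (w,x)\<partial>\<kappa> x\<bar>\<le>(\<integral>w. \<bar>f (w,x)\<bar>\<partial>\<kappa> x)" by (rule integral_abs_bound)
  also have "\<dots>\<le>(\<integral>w. B\<partial>\<kappa> x)"
   using int B by (intro integral_mono integrable_abs finite_measure.integrable_const prob_space.finite_measure kernel_D) auto
  also have "\<dots> = B" using prob_space.prob_space[OF kernel_D(1)] by simp
  finally show ?thesis .
 qed
 then show "\<bar>\<integral>w. f (w,x)\<partial>\<kappa> x\<bar>\<le>B" .
 have shift: "(\<integral>\<^sup>+w. ennreal (f (w,x) + B)\<partial>\<kappa> x) = ennreal ((\<integral>w. f (w,x)\<partial>\<kappa> x) + B)" for x
 proof -
  interpret k: prob_space "\<kappa> x" by (rule kernel_D)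
  have "(\<integral>\<^sup>+w. ennreal (f (w,x) + B)\<partial>\<kappa> x) = ennreal (\<integral>w. f (w,x) + B\<partial>\<kappa> x)"
   by (rule nn_integral_eq_integral) (use int f0 in auto)
  also have "(\<integral>w. f (w,x) + B\<partial>\<kappa> x) = (\<integral>w. f (w,x)\<partial>\<kappa> x) + B" using int by (simp add: k.prob_space)
  finally show ?thesis .
 qed
 have fB: "(%p. ennreal (f p + B))\<in>borel_measurable RS" using f by simp
 have "(%x. enn2real (\<integral>\<^sup>+w. ennreal (f (w,x) + B)\<partial>\<kappa> x) - B)\<in>borel_measurable borel"
  using nn_integral_kernel_prod(1)[OF fB] by simp
 moreover have "enn2real (\<integral>\<^sup>+w. ennreal (f (w,x) + B)\<partial>\<kappa> x) - B = (\<integral>w. f (w,x)\<partial>\<kappa> x)" for x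
  unfolding shift using bd[of x] by (simp add: enn2real_ennreal)
 ultimately show m: "(%x. \<integral>w. f (w,x)\<partial>\<kappa> x)\<in>borel_measurable borel" by simp
 interpret \<mu>: prob_space \<mu> by (rule prob_algebraD[OF \<mu>])
 interpret P: prob_space "kernel_prod \<kappa> \<mu>" by (rule prob_algebraD[OF kernel_prod_prob])
 have fP: "f\<in>borel_measurable (kernel_prod \<kappa> \<mu>)" unfolding measurable_cong_sets[OF sets_kernel_prod refl] by (rule f)
 have m': "(%x. \<integral>w. f (w,x)\<partial>\<kappa> x)\<in>borel_measurable \<mu>"
  unfolding measurable_cong_sets[OF prob_algebraD(2)[OF \<mu>] refl] by (rule m)
 have iP: "integrable (kernel_prod \<kappa> \<mu>) f" by (rule P.integrable_const_bound[of _ B]) (use fP B in auto)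
 have i\<mu>: "integrable \<mu> (%x. \<integral>w. f (w,x)\<partial>\<kappa> x)" by (rule \<mu>.integrable_const_bound[of _ B]) (use m' bd in auto)
 have g0: "0\<le>(\<integral>w. f (w,x)\<partial>\<kappa> x) + B" for x using bd[of x] by linarith
 have "ennreal ((\<integral>p. f p\<partial>kernel_prod \<kappa> \<mu>) + B) = ennreal (\<integral>p. f p + B\<partial>kernel_prod \<kappa> \<mu>)"
  using iP by (simp add: P.prob_space)
 also have "\<dots> = (\<integral>\<^sup>+p. ennreal (f p + B)\<partial>kernel_prod \<kappa> \<mu>)"
  by (rule nn_integral_eq_integral[symmetric]) (use iP f0 in auto)
 also have "\<dots> = (\<integral>\<^sup>+x. \<integral>\<^sup>+w. ennreal (f (w,x) + B)\<partial>\<kappa> x\<partial>\<mu>)" by (rule nn_integral_kernel_prod(2)[OF fB])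
 also have "\<dots> = (\<integral>\<^sup>+x. ennreal ((\<integral>w. f (w,x)\<partial>\<kappa> x) + B)\<partial>\<mu>)" unfolding shift ..
 also have "\<dots> = ennreal (\<integral>x. (\<integral>w. f (w,x)\<partial>\<kappa> x) + B\<partial>\<mu>)"
  by (rule nn_integral_eq_integral) (use i\<mu> g0 in auto)
 also have "(\<integral>x. (\<integral>w. f (w,x)\<partial>\<kappa> x) + B\<partial>\<mu>) = (\<integral>x. \<integral>w. f (w,x)\<partial>\<kappa> x\<partial>\<mu>) + B"
  using i\<mu> by (simp add: \<mu>.prob_space)
 finally have e: "ennreal ((\<integral>p. f p\<partial>kernel_prod \<kappa> \<mu>) + B) = ennreal ((\<integral>x. \<integral>w. f (w,x)\<partial>\<kappa> x\<partial>\<mu>) + B)" .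
 have "0\<le>(\<integral>p. f p + B\<partial>kernel_prod \<kappa> \<mu>)" "0\<le>(\<integral>x. (\<integral>w. f (w,x)\<partial>\<kappa> x) + B\<partial>\<mu>)"
  by (intro integral_nonneg_AE AE_I2 f0 g0)+
 then have "0\<le>(\<integral>p. f p\<partial>kernel_prod \<kappa> \<mu>) + B" "0\<le>(\<integral>x. \<integral>w. f (w,x)\<partial>\<kappa> x\<partial>\<mu>) + B"
  using iP i\<mu> by (simp_all add: P.prob_space \<mu>.prob_space)
 then show "(\<integral>p. f p\<partial>kernel_prod \<kappa> \<mu>) = (\<integral>x. \<integral>w. f (w,x)\<partial>\<kappa> x\<partial>\<mu>)" using e by simp
qed

end

section \<open>Entropy of kernels relative to product measures\<close>

lemma const_kernel: "\<alpha>\<in>space (prob_algebra Rplus) ==> (%_. \<alpha>)\<in>measurable borel (prob_algebra Rplus)"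
 by simp

text \<open>Product measures become constant kernels, so one integration formula serves both sides
  of an entropy comparison.\<close>

lemma kernel_prod_const:
 assumes \<alpha>: "\<alpha>\<in>space (prob_algebra Rplus)" and \<mu>: "(\<mu> :: 's::topological_space measure)\<in>M1"
 shows "kernel_prod (%_. \<alpha>) \<mu> = \<alpha>\<Otimes>\<^sub>M\<mu>"
proof (rule measure_eqI)
 interpret a: prob_space \<alpha> by (rule prob_algebraD[OF \<alpha>])
 interpret b: prob_space \<mu> by (rule prob_algebraD[OF \<mu>])
 interpret P: pair_prob_space \<alpha> \<mu> ..
 note s = prob_product(2)[OF \<alpha> \<mu>] and k = const_kernel[OF \<alpha>]
 show "sets (kernel_prod (%_. \<alpha>) \<mu>) = sets (\<alpha>\<Otimes>\<^sub>M\<mu>)" using sets_kernel_prod[OF k \<mu>] s by simp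
 fix A assume "A\<in>sets (kernel_prod (%_. \<alpha>) \<mu>)"
 then have A: "A\<in>sets RS" using sets_kernel_prod[OF k \<mu>] by simp
 have "emeasure (kernel_prod (%_. \<alpha>) \<mu>) A = (\<integral>\<^sup>+p. indicator A p\<partial>kernel_prod (%_. \<alpha>) \<mu>)"
  using A sets_kernel_prod[OF k \<mu>] by simp
 also have "\<dots> = (\<integral>\<^sup>+x. \<integral>\<^sup>+w. indicator A (w,x)\<partial>\<alpha>\<partial>\<mu>)" by (rule nn_integral_kernel_prod(2)[OF k \<mu>]) (use A in simp)
 also have "\<dots> = (\<integral>\<^sup>+p. indicator A p\<partial>(\<alpha>\<Otimes>\<^sub>M\<mu>))" by (rule P.nn_integral_snd, rule borel_measurable_indicator, unfold s, rule A)
 also have "\<dots> = emeasure (\<alpha>\<Otimes>\<^sub>M\<mu>) A" using A s by simp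
 finally show "emeasure (kernel_prod (%_. \<alpha>) \<mu>) A = emeasure (\<alpha>\<Otimes>\<^sub>M\<mu>) A" .
qed

text \<open>The variational formula, applied to each \<open>\<kappa> x\<close> and integrated, together with Jensen's inequality
 for the logarithm. The entropy of \<open>\<kappa> x\<close> is not needed to be measurable in \<open>x\<close>.\<close>

lemma rel_entropy_kernel_prod_le:
 fixes \<mu> :: "'s::topological_space measure"
 assumes \<kappa>: "\<kappa>\<in>measurable borel (prob_algebra Rplus)" and \<mu>: "\<mu>\<in>M1" and \<alpha>: "\<alpha>\<in>space (prob_algebra Rplus)"
 shows "rel_entropy (kernel_prod \<kappa> \<mu>) (\<alpha>\<Otimes>\<^sub>M\<mu>)\<le>(\<integral>\<^sup>+x. rel_entropy (\<kappa> x) \<alpha>\<partial>\<mu>)"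
proof (cases "\<integral>\<^sup>+x. rel_entropy (\<kappa> x) \<alpha>\<partial>\<mu>")
 case (real c)
 note k\<alpha> = const_kernel[OF \<alpha>] and s = prob_product(2)[OF \<alpha> \<mu>]
 note K = prob_algebraD[OF kernel_prod_prob[OF \<kappa> \<mu>]]
 interpret \<mu>: prob_space \<mu> by (rule prob_algebraD[OF \<mu>])
 have "rel_entropy (kernel_prod \<kappa> \<mu>) (\<alpha>\<Otimes>\<^sub>M\<mu>)\<le>ennreal c"
 proof (rule variational_imp_rel_entropy_le[OF prob_product(1)[OF \<alpha> \<mu>] K(1) _ real(1)])
  show "sets (kernel_prod \<kappa> \<mu>) = sets (\<alpha>\<Otimes>\<^sub>M\<mu>)" unfolding s by (rule K(2))
  fix f :: "real\<times>'s => real" and B assume "f\<in>borel_measurable (\<alpha>\<Otimes>\<^sub>M\<mu>)" and B: "\<And>p. \<bar>f p\<bar>\<le>B"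
  then have f: "f\<in>borel_measurable RS" unfolding measurable_cong_sets[OF s refl] by blast
  have ef: "(%p. exp (f p))\<in>borel_measurable RS" using f by simp
  have fB: "f p\<le>B" "- B\<le>f p" for p using B[of p] by linarith+
  have eB: "\<bar>exp (f p)\<bar>\<le>exp B" for p using fB by simp
  define g where "g x = (\<integral>w. f (w,x)\<partial>\<kappa> x)" for x
  define Y where "Y x = (\<integral>w. exp (f (w,x))\<partial>\<alpha>)" for x
  define z where "z = (mean \<mu> Y)"
  note gI = integral_kernel_prod[OF \<kappa> \<mu> f B] and YI = integral_kernel_prod[OF k\<alpha> \<mu> ef eB]
  have gm: "g\<in>borel_measurable \<mu>" and Ym: "Y\<in>borel_measurable \<mu>"
   unfolding measurable_cong_sets[OF \<mu>(1)[THEN prob_algebraD(2)] refl] g_def[abs_def] Y_def[abs_def] by (rule gI, rule YI)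
  have Yb: "exp (- B)\<le>Y x" "Y x\<le>exp B" for x
  proof -
   interpret a: prob_space \<alpha> by (rule prob_algebraD[OF \<alpha>])
   have "(\<integral>w. exp (- B)\<partial>\<alpha>)\<le>Y x" unfolding Y_def by (rule integral_mono) (use YI(3) fB in auto)
   then show "exp (- B)\<le>Y x" by (simp add: a.prob_space)
   show "Y x\<le>exp B" using YI(2)[of x] unfolding Y_def by linarith
  qed
  have Y0: "0 < Y x" for x using Yb(1)[of x] exp_gt_zero[of "- B"] by linarith
  have lY: "\<bar>ln (Y x)\<bar>\<le>B" for x
   using ln_ge_iff[OF Y0[of x], of "- B"] Yb[of x] ln_le_cancel_iff[OF Y0[of x], of "exp B"] by (simp add: abs_le_iff)
  have ig: "integrable \<mu> g" by (rule \<mu>.integrable_const_bound[of _ B]) (use gI(2) gm in \<open>auto simp: g_def\<close>)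
  have iY: "integrable \<mu> Y" by (rule \<mu>.integrable_const_bound[of _ "exp B"]) (use YI(2) Ym in \<open>auto simp: Y_def\<close>)
  have ilY: "integrable \<mu> (%x. ln (Y x))" by (rule \<mu>.integrable_const_bound[of _ B]) (use lY Ym in auto)
  \<comment> \<open>\<open>ennreal\<close> cuts off negative values, which only enlarges the
    integral of the left-hand side; an upper bound for it is all that is wanted. Infinite entropy of
    \<kappa> x is harmless.\<close>
  have "ennreal (g x - ln (Y x))\<le>rel_entropy (\<kappa> x) \<alpha>" for x
  proof (cases "rel_entropy (\<kappa> x) \<alpha>")
   case (real h)
   have "(\<integral>w. f (w,x)\<partial>\<kappa> x)\<le>h + ln (\<integral>w. exp (f (w,x))\<partial>\<alpha>)"
   proof (rule rel_entropy_le_imp_variational[OF prob_algebraD(1)[OF \<alpha>] kernel_D(1)[OF \<kappa> \<mu>] _ eq_refl[OF real(2)] real(1) _ B])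
    show "sets (\<kappa> x) = sets \<alpha>" using kernel_D(2)[OF \<kappa> \<mu>] prob_algebraD(2)[OF \<alpha>] by simp
    show "(%w. f (w,x))\<in>borel_measurable \<alpha>"
     unfolding measurable_cong_sets[OF prob_algebraD(2)[OF \<alpha>] refl] by (rule measurable_compose[OF _ f]) measurable
   qed
   then show ?thesis unfolding real(2) g_def Y_def using real(1) by (intro ennreal_leI) linarith
  qed simp
  then have "(\<integral>\<^sup>+x. ennreal (g x - ln (Y x))\<partial>\<mu>)\<le>ennreal c" unfolding real(2)[symmetric] by (rule nn_integral_mono)
  then have "enn2real (\<integral>\<^sup>+x. ennreal (g x - ln (Y x))\<partial>\<mu>)\<le>c" using real(1) by (simp add: enn2real_leI)
  moreover have "(\<integral>x. g x - ln (Y x)\<partial>\<mu>)\<le>enn2real (\<integral>\<^sup>+x. ennreal (g x - ln (Y x))\<partial>\<mu>)"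
   by (subst real_lebesgue_integral_def) (use ig ilY in auto)
  ultimately have 1: "(mean \<mu> g) - (\<integral>x. ln (Y x)\<partial>\<mu>)\<le>c" using ig ilY by simp
  have "exp (- B) = (\<integral>x. exp (- B)\<partial>\<mu>)" by (simp add: \<mu>.prob_space)
  also have "\<dots>\<le>z" unfolding z_def by (rule integral_mono) (use iY Yb in auto)
  finally have z0: "0 < z" using exp_gt_zero[of "- B"] by linarith
  \<comment> \<open>The tangent of the logarithm at the mean z; integrating it is Jensen's
    inequality.\<close>
  have "ln (Y x)\<le>ln z + (Y x/z - 1)" for x
   using ln_le_minus_one[of "Y x/z"] Y0[of x] z0 by (simp add: ln_div)
  then have "(\<integral>x. ln (Y x)\<partial>\<mu>)\<le>(\<integral>x. ln z + (Y x/z - 1)\<partial>\<mu>)" by (intro integral_mono ilY) (use iY in auto)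
  also have "\<dots> = ln z" using iY z0 by (simp add: \<mu>.prob_space z_def[symmetric])
  finally have 2: "(\<integral>x. ln (Y x)\<partial>\<mu>)\<le>ln z" .
  have "(\<integral>p. f p\<partial>kernel_prod \<kappa> \<mu>) = (mean \<mu> g)" unfolding g_def by (rule gI(4))
  moreover have "(\<integral>p. exp (f p)\<partial>(\<alpha>\<Otimes>\<^sub>M\<mu>)) = z"
   unfolding z_def Y_def kernel_prod_const[OF \<alpha> \<mu>, symmetric] by (rule YI(4))
  ultimately show "(\<integral>p. f p\<partial>kernel_prod \<kappa> \<mu>)\<le>c + ln (\<integral>p. exp (f p)\<partial>(\<alpha>\<Otimes>\<^sub>M\<mu>))" using 1 2 by simp
 qed
 then show ?thesis unfolding real(2) .
qed simp

text \<open>Fubini's theorem for g ln g. The sectional entropies are nonnegative because t ln t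
  \<ge> t - 1 and each section of g has integral 1, so \<open>ennreal\<close> loses nothing.\<close>

lemma rel_entropy_density_kernel:
 fixes g :: "real\<times>'s::topological_space => real"
 assumes \<alpha>: "\<alpha>\<in>space (prob_algebra Rplus)" and \<mu>: "\<mu>\<in>M1"
  and g: "g\<in>borel_measurable RS" and g0: "\<And>p. 0\<le>g p"
  and one: "\<And>x. (\<integral>\<^sup>+w. ennreal (g (w,x))\<partial>\<alpha>) = 1"
 shows "(\<integral>\<^sup>+x. rel_entropy (density \<alpha> (%w. ennreal (g (w,x)))) \<alpha>\<partial>\<mu>)\<le>rel_entropy (density (\<alpha>\<Otimes>\<^sub>M\<mu>) (%p. ennreal (g p))) (\<alpha>\<Otimes>\<^sub>M\<mu>)"
proof -
 interpret a: prob_space \<alpha> by (rule prob_algebraD[OF \<alpha>])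
 interpret b: prob_space \<mu> by (rule prob_algebraD[OF \<mu>])
 interpret P: pair_prob_space \<alpha> \<mu> ..
 note s = prob_product(2)[OF \<alpha> \<mu>]
 let ?G = "%p. g p*ln (g p)"
 have gm: "g\<in>borel_measurable (\<alpha>\<Otimes>\<^sub>M\<mu>)" unfolding measurable_cong_sets[OF s refl] by (rule g)
 have gx: "(%w. g (w,x))\<in>borel_measurable \<alpha>" for x
  unfolding measurable_cong_sets[OF prob_algebraD(2)[OF \<alpha>] refl] by (rule measurable_compose[OF _ g]) measurable
 have H: "rel_entropy (density (\<alpha>\<Otimes>\<^sub>M\<mu>) (%p. ennreal (g p))) (\<alpha>\<Otimes>\<^sub>M\<mu>) =
   (if integrable (\<alpha>\<Otimes>\<^sub>M\<mu>) ?G then ennreal (\<integral>p. ?G p\<partial>(\<alpha>\<Otimes>\<^sub>M\<mu>)) else \<infinity>)"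
  by (rule rel_entropy_density[OF P.prob_space_axioms gm g0])
 have Hx: "rel_entropy (density \<alpha> (%w. ennreal (g (w,x)))) \<alpha> =
   (if integrable \<alpha> (%w. ?G (w,x)) then ennreal (\<integral>w. ?G (w,x)\<partial>\<alpha>) else \<infinity>)" for x
  by (rule rel_entropy_density[OF a.prob_space_axioms gx g0])
 show ?thesis
 proof (cases "integrable (\<alpha>\<Otimes>\<^sub>M\<mu>) ?G")
  case True
  then have int: "integrable (\<alpha>\<Otimes>\<^sub>M\<mu>) (case_prod (%w x. ?G (w,x)))" by (simp add: case_prod_unfold)
  have ix: "integrable \<alpha> (%w. g (w,x)) \<and> (\<integral>w. g (w,x)\<partial>\<alpha>) = 1" for x
  proof -
   have i: "integrable \<alpha> (%w. g (w,x))" by (rule integrableI_nonneg) (use gx g0 one in auto)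
   have "ennreal (\<integral>w. g (w,x)\<partial>\<alpha>) = 1" unfolding one[of x, symmetric] by (rule nn_integral_eq_integral[symmetric]) (use i g0 in auto)
   then show ?thesis using i by (simp add: ennreal_eq_1)
  qed
  have pos: "0\<le>(\<integral>w. ?G (w,x)\<partial>\<alpha>)" if "integrable \<alpha> (%w. ?G (w,x))" for x
  proof -
   have "g p - 1\<le>?G p" for p
   proof (cases "g p = 0")
    case False
    then have p: "0 < g p" using g0[of p] by linarith
    have "1 - 1/g p\<le>ln (g p)" using ln_le_minus_one[of "1/g p"] p by (simp add: ln_div)
    then have "g p*(1 - 1/g p)\<le>?G p" using p by (intro mult_left_mono) simp_all
    then show ?thesis using p by (simp add: right_diff_distrib)
   qed simp
   then have "(\<integral>w. g (w,x) - 1\<partial>\<alpha>)\<le>(\<integral>w. ?G (w,x)\<partial>\<alpha>)" by (intro integral_mono that) (use ix in auto)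
   then show ?thesis using ix[of x] by (simp add: a.prob_space)
  qed
  have ae: "AE x in \<mu>. integrable \<alpha> (%w. ?G (w,x))" by (rule P.AE_integrable_snd[OF int])
  have "(\<integral>\<^sup>+x. rel_entropy (density \<alpha> (%w. ennreal (g (w,x)))) \<alpha>\<partial>\<mu>) = (\<integral>\<^sup>+x. ennreal (\<integral>w. ?G (w,x)\<partial>\<alpha>)\<partial>\<mu>)"
   by (rule nn_integral_cong_AE) (use ae in eventually_elim, simp add: Hx)
  also have "\<dots> = ennreal (\<integral>x. \<integral>w. ?G (w,x)\<partial>\<alpha>\<partial>\<mu>)"
   by (rule nn_integral_eq_integral[OF P.integrable_snd[OF int]]) (use ae in eventually_elim, rule pos)
  also have "(\<integral>x. \<integral>w. ?G (w,x)\<partial>\<alpha>\<partial>\<mu>) = (\<integral>p. ?G p\<partial>(\<alpha>\<Otimes>\<^sub>M\<mu>))"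
   using P.integral_snd[OF int] by (simp add: case_prod_unfold)
  finally show ?thesis unfolding H using True by simp
 qed (simp add: H)
qed

text \<open>Finite entropy provides a density g with respect to the product of the marginals, and
  its sections serve as densities of \<kappa> x with respect to the first marginal.\<close>

lemma disintegration:
 fixes \<rho> :: "(real\<times>'s::topological_space) measure"
 assumes \<rho>: "\<rho>\<in>space (prob_algebra RS)" and H: "rel_entropy \<rho> (marg1 \<rho>\<Otimes>\<^sub>Mmarg2 \<rho>) < \<infinity>"
 obtains \<kappa> where "\<kappa>\<in>measurable borel (prob_algebra Rplus)" "kernel_prod \<kappa> (marg2 \<rho>) = \<rho>"
  "(\<integral>\<^sup>+x. rel_entropy (\<kappa> x) (marg1 \<rho>)\<partial>marg2 \<rho>)\<le>rel_entropy \<rho> (marg1 \<rho>\<Otimes>\<^sub>Mmarg2 \<rho>)"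
proof -
 define \<alpha> where "\<alpha> = marg1 \<rho>"
 define \<mu> where "\<mu> = marg2 \<rho>"
 have \<alpha>: "\<alpha>\<in>space (prob_algebra Rplus)" and \<mu>: "\<mu>\<in>M1" unfolding \<alpha>_def \<mu>_def by (rule marg_prob[OF \<rho>])+
 interpret a: prob_space \<alpha> by (rule prob_algebraD[OF \<alpha>])
 interpret b: prob_space \<mu> by (rule prob_algebraD[OF \<mu>])
 interpret P: pair_prob_space \<alpha> \<mu> ..
 note s = prob_product(2)[OF \<alpha> \<mu>] and k\<alpha> = const_kernel[OF \<alpha>] and s\<alpha> = prob_algebraD(2)[OF \<alpha>] and s\<mu> = prob_algebraD(2)[OF \<mu>]
 have s\<rho>: "sets \<rho> = sets (\<alpha>\<Otimes>\<^sub>M\<mu>)" unfolding s by (rule prob_algebraD[OF \<rho>])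
 have ac: "absolutely_continuous (\<alpha>\<Otimes>\<^sub>M\<mu>) \<rho>"
  using H unfolding rel_entropy_def \<alpha>_def[symmetric] \<mu>_def[symmetric] by (auto split: if_splits)
 obtain g :: "real\<times>'s => real" where gm: "g\<in>borel_measurable (\<alpha>\<Otimes>\<^sub>M\<mu>)" and g0: "\<And>p. 0\<le>g p"
  and \<rho>g: "\<rho> = density (\<alpha>\<Otimes>\<^sub>M\<mu>) (%p. ennreal (g p))"
  by (rule absolutely_continuous_density_real[OF P.prob_space_axioms prob_algebraD(1)[OF \<rho>] s\<rho> ac]) (rule that)
 have g: "g\<in>borel_measurable RS" using gm unfolding measurable_cong_sets[OF s refl] .
 have ge: "(%p. ennreal (g p))\<in>borel_measurable RS" using g by simp
 define N where "N x = (\<integral>\<^sup>+w. ennreal (g (w,x))\<partial>\<alpha>)" for x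
 have Nm: "N\<in>borel_measurable borel" unfolding N_def[abs_def] by (rule nn_integral_kernel_prod(1)[OF k\<alpha> \<mu> ge])
 have nnP: "(\<integral>\<^sup>+p. F p\<partial>(\<alpha>\<Otimes>\<^sub>M\<mu>)) = (\<integral>\<^sup>+x. \<integral>\<^sup>+w. F (w,x)\<partial>\<alpha>\<partial>\<mu>)" if "F\<in>borel_measurable RS" for F
  unfolding kernel_prod_const[OF \<alpha> \<mu>, symmetric] by (rule nn_integral_kernel_prod(2)[OF k\<alpha> \<mu> that])
 have dens: "emeasure (density (\<alpha>\<Otimes>\<^sub>M\<mu>) (%p. ennreal (f p))) A = (\<integral>\<^sup>+x. \<integral>\<^sup>+w. ennreal (f (w,x))*indicator A (w,x)\<partial>\<alpha>\<partial>\<mu>)"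
  if f: "f\<in>borel_measurable RS" and A: "A\<in>sets RS" for f :: "real\<times>'s => real" and A
 proof -
  have f1: "(%p. ennreal (f p))\<in>borel_measurable (\<alpha>\<Otimes>\<^sub>M\<mu>)" unfolding measurable_cong_sets[OF s refl] using f by simp
  have A1: "A\<in>sets (\<alpha>\<Otimes>\<^sub>M\<mu>)" unfolding s by (rule A)
  have "emeasure (density (\<alpha>\<Otimes>\<^sub>M\<mu>) (%p. ennreal (f p))) A = (\<integral>\<^sup>+p. ennreal (f p)*indicator A p\<partial>(\<alpha>\<Otimes>\<^sub>M\<mu>))"
   by (rule emeasure_density[OF f1 A1])
  also have "\<dots> = (\<integral>\<^sup>+x. \<integral>\<^sup>+w. ennreal (f (w,x))*indicator A (w,x)\<partial>\<alpha>\<partial>\<mu>)"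
   by (rule nnP) (use f A in simp)
  finally show ?thesis .
 qed
 \<comment> \<open>N is the density of the second marginal of \<rho> with respect to \<mu>, and this
   marginal is \<mu> itself.\<close>
 have ae: "AE x in \<mu>. N x = 1"
 proof (rule b.density_unique)
  show "N\<in>borel_measurable \<mu>" unfolding measurable_cong_sets[OF s\<mu> refl] by (rule Nm)
  then show "density \<mu> N = density \<mu> (%_. 1)"
  proof (intro measure_eqI)
   fix B assume N1: "N\<in>borel_measurable \<mu>" and "B\<in>sets (density \<mu> N)"
   then have B\<mu>: "B\<in>sets \<mu>" and B: "B\<in>sets borel" using s\<mu> by simp_all
   have RB: "{0..}\<times>B\<in>sets RS" using sets.top[of Rplus] B by (auto intro: pair_measureI)
   have "emeasure \<mu> B = emeasure \<rho> (snd -` B\<inter>space \<rho>)"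
    unfolding \<mu>_def marg2_def by (rule emeasure_distr[OF joint_measurable(2)[OF prob_algebraD(2)[OF \<rho>]] B])
   also have "snd -` B\<inter>space \<rho> = {0..}\<times>B" using prob_algebraD(3)[OF \<rho>] by (auto simp: space_pair_measure)
   also have "emeasure \<rho> ({0..}\<times>B) = (\<integral>\<^sup>+x. \<integral>\<^sup>+w. ennreal (g (w,x))*indicator ({0..}\<times>B) (w,x)\<partial>\<alpha>\<partial>\<mu>)"
    unfolding \<rho>g by (rule dens[OF g RB])
   also have "\<dots> = (\<integral>\<^sup>+x. N x*indicator B x\<partial>\<mu>)"
   proof (rule nn_integral_cong)
    fix x
    have "(\<integral>\<^sup>+w. ennreal (g (w,x))*indicator ({0..}\<times>B) (w,x)\<partial>\<alpha>) = (\<integral>\<^sup>+w. ennreal (g (w,x))*indicator B x\<partial>\<alpha>)"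
     by (rule nn_integral_cong) (use prob_algebraD(3)[OF \<alpha>] in \<open>auto simp: indicator_def\<close>)
    also have "\<dots> = N x*indicator B x"
     unfolding N_def by (rule nn_integral_multc) (unfold measurable_cong_sets[OF s\<alpha> refl], rule measurable_compose[OF _ ge], measurable)
    finally show "(\<integral>\<^sup>+w. ennreal (g (w,x))*indicator ({0..}\<times>B) (w,x)\<partial>\<alpha>) = N x*indicator B x" .
   qed
   also have "\<dots> = emeasure (density \<mu> N) B" by (rule emeasure_density[OF N1 B\<mu>, symmetric])
   finally show "emeasure (density \<mu> N) B = emeasure (density \<mu> (%_. 1)) B" unfolding density_1 by simp
  qed simp
 qed simp
 \<comment> \<open>On the null set where the section is not normalised it is replaced by the
   constant density 1, so that \<kappa> x is a probability measure for every x.\<close>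
 define g' where "g' p = (if N (snd p) = 1 then g p else 1)" for p
 have g'm: "g'\<in>borel_measurable RS"
 proof -
  have "(%p. N (snd p))\<in>borel_measurable RS" by (rule measurable_compose[OF measurable_snd Nm])
  then have "{p\<in>space RS. N (snd p) = 1}\<in>sets (Rplus\<Otimes>\<^sub>M(borel :: 's measure))" by measurable
  then show ?thesis unfolding g'_def[abs_def] using g by (intro measurable_If) auto
 qed
 have g'0: "0\<le>g' p" for p using g0 by (simp add: g'_def)
 have g'1: "(\<integral>\<^sup>+w. ennreal (g' (w,x))\<partial>\<alpha>) = 1" for x
  by (cases "N x = 1") (simp_all add: g'_def N_def a.emeasure_space_1)
 have g'e: "(%p. ennreal (g' p))\<in>borel_measurable RS" using g'm by simp
 have g'x: "(%w. ennreal (g' (w,x)))\<in>borel_measurable \<alpha>" for x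
  unfolding measurable_cong_sets[OF s\<alpha> refl] by (rule measurable_compose[OF _ g'e]) measurable
 have \<rho>g': "\<rho> = density (\<alpha>\<Otimes>\<^sub>M\<mu>) (%p. ennreal (g' p))"
 proof (rule measure_eqI)
  show "sets \<rho> = sets (density (\<alpha>\<Otimes>\<^sub>M\<mu>) (%p. ennreal (g' p)))" using s\<rho> by simp
  fix A assume "A\<in>sets \<rho>"
  then have A: "A\<in>sets RS" unfolding s\<rho> s .
  have "emeasure \<rho> A = (\<integral>\<^sup>+x. \<integral>\<^sup>+w. ennreal (g (w,x))*indicator A (w,x)\<partial>\<alpha>\<partial>\<mu>)"
   by (subst \<rho>g) (rule dens[OF g A])
  also have "\<dots> = (\<integral>\<^sup>+x. \<integral>\<^sup>+w. ennreal (g' (w,x))*indicator A (w,x)\<partial>\<alpha>\<partial>\<mu>)"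
   by (rule nn_integral_cong_AE) (use ae in eventually_elim, simp add: g'_def)
  also have "\<dots> = emeasure (density (\<alpha>\<Otimes>\<^sub>M\<mu>) (%p. ennreal (g' p))) A" by (rule dens[OF g'm A, symmetric])
  finally show "emeasure \<rho> A = emeasure (density (\<alpha>\<Otimes>\<^sub>M\<mu>) (%p. ennreal (g' p))) A" .
 qed
 define \<kappa> where "\<kappa> x = density \<alpha> (%w. ennreal (g' (w,x)))" for x
 have em: "emeasure (\<kappa> x) A = (\<integral>\<^sup>+w. ennreal (g' (w,x))*indicator A w\<partial>\<alpha>)" if "A\<in>sets Rplus" for A x
  unfolding \<kappa>_def by (rule emeasure_density[OF g'x]) (use that s\<alpha> in simp)
 have pk: "prob_space (\<kappa> x)" for x
 proof (rule prob_spaceI)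
  have "emeasure (\<kappa> x) (space (\<kappa> x)) = (\<integral>\<^sup>+w. ennreal (g' (w,x))*indicator (space \<alpha>) w\<partial>\<alpha>)"
   unfolding \<kappa>_def by (subst emeasure_density[OF g'x]) simp_all
  also have "\<dots> = (\<integral>\<^sup>+w. ennreal (g' (w,x))\<partial>\<alpha>)" by (rule nn_integral_cong) simp
  finally show "emeasure (\<kappa> x) (space (\<kappa> x)) = 1" unfolding g'1 .
 qed
 have \<kappa>m: "\<kappa>\<in>measurable borel (prob_algebra Rplus)"
 proof (rule measurable_prob_algebraI[OF pk measurable_subprob_algebra])
  show "subprob_space (\<kappa> x)" for x by (rule prob_space_imp_subprob_space[OF pk])
  show "sets (\<kappa> x) = sets Rplus" for x by (simp add: \<kappa>_def s\<alpha>)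
  fix A assume A: "A\<in>sets Rplus"
  have "(%p. ennreal (g' p)*indicator A (fst p))\<in>borel_measurable RS"
   by (intro borel_measurable_times_ennreal g'e measurable_compose[OF measurable_fst borel_measurable_indicator[OF A]])
  then have "(%x. \<integral>\<^sup>+w. ennreal (g' (w,x))*indicator A (fst (w,x))\<partial>\<alpha>)\<in>borel_measurable borel"
   by (rule nn_integral_kernel_prod(1)[OF k\<alpha> \<mu>])
  then show "(%x. emeasure (\<kappa> x) A)\<in>borel_measurable borel" using em[OF A] by simp
 qed
 have "kernel_prod \<kappa> \<mu> = \<rho>"
 proof (rule measure_eqI)
  show "sets (kernel_prod \<kappa> \<mu>) = sets \<rho>" unfolding s\<rho> s by (rule sets_kernel_prod[OF \<kappa>m \<mu>])
  fix A assume "A\<in>sets (kernel_prod \<kappa> \<mu>)"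
  then have A: "A\<in>sets RS" unfolding sets_kernel_prod[OF \<kappa>m \<mu>] .
  have Ax: "{w\<in>{0..}. (w,x)\<in>A}\<in>sets Rplus" for x
  proof -
   have "(%w. (w,x)) -` A\<inter>space Rplus\<in>sets Rplus" by (rule measurable_sets[OF _ A]) measurable
   moreover have "(%w. (w,x)) -` A\<inter>space Rplus = {w\<in>{0..}. (w,x)\<in>A}" by auto
   ultimately show ?thesis by simp
  qed
  have "emeasure (kernel_prod \<kappa> \<mu>) A = (\<integral>\<^sup>+x. emeasure (\<kappa> x) {w\<in>{0..}. (w,x)\<in>A}\<partial>\<mu>)"
   by (rule emeasure_kernel_prod[OF \<kappa>m \<mu> A])
  also have "\<dots> = (\<integral>\<^sup>+x. \<integral>\<^sup>+w. ennreal (g' (w,x))*indicator A (w,x)\<partial>\<alpha>\<partial>\<mu>)"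
   unfolding em[OF Ax] using prob_algebraD(3)[OF \<alpha>] by (intro nn_integral_cong) (auto simp: indicator_def)
  also have "\<dots> = emeasure \<rho> A" by (subst \<rho>g') (rule dens[OF g'm A, symmetric])
  finally show "emeasure (kernel_prod \<kappa> \<mu>) A = emeasure \<rho> A" .
 qed
 moreover have "(\<integral>\<^sup>+x. rel_entropy (\<kappa> x) \<alpha>\<partial>\<mu>)\<le>rel_entropy \<rho> (\<alpha>\<Otimes>\<^sub>M\<mu>)"
  unfolding \<kappa>_def by (subst \<rho>g') (rule rel_entropy_density_kernel[OF \<alpha> \<mu> g'm g'0 g'1])
 ultimately show thesis using that[OF \<kappa>m] unfolding \<alpha>_def \<mu>_def by blast
qed

section \<open>The equivalent forms of the rate function\<close>

lemma rel_entropy_self: "prob_space \<alpha> ==> rel_entropy \<alpha> \<alpha> = 0"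
 using rel_entropy_density[of \<alpha> "%_. 1"] by (simp add: density_1)

text \<open>The infimum over \<rho> is grouped by the second marginal. In the first direction IX
  \<mu> is moved to the other side by subtraction, which is legitimate when it is finite; when it is
  infinite the inequality is trivial.\<close>

lemma Krate_calK:
 fixes IX :: "'s::topological_space measure => ennreal"
 shows "Krate IW IX \<nu> = (INF \<mu>\<in>M1. calK IW \<nu> \<mu> + IX \<mu>)"
proof (rule antisym)
 show "Krate IW IX \<nu>\<le>(INF \<mu>\<in>M1. calK IW \<nu> \<mu> + IX \<mu>)"
 proof (rule INF_greatest)
  fix \<mu> :: "'s measure"
  have "Krate IW IX \<nu> - IX \<mu>\<le>calK IW \<nu> \<mu>" if "IX \<mu>\<noteq>top"
   unfolding calK_def
  proof (rule INF_greatest)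
   fix \<rho> :: "(real\<times>'s) measure" assume "\<rho>\<in>{\<rho>\<in>M11. marg2 \<rho> = \<mu> \<and> Fmap \<rho> = \<nu>}"
   then have \<rho>: "\<rho>\<in>M11" "marg2 \<rho> = \<mu>" "Fmap \<rho> = \<nu>" by blast+
   have "Krate IW IX \<nu>\<le>Jrate IW IX \<rho>" unfolding Krate_def by (rule INF_lower) (use \<rho> in blast)
   then have "Krate IW IX \<nu>\<le>IX \<mu> + (rel_entropy \<rho> (marg1 \<rho>\<Otimes>\<^sub>M\<mu>) + IW (marg1 \<rho>))"
    unfolding Jrate_def \<rho>(2) by (simp add: add.commute)
   then show "Krate IW IX \<nu> - IX \<mu>\<le>rel_entropy \<rho> (marg1 \<rho>\<Otimes>\<^sub>M\<mu>) + IW (marg1 \<rho>)"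
    using that by (simp add: ennreal_minus_le_iff)
  qed
  then show "Krate IW IX \<nu>\<le>calK IW \<nu> \<mu> + IX \<mu>"
   by (cases "IX \<mu> = top") (simp_all add: ennreal_minus_le_iff add.commute)
 qed
 show "(INF \<mu>\<in>M1. calK IW \<nu> \<mu> + IX \<mu>)\<le>Krate IW IX \<nu>"
  unfolding Krate_def
 proof (rule INF_greatest)
  fix \<rho> :: "(real\<times>'s) measure" assume "\<rho>\<in>{\<rho>\<in>M11. Fmap \<rho> = \<nu>}"
  then have \<rho>: "\<rho>\<in>M11" "Fmap \<rho> = \<nu>" by blast+
  have "(INF \<mu>\<in>M1. calK IW \<nu> \<mu> + IX \<mu>)\<le>calK IW \<nu> (marg2 \<rho>) + IX (marg2 \<rho>)"
   by (rule INF_lower) (rule marg2_M1[OF \<rho>(1)])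
  also have "calK IW \<nu> (marg2 \<rho>)\<le>rel_entropy \<rho> (marg1 \<rho>\<Otimes>\<^sub>Mmarg2 \<rho>) + IW (marg1 \<rho>)"
   unfolding calK_def by (rule INF_lower) (use \<rho> in blast)
  finally show "(INF \<mu>\<in>M1. calK IW \<nu> \<mu> + IX \<mu>)\<le>Jrate IW IX \<rho>" unfolding Jrate_def by (simp add: add_right_mono)
 qed
qed

text \<open>A kernel yields a coupling of no larger entropy by
  \<open>rel_entropy_kernel_prod_le\<close>, and a coupling of finite entropy yields a kernel by
  \<open>disintegration\<close>. Couplings of infinite entropy do not lower the infimum.\<close>

lemma calK_kernel:
 fixes \<mu> :: "'s::topological_space measure"
 assumes \<mu>: "\<mu>\<in>M1"
 shows "calK IW \<nu> \<mu> = (INF \<kappa>\<in>{\<kappa>\<in>measurable borel (prob_algebra Rplus). kernel_prod \<kappa> \<mu>\<in>M11 \<and> Fmap (kernel_prod \<kappa> \<mu>) = \<nu>}.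
  (\<integral>\<^sup>+x. rel_entropy (\<kappa> x) (marg1 (kernel_prod \<kappa> \<mu>))\<partial>\<mu>) + IW (marg1 (kernel_prod \<kappa> \<mu>)))"
  (is "_ = (INF \<kappa>\<in>?S. ?T \<kappa>)")
proof (rule antisym)
 show "calK IW \<nu> \<mu>\<le>(INF \<kappa>\<in>?S. ?T \<kappa>)"
 proof (rule INF_greatest)
  fix \<kappa> assume "\<kappa>\<in>?S"
  then have \<kappa>: "\<kappa>\<in>measurable borel (prob_algebra Rplus)" "kernel_prod \<kappa> \<mu>\<in>M11" "Fmap (kernel_prod \<kappa> \<mu>) = \<nu>" by blast+
  have "calK IW \<nu> \<mu>\<le>rel_entropy (kernel_prod \<kappa> \<mu>) (marg1 (kernel_prod \<kappa> \<mu>)\<Otimes>\<^sub>M\<mu>) + IW (marg1 (kernel_prod \<kappa> \<mu>))"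
   unfolding calK_def by (rule INF_lower) (use \<kappa> marg2_kernel_prod[OF \<kappa>(1) \<mu>] in blast)
  also have "\<dots>\<le>?T \<kappa>"
   by (intro add_right_mono rel_entropy_kernel_prod_le[OF \<kappa>(1) \<mu>] marg_prob(1) M11D(1)[OF \<kappa>(2)])
  finally show "calK IW \<nu> \<mu>\<le>?T \<kappa>" .
 qed
 show "(INF \<kappa>\<in>?S. ?T \<kappa>)\<le>calK IW \<nu> \<mu>"
  unfolding calK_def
 proof (rule INF_greatest)
  fix \<rho> :: "(real\<times>'s) measure" assume "\<rho>\<in>{\<rho>\<in>M11. marg2 \<rho> = \<mu> \<and> Fmap \<rho> = \<nu>}"
  then have \<rho>: "\<rho>\<in>M11" "marg2 \<rho> = \<mu>" "Fmap \<rho> = \<nu>" by blast+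
  show "(INF \<kappa>\<in>?S. ?T \<kappa>)\<le>rel_entropy \<rho> (marg1 \<rho>\<Otimes>\<^sub>M\<mu>) + IW (marg1 \<rho>)"
  proof (cases "rel_entropy \<rho> (marg1 \<rho>\<Otimes>\<^sub>M\<mu>) < \<infinity>")
   case True
   obtain \<kappa> where \<kappa>: "\<kappa>\<in>measurable borel (prob_algebra Rplus)" "kernel_prod \<kappa> \<mu> = \<rho>"
    "(\<integral>\<^sup>+x. rel_entropy (\<kappa> x) (marg1 \<rho>)\<partial>\<mu>)\<le>rel_entropy \<rho> (marg1 \<rho>\<Otimes>\<^sub>M\<mu>)"
    using True unfolding \<rho>(2)[symmetric] by (rule disintegration[OF M11D(1)[OF \<rho>(1)]]) (rule that[unfolded \<rho>(2)[symmetric]])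
   have "(INF \<kappa>\<in>?S. ?T \<kappa>)\<le>?T \<kappa>" by (rule INF_lower) (use \<kappa>(1,2) \<rho>(1,3) in blast)
   also have "\<dots>\<le>rel_entropy \<rho> (marg1 \<rho>\<Otimes>\<^sub>M\<mu>) + IW (marg1 \<rho>)" unfolding \<kappa>(2) by (rule add_right_mono[OF \<kappa>(3)])
   finally show ?thesis .
  next
   case False
   then have "rel_entropy \<rho> (marg1 \<rho>\<Otimes>\<^sub>M\<mu>) = \<infinity>" by (simp add: less_top[symmetric])
   then show ?thesis by simp
  qed
 qed
qed

text \<open>The product of \<alpha> and \<nu> has entropy 0 and, as \<alpha> has mean 1, image
  \<nu>; it costs IW \<alpha> + IX \<nu>, and the first term can be made arbitrarily small.\<close>

lemma Krate_le:
 assumes inf: "(INF \<alpha>\<in>M11_Rplus. IW \<alpha>) = 0" and \<nu>: "(\<nu> :: 's::topological_space measure)\<in>M1"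
 shows "Krate IW IX \<nu>\<le>IX \<nu>"
proof -
 have "Krate IW IX \<nu>\<le>IW \<alpha> + IX \<nu>" if \<alpha>: "\<alpha>\<in>M11_Rplus" for \<alpha>
 proof -
  note \<alpha>p = M11_RplusD(5)[OF \<alpha>]
  note k = const_kernel[OF \<alpha>p]
  let ?\<rho> = "kernel_prod (%_. \<alpha>) \<nu>"
  interpret a: prob_space \<alpha> by (rule prob_algebraD[OF \<alpha>p])
  interpret b: prob_space \<nu> by (rule prob_algebraD[OF \<nu>])
  have "marg1 ?\<rho> = distr (\<alpha>\<Otimes>\<^sub>M\<nu>) \<alpha> fst"
   unfolding marg1_def kernel_prod_const[OF \<alpha>p \<nu>] by (rule distr_cong) (use prob_algebraD(2)[OF \<alpha>p] in simp_all)
  also have "\<dots> = \<alpha>" by (rule b.distr_pair_fst)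
  finally have m1: "marg1 ?\<rho> = \<alpha>" .
  have M: "?\<rho>\<in>M11" by (rule M11I[OF kernel_prod_prob[OF k \<nu>]]) (simp add: m1 \<alpha>)
  have m2: "marg2 ?\<rho> = \<nu>" by (rule marg2_kernel_prod[OF k \<nu>])
  have F: "Fmap ?\<rho> = \<nu>"
  proof (rule measure_eqI)
   show "sets (Fmap ?\<rho>) = sets \<nu>" using prob_algebraD(2)[OF \<nu>] by (simp add: Fmap_def)
   fix A assume "A\<in>sets (Fmap ?\<rho>)"
   then have A: "A\<in>sets borel" by (simp add: Fmap_def)
   have m1: "(%p. ennreal (fst p))\<in>borel_measurable RS"
    using measurable_compose[OF measurable_fst measurable_Rplus_real] by simp
   have m2: "(%p. indicator ({0..}\<times>A) p :: ennreal)\<in>borel_measurable RS"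
    by (rule borel_measurable_indicator) (use A sets.top[of Rplus] in \<open>auto intro: pair_measureI\<close>)
   have m: "(%(w,x). ennreal w*indicator ({0..}\<times>A) (w,x))\<in>borel_measurable RS"
    using borel_measurable_times_ennreal[OF m1 m2] by (simp add: split_beta')
   have "emeasure (Fmap ?\<rho>) A = (\<integral>\<^sup>+(w,x). ennreal w*indicator ({0..}\<times>A) (w,x)\<partial>?\<rho>)"
    by (rule emeasure_Fmap[OF M A])
   also have "\<dots> = (\<integral>\<^sup>+x. \<integral>\<^sup>+w. ennreal w*indicator ({0..}\<times>A) (w,x)\<partial>\<alpha>\<partial>\<nu>)"
    by (subst nn_integral_kernel_prod(2)[OF k \<nu> m]) simp
   also have "\<dots> = (\<integral>\<^sup>+x. indicator A x\<partial>\<nu>)"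
   proof (rule nn_integral_cong)
    fix x
    have "(\<integral>\<^sup>+w. ennreal w*indicator ({0..}\<times>A) (w,x)\<partial>\<alpha>) = (\<integral>\<^sup>+w. ennreal w*indicator A x\<partial>\<alpha>)"
     by (rule nn_integral_cong) (use prob_algebraD(3)[OF \<alpha>p] in \<open>auto simp: indicator_def\<close>)
    also have "\<dots> = indicator A x" by (cases "x\<in>A") (simp_all add: M11_RplusD(4)[OF \<alpha>])
    finally show "(\<integral>\<^sup>+w. ennreal w*indicator ({0..}\<times>A) (w,x)\<partial>\<alpha>) = indicator A x" .
   qed
   also have "\<dots> = emeasure \<nu> A" using A prob_algebraD(2)[OF \<nu>] by simp
   finally show "emeasure (Fmap ?\<rho>) A = emeasure \<nu> A" .
  qed
  have "rel_entropy ?\<rho> (\<alpha>\<Otimes>\<^sub>M\<nu>)\<le>(\<integral>\<^sup>+x. rel_entropy \<alpha> \<alpha>\<partial>\<nu>)" by (rule rel_entropy_kernel_prod_le[OF k \<nu> \<alpha>p])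
  also have "\<dots> = 0" by (simp add: rel_entropy_self[OF a.prob_space_axioms])
  finally have "Jrate IW IX ?\<rho>\<le>IW \<alpha> + IX \<nu>" unfolding Jrate_def m1 m2 by simp
  moreover have "Krate IW IX \<nu>\<le>Jrate IW IX ?\<rho>" unfolding Krate_def by (rule INF_lower) (use M F in blast)
  ultimately show ?thesis by (rule order_trans[rotated])
 qed
 then have "Krate IW IX \<nu> - IX \<nu>\<le>IW \<alpha>" if "\<alpha>\<in>M11_Rplus" "IX \<nu>\<noteq>top" for \<alpha>
  using that by (simp add: ennreal_minus_le_iff add.commute)
 then have "Krate IW IX \<nu> - IX \<nu>\<le>0" if "IX \<nu>\<noteq>top"
  unfolding inf[symmetric] using that by (intro INF_greatest)
 then show ?thesis using ennreal_minus_le_iff[of "Krate IW IX \<nu>" "IX \<nu>" 0] by (cases "IX \<nu> = top") simp_all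
qed

theorem corollary1p2:
  fixes M :: "'w measure"
    and W :: "nat \<Rightarrow> nat \<Rightarrow> 'w \<Rightarrow> real"
    and X :: "nat \<Rightarrow> nat \<Rightarrow> 'w \<Rightarrow> 's::polish_space"
    and IW :: "real measure \<Rightarrow> ennreal"
    and IX :: "'s measure \<Rightarrow> ennreal"
  assumes "prob_space M"
    and "\<And>n i. n \<ge> 1 \<Longrightarrow> i \<in> {1..n} \<Longrightarrow> W n i \<in> measurable M Rplus"
    and "\<And>n i. n \<ge> 1 \<Longrightarrow> i \<in> {1..n} \<Longrightarrow> X n i \<in> measurable M borel"
    and "\<And>n \<omega>. n \<ge> 1 \<Longrightarrow> \<omega> \<in> space M \<Longrightarrow> (\<Sum>i=1..n. W n i \<omega>) = real n"
    and "\<And>n. n \<ge> 1 \<Longrightarrow> exchangeable M Rplus n (W n)"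
    and "LDP_rv M W1_topology (\<lambda>n \<omega>. weighted_empirical Rplus n (\<lambda>_. 1) (\<lambda>i. W n i \<omega>)) IW"
    and "good_rate W1_topology IW"
    and "LDP_rv M weak_topology (\<lambda>n \<omega>. weighted_empirical borel n (\<lambda>_. 1) (\<lambda>i. X n i \<omega>)) IX"
    and "good_rate weak_topology IX"
    and "\<And>n. n \<ge> 1 \<Longrightarrow> independent_rv M
           (Pi\<^sub>M {1..n} (\<lambda>_. borel)) (\<lambda>\<omega>. \<lambda>i\<in>{1..n}. X n i \<omega>)
           (Pi\<^sub>M {1..n} (\<lambda>_. Rplus)) (\<lambda>\<omega>. \<lambda>i\<in>{1..n}. W n i \<omega>)"
  shows "LDP_rv M weak_topology
           (\<lambda>n \<omega>. weighted_empirical borel n (\<lambda>i. W n i \<omega>) (\<lambda>i. X n i \<omega>)) (Krate IW IX) \<and>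
         good_rate weak_topology (Krate IW IX) \<and>
         (\<forall>\<nu>\<in>M1.
            Krate IW IX \<nu> =
              (INF \<mu>\<in>M1.
                 (INF \<kappa>\<in>{\<kappa> \<in> measurable borel (prob_algebra Rplus).
                            kernel_prod \<kappa> \<mu> \<in> M11 \<and> Fmap (kernel_prod \<kappa> \<mu>) = \<nu>}.
                    (\<integral>\<^sup>+x. rel_entropy (\<kappa> x) (marg1 (kernel_prod \<kappa> \<mu>)) \<partial>\<mu>)
                      + IW (marg1 (kernel_prod \<kappa> \<mu>)))
                 + IX \<mu>) \<and>
            Krate IW IX \<nu> = (INF \<mu>\<in>M1. calK IW \<nu> \<mu> + IX \<mu>) \<and>
            Krate IW IX \<nu> \<le> IX \<nu>)"
proof -
  interpret prob_space M by fact
  have array: "weighted_array M n (W n) (X n)" if "1 \<le> n" for n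
    by unfold_locales (use that assms in auto)
  interpret weighted_arrays M W X IW IX
    by (intro weighted_arrays.intro weighted_arrays_axioms.intro array assms(1,6-9))
  have "(INF \<alpha>\<in>M11_Rplus. IW \<alpha>) = 0"
    using LDP_inf_zero[OF LDPW'] by simp
  then have le: "Krate IW IX \<nu> \<le> IX \<nu>" if "\<nu> \<in> M1" for \<nu> by (rule Krate_le[OF _ that])
  have kernel: "Krate IW IX \<nu> = (INF \<mu>\<in>M1.
       (INF \<kappa>\<in>{\<kappa> \<in> measurable borel (prob_algebra Rplus).
                  kernel_prod \<kappa> \<mu> \<in> M11 \<and> Fmap (kernel_prod \<kappa> \<mu>) = \<nu>}.
          (\<integral>\<^sup>+x. rel_entropy (\<kappa> x) (marg1 (kernel_prod \<kappa> \<mu>)) \<partial>\<mu>)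
            + IW (marg1 (kernel_prod \<kappa> \<mu>)))
       + IX \<mu>)" for \<nu>
    unfolding Krate_calK by (rule INF_cong[OF refl]) (simp only: calK_kernel)
  show ?thesis by (intro conjI ballI LDP_weighted good_rate_Krate kernel Krate_calK le)
qed

end
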